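(* Let $k\ge1$ be an integer and $\mathbf r>0$. The robust risk admits the lower bound $$\liminf_{n\to\infty}\ \inf_{\widehat S_n\in\Sigma_n}\ v_n^{2k/(2k+1)}\ \sup_{S\in W_{k,\mathbf r}}\mathcal R^*_n(\widehat S_n,S)\ \ge\ l_k(\mathbf r).$$
   Context: Model. One observes $(y_t)_{0\le t\le n}$ with $dy_t=S(t)\,dt+d\xi_t$, $S$ an unknown $1$-periodic function, where the noise is the Ornstein–Uhlenbeck–Lévy process $d\xi_t=a\xi_t\,dt+du_t$, $\xi_0=0$, $u_t=\varrho_1w_t+\varrho_2z_t$, $z_t=\int_0^t\int_{\mathbb R}x\,(\mu-\widetilde\mu)(ds\,dx)$. Here $w$ is a standard Brownian motion, $\mu$ is the jump measure (independent of $w$) with deterministic compensator $\widetilde\mu(ds\,dx)=ds\,\Pi(dx)$, and $\Pi$ is a (fixed) Lévy measure on $\mathbb R\setminus\{0\}$ with $\int x^2\,\Pi(dx)=1$, $\int x^8\,\Pi(dx)<\infty$. The nuisance parameters satisfy $-a_{\max}\le a\le0$, $0<\underline\varrho\le\varrho_1^2$, $\sigma_Q=\varrho_1^2+\varrho_2^2\le\varsigma^*$, where $a_{\max}=a_{\max}(n)$, $\underline\varrho=\underline\varrho_n$, $\varsigma^*=\varsigma^*_n$ are such that for any $\epsilon>0$: $\lim_n a_{\max}(n)/n^\epsilon=0$, $\liminf_n n^\epsilon\underline\varrho_n>0$, $\lim_n n^{-\epsilon}\varsigma^*_n=0$. $\mathcal Q_n$ is the family of all distributions $Q$ of such noise processes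 on the Skorokhod space $D[0,n]$. Risks. $\|f\|^2=\int_0^1f^2\,dt$, $\mathcal R^*_n(\widehat S,S)=\sup_{Q\in\mathcal Q_n}E_{Q,S}\|\widehat S-S\|^2$, where $E_{Q,S}$ is the expectation under the law of $y$. $\Sigma_n$ is the set of all estimators of $S$ measurable with respect to $\sigma\{y_t,0\le t\le n\}$. $v_n=n/\varsigma^*_n$. Classes. $C^k_p[0,1]$ is the space of $k$ times differentiable $1$-periodic functions $f:\mathbb R\to\mathbb R$ with $f^{(i)}(0)=f^{(i)}(1)$ for $0\le i\le k-1$; $W_{k,\mathbf r}=\{f\in C^k_p[0,1]:\sum_{j=0}^k\|f^{(j)}\|^2\le\mathbf r\}$. The Pinsker constant is $l_k(\mathbf r)=((1+2k)\mathbf r)^{1/(2k+1)}\left(\dfrac{k}{\pi(k+1)}\right)^{2k/(2k+1)}$. *)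

theory Defs
  imports "HOL-Probability.Probability"
begin

section \<open>Path space\<close>

text \<open>One-sided limits are taken inside \<open>I\<close>, so at the right (left) endpoint of \<open>I\<close> the filter
  is trivial and the right (left) limit condition is void.\<close>

definition cadlag_on :: "real set \<Rightarrow> (real \<Rightarrow> real) \<Rightarrow> bool" where
  "cadlag_on I f \<longleftrightarrow> (\<forall>t\<in>I. (f \<longlongrightarrow> f t) (at t within (I \<inter> {t<..})) \<and>
     (\<exists>l. (f \<longlongrightarrow> l) (at t within (I \<inter> {..<t}))))"

text \<open>The Skorokhod space \<open>D[0,T]\<close> with the \<open>\<sigma>\<close>-algebra generated by the coordinate maps,
  which is the Borel \<open>\<sigma>\<close>-algebra of the Skorokhod topology.
  Paths are set to \<open>undefined\<close> outside \<open>[0,T]\<close>.\<close>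

definition skorokhod :: "real \<Rightarrow> (real \<Rightarrow> real) measure" where
  "skorokhod T = restrict_space (\<Pi>\<^sub>M t\<in>{0..T}. (borel :: real measure)) {f. cadlag_on {0..T} f}"


section \<open>Driving processes\<close>

text \<open>Processes are curried as \<open>time \<Rightarrow> sample point \<Rightarrow> value\<close>; only times \<open>t \<ge> 0\<close> matter.\<close>

definition brownian_motion :: "'w measure \<Rightarrow> (real \<Rightarrow> 'w \<Rightarrow> real) \<Rightarrow> bool" where
  "brownian_motion M w \<longleftrightarrow>
     (\<forall>t\<ge>0. w t \<in> borel_measurable M) \<and>
     (\<forall>\<omega>\<in>space M. w 0 \<omega> = 0 \<and> continuous_on {0..} (\<lambda>t. w t \<omega>)) \<and>
     (\<forall>s t. 0 \<le> s \<and> s < t \<longrightarrow>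
        distributed M lborel (\<lambda>\<omega>. w t \<omega> - w s \<omega>) (normal_density 0 (sqrt (t - s)))) \<and>
     (\<forall>(\<tau> :: nat \<Rightarrow> real) m. 0 \<le> \<tau> 0 \<and> mono \<tau> \<longrightarrow>
        prob_space.indep_vars M (\<lambda>_. borel) (\<lambda>i \<omega>. w (\<tau> (Suc i)) \<omega> - w (\<tau> i) \<omega>) {..<m})"

definition levy_measure :: "real measure \<Rightarrow> bool" where
  "levy_measure \<Lambda> \<longleftrightarrow> sets \<Lambda> = sets borel \<and> emeasure \<Lambda> {0} = 0 \<and>
     (\<integral>\<^sup>+ x. ennreal (min 1 (x\<^sup>2)) \<partial>\<Lambda>) < \<infinity>"

definition jump :: "(real \<Rightarrow> real) \<Rightarrow> real \<Rightarrow> real" where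
  "jump f t = f t - Lim (at_left t) f"

text \<open>The jump measure \<open>\<Sum> \<delta>(s, \<Delta>f(s))\<close>, summed over the jump times \<open>s > 0\<close> of \<open>f\<close>,
  as the image of counting measure on the jump times.\<close>

definition jump_measure :: "(real \<Rightarrow> real) \<Rightarrow> (real \<times> real) measure" where
  "jump_measure f = distr (count_space {s. 0 < s \<and> jump f s \<noteq> 0}) borel (\<lambda>s. (s, jump f s))"

definition natural_filtration :: "'w measure \<Rightarrow> (real \<Rightarrow> 'w \<Rightarrow> real) \<Rightarrow> real \<Rightarrow> 'w set set" where
  "natural_filtration M z t =
     sigma_sets (space M) {z s -` B \<inter> space M | s B. 0 \<le> s \<and> s \<le> t \<and> B \<in> sets borel}"

text \<open>The product of the predictable \<open>\<sigma>\<close>-algebra on \<open>\<Omega> \<times> (0,\<infinity>)\<close> with the Borel sets of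
  marks, as a \<open>\<sigma>\<close>-algebra on triples \<open>(\<omega>, s, x)\<close>. The times \<open>s \<le> 0\<close> form a single atom, which is
  charged neither by jump measures nor by the compensators below.\<close>

definition predictable_marked ::
    "'w measure \<Rightarrow> (real \<Rightarrow> 'w set set) \<Rightarrow> ('w \<times> real \<times> real) measure" where
  "predictable_marked M F = sigma (space M \<times> UNIV)
     {A \<times> ({s<..t} \<times> B) | A s t B. 0 \<le> s \<and> s \<le> t \<and> A \<in> F s \<and> B \<in> sets borel}"

definition has_compensator :: "'w measure \<Rightarrow> (real \<Rightarrow> 'w set set) \<Rightarrow>
    ('w \<Rightarrow> (real \<times> real) measure) \<Rightarrow> (real \<times> real) measure \<Rightarrow> bool" where
  "has_compensator M F \<mu> \<nu> \<longleftrightarrow>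
     (\<forall>W :: 'w \<times> real \<times> real \<Rightarrow> ennreal. W \<in> borel_measurable (predictable_marked M F) \<longrightarrow>
        (\<integral>\<^sup>+ \<omega>. (\<integral>\<^sup>+ p. W (\<omega>, p) \<partial>\<mu> \<omega>) \<partial>M) = (\<integral>\<^sup>+ \<omega>. (\<integral>\<^sup>+ p. W (\<omega>, p) \<partial>\<nu>) \<partial>M))"

text \<open>\<open>ds \<Lambda>(dx)\<close> on \<open>(0,\<infinity>) \<times> \<real>\<close>.\<close>

definition levy_compensator :: "real measure \<Rightarrow> (real \<times> real) measure" where
  "levy_compensator \<Lambda> = density lborel (indicator {0<..}) \<Otimes>\<^sub>M \<Lambda>"

text \<open>\<open>z(t)\<close> is the stochastic integral of \<open>x\<close> over \<open>(0,t] \<times> \<real>\<close> against \<open>\<mu> - ds \<Lambda>(dx)\<close>, that is,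
  the mean-square limit of the compensated sums of the jumps of size exceeding \<open>\<epsilon>\<close>.\<close>

definition compensated_integral :: "'w measure \<Rightarrow> ('w \<Rightarrow> (real \<times> real) measure) \<Rightarrow>
    real measure \<Rightarrow> (real \<Rightarrow> 'w \<Rightarrow> real) \<Rightarrow> bool" where
  "compensated_integral M \<mu> \<Lambda> z \<longleftrightarrow>
     (\<forall>t\<ge>0. ((\<lambda>\<epsilon>. \<integral>\<^sup>+ \<omega>. ennreal
        (((LINT p:{0<..t} \<times> {x. \<epsilon> < \<bar>x\<bar>}|\<mu> \<omega>. snd p) - t * (LINT x:{x. \<epsilon> < \<bar>x\<bar>}|\<Lambda>. x) - z t \<omega>)\<^sup>2)
        \<partial>M) \<longlongrightarrow> 0) (at_right 0))"


section \<open>The noise\<close>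

definition ou_levy_noise :: "'w measure \<Rightarrow> real measure \<Rightarrow> real \<Rightarrow> real \<Rightarrow> real \<Rightarrow>
    (real \<Rightarrow> 'w \<Rightarrow> real) \<Rightarrow> bool" where
  "ou_levy_noise M \<Lambda> a \<rho>1 \<rho>2 \<xi> \<longleftrightarrow> prob_space M \<and>
     (\<exists>w z :: real \<Rightarrow> 'w \<Rightarrow> real. let \<mu> = (\<lambda>\<omega>. jump_measure (\<lambda>t. z t \<omega>)) in
        brownian_motion M w \<and>
        (\<forall>t\<ge>0. z t \<in> borel_measurable M) \<and>
        (\<forall>\<omega>\<in>space M. cadlag_on {0..} (\<lambda>t. z t \<omega>)) \<and>
        has_compensator M (natural_filtration M z) \<mu> (levy_compensator \<Lambda>) \<and>
        compensated_integral M \<mu> \<Lambda> z \<and>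
        prob_space.indep_set M
          (sigma_sets (space M) {w t -` B \<inter> space M | t B. 0 \<le> t \<and> B \<in> sets borel})
          (sigma_sets (space M) {(\<lambda>\<omega>. emeasure (\<mu> \<omega>) A) -` B \<inter> space M | A B.
             A \<in> sets borel \<and> B \<in> sets borel}) \<and>
        (\<forall>t\<ge>0. \<xi> t \<in> borel_measurable M) \<and>
        (\<forall>\<omega>\<in>space M. cadlag_on {0..} (\<lambda>t. \<xi> t \<omega>)) \<and>
        (AE \<omega> in M. \<xi> 0 \<omega> = 0 \<and>
           (\<forall>t\<ge>0. \<xi> t \<omega> = a * (LBINT s:{0..t}. \<xi> s \<omega>) + (\<rho>1 * w t \<omega> + \<rho>2 * z t \<omega>))))"

text \<open>The probability space ranges over all measures on pairs of functions: this type carries the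
  canonical space of the pair \<open>(w, z)\<close>, so no law is lost by fixing it.\<close>

definition noise_laws :: "real \<Rightarrow> real measure \<Rightarrow> real \<Rightarrow> real \<Rightarrow> real \<Rightarrow> (real \<Rightarrow> real) measure set"
  where
  "noise_laws T \<Lambda> amax rlow vs =
     {distr M (skorokhod T) (\<lambda>\<omega>. \<lambda>t\<in>{0..T}. \<xi> t \<omega>) |
        (M :: ((real \<Rightarrow> real) \<times> (real \<Rightarrow> real)) measure) \<xi> a \<rho>1 \<rho>2.
        - amax \<le> a \<and> a \<le> 0 \<and> rlow \<le> \<rho>1\<^sup>2 \<and> \<rho>1\<^sup>2 + \<rho>2\<^sup>2 \<le> vs \<and> ou_levy_noise M \<Lambda> a \<rho>1 \<rho>2 \<xi>}"


section \<open>Risks, estimators, functional classes\<close>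

text \<open>The law of the observation \<open>y\<close>, given the law \<open>Q\<close> of the noise.\<close>

definition observation_law ::
    "real \<Rightarrow> (real \<Rightarrow> real) \<Rightarrow> (real \<Rightarrow> real) measure \<Rightarrow> (real \<Rightarrow> real) measure" where
  "observation_law T S Q =
     distr Q (skorokhod T) (\<lambda>x. \<lambda>t\<in>{0..T}. (LBINT s:{0..t}. S s) + x t)"

definition norm01_sq :: "(real \<Rightarrow> real) \<Rightarrow> ennreal" where
  "norm01_sq f = (\<integral>\<^sup>+ t\<in>{0..1}. ennreal ((f t)\<^sup>2) \<partial>lborel)"

text \<open>Estimators are jointly measurable in the observed path and the argument in \<open>[0,1]\<close>.\<close>

definition estimators :: "real \<Rightarrow> ((real \<Rightarrow> real) \<Rightarrow> real \<Rightarrow> real) set" where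
  "estimators T = {Se. (\<lambda>(y, t). Se y t) \<in>
     borel_measurable (skorokhod T \<Otimes>\<^sub>M restrict_space borel {0..1})}"

definition robust_risk :: "real \<Rightarrow> (real \<Rightarrow> real) measure set \<Rightarrow>
    ((real \<Rightarrow> real) \<Rightarrow> real \<Rightarrow> real) \<Rightarrow> (real \<Rightarrow> real) \<Rightarrow> ennreal" where
  "robust_risk T \<Q> Se S =
     (SUP Q\<in>\<Q>. \<integral>\<^sup>+ y. norm01_sq (\<lambda>t. Se y t - S t) \<partial>observation_law T S Q)"

definition Ckp :: "nat \<Rightarrow> (real \<Rightarrow> real) set" where
  "Ckp k = {f. (\<forall>x. f (x + 1) = f x) \<and>
     (\<forall>i<k. (\<forall>x. (deriv ^^ i) f differentiable (at x)) \<and> (deriv ^^ i) f 0 = (deriv ^^ i) f 1)}"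

definition sobolev_ball :: "nat \<Rightarrow> real \<Rightarrow> (real \<Rightarrow> real) set" where
  "sobolev_ball k r = {f \<in> Ckp k. (\<Sum>j\<le>k. norm01_sq ((deriv ^^ j) f)) \<le> ennreal r}"

definition pinsker_const :: "nat \<Rightarrow> real \<Rightarrow> real" where
  "pinsker_const k r = ((1 + 2 * real k) * r) powr (1 / (2 * real k + 1)) *
     (real k / (pi * (real k + 1))) powr (2 * real k / (2 * real k + 1))"

end

theory Submission
  imports Defs
begin

text \<open>
  Any noise distribution in the class gives a lower bound for the robust risk. The least favourable
  choice is \<open>a = 0\<close>, \<open>\<rho>1 = sqrt vs\<close>, \<open>\<rho>2 = 0\<close>: the noise is then \<open>sqrt vs\<close> times a Brownian
  motion, and observing \<open>S\<close> over \<open>[0,n]\<close> amounts to observing each trigonometric Fourier coefficient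
  of \<open>S\<close> with independent Gaussian errors of variance \<open>vs/n = 1/v\<close>. The claim thus reduces to
  Pinsker's lower bound for this Gaussian sequence model on a Sobolev ellipsoid.

  The statistical part is a Bayes argument. Give the first \<open>d\<close> Fourier coefficients independent priors
  \<open>N(0, s j)\<close>. Integrating \<open>L\<^sup>2\<close>-losses against a prior and applying Bessel's inequality bounds the
  risk from below by a sum of one-dimensional Bayes risks \<open>s \<epsilon>\<^sup>2 / (s + \<epsilon>\<^sup>2)\<close> (\<open>bayes_1d\<close>,
  \<open>bayes_coordinate\<close>). A Gaussian prior charges the complement of the Sobolev ball; there the squared
  error of a truncated estimator is controlled by the quadratic form defining the ball, and a Chernoff bound
  makes the excess exponentially small (\<open>bayes_risk_bound\<close>). Pinsker's weights
  \<open>s = ((L/l)^k - 1)/v\<close> at frequency \<open>l < L\<close>, with \<open>L\<close> a constant times \<open>v powr (1/(2k+1))\<close>, turn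
  the finite bound into the constant \<open>l_k(r)\<close>: power sums decide both how large the constant may be
  for the prior to sit inside the ball, and the value of the Bayes risk
  (\<open>pinsker_weights_bound\<close>, \<open>pinsker_const_bound\<close>).

  Two objects have to be produced before this can start. First, a Brownian motion in which the
  noise of the \<open>d\<close> Fourier coefficients is carried by \<open>d\<close> coordinates of the sample point that
  nothing else depends on; it is obtained from Levy's midpoint construction by replacing the Wiener
  integrals of the basis functions by fresh Gaussian coordinates
  (\<open>brownian_motion_with_coordinates\<close>). Secondly, the definition of the noise demands a
  compensated jump process for the given Levy measure even when its coefficient \<open>\<rho>2\<close> vanishes.
  It is built from a Poisson random measure: Mecke's formula gives its compensator, Kolmogorov's
  maximal inequality the uniform convergence of compensated jump sums, hence cadlag paths
  with the right jumps (\<open>mecke\<close>, \<open>cpt_maximal\<close>, \<open>lev_uniform\<close>, \<open>gaussian_noise_exists\<close>).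
\<close>

section \<open>Characteristic functions and Gaussian families\<close>

text \<open>The weights \<open>Re (c g) + K + 1\<close> with \<open>norm c = 1\<close> are positive, so they
  define probability measures after normalisation. The hypotheses say that \<open>X\<close> has the same
  characteristic function under these measures as under \<open>M\<close>, hence the same law by Levy's
  uniqueness theorem; \<open>c = 1\<close> and \<open>c = - \<i>\<close> recover the real and imaginary
  parts.\<close>

lemma (in prob_space) indicator_factor_of_iexp_factor:
 fixes g :: "'a => complex" and X :: "'a => real"
 assumes g[measurable]: "g \<in> borel_measurable M" and gb: "\<And>x. x \<in> space M ==> norm (g x) \<le> K"
  and X[measurable]: "X \<in> borel_measurable M" and A[measurable]: "A \<in> sets borel"
  and f: "\<And>u. (CLINT x|M. g x * iexp (u * X x)) = (CLINT x|M. g x) * (CLINT x|M. iexp (u * X x))"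
  and f': "\<And>u. (CLINT x|M. cnj (g x) * iexp (u * X x)) = (CLINT x|M. cnj (g x)) * (CLINT x|M. iexp (u * X x))"
 shows "(CLINT x|M. g x * indicator A (X x)) = (CLINT x|M. g x) * prob (X -` A \<inter> space M)"
proof -
 have [measurable]: "(\<lambda>x. cnj (g x)) \<in> borel_measurable M"
  by (rule borel_measurable_continuous_onI[THEN measurable_compose_rev, OF _ g]) (intro continuous_intros)
 have bd: "norm (g x) * c \<le> K" if "x \<in> space M" "c \<le> 1" for x c
  using mult_left_mono[OF that(2) norm_ge_zero[of "g x"]] gb[OF that(1)] by simp
 have intg: "integrable M (\<lambda>x. g x * h x)" if [measurable]: "h \<in> borel_measurable M" and "\<And>x. norm (h x) \<le> 1" for h :: "'a => complex"
  by (rule integrable_const_bound[of _ K]) (use bd[OF _ that(2)] that(1) in \<open>auto simp: norm_mult\<close>)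
 have intg': "integrable M (\<lambda>x. cnj (g x) * h x)" if [measurable]: "h \<in> borel_measurable M" and "\<And>x. norm (h x) \<le> 1" for h :: "'a => complex"
  by (rule integrable_const_bound[of _ K]) (use bd[OF _ that(2)] that(1) in \<open>auto simp: norm_mult\<close>)
 have inth: "integrable M h" if [measurable]: "h \<in> borel_measurable M" and "\<And>x. norm (h x) \<le> 1" for h :: "'a => complex"
  by (rule integrable_const_bound[of _ 1]) (use that in auto)
 have K0: "0 \<le> K" using not_empty gb norm_ge_zero by (meson all_not_in_conv order_trans)
 have key: "(LINT x|M. Re (c * g x) * indicator A (X x)) = (LINT x|M. Re (c * g x)) * prob (X -` A \<inter> space M)"
  if c: "norm c = 1" for c :: complex
 proof -
  define r where "r x = Re (c * g x) + (K + 1)" for x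
  have r[measurable]: "r \<in> borel_measurable M" unfolding r_def by measurable
  have rg: "\<bar>Re (c * g x)\<bar> \<le> K" if "x \<in> space M" for x
   using abs_Re_le_cmod[of "c * g x"] gb[OF that] c by (simp add: norm_mult)
  have rb: "1 \<le> r x" "\<bar>r x\<bar> \<le> 2 * K + 1" if "x \<in> space M" for x using rg[OF that] by (auto simp: r_def)
  have ri: "integrable M r" by (rule integrable_const_bound[of _ "2 * K + 1"]) (use rb in auto)
  have re: "complex_of_real (r x) = c / 2 * g x + cnj c / 2 * cnj (g x) + (K + 1)" for x
   by (auto simp: r_def complex_eq_iff field_simps)
  have rsum: "(CLINT x|M. r x * h x) = c / 2 * (CLINT x|M. g x * h x) + cnj c / 2 * (CLINT x|M. cnj (g x) * h x) + (K + 1) * (CLINT x|M. h x)"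
   if "h \<in> borel_measurable M" "\<And>x. norm (h x) \<le> 1" for h :: "'a => complex"
  proof -
   have "(CLINT x|M. r x * h x) = (CLINT x|M. c / 2 * (g x * h x) + cnj c / 2 * (cnj (g x) * h x) + (K + 1) * h x)"
    unfolding re by (simp add: algebra_simps)
   then show ?thesis using intg[OF that] intg'[OF that] inth[OF that] by simp
  qed
  have rf: "(CLINT x|M. r x * iexp (u * X x)) = (CLINT x|M. r x) * (CLINT x|M. iexp (u * X x))" for u
   using rsum[of "\<lambda>x. iexp (u * X x)"] rsum[of "\<lambda>_. 1"] f[of u] f'[of u] by (simp add: prob_space algebra_simps)
  define C where "C = (LINT x|M. r x)"
  have "(LINT x|M. 1) \<le> C" unfolding C_def by (rule integral_mono) (use ri rb in auto)
  then have C: "0 < C" by (simp add: prob_space)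
  have rp: "0 \<le> r x" if "x \<in> space M" for x using rb(1)[OF that] by simp
  define D where "D = density M (\<lambda>x. ennreal (r x / C))"
  interpret D: prob_space D
  proof
   have "emeasure D (space D) = (\<integral>\<^sup>+x. ennreal (r x / C) \<partial>M)"
    unfolding D_def by (simp add: emeasure_density cong: nn_integral_cong)
   also have "\<dots> = ennreal (LINT x|M. r x / C)"
    by (rule nn_integral_eq_integral) (use ri rp C in auto)
   also have "\<dots> = 1" using C by (simp add: C_def)
   finally show "emeasure D (space D) = 1" .
  qed
  have ID: "(CLINT x|D. h x) = (CLINT x|M. r x * h x) / C" if [measurable]: "h \<in> borel_measurable M" for h :: "'a => complex"
  proof -
   have "(CLINT x|D. h x) = (CLINT x|M. (r x / C) *\<^sub>R h x)"
    unfolding D_def by (rule integral_density) (use rp C in auto)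
   also have "\<dots> = (CLINT x|M. (r x * h x) / C)" by (simp add: scaleR_conv_of_real)
   finally show ?thesis by simp
  qed
  have mD[measurable]: "X \<in> borel_measurable D" unfolding D_def by simp
  have "distr D borel X = distr M borel X"
  proof (rule Levy_uniqueness)
   show "char (distr D borel X) = char (distr M borel X)"
   proof
    fix u
    have "char (distr D borel X) u = (CLINT x|D. iexp (u * X x))"
     unfolding char_def by (rule integral_distr) auto
    also have "\<dots> = (CLINT x|M. r x * iexp (u * X x)) / C" by (rule ID) simp
    also have "\<dots> = (CLINT x|M. iexp (u * X x))"
     unfolding rf using C by (simp add: C_def)
    also have "\<dots> = char (distr M borel X) u"
     unfolding char_def by (rule integral_distr[symmetric]) auto
    finally show "char (distr D borel X) u = char (distr M borel X) u" .
   qed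
  qed auto
  hence "measure (distr D borel X) A = measure (distr M borel X) A" by simp
  hence e: "measure D (X -` A \<inter> space D) = prob (X -` A \<inter> space M)"
   by (simp add: measure_distr)
  have sD: "space D = space M" by (simp add: D_def)
  have "measure D (X -` A \<inter> space D) = (LINT x|D. indicator (X -` A \<inter> space M) x)"
   by (simp add: sD)
  also have "\<dots> = (LINT x|M. (r x / C) *\<^sub>R indicator (X -` A \<inter> space M) x)"
   unfolding D_def by (rule integral_density) (use rp C in auto)
  also have "\<dots> = (LINT x|M. (r x * indicator A (X x)) / C)"
   by (intro Bochner_Integration.integral_cong) (auto simp: indicator_def)
  also have "\<dots> = (LINT x|M. r x * indicator A (X x)) / C" by simp
  finally have rA: "(LINT x|M. r x * indicator A (X x)) = C * prob (X -` A \<inter> space M)" using C e by (simp add: field_simps)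
  have iA: "integrable M (\<lambda>x. indicat_real A (X x))" "integrable M (\<lambda>x. Re (c * g x) * indicator A (X x))" "integrable M (\<lambda>x. Re (c * g x))"
   by (rule integrable_const_bound[of _ "K + 1"]; use rg K0 in \<open>force simp: indicator_def\<close>)+
  have "(LINT x|M. indicat_real A (X x)) = (LINT x|M. indicator (X -` A \<inter> space M) x)"
   by (intro Bochner_Integration.integral_cong) (auto simp: indicator_def)
  then have "(LINT x|M. r x * indicator A (X x)) = (LINT x|M. Re (c * g x) * indicator A (X x)) + (K + 1) * prob (X -` A \<inter> space M)"
   unfolding r_def distrib_right using iA by simp
  moreover have "C = (LINT x|M. Re (c * g x)) + (K + 1)" unfolding C_def r_def using iA by (simp add: prob_space)
  ultimately show ?thesis using rA by (simp add: algebra_simps)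
 qed
 have gint: "integrable M g" using intg[of "\<lambda>_. 1"] by simp
 have gi: "integrable M (\<lambda>x. g x * indicator A (X x))"
  by (rule intg) (auto simp: indicator_def)
 have gR: "Re (g x * indicator A (X x)) = Re (g x) * indicator A (X x)"
  and gI: "Im (g x * indicator A (X x)) = Im (g x) * indicator A (X x)" for x
  by (auto simp: indicator_def)
 have "Re (CLINT x|M. g x * indicator A (X x)) = (LINT x|M. Re (g x) * indicator A (X x))"
  unfolding gR[symmetric] by (rule integral_Re[OF gi, symmetric])
 moreover have "Im (CLINT x|M. g x * indicator A (X x)) = (LINT x|M. Im (g x) * indicator A (X x))"
  unfolding gI[symmetric] by (rule integral_Im[OF gi, symmetric])
 ultimately show ?thesis using key[of 1] key[of "- \<i>"] integral_Re[OF gint] integral_Im[OF gint]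
  by (simp add: complex_eq_iff)
qed

text \<open>The one-dimensional uniqueness theorem suffices, because the exponentials can be traded for
  indicators one variable at a time by the preceding lemma.\<close>

lemma (in prob_space) indep_vars_of_char:
 fixes X :: "nat => 'a => real"
 assumes X: "\<And>k. k < m ==> X k \<in> borel_measurable M"
  and char: "\<And>u :: nat => real. (CLINT x|M. iexp (\<Sum>k<m. u k * X k x)) = (\<Prod>k<m. CLINT x|M. iexp (u k * X k x))"
 shows "indep_vars (\<lambda>_. borel) X {..<m}"
proof (cases "m = 0")
 case True
 then show ?thesis by (simp add: indep_vars_def indep_sets_def)
next
 case False
 define \<phi> where "\<phi> k s = (CLINT x|M. iexp (s * X k x))" for k s
 have \<phi>0: "\<phi> k 0 = 1" for k by (simp add: \<phi>_def prob_space)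
 have H: "(CLINT x|M. (\<Prod>k<j. indicator (A k) (X k x)) * iexp (\<Sum>k\<in>{j..<m}. u k * X k x)) =
   (\<Prod>k<j. complex_of_real (prob (X k -` A k \<inter> space M))) * (\<Prod>k\<in>{j..<m}. \<phi> k (u k))"
  if "j \<le> m" "\<And>k. A k \<in> sets borel" for j A u
  using that
 proof (induction j arbitrary: u)
  case 0
  then show ?case using char[of u] by (simp add: \<phi>_def atLeast0LessThan)
 next
  case (Suc j)
  have jm: "j < m" and [measurable]: "A k \<in> sets borel" for k using Suc by auto
  have split: "{j..<m} = insert j {Suc j..<m}" using jm by auto
  have mX: "k \<in> {Suc j..<m} ==> X k \<in> borel_measurable M" "k < j ==> X k \<in> borel_measurable M" for k
   using X jm by auto
  define g where "g u x = (\<Prod>k<j. indicator (A k) (X k x)) * iexp (\<Sum>k\<in>{Suc j..<m}. u k * X k x)" for u :: "nat => real" and x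
  have gm: "g u \<in> borel_measurable M" for u
   unfolding g_def using mX X by measurable
  have gn: "norm (g u x) \<le> 1" for u x
   by (auto simp: g_def norm_mult indicator_def simp flip: prod_norm intro!: prod_le_1)
  have ci: "cnj (indicator B y) = indicator B y" for B and y :: real by (simp add: indicator_def)
  have cg: "cnj (g u x) = g (\<lambda>k. - u k) x" for u x
   unfolding g_def by (simp add: ci sum_negf exp_cnj)
  have IH: "(CLINT x|M. g u x * iexp (s * X j x)) =
    (\<Prod>k<j. complex_of_real (prob (X k -` A k \<inter> space M))) * (\<Prod>k\<in>{Suc j..<m}. \<phi> k (u k)) * \<phi> j s" for u s
  proof -
   have e: "(\<Sum>k\<in>{j..<m}. (u(j := s)) k * X k x) = s * X j x + (\<Sum>k\<in>{Suc j..<m}. u k * X k x)" for x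
    unfolding split by (subst sum.insert) (auto intro!: sum.cong)
   have e': "(\<Prod>k\<in>{j..<m}. \<phi> k ((u(j := s)) k)) = \<phi> j s * (\<Prod>k\<in>{Suc j..<m}. \<phi> k (u k))"
    unfolding split by (subst prod.insert) (auto intro!: prod.cong)
   have "(CLINT x|M. g u x * iexp (s * X j x)) =
    (CLINT x|M. (\<Prod>k<j. indicator (A k) (X k x)) * iexp (\<Sum>k\<in>{j..<m}. (u(j := s)) k * X k x))"
    unfolding e g_def by (simp add: distrib_left exp_add mult_ac)
   also have "\<dots> = (\<Prod>k<j. complex_of_real (prob (X k -` A k \<inter> space M))) * (\<Prod>k\<in>{j..<m}. \<phi> k ((u(j := s)) k))"
    by (rule Suc.IH) (use jm in auto)
   finally show ?thesis unfolding e' by (simp add: mult_ac)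
  qed
  have IH0: "(CLINT x|M. g u x) =
    (\<Prod>k<j. complex_of_real (prob (X k -` A k \<inter> space M))) * (\<Prod>k\<in>{Suc j..<m}. \<phi> k (u k))" for u
   using IH[of u 0] by (simp add: \<phi>0)
  have "(CLINT x|M. g u x * indicator (A j) (X j x)) = (CLINT x|M. g u x) * prob (X j -` A j \<inter> space M)"
  proof (rule indicator_factor_of_iexp_factor[OF gm gn X[OF jm]])
   show "(CLINT x|M. g u x * iexp (s * X j x)) = (CLINT x|M. g u x) * (CLINT x|M. iexp (s * X j x))" for s
    unfolding IH IH0 by (simp add: \<phi>_def)
   show "(CLINT x|M. cnj (g u x) * iexp (s * X j x)) = (CLINT x|M. cnj (g u x)) * (CLINT x|M. iexp (s * X j x))" for s
    unfolding cg IH IH0 by (simp add: \<phi>_def)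
  qed simp
  moreover have "g u x * indicator (A j) (X j x) = (\<Prod>k<Suc j. indicator (A k) (X k x)) * iexp (\<Sum>k\<in>{Suc j..<m}. u k * X k x)" for x
   by (simp add: g_def mult_ac)
  ultimately show ?case unfolding IH0 by (simp add: mult_ac)
 qed
 have "prob (\<Inter>j\<in>{..<m}. X j -` A j \<inter> space M) = (\<Prod>j<m. prob (X j -` A j \<inter> space M))" if A: "A \<in> (\<Pi> i\<in>{..<m}. sets borel)" for A
 proof -
  define A' where "A' k = (if k < m then A k else UNIV)" for k
  have A': "A' k \<in> sets borel" for k using A by (auto simp: A'_def)
  have I: "(\<Inter>j\<in>{..<m}. X j -` A j \<inter> space M) \<in> events"
   using A X False by (intro sets.finite_INT) (auto intro!: measurable_sets)
  have "(CLINT x|M. (\<Prod>k<m. indicator (A' k) (X k x))) = (\<Prod>k<m. complex_of_real (prob (X k -` A' k \<inter> space M)))"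
   using H[of m A' u] A' by simp
  also have "\<dots> = complex_of_real (\<Prod>j<m. prob (X j -` A j \<inter> space M))"
   by (simp add: A'_def)
  also have "(CLINT x|M. (\<Prod>k<m. indicator (A' k) (X k x))) = (CLINT x|M. complex_of_real (indicator (\<Inter>j\<in>{..<m}. X j -` A j \<inter> space M) x))"
  proof (rule Bochner_Integration.integral_cong[OF refl])
   fix x assume "x \<in> space M"
   show "(\<Prod>k<m. indicator (A' k) (X k x)) = complex_of_real (indicator (\<Inter>j\<in>{..<m}. X j -` A j \<inter> space M) x)"
   proof (cases "\<forall>k<m. X k x \<in> A k")
    case True
    then show ?thesis using \<open>x \<in> space M\<close> by (auto simp: A'_def intro!: prod.neutral)
   next
    case False
    then obtain k where "k < m" "X k x \<notin> A k" by auto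
    then show ?thesis by (auto simp: A'_def indicator_def intro!: prod_zero)
   qed
  qed
  also have "\<dots> = complex_of_real (prob (\<Inter>j\<in>{..<m}. X j -` A j \<inter> space M))"
   using I by simp
  finally show ?thesis by (simp only: of_real_eq_iff)
 qed
 then show ?thesis
  using False X by (subst indep_vars_finite[where E="\<lambda>_. sets borel"]) (auto simp: Int_stable_def sets.sigma_sets_eq[of borel, simplified])
qed

text \<open>Centred normal laws of variance \<open>v\<close>, the degenerate case \<open>v = 0\<close>
  included, which a density would exclude.\<close>

definition gauss :: "'w measure => ('w => real) => real => bool" where
 "gauss M X v \<longleftrightarrow> X \<in> borel_measurable M \<and>
   (\<forall>t. (CLINT \<omega>|M. iexp (t * X \<omega>)) = complex_of_real (exp (- (t\<^sup>2 * v / 2))))"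

lemma (in prob_space) gauss_lim:
 assumes g: "\<And>n. gauss M (X n) (v n)" and Y[measurable]: "Y \<in> borel_measurable M"
  and l: "AE \<omega> in M. (\<lambda>n. X n \<omega>) \<longlonglongrightarrow> Y \<omega>" and v: "v \<longlonglongrightarrow> v'"
 shows "gauss M Y v'"
 unfolding gauss_def
proof (intro conjI allI Y)
 fix t :: real
 have [measurable]: "X n \<in> borel_measurable M" for n using g by (auto simp: gauss_def)
 have "(\<lambda>n. CLINT \<omega>|M. iexp (t * X n \<omega>)) \<longlonglongrightarrow> (CLINT \<omega>|M. iexp (t * Y \<omega>))"
 proof (rule integral_dominated_convergence[where w="\<lambda>_. 1"])
  show "AE \<omega> in M. (\<lambda>n. iexp (t * X n \<omega>)) \<longlonglongrightarrow> iexp (t * Y \<omega>)"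
   using l by eventually_elim (auto intro!: tendsto_intros)
 qed auto
 moreover have "(\<lambda>n. CLINT \<omega>|M. iexp (t * X n \<omega>)) \<longlonglongrightarrow> complex_of_real (exp (- (t\<^sup>2 * v' / 2)))"
  using g unfolding gauss_def by (auto intro!: tendsto_intros v)
 ultimately show "(CLINT \<omega>|M. iexp (t * Y \<omega>)) = complex_of_real (exp (- (t\<^sup>2 * v' / 2)))"
  by (rule LIMSEQ_unique)
qed

lemma gauss_cong: "gauss M X v ==> (\<And>\<omega>. \<omega> \<in> space M ==> X \<omega> = Y \<omega>) ==> v = v' ==> gauss M Y v'"
 unfolding gauss_def by (simp cong: measurable_cong Bochner_Integration.integral_cong)

lemma (in prob_space) gauss_distributed:
 assumes g: "gauss M X v" and v: "v > 0"
 shows "distributed M lborel X (normal_density 0 (sqrt v))"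
proof -
 let ?S = "std_normal_distribution"
 interpret S: real_distribution ?S by (rule real_dist_normal_dist)
 have X[measurable]: "X \<in> borel_measurable M" using g by (auto simp: gauss_def)
 have "distributed ?S lborel (\<lambda>x. x) std_normal_density"
  unfolding distributed_def by (auto simp: distr_id2)
 from S.normal_density_affine[OF this, of "sqrt v" 0]
 have "distributed ?S lborel (\<lambda>x. sqrt v * x) (normal_density 0 (sqrt v))" using v by simp
 hence d: "density lborel (normal_density 0 (sqrt v)) = distr ?S borel (\<lambda>x. sqrt v * x)"
  unfolding distributed_def by (metis distr_cong sets_lborel)
 have "distr M borel X = distr ?S borel (\<lambda>x. sqrt v * x)"
 proof (rule Levy_uniqueness)
  show "char (distr M borel X) = char (distr ?S borel (\<lambda>x. sqrt v * x))"
  proof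
   fix t
   have "char (distr ?S borel (\<lambda>x. sqrt v * x)) t = char ?S (t * sqrt v)"
    unfolding char_def by (subst integral_distr) (auto simp: mult_ac)
   also have "\<dots> = complex_of_real (exp (- (t\<^sup>2 * v / 2)))"
    using v by (simp add: char_std_normal_distribution power_mult_distrib)
   also have "\<dots> = char (distr M borel X) t"
    unfolding char_def using g by (subst integral_distr) (auto simp: gauss_def)
   finally show "char (distr M borel X) t = char (distr ?S borel (\<lambda>x. sqrt v * x)) t" ..
  qed
 qed auto
 hence "distr M lborel X = density lborel (normal_density 0 (sqrt v))"
  unfolding d by (metis distr_cong sets_lborel)
 then show ?thesis unfolding distributed_def by simp
qed

text \<open>Centred Gaussian families with covariance \<open>K\<close>: every finite linear combination is
  normal, with the variance that \<open>K\<close> prescribes.\<close>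

definition gfam :: "'w measure => ('i => 'w => real) => ('i => 'i => real) => 'i set => bool" where
 "gfam M X K S \<longleftrightarrow> (\<forall>F c. finite F \<and> F \<subseteq> S \<longrightarrow>
   gauss M (\<lambda>\<omega>. \<Sum>i\<in>F. c i * X i \<omega>) (\<Sum>i\<in>F. \<Sum>j\<in>F. c i * c j * K i j))"

lemma gfamD: "gfam M X K S ==> finite F ==> F \<subseteq> S ==>
  gauss M (\<lambda>\<omega>. \<Sum>i\<in>F. c i * X i \<omega>) (\<Sum>i\<in>F. \<Sum>j\<in>F. c i * c j * K i j)"
 by (auto simp: gfam_def)

lemma gfam_single: "gfam M X K S ==> i \<in> S ==> gauss M (X i) (K i i)"
 using gfamD[of M X K S "{i}" "\<lambda>_. 1"] by simp

lemma gfam_measurable: "gfam M X K S ==> i \<in> S ==> X i \<in> borel_measurable M"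
 using gfam_single[of M X K S i] by (simp add: gauss_def)

lemma (in prob_space) gfam_lim:
 assumes g: "\<And>n. gfam M (X n) (K n) S" and Y: "\<And>i. i \<in> S ==> Y i \<in> borel_measurable M"
  and l: "\<And>i. i \<in> S ==> AE \<omega> in M. (\<lambda>n. X n i \<omega>) \<longlonglongrightarrow> Y i \<omega>"
  and k: "\<And>i j. i \<in> S ==> j \<in> S ==> (\<lambda>n. K n i j) \<longlonglongrightarrow> K' i j"
 shows "gfam M Y K' S"
 unfolding gfam_def
proof (intro allI impI, elim conjE)
 fix F :: "'b set" and c assume F: "finite F" "F \<subseteq> S"
 show "gauss M (\<lambda>\<omega>. \<Sum>i\<in>F. c i * Y i \<omega>) (\<Sum>i\<in>F. \<Sum>j\<in>F. c i * c j * K' i j)"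
 proof (rule gauss_lim[OF gfamD[OF g F]])
  show "(\<lambda>\<omega>. \<Sum>i\<in>F. c i * Y i \<omega>) \<in> borel_measurable M"
   using F Y by (intro borel_measurable_sum borel_measurable_times) auto
  have "AE \<omega> in M. \<forall>i\<in>F. (\<lambda>n. X n i \<omega>) \<longlonglongrightarrow> Y i \<omega>"
   using F l by (intro AE_finite_allI) auto
  then show "AE \<omega> in M. (\<lambda>n. \<Sum>i\<in>F. c i * X n i \<omega>) \<longlonglongrightarrow> (\<Sum>i\<in>F. c i * Y i \<omega>)"
   by eventually_elim (auto intro!: tendsto_intros)
  show "(\<lambda>n. \<Sum>i\<in>F. \<Sum>j\<in>F. c i * c j * K n i j) \<longlonglongrightarrow> (\<Sum>i\<in>F. \<Sum>j\<in>F. c i * c j * K' i j)"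
   using F k by (intro tendsto_intros) auto
 qed
qed

text \<open>Linear images of Gaussian families are Gaussian; the coefficients \<open>d\<close> of each new
  variable vanish outside a finite set \<open>F a\<close>, so all sums can be taken over a common finite index
  set.\<close>

lemma gfam_linear:
 assumes g: "gfam M X K S"
  and F: "\<And>a. a \<in> A ==> finite (F a) \<and> F a \<subseteq> S"
  and d: "\<And>a i. a \<in> A ==> i \<notin> F a ==> d a i = 0"
  and Y: "\<And>a \<omega>. a \<in> A ==> \<omega> \<in> space M ==> Y a \<omega> = (\<Sum>i\<in>F a. d a i * X i \<omega>)"
  and K': "\<And>a b. a \<in> A ==> b \<in> A ==> K' a b = (\<Sum>i\<in>F a. \<Sum>j\<in>F b. d a i * d b j * K i j)"
 shows "gfam M Y K' A"
 unfolding gfam_def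
proof (intro allI impI, elim conjE)
 fix G :: "'c set" and c assume G: "finite G" "G \<subseteq> A"
 define U where "U = (\<Union>a\<in>G. F a)"
 have U: "finite U" "U \<subseteq> S" using G F by (auto simp: U_def)
 have FU: "F a \<subseteq> U" if "a \<in> G" for a using that by (auto simp: U_def)
 have Y': "Y a \<omega> = (\<Sum>i\<in>U. d a i * X i \<omega>)" if "a \<in> G" "\<omega> \<in> space M" for a \<omega>
 proof -
  have "a \<in> A" using that G by auto
  then show ?thesis using that U FU[of a] d[of a] by (subst Y) (auto intro!: sum.mono_neutral_left)
 qed
 have KK: "K' a b = (\<Sum>i\<in>U. \<Sum>j\<in>U. d a i * d b j * K i j)" if "a \<in> G" "b \<in> G" for a b
 proof -
  have ab: "a \<in> A" "b \<in> A" using that G by auto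
  have "K' a b = (\<Sum>i\<in>F a. \<Sum>j\<in>U. d a i * d b j * K i j)"
  proof -
   have "(\<Sum>j\<in>F b. d a i * d b j * K i j) = (\<Sum>j\<in>U. d a i * d b j * K i j)" for i
    using that ab U FU[of b] d[of b] by (intro sum.mono_neutral_left) auto
   then show ?thesis using ab by (simp add: K')
  qed
  also have "\<dots> = (\<Sum>i\<in>U. \<Sum>j\<in>U. d a i * d b j * K i j)"
   using that ab U FU[of a] d[of a] by (auto intro!: sum.mono_neutral_left)
  finally show ?thesis .
 qed
 let ?c = "\<lambda>i. \<Sum>a\<in>G. c a * d a i"
 show "gauss M (\<lambda>\<omega>. \<Sum>i\<in>G. c i * Y i \<omega>) (\<Sum>i\<in>G. \<Sum>j\<in>G. c i * c j * K' i j)"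
 proof (rule gauss_cong[OF gfamD[OF g U, of ?c]])
  fix \<omega> assume w: "\<omega> \<in> space M"
  have "(\<Sum>i\<in>U. ?c i * X i \<omega>) = (\<Sum>i\<in>U. \<Sum>a\<in>G. c a * (d a i * X i \<omega>))"
   by (simp only: sum_distrib_right mult.assoc)
  also have "\<dots> = (\<Sum>a\<in>G. c a * (\<Sum>i\<in>U. d a i * X i \<omega>))"
   by (subst sum.swap) (simp add: sum_distrib_left)
  also have "\<dots> = (\<Sum>a\<in>G. c a * Y a \<omega>)" using w by (intro sum.cong) (auto simp: Y')
  finally show "(\<Sum>i\<in>U. ?c i * X i \<omega>) = (\<Sum>i\<in>G. c i * Y i \<omega>)" .
 next
  have "(\<Sum>i\<in>U. \<Sum>j\<in>U. ?c i * ?c j * K i j) = (\<Sum>i\<in>U. \<Sum>j\<in>U. \<Sum>a\<in>G. \<Sum>b\<in>G. c a * c b * (d a i * d b j * K i j))"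
  proof (intro sum.cong refl)
   fix i j
   have "?c i * ?c j = (\<Sum>a\<in>G. \<Sum>b\<in>G. c a * d a i * (c b * d b j))" by (rule sum_product)
   then show "?c i * ?c j * K i j = (\<Sum>a\<in>G. \<Sum>b\<in>G. c a * c b * (d a i * d b j * K i j))"
    by (simp add: sum_distrib_left sum_distrib_right mult_ac)
  qed
  also have "\<dots> = (\<Sum>i\<in>U. \<Sum>a\<in>G. \<Sum>j\<in>U. \<Sum>b\<in>G. c a * c b * (d a i * d b j * K i j))"
   by (intro sum.cong refl sum.swap)
  also have "\<dots> = (\<Sum>a\<in>G. \<Sum>i\<in>U. \<Sum>j\<in>U. \<Sum>b\<in>G. c a * c b * (d a i * d b j * K i j))"
   by (rule sum.swap)
  also have "\<dots> = (\<Sum>a\<in>G. \<Sum>i\<in>U. \<Sum>b\<in>G. \<Sum>j\<in>U. c a * c b * (d a i * d b j * K i j))"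
   by (intro sum.cong refl sum.swap)
  also have "\<dots> = (\<Sum>a\<in>G. \<Sum>b\<in>G. \<Sum>i\<in>U. \<Sum>j\<in>U. c a * c b * (d a i * d b j * K i j))"
   by (intro sum.cong refl sum.swap)
  also have "\<dots> = (\<Sum>a\<in>G. \<Sum>b\<in>G. c a * c b * K' a b)"
   by (intro sum.cong refl) (simp add: KK sum_distrib_left)
  finally show "(\<Sum>i\<in>U. \<Sum>j\<in>U. ?c i * ?c j * K i j) = (\<Sum>i\<in>G. \<Sum>j\<in>G. c i * c j * K' i j)" .
 qed
qed

lemma (in prob_space) gfam_indep:
 fixes X :: "nat => 'a => real"
 assumes g: "gfam M X (\<lambda>i j. if i = j then v i else 0) {..<m}"
 shows "indep_vars (\<lambda>_. borel) X {..<m}"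
proof (rule indep_vars_of_char)
 show "X k \<in> borel_measurable M" if "k < m" for k using gfam_measurable[OF g] that by simp
 fix u :: "nat => real"
 have "(CLINT x|M. iexp (1 * (\<Sum>k<m. u k * X k x))) = complex_of_real (exp (- (1\<^sup>2 * (\<Sum>i<m. \<Sum>j<m. u i * u j * (if i = j then v i else 0)) / 2)))"
  using gfamD[OF g finite_lessThan order_refl, of u] unfolding gauss_def by blast
 also have "(\<Sum>i<m. \<Sum>j<m. u i * u j * (if i = j then v i else 0)) = (\<Sum>i<m. (u i)\<^sup>2 * v i)"
  by (simp add: if_distrib sum.delta power2_eq_square cong: if_cong)
 also have "complex_of_real (exp (- (1\<^sup>2 * (\<Sum>i<m. (u i)\<^sup>2 * v i) / 2))) = (\<Prod>i<m. complex_of_real (exp (- ((u i)\<^sup>2 * v i / 2))))"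
  by (simp add: exp_sum sum_divide_distrib flip: sum_negf of_real_prod)
 also have "\<dots> = (\<Prod>k<m. CLINT x|M. iexp (u k * X k x))"
  using gfam_single[OF g] by (intro prod.cong) (auto simp: gauss_def)
 finally show "(CLINT x|M. iexp (\<Sum>k<m. u k * X k x)) = (\<Prod>k<m. CLINT x|M. iexp (u k * X k x))" by simp
qed

text \<open>The increments have covariance zero, and for Gaussian families this is independence.\<close>

lemma (in prob_space) brownian_motion_of_gfam:
 assumes c: "\<And>\<omega>. \<omega> \<in> space M ==> w 0 \<omega> = 0 \<and> continuous_on {0..} (\<lambda>t. w t \<omega>)"
  and g: "gfam M w min {0..}"
 shows "brownian_motion M w"
proof -
 have inc: "gfam M (\<lambda>i \<omega>. w (\<tau> (Suc i)) \<omega> - w (\<tau> i) \<omega>) (\<lambda>i j. if i = j then \<tau> (Suc i) - \<tau> i else 0) UNIV"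
  if t: "0 \<le> \<tau> 0" "mono \<tau>" for \<tau> :: "nat => real"
 proof (rule gfam_linear[OF g, where F="\<lambda>i. {\<tau> (Suc i), \<tau> i}" and d="\<lambda>i t. (if t = \<tau> (Suc i) then 1 else 0) - (if t = \<tau> i then 1 else 0)"])
  have pos: "0 \<le> \<tau> i" for i using t by (meson le0 monoD order_trans)
  then show "finite {\<tau> (Suc a), \<tau> a} \<and> {\<tau> (Suc a), \<tau> a} \<subseteq> {0..}" for a by auto
  show "w (\<tau> (Suc a)) \<omega> - w (\<tau> a) \<omega> = (\<Sum>i\<in>{\<tau> (Suc a), \<tau> a}. ((if i = \<tau> (Suc a) then 1 else 0) - (if i = \<tau> a then 1 else 0)) * w i \<omega>)" for a \<omega>
   by (cases "\<tau> (Suc a) = \<tau> a") auto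
  have st: "(\<Sum>i\<in>{\<tau> (Suc a), \<tau> a}. ((if i = \<tau> (Suc a) then 1 else 0) - (if i = \<tau> a then 1 else 0)) * f i) = f (\<tau> (Suc a)) - f (\<tau> a)" for a and f :: "real => real"
   by (cases "\<tau> (Suc a) = \<tau> a") auto
  show "(if a = b then \<tau> (Suc a) - \<tau> a else 0) = (\<Sum>i\<in>{\<tau> (Suc a), \<tau> a}. \<Sum>j\<in>{\<tau> (Suc b), \<tau> b}.
    ((if i = \<tau> (Suc a) then 1 else 0) - (if i = \<tau> a then 1 else 0)) * ((if j = \<tau> (Suc b) then 1 else 0) - (if j = \<tau> b then 1 else 0)) * min i j)" for a b
  proof -
   have m: "\<tau> i \<le> \<tau> j" if "i \<le> j" for i j using t that by (auto dest: monoD)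
   have "(\<Sum>i\<in>{\<tau> (Suc a), \<tau> a}. \<Sum>j\<in>{\<tau> (Suc b), \<tau> b}.
    ((if i = \<tau> (Suc a) then 1 else 0) - (if i = \<tau> a then 1 else 0)) * ((if j = \<tau> (Suc b) then 1 else 0) - (if j = \<tau> b then 1 else 0)) * min i j)
    = (\<Sum>i\<in>{\<tau> (Suc a), \<tau> a}. ((if i = \<tau> (Suc a) then 1 else 0) - (if i = \<tau> a then 1 else 0)) * (\<Sum>j\<in>{\<tau> (Suc b), \<tau> b}.
     ((if j = \<tau> (Suc b) then 1 else 0) - (if j = \<tau> b then 1 else 0)) * min i j))"
    by (simp only: sum_distrib_left mult.assoc)
   also have "\<dots> = (min (\<tau> (Suc a)) (\<tau> (Suc b)) - min (\<tau> (Suc a)) (\<tau> b)) - (min (\<tau> a) (\<tau> (Suc b)) - min (\<tau> a) (\<tau> b))"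
    unfolding st ..
   also have "\<dots> = (if a = b then \<tau> (Suc a) - \<tau> a else 0)"
   proof -
    consider "a = b" | "Suc a \<le> b" | "Suc b \<le> a" by linarith
    then show ?thesis
     using m[of a "Suc a"] m[of b "Suc b"] m[of "Suc a" b] m[of "Suc b" a] by cases (auto simp: min_def)
   qed
   finally show ?thesis ..
  qed
 qed auto
 show ?thesis
  unfolding brownian_motion_def
 proof (intro conjI ballI allI impI)
  show "w t \<in> borel_measurable M" if "0 \<le> t" for t using gfam_measurable[OF g] that by simp
  show "w 0 \<omega> = 0" "continuous_on {0..} (\<lambda>t. w t \<omega>)" if "\<omega> \<in> space M" for \<omega> using c that by auto
 next
  fix s t :: real assume st: "0 \<le> s \<and> s < t"
  define \<tau> where "\<tau> i = (if i = 0 then s else t)" for i :: nat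
  have "gauss M (\<lambda>\<omega>. w (\<tau> (Suc 0)) \<omega> - w (\<tau> 0) \<omega>) (\<tau> (Suc 0) - \<tau> 0)"
   using gfam_single[OF inc[of \<tau>], of 0] st by (auto simp: \<tau>_def mono_def)
  then show "distributed M lborel (\<lambda>\<omega>. w t \<omega> - w s \<omega>) (normal_density 0 (sqrt (t - s)))"
   using st by (intro gauss_distributed) (auto simp: \<tau>_def)
 next
  fix \<tau> :: "nat => real" and m assume "0 \<le> \<tau> 0 \<and> mono \<tau>"
  then have "gfam M (\<lambda>i \<omega>. w (\<tau> (Suc i)) \<omega> - w (\<tau> i) \<omega>) (\<lambda>i j. if i = j then \<tau> (Suc i) - \<tau> i else 0) {..<m}"
   using inc[of \<tau>] by (auto simp: gfam_def)
  then show "indep_vars (\<lambda>_. borel) (\<lambda>i \<omega>. w (\<tau> (Suc i)) \<omega> - w (\<tau> i) \<omega>) {..<m}"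
   by (rule gfam_indep)
 qed
qed

lemma distr_PiM_resample:
 assumes "\<And>i. i \<in> I ==> prob_space (M i)" "i \<in> I"
 shows "distr (M i \<Otimes>\<^sub>M PiM I M) (PiM I M) (\<lambda>(x, X). X(i := x)) = PiM I M"
 using distr_pair_PiM_eq_PiM[of I M i] assms by (simp add: insert_absorb)

lemma gfam_coordinates:
 "gfam (PiM (UNIV :: 'i set) (\<lambda>_. std_normal_distribution)) (\<lambda>i \<omega>. \<omega> i) (\<lambda>i j. if i = j then 1 else 0) UNIV"
 unfolding gfam_def
proof (intro allI impI, elim conjE)
 fix F :: "'i set" and c :: "'i => real" assume F: "finite F"
 let ?S = "std_normal_distribution" and ?P = "PiM (UNIV :: 'i set) (\<lambda>_. std_normal_distribution)"
 interpret S: real_distribution ?S by (rule real_dist_normal_dist)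
 interpret P: product_prob_space "\<lambda>_. ?S" "UNIV :: 'i set" ..
 have mc[measurable]: "(\<lambda>\<omega>. \<omega> i) \<in> borel_measurable ?P" for i
  using measurable_component_singleton[of i UNIV "\<lambda>_. ?S"] by (simp cong: measurable_cong_sets)
 have "P.indep_vars (\<lambda>_. borel) (\<lambda>i \<omega>. \<omega> i) (UNIV :: 'i set)"
 proof (subst P.indep_vars_iff_distr_eq_PiM')
  have "distr ?P borel (\<lambda>\<omega>. \<omega> i) = ?S" for i
   using P.PiM_component[of i] by (metis UNIV_I distr_cong sets_density sets_lborel)
  moreover have "distr ?P (Pi\<^sub>M UNIV (\<lambda>i. borel)) (\<lambda>x. restrict x UNIV) = ?P"
   by (subst distr_cong[of ?P ?P _ ?P _ "\<lambda>x. x"]) (auto intro!: sets_PiM_cong simp: distr_id2)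
  ultimately show "distr ?P (Pi\<^sub>M UNIV (\<lambda>i. borel)) (\<lambda>x. \<lambda>i\<in>UNIV. x i) = Pi\<^sub>M UNIV (\<lambda>i. distr ?P borel (\<lambda>\<omega>. \<omega> i))"
   by simp
 qed auto
 then have "P.indep_vars (\<lambda>_. borel) (\<lambda>i \<omega>. c i * \<omega> i) (UNIV :: 'i set)"
  by (rule P.indep_vars_compose2) auto
 then have ind: "P.indep_vars (\<lambda>_. borel) (\<lambda>i \<omega>. c i * \<omega> i) F"
  by (rule P.indep_vars_subset) auto
 have one: "(CLINT \<omega>|?P. iexp (t * (c i * \<omega> i))) = complex_of_real (exp (- (t * c i)\<^sup>2 / 2))" for t i
 proof -
  have "(CLINT \<omega>|?P. iexp (t * (c i * \<omega> i))) = (CLINT x|distr ?P ?S (\<lambda>\<omega>. \<omega> i). iexp (t * (c i * x)))"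
   by (subst integral_distr) auto
  also have "\<dots> = char ?S (t * c i)" by (simp add: P.PiM_component char_def mult_ac)
  finally show ?thesis by (simp add: char_std_normal_distribution)
 qed
 show "gauss ?P (\<lambda>\<omega>. \<Sum>i\<in>F. c i * \<omega> i) (\<Sum>i\<in>F. \<Sum>j\<in>F. c i * c j * (if i = j then 1 else 0))"
  unfolding gauss_def
 proof (intro conjI allI)
  fix t
  have "(CLINT \<omega>|?P. iexp (t * (\<Sum>i\<in>F. c i * \<omega> i))) = char (distr ?P borel (\<lambda>\<omega>. \<Sum>i\<in>F. c i * \<omega> i)) t"
   unfolding char_def by (subst integral_distr) auto
  also have "\<dots> = (\<Prod>i\<in>F. char (distr ?P borel (\<lambda>\<omega>. c i * \<omega> i)) t)"
   by (rule P.char_distr_sum[OF ind])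
  also have "\<dots> = (\<Prod>i\<in>F. complex_of_real (exp (- (t * c i)\<^sup>2 / 2)))"
   unfolding char_def by (intro prod.cong refl, subst integral_distr) (simp_all add: one del: of_real_mult of_real_exp)
  also have "\<dots> = complex_of_real (exp (\<Sum>i\<in>F. - (t * c i)\<^sup>2 / 2))"
   using F by (simp add: exp_sum)
  also have "(\<Sum>i\<in>F. - (t * c i)\<^sup>2 / 2) = - (t\<^sup>2 * (\<Sum>i\<in>F. \<Sum>j\<in>F. c i * c j * (if i = j then 1 else 0)) / 2)"
   using F by (simp add: if_distrib sum.delta power_mult_distrib power2_eq_square sum_distrib_left sum_divide_distrib sum_negf mult_ac cong: if_cong)
  finally show "(CLINT \<omega>|?P. iexp (t * (\<Sum>i\<in>F. c i * \<omega> i))) = complex_of_real (exp (- (t\<^sup>2 * (\<Sum>i\<in>F. \<Sum>j\<in>F. c i * c j * (if i = j then 1 else 0)) / 2)))" .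
 qed measurable
qed

section \<open>Levy's construction of Brownian motion\<close>

text \<open>The integral of the Haar scaling function of the unit interval starting at
  \<open>k\<close>.\<close>

definition ramp :: "nat => real => real" where
 "ramp k x = max 0 (min 1 (x - real k))"

lemma ramp_bounds: "0 \<le> ramp k x" "ramp k x \<le> 1" by (auto simp: ramp_def)
lemma ramp_zero: "x \<le> real k ==> ramp k x = 0" by (auto simp: ramp_def)
lemma ramp_mono: "x \<le> y ==> ramp k x \<le> ramp k y" by (auto simp: ramp_def)
lemma ramp_Suc_le: "ramp (Suc k) x \<le> (ramp k x)\<^sup>2"
 by (cases "x \<le> real k + 1") (auto simp: ramp_def)
lemma ramp_antimono: "ramp (Suc k) x \<le> ramp k x" by (auto simp: ramp_def)
lemma ramp_half: "ramp k x = (ramp (2*k) (2*x) + ramp (2*k+1) (2*x)) / 2"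
 by (auto simp: ramp_def max_def min_def)
lemma continuous_ramp[continuous_intros]:
 "continuous_on A f ==> continuous_on A (\<lambda>x. ramp k (f x))"
 unfolding ramp_def by (intro continuous_intros)

lemma sum_ramp: "0 \<le> x ==> x \<le> real K ==> (\<Sum>k<K. ramp k x) = x"
proof (induction K arbitrary: x)
 case (Suc K)
 show ?case
 proof (cases "x \<le> real K")
  case True then show ?thesis using Suc by (simp add: ramp_zero)
 next
  case False
  have "(\<Sum>k<K. ramp k x) = (\<Sum>k<K. ramp k (real K))"
   using False by (intro sum.cong) (auto simp: ramp_def)
  then show ?thesis using False Suc by (simp add: ramp_def)
 qed
qed auto

text \<open>The integral of the Haar wavelet of the unit interval starting at \<open>k\<close>, scaled to
  height one.\<close>

definition tent :: "nat => real => real" where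
 "tent k x = ramp (2*k) (2*x) - ramp (2*k+1) (2*x)"

lemma tent_bounds: "0 \<le> tent k x" "tent k x \<le> 1"
 using ramp_antimono[of "2*k" "2*x"] ramp_bounds[of "2*k" "2*x"] ramp_bounds[of "2*k+1" "2*x"] by (auto simp: tent_def)

lemma tent_zero: "x \<le> real k ==> tent k x = 0" by (simp add: tent_def ramp_zero)

lemma sum_tent: "(\<Sum>k<K. tent k x) \<le> 1"
proof -
 have "(\<Sum>k<K. tent k x) \<le> ramp 0 (2*x) - ramp (2*K) (2*x)"
 proof (induction K)
  case (Suc K)
  then show ?case using ramp_antimono[of "2*K+1" "2*x"] by (simp add: tent_def)
 qed simp
 then show ?thesis using ramp_bounds[of 0 "2*x"] ramp_bounds[of "2*K" "2*x"] by linarith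
qed

text \<open>Parseval for the two-dimensional space of step functions on the halves of a unit interval: the
  Haar scaling function and wavelet span the same space as the indicators of the halves.\<close>

lemma ramp_tent: "ramp k s * ramp k t + tent k s * tent k t / 4
  = (ramp (2*k) (2* s) * ramp (2*k) (2* t) + ramp (2*k+1) (2* s) * ramp (2*k+1) (2* t)) / 2"
 unfolding ramp_half[of k s] ramp_half[of k t] tent_def by (simp add: field_simps)

lemma sum_even_odd: "(\<Sum>k<2*K. f k) = (\<Sum>k<K. f (2*k) + f (2*k+1 :: nat))" for f :: "nat => real"
 by (induction K) auto

lemma ramp_cov_refine:
 "(\<Sum>k<K. ramp k s * ramp k t) + (\<Sum>k<K. tent k s * tent k t) / 4
  = (\<Sum>k<2*K. ramp k (2* s) * ramp k (2* t)) / 2"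
 unfolding sum_even_odd sum_divide_distrib sum.distrib[symmetric] ramp_tent ..

text \<open>Both factors are full ramps in every cell left of \<open>s\<close>, and at most one cell
  remains.\<close>

lemma ramp_cov_bound:
 assumes "0 \<le> s" "s \<le> t" "t \<le> real K"
 shows "\<bar>(\<Sum>k<K. ramp k s * ramp k t) - s\<bar> \<le> 1"
proof -
 have "(\<Sum>k<K. ramp k s * ramp k t) \<le> (\<Sum>k<K. ramp k s * 1)"
  by (intro sum_mono mult_left_mono) (auto simp: ramp_bounds)
 moreover have "(\<Sum>k<K. ramp k s) = s" using assms by (intro sum_ramp) auto
 moreover have "(\<Sum>k<K. ramp k s) - (\<Sum>k<K. ramp k s * ramp k t) \<le> 1"
 proof -
  have "(\<Sum>k<K. ramp k s) - (\<Sum>k<K. ramp k s * ramp k t) = (\<Sum>k<K. ramp k s - ramp k s * ramp k t)"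
   by (simp add: sum_subtractf)
  also have "\<dots> \<le> (\<Sum>k<K. ramp k s - ramp (Suc k) s)"
  proof (rule sum_mono)
   fix k
   have "ramp k s * ramp k s \<le> ramp k s * ramp k t"
    using assms by (intro mult_left_mono ramp_mono ramp_bounds) auto
   then show "ramp k s - ramp k s * ramp k t \<le> ramp k s - ramp (Suc k) s"
    using ramp_Suc_le[of k s] by (simp add: power2_eq_square)
  qed
  also have "\<dots> = ramp 0 s - ramp K s" by (induction K) auto
  finally show ?thesis using ramp_bounds[of 0 s] ramp_bounds[of K s] by linarith
 qed
 ultimately show ?thesis by auto
qed

text \<open>The Schauder functions: level \<open>0\<close> carries the increments over unit intervals, level
  \<open>n + 1\<close> the midpoint corrections at mesh \<open>2^-n\<close>.\<close>

fun bmcoef :: "nat => nat => real => real" where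
 "bmcoef 0 k t = ramp k t"
| "bmcoef (Suc n) k t = sqrt (1 / 2 ^ n) / 2 * tent k (2 ^ n * t)"

lemma continuous_bmcoef[continuous_intros]: "continuous_on A (bmcoef n k)"
 by (cases n) (auto simp: tent_def fun_eq_iff intro!: continuous_intros simp flip: fun_eq_iff)

lemma bmcoef_zero: "t \<le> real T ==> 2 ^ n * T \<le> k ==> bmcoef n k t = 0"
proof (cases n)
 case 0 assume "t \<le> real T" "2 ^ n * T \<le> k" then show ?thesis using 0 by (auto intro!: ramp_zero)
next
 case (Suc m) assume a: "t \<le> real T" "2 ^ n * T \<le> k"
 have "2 ^ m * t \<le> 2 ^ m * real T" using a by simp
 also have "\<dots> = real (2 ^ m * T)" by simp
 also have "\<dots> \<le> real k" using a Suc by (simp only: of_nat_le_iff) (auto intro: order_trans[rotated])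
 finally show ?thesis using Suc by (simp add: tent_zero)
qed

text \<open>The refinement identity telescopes: the levels up to \<open>N\<close> together have the covariance
  of a random walk interpolated at mesh \<open>2^-N\<close>, which tends to \<open>min s t\<close>.\<close>

lemma bmcoef_sum:
 assumes "s \<le> real T" "t \<le> real T"
 shows "(\<Sum>n\<le>N. \<Sum>k<2^n*T. bmcoef n k s * bmcoef n k t) = (\<Sum>k<2^N*T. ramp k (2^N* s) * ramp k (2^N* t)) / 2^N"
proof (induction N)
 case (Suc N)
 have "(\<Sum>k<2^Suc N*T. bmcoef (Suc N) k s * bmcoef (Suc N) k t) = (\<Sum>k<2^N*T. bmcoef (Suc N) k s * bmcoef (Suc N) k t)"
 proof (rule sum.mono_neutral_right)
  show "\<forall>k\<in>{..<2 ^ Suc N * T} - {..<2 ^ N * T}. bmcoef (Suc N) k s * bmcoef (Suc N) k t = 0"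
  proof
   fix k assume "k \<in> {..<2 ^ Suc N * T} - {..<2 ^ N * T}"
   hence "2 ^ N * T \<le> k" by auto
   hence "real (2 ^ N * T) \<le> real k" by (simp only: of_nat_le_iff)
   moreover have "2 ^ N * s \<le> real (2 ^ N * T)" using assms by simp
   ultimately have "tent k (2 ^ N * s) = 0" by (intro tent_zero) linarith
   then show "bmcoef (Suc N) k s * bmcoef (Suc N) k t = 0" by simp
  qed
 qed auto
 also have "\<dots> = (\<Sum>k<2^N*T. tent k (2^N* s) * tent k (2^N* t)) / 4 / 2^N"
  by (simp add: sum_divide_distrib field_simps real_sqrt_divide)
 finally have e: "(\<Sum>k<2^Suc N*T. bmcoef (Suc N) k s * bmcoef (Suc N) k t) = (\<Sum>k<2^N*T. tent k (2^N* s) * tent k (2^N* t)) / 4 / 2^N" .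
 have "(\<Sum>n\<le>Suc N. \<Sum>k<2^n*T. bmcoef n k s * bmcoef n k t) =
  ((\<Sum>k<2^N*T. ramp k (2^N* s) * ramp k (2^N* t)) + (\<Sum>k<2^N*T. tent k (2^N* s) * tent k (2^N* t)) / 4) / 2^N"
  using Suc e by (simp add: add_divide_distrib)
 also have "\<dots> = (\<Sum>k<2*(2^N*T). ramp k (2*(2^N* s)) * ramp k (2*(2^N* t))) / 2 / 2^N"
  by (simp only: ramp_cov_refine)
 finally show ?case by (simp add: mult_ac)
qed simp

lemma bmcoef_cov_lim:
 assumes "0 \<le> s" "s \<le> real T" "0 \<le> t" "t \<le> real T"
 shows "(\<lambda>N. \<Sum>n\<le>N. \<Sum>k<2^n*T. bmcoef n k s * bmcoef n k t) \<longlonglongrightarrow> min s t"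
proof -
 have *: "(\<lambda>N. \<Sum>n\<le>N. \<Sum>k<2^n*T. bmcoef n k s * bmcoef n k t) \<longlonglongrightarrow> s"
  if st: "0 \<le> s" "s \<le> t" "t \<le> real T" for s t
 proof -
  have "(\<lambda>N. (1/2)^N) \<longlonglongrightarrow> (0::real)" by (rule LIMSEQ_realpow_zero) auto
  then have "(\<lambda>N. s - (\<Sum>n\<le>N. \<Sum>k<2^n*T. bmcoef n k s * bmcoef n k t)) \<longlonglongrightarrow> 0"
  proof (rule Lim_null_comparison[rotated])
   show "\<forall>\<^sub>F N in sequentially. norm (s - (\<Sum>n\<le>N. \<Sum>k<2^n*T. bmcoef n k s * bmcoef n k t)) \<le> (1/2)^N"
   proof (rule always_eventually, rule allI)
    fix N
    have "\<bar>(\<Sum>k<2^N*T. ramp k (2^N* s) * ramp k (2^N* t)) - 2^N* s\<bar> \<le> 1"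
     using st by (intro ramp_cov_bound) auto
    hence "\<bar>(\<Sum>k<2^N*T. ramp k (2^N* s) * ramp k (2^N* t)) - 2^N* s\<bar> / 2^N \<le> 1 / 2^N"
     by (rule divide_right_mono) auto
    also have "\<bar>(\<Sum>k<2^N*T. ramp k (2^N* s) * ramp k (2^N* t)) - 2^N* s\<bar> / 2^N
      = \<bar>((\<Sum>k<2^N*T. ramp k (2^N* s) * ramp k (2^N* t)) - 2^N* s) / 2^N\<bar>" by simp
    also have "((\<Sum>k<2^N*T. ramp k (2^N* s) * ramp k (2^N* t)) - 2^N* s) / 2^N
     = (\<Sum>k<2^N*T. ramp k (2^N* s) * ramp k (2^N* t)) / 2^N - s" by (simp add: diff_divide_distrib)
    finally show "norm (s - (\<Sum>n\<le>N. \<Sum>k<2^n*T. bmcoef n k s * bmcoef n k t)) \<le> (1/2)^N"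
     using st by (subst bmcoef_sum) (auto simp: power_divide abs_minus_commute)
   qed
  qed
  from tendsto_diff[OF tendsto_const[of s] this] show ?thesis by simp
 qed
 show ?thesis
 proof (cases "s \<le> t")
  case True then show ?thesis using *[of s t] assms by simp
 next
  case False then show ?thesis using *[of t s] assms by (simp add: mult.commute)
 qed
qed

abbreviation Gsp :: "(real => real) measure" where
 "Gsp \<equiv> PiM UNIV (\<lambda>_. std_normal_distribution)"

text \<open>Level \<open>n\<close>, position \<open>k\<close> uses a negative coordinate, so that the
  coordinates \<open>real j\<close> stay free.\<close>

definition bmidx :: "nat => nat => real" where
 "bmidx n k = - 1 - real (prod_encode (n, k))"

lemma bmidx_inj: "bmidx n k = bmidx n' k' \<longleftrightarrow> n = n' \<and> k = k'"
 by (auto simp: bmidx_def)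

lemma bmidx_neq: "bmidx n k \<noteq> real j"
 unfolding bmidx_def using of_nat_0_le_iff[of j, where 'a=real] of_nat_0_le_iff[of "prod_encode (n,k)", where 'a=real] by linarith

definition bmlev :: "nat => real => (real => real) => real" where
 "bmlev n t \<omega> = (\<Sum>k<2^n*nat \<lceil>t\<rceil>. bmcoef n k t * \<omega> (bmidx n k))"

lemma bmlev_eq: "t \<le> real T ==> bmlev n t \<omega> = (\<Sum>k<2^n*T. bmcoef n k t * \<omega> (bmidx n k))"
 unfolding bmlev_def
proof (rule sum.mono_neutral_left)
 assume t: "t \<le> real T"
 hence "nat \<lceil>t\<rceil> \<le> T" by linarith
 then show "{..<2 ^ n * nat \<lceil>t\<rceil>} \<subseteq> {..<2 ^ n * T}" by (auto intro: less_le_trans)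
 have "t \<le> real (nat \<lceil>t\<rceil>)" by linarith
 then show "\<forall>k\<in>{..<2 ^ n * T} - {..<2 ^ n * nat \<lceil>t\<rceil>}. bmcoef n k t * \<omega> (bmidx n k) = 0"
  using bmcoef_zero[of t "nat \<lceil>t\<rceil>" n] by auto
qed auto

text \<open>A summable bound for level \<open>n + 1\<close>. It comes from \<open>\<bar>x\<bar> \<le> \<delta>
  + x^4 / \<delta>^3\<close> with \<open>\<delta> = sqrt (2^n) * (9/10)^n\<close>, multiplied by the
  coefficient \<open>sqrt (1/2^n)\<close> of the tents; at every time at most one tent of a level is nonzero.
  As there are of the order of \<open>2^n\<close> normal coordinates with fourth moment \<open>3\<close>, the
  expectations are of the order of \<open>(500/729)^n\<close>.\<close>

definition bmdom :: "nat => nat => (real => real) => real" where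
 "bmdom T n \<omega> = (1/4)^n * (1000/729)^n * (\<Sum>k<2^Suc n*T. (\<omega> (bmidx (Suc n) k))^4)"

lemma bmdom_nonneg: "0 \<le> bmdom T n \<omega>"
 unfolding bmdom_def by (intro mult_nonneg_nonneg sum_nonneg) auto

lemma bmlev_le:
 assumes "t \<le> real T"
 shows "\<bar>bmlev (Suc n) t \<omega>\<bar> \<le> (9/10)^n + bmdom T n \<omega>"
proof -
 \<comment> \<open>the threshold that splits the two terms of the bound\<close>
 define \<delta> :: real where "\<delta> = sqrt (2^n) * (9/10)^n"
 have d: "\<delta> > 0" by (simp add: \<delta>_def)
 have x: "\<bar>x\<bar> \<le> \<delta> + x^4 / \<delta>^3" for x
 proof (cases "\<bar>x\<bar> \<le> \<delta>")
  case True then show ?thesis using d by (auto intro!: add_increasing2)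
 next
  case False
  have "\<bar>x\<bar> * \<delta>^3 \<le> \<bar>x\<bar> * \<bar>x\<bar>^3" using False d by (intro mult_left_mono power_mono) auto
  also have "\<dots> = x^4" by (simp add: power4_eq_xxxx power3_eq_cube abs_if)
  finally have "\<bar>x\<bar> \<le> x^4 / \<delta>^3" using d by (simp add: field_simps)
  then show ?thesis using d by linarith
 qed
 let ?h = "\<lambda>k. tent k (2^n* t)" and ?w = "\<lambda>k. \<omega> (bmidx (Suc n) k)"
 have "\<bar>bmlev (Suc n) t \<omega>\<bar> \<le> (\<Sum>k<2^Suc n*T. \<bar>bmcoef (Suc n) k t * ?w k\<bar>)"
  unfolding bmlev_eq[OF assms] by (rule sum_abs)
 also have "\<dots> = sqrt (1/2^n) / 2 * (\<Sum>k<2^Suc n*T. ?h k * \<bar>?w k\<bar>)"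
  unfolding sum_distrib_left by (intro sum.cong) (auto simp: abs_mult tent_bounds)
 also have "\<dots> \<le> sqrt (1/2^n) / 2 * (\<Sum>k<2^Suc n*T. ?h k * \<delta> + 1 * ((?w k)^4/\<delta>^3))"
 proof (intro mult_left_mono sum_mono)
  fix k
  have "?h k * \<bar>?w k\<bar> \<le> ?h k * (\<delta> + (?w k)^4/\<delta>^3)" by (intro mult_left_mono x tent_bounds)
  also have "\<dots> \<le> ?h k * \<delta> + 1 * ((?w k)^4/\<delta>^3)"
   unfolding distrib_left using d by (intro add_left_mono mult_right_mono tent_bounds) auto
  finally show "?h k * \<bar>?w k\<bar> \<le> ?h k * \<delta> + 1 * ((?w k)^4/\<delta>^3)" .
 qed auto
 also have "\<dots> = sqrt (1/2^n) / 2 * ((\<Sum>k<2^Suc n*T. ?h k) * \<delta> + (\<Sum>k<2^Suc n*T. (?w k)^4) / \<delta>^3)"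
  by (simp add: sum.distrib sum_distrib_right sum_divide_distrib del: power_Suc)
 also have "\<dots> \<le> sqrt (1/2^n) / 2 * (1 * \<delta> + (\<Sum>k<2^Suc n*T. (?w k)^4) / \<delta>^3)"
  using d by (intro mult_left_mono add_right_mono mult_right_mono sum_tent) auto
 also have "\<dots> = (sqrt (1/2^n) * \<delta> + sqrt (1/2^n) / \<delta>^3 * (\<Sum>k<2^Suc n*T. (?w k)^4)) / 2"
  by (simp add: field_simps del: power_Suc)
 also have "sqrt (1/2^n) * \<delta> = (9/10)^n" by (simp add: \<delta>_def real_sqrt_divide)
 also have "sqrt (1/2^n) / \<delta>^3 = (1/4)^n * (1000/729)^n"
 proof -
  have s: "sqrt (2^n) * sqrt (2^n) = (2::real)^n" by simp
  have q: "(9/10)^n * (9/10)^n * (9/10)^n = (729/1000 :: real)^n" by (simp flip: power_mult_distrib)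
  have "\<delta>^3 = (sqrt (2^n) * sqrt (2^n)) * sqrt (2^n) * ((9/10)^n * (9/10)^n * (9/10)^n)"
   by (simp only: \<delta>_def power3_eq_cube mult_ac)
  hence "\<delta>^3 = 2^n * sqrt (2^n) * (729/1000)^n" unfolding s q .
  hence "sqrt (1/2^n) / \<delta>^3 = 1 / ((sqrt (2^n) * sqrt (2^n)) * 2^n * (729/1000)^n)"
   by (simp add: real_sqrt_divide mult_ac)
  also have "\<dots> = 1 / (4^n * (729/1000)^n)" unfolding s by (simp flip: power_mult_distrib)
  finally show ?thesis by (simp add: power_divide)
 qed
 also have "((9/10)^n + (1/4)^n * (1000/729)^n * (\<Sum>k<2^Suc n*T. (?w k)^4)) / 2 = ((9/10)^n + bmdom T n \<omega>) / 2"
  by (simp add: bmdom_def)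
 also have "\<dots> \<le> (9/10)^n + bmdom T n \<omega>" using bmdom_nonneg[of T n \<omega>] by simp
 finally show ?thesis .
qed

definition bmgood :: "(real => real) set" where
 "bmgood = {\<omega>. \<forall>T::nat. (\<Sum>n. ennreal (bmdom T n \<omega>)) < \<top>}"

text \<open>On the null set where the series need not converge the path is set to zero, so that continuity
  holds for every sample point.\<close>

definition bm :: "real => (real => real) => real" where
 "bm t \<omega> = (if \<omega> \<in> bmgood then \<Sum>n. bmlev n t \<omega> else 0)"

lemma bmdom_summable: "\<omega> \<in> bmgood ==> summable (\<lambda>n. (9/10)^n + bmdom T n \<omega>)"
 by (intro summable_add summable_geometric summable_suminf_not_top) (auto simp: bmdom_nonneg bmgood_def less_top)

lemma bm_uniform:
 assumes "\<omega> \<in> bmgood"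
 shows "uniform_limit {0..real T} (\<lambda>N t. \<Sum>n<N. bmlev n t \<omega>) (\<lambda>t. bm t \<omega>) sequentially"
proof -
 have "uniform_limit {0..real T} (\<lambda>N t. \<Sum>n<N. bmlev (Suc n) t \<omega>) (\<lambda>t. \<Sum>n. bmlev (Suc n) t \<omega>) sequentially"
  by (rule Weierstrass_m_test[OF _ bmdom_summable[OF assms, of T]]) (auto intro: bmlev_le)
 hence "uniform_limit {0..real T} (\<lambda>N t. bmlev 0 t \<omega> + (\<Sum>n<N. bmlev (Suc n) t \<omega>)) (\<lambda>t. bmlev 0 t \<omega> + (\<Sum>n. bmlev (Suc n) t \<omega>)) sequentially"
  by (intro uniform_limit_intros)
 hence "uniform_limit {0..real T} (\<lambda>N t. (\<Sum>n<Suc N. bmlev n t \<omega>)) (\<lambda>t. bmlev 0 t \<omega> + (\<Sum>n. bmlev (Suc n) t \<omega>)) sequentially"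
  by (simp only: sum.lessThan_Suc_shift)
 hence "uniform_limit {0..real T} (\<lambda>N t. (\<Sum>n<N. bmlev n t \<omega>)) (\<lambda>t. bmlev 0 t \<omega> + (\<Sum>n. bmlev (Suc n) t \<omega>)) sequentially"
  unfolding uniform_limit_iff by (subst (asm) eventually_sequentially_Suc)
 moreover have eq: "bmlev 0 t \<omega> + (\<Sum>n. bmlev (Suc n) t \<omega>) = bm t \<omega>" if "t \<in> {0..real T}" for t
 proof -
  have "summable (\<lambda>n. bmlev (Suc n) t \<omega>)"
   by (rule summable_comparison_test'[OF bmdom_summable[OF assms, of T], of 0]) (use that in \<open>auto intro: bmlev_le\<close>)
  then have "summable (\<lambda>n. bmlev n t \<omega>)" using summable_Suc_iff[of "\<lambda>n. bmlev n t \<omega>"] by simp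
  from suminf_split_head[OF this] show ?thesis using assms by (simp add: bm_def)
 qed
 moreover have "uniform_limit {0..real T} (\<lambda>N t. \<Sum>n<N. bmlev n t \<omega>) (\<lambda>t. bmlev 0 t \<omega> + (\<Sum>n. bmlev (Suc n) t \<omega>)) sequentially
   \<longleftrightarrow> uniform_limit {0..real T} (\<lambda>N t. \<Sum>n<N. bmlev n t \<omega>) (\<lambda>t. bm t \<omega>) sequentially"
  by (rule uniform_limit_cong') (use eq in auto)
 ultimately show ?thesis by simp
qed

lemma bm_tendsto: "\<omega> \<in> bmgood ==> 0 \<le> t ==> (\<lambda>N. \<Sum>n\<le>N. bmlev n t \<omega>) \<longlonglongrightarrow> bm t \<omega>"
 using tendsto_uniform_limitI[OF bm_uniform[of \<omega> "nat \<lceil>t\<rceil>"], of t] real_nat_ceiling_ge[of t]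
 by (auto simp: lessThan_Suc_atMost[symmetric] dest: LIMSEQ_Suc)

lemma continuous_bm: "continuous_on {0..} (\<lambda>t. bm t \<omega>)"
proof (cases "\<omega> \<in> bmgood")
 case True
 have c: "continuous_on {0..real T} (\<lambda>t. bm t \<omega>)" for T
 proof (rule uniform_limit_theorem[OF _ bm_uniform[OF True]])
  have "continuous_on {0..real T} (\<lambda>t. \<Sum>n<N. bmlev n t \<omega>)" for N
  proof (intro continuous_on_sum)
   fix n
   have "continuous_on {0..real T} (\<lambda>t. \<Sum>k<2^n*T. bmcoef n k t * \<omega> (bmidx n k))"
    by (intro continuous_intros)
   then show "continuous_on {0..real T} (\<lambda>t. bmlev n t \<omega>)"
    by (subst continuous_on_cong[OF refl bmlev_eq]) auto
  qed
  then show "\<forall>\<^sub>F N in sequentially. continuous_on {0..real T} (\<lambda>t. \<Sum>n<N. bmlev n t \<omega>)" by simp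
 qed simp
 show ?thesis
  unfolding continuous_on_eq_continuous_within
 proof
  fix x :: real assume x: "x \<in> {0..}"
  let ?T = "nat \<lceil>x\<rceil> + 1"
  have xT: "x < real ?T" by linarith
  have "continuous (at x within {0..real ?T}) (\<lambda>t. bm t \<omega>)"
   using c[of ?T] x xT by (simp add: continuous_on_eq_continuous_within)
  moreover have "at x within {0..real ?T} = at x within {0..}"
   by (rule at_within_nhd[of x "{..<real ?T}"]) (use xT in auto)
  ultimately show "continuous (at x within {0..}) (\<lambda>t. bm t \<omega>)" by (simp only:)
 qed
qed (simp add: bm_def)

lemma bm_zero: "bm 0 \<omega> = 0" by (simp add: bm_def bmlev_def)

lemma measurable_Gsp_component[measurable]: "(\<lambda>\<omega>. \<omega> i) \<in> borel_measurable Gsp"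
 using measurable_component_singleton[of i UNIV "\<lambda>_. std_normal_distribution"] by (simp cong: measurable_cong_sets)

lemma measurable_bmdom[measurable]: "bmdom T n \<in> borel_measurable Gsp"
 unfolding bmdom_def by measurable

lemma measurable_bmlev[measurable]: "bmlev n t \<in> borel_measurable Gsp"
 unfolding bmlev_def by measurable

lemma bmgood_sets[measurable]: "Measurable.pred Gsp (\<lambda>\<omega>. \<omega> \<in> bmgood)"
 unfolding bmgood_def by measurable

lemma measurable_bm[measurable]: "bm t \<in> borel_measurable Gsp"
 unfolding bm_def by measurable

lemma prob_space_Gsp: "prob_space Gsp"
 by (intro prob_space_PiM real_distribution.axioms(1) real_dist_normal_dist)

lemma nn_integral_Gsp_component: "f \<in> borel_measurable borel ==> (\<integral>\<^sup>+\<omega>. f (\<omega> i) \<partial>Gsp) = (\<integral>\<^sup>+x. f x \<partial>std_normal_distribution)"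
proof -
 assume f[measurable]: "f \<in> borel_measurable borel"
 have "(\<integral>\<^sup>+\<omega>. f (\<omega> i) \<partial>Gsp) = (\<integral>\<^sup>+x. f x \<partial>distr Gsp std_normal_distribution (\<lambda>\<omega>. \<omega> i))"
  by (subst nn_integral_distr) auto
 then show ?thesis
  using distr_PiM_component[of UNIV "\<lambda>_. std_normal_distribution" i] by (simp add: real_distribution.axioms(1) real_dist_normal_dist)
qed

lemma AE_bmgood: "AE \<omega> in Gsp. \<omega> \<in> bmgood"
proof -
 have "AE \<omega> in Gsp. (\<Sum>n. ennreal (bmdom T n \<omega>)) \<noteq> \<infinity>" for T
 proof (rule nn_integral_PInf_AE)
  have m4: "(\<integral>\<^sup>+x. ennreal (x^4) \<partial>std_normal_distribution) = 3"
  proof -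
   have "(\<integral>\<^sup>+x. ennreal (x^4) \<partial>std_normal_distribution) = ennreal (LINT x|std_normal_distribution. x^4)"
    using std_normal_distribution_even_moments(2)[of 2] by (intro nn_integral_eq_integral) auto
   also have "(LINT x|std_normal_distribution. x^4) = 3"
    using std_normal_distribution_even_moments(1)[of 2] by (simp add: fact_numeral)
   finally show ?thesis by simp
  qed
  have e: "(\<integral>\<^sup>+\<omega>. ennreal (bmdom T n \<omega>) \<partial>Gsp) = ennreal (6 * real T * (500/729)^n)" for n
  proof -
   have "(\<integral>\<^sup>+\<omega>. ennreal (bmdom T n \<omega>) \<partial>Gsp) = (\<integral>\<^sup>+\<omega>. ennreal ((1/4)^n * (1000/729)^n) * (\<Sum>k<2^Suc n*T. ennreal ((\<omega> (bmidx (Suc n) k))^4)) \<partial>Gsp)"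
    unfolding bmdom_def by (intro nn_integral_cong) (simp add: ennreal_mult sum_nonneg del: power_Suc flip: sum_ennreal)
   also have "\<dots> = ennreal ((1/4)^n * (1000/729)^n) * (\<Sum>k<2^Suc n*T. 3)"
    by (subst nn_integral_cmult, measurable, subst nn_integral_sum) (auto simp: nn_integral_Gsp_component[of "\<lambda>x. ennreal (x^4)"] m4 simp del: power_Suc sum_ennreal)
   also have "\<dots> = ennreal ((1/4)^n * (1000/729)^n) * ennreal (real (2^Suc n*T) * 3)"
    by (simp del: power_Suc add: ennreal_mult ennreal_of_nat_eq_real_of_nat)
   also have "\<dots> = ennreal (((1/4)^n * (1000/729)^n) * (real (2^Suc n*T) * 3))"
    by (rule ennreal_mult[symmetric]) auto
   also have "((1/4)^n * (1000/729)^n) * (real (2^Suc n*T) * 3) = 6 * real T * (500/729 :: real)^n"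
   proof -
    have "(500/729 :: real)^n = ((1/4) * (1000/729) * 2)^n" by simp
    also have "\<dots> = (1/4)^n * (1000/729)^n * 2^n" by (simp only: power_mult_distrib)
    finally show ?thesis by simp
   qed
   finally show ?thesis .
  qed
  have "(\<integral>\<^sup>+\<omega>. (\<Sum>n. ennreal (bmdom T n \<omega>)) \<partial>Gsp) = (\<Sum>n. ennreal (6 * real T * (500/729)^n))"
   by (subst nn_integral_suminf) (auto simp: e)
  also have "\<dots> \<noteq> \<infinity>"
   by (subst suminf_ennreal2) (auto intro!: summable_mult summable_geometric)
  finally show "(\<integral>\<^sup>+\<omega>. (\<Sum>n. ennreal (bmdom T n \<omega>)) \<partial>Gsp) \<noteq> \<infinity>" .
 qed simp
 hence "AE \<omega> in Gsp. \<forall>T. (\<Sum>n. ennreal (bmdom T n \<omega>)) \<noteq> \<infinity>" by (simp add: AE_all_countable)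
 then show ?thesis by eventually_elim (simp add: bmgood_def less_top)
qed

lemma bm_irrelevant: "bm t (fun_upd \<omega> (real j) b) = bm t \<omega>"
 by (simp add: bm_def bmlev_def bmgood_def bmdom_def bmidx_neq)

section \<open>Replacing Wiener integrals by free coordinates\<close>

text \<open>The covariance of the free coordinates together with the Brownian motion, which uses none of
  them.\<close>

definition jointK :: "nat + real => nat + real => real" where
 "jointK a b = (case (a, b) of (Inl i, Inl j) => if i = j then 1 else 0
   | (Inr s, Inr t) => min s t | _ => 0)"

lemma gfam_joint:
 "gfam Gsp (\<lambda>a \<omega>. case a of Inl j => \<omega> (real j) | Inr t => bm t \<omega>) jointK (UNIV <+> {0..})"
proof -
 interpret prob_space Gsp by (rule prob_space_Gsp)
 define F :: "nat => nat + real => real set" where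
  "F N a = (case a of Inl j => {real j} | Inr t => (\<lambda>(n, k). bmidx n k) ` (SIGMA n:{..N}. {..<2^n * nat \<lceil>t\<rceil>}))" for N a
 define G :: "nat + real => real => real" where
  "G a i = (case a of Inl j => if i = real j then 1 else 0
    | Inr t => if i < 0 then (case prod_decode (nat \<lfloor>- 1 - i\<rfloor>) of (n, k) => bmcoef n k t) else 0)" for a i
 have Gb: "G (Inr t) (bmidx n k) = bmcoef n k t" for t n k
  by (simp add: G_def bmidx_def)
 define d where "d N a i = (if i \<in> F N a then G a i else 0)" for N a i
 have inj: "inj_on (\<lambda>(n, k). bmidx n k) A" for A by (auto simp: inj_on_def bmidx_inj)
 have sumF: "(\<Sum>i\<in>F N (Inr t). f i) = (\<Sum>n\<le>N. \<Sum>k<2^n * nat \<lceil>t\<rceil>. f (bmidx n k))" for N t and f :: "real => real"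
  by (simp add: F_def sum.reindex[OF inj, unfolded case_prod_unfold] sum.Sigma o_def case_prod_unfold)
 have finF: "finite (F N a)" for N a by (auto simp: F_def split: sum.split)
 have memF: "bmidx n k \<in> F N (Inr t) \<longleftrightarrow> n \<le> N \<and> k < 2^n * nat \<lceil>t\<rceil>" for n k N t
  by (auto simp: F_def bmidx_inj image_iff)
 define X where "X N a \<omega> = (case a of Inl j => \<omega> (real j) | Inr t => (\<Sum>n\<le>N. bmlev n t \<omega>))" for N a and \<omega> :: "real => real"
 define KN where "KN N a b = (\<Sum>i\<in>F N a. d N a i * d N b i)" for N a b
 have g: "gfam Gsp (X N) (KN N) (UNIV <+> {0..})" for N
 proof (rule gfam_linear[OF gfam_coordinates, where F="F N" and d="d N"])
  show "X N a \<omega> = (\<Sum>i\<in>F N a. d N a i * \<omega> i)" for a \<omega>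
  proof (cases a)
   case (Inl j) then show ?thesis by (simp add: X_def d_def G_def F_def)
  next
   case (Inr t)
   have "(\<Sum>i\<in>F N (Inr t). d N (Inr t) i * \<omega> i) = (\<Sum>n\<le>N. \<Sum>k<2^n * nat \<lceil>t\<rceil>. bmcoef n k t * \<omega> (bmidx n k))"
    unfolding sumF by (intro sum.cong refl) (simp add: d_def memF Gb)
   then show ?thesis using Inr by (simp add: X_def bmlev_def)
  qed
  show "KN N a b = (\<Sum>i\<in>F N a. \<Sum>j\<in>F N b. d N a i * d N b j * (if i = j then 1 else 0))" for a b
  proof -
   have "(\<Sum>j\<in>F N b. d N a i * d N b j * (if i = j then 1 else 0)) = d N a i * d N b i" for i
    using finF[of N b] by (simp add: if_distrib sum.delta' d_def cong: if_cong)
   then show ?thesis unfolding KN_def by simp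
  qed
 qed (auto simp: finF d_def)
 show ?thesis
 proof (rule gfam_lim[where X=X and K=KN, OF g])
  fix a :: "nat + real" assume a: "a \<in> UNIV <+> {0..}"
  show "(\<lambda>\<omega>. case a of Inl j => \<omega> (real j) | Inr t => bm t \<omega>) \<in> borel_measurable Gsp"
   by (cases a) auto
  show "AE \<omega> in Gsp. (\<lambda>n. X n a \<omega>) \<longlonglongrightarrow> (case a of Inl j => \<omega> (real j) | Inr t => bm t \<omega>)"
   using AE_bmgood by eventually_elim (use a in \<open>auto simp: X_def intro: bm_tendsto\<close>)
 next
  fix a b :: "nat + real" assume ab: "a \<in> UNIV <+> {0..}" "b \<in> UNIV <+> {0..}"
  show "(\<lambda>N. KN N a b) \<longlonglongrightarrow> jointK a b"
  proof (cases a; cases b)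
   fix i j assume "a = Inl i" "b = Inl j"
   then show ?thesis by (auto simp: KN_def jointK_def d_def G_def F_def)
  next
   fix i t assume *: "a = Inl i" "b = Inr t"
   have "real i \<notin> F N (Inr t)" for N using bmidx_neq[symmetric] by (auto simp: F_def)
   then show ?thesis using * by (simp add: KN_def jointK_def d_def F_def)
  next
   fix i t assume *: "b = Inl i" "a = Inr t"
   have "KN N a b = 0" for N
    unfolding KN_def * using bmidx_neq by (intro sum.neutral) (auto simp: d_def F_def)
   then show ?thesis using * by (simp add: jointK_def)
  next
   fix s t assume *: "a = Inr s" "b = Inr t"
   with ab have st: "0 \<le> s" "0 \<le> t" by auto
   define T where "T = max (nat \<lceil>s\<rceil>) (nat \<lceil>t\<rceil>)"
   have sT: "s \<le> real T" "t \<le> real T"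
    using real_nat_ceiling_ge[of s] real_nat_ceiling_ge[of t] by (auto simp: T_def)
   have "KN N a b = (\<Sum>n\<le>N. \<Sum>k<2^n*T. bmcoef n k s * bmcoef n k t)" for N
    unfolding KN_def * sumF
   proof (rule sum.cong[OF refl])
    fix n assume n: "n \<in> {..N}"
    have "(\<Sum>k<2^n * nat \<lceil>s\<rceil>. d N (Inr s) (bmidx n k) * d N (Inr t) (bmidx n k)) = (\<Sum>k<2^n * nat \<lceil>s\<rceil>. bmcoef n k s * bmcoef n k t)"
    proof (intro sum.cong refl)
     fix k assume k: "k \<in> {..<2^n * nat \<lceil>s\<rceil>}"
     show "d N (Inr s) (bmidx n k) * d N (Inr t) (bmidx n k) = bmcoef n k s * bmcoef n k t"
      using n k bmcoef_zero[of t "nat \<lceil>t\<rceil>" n k] real_nat_ceiling_ge[of t] by (simp add: d_def memF Gb not_less)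
    qed
    also have "\<dots> = (\<Sum>k<2^n*T. bmcoef n k s * bmcoef n k t)"
    proof (rule sum.mono_neutral_left)
     show "\<forall>k\<in>{..<2 ^ n * T} - {..<2 ^ n * nat \<lceil>s\<rceil>}. bmcoef n k s * bmcoef n k t = 0"
      using bmcoef_zero[of s "nat \<lceil>s\<rceil>" n] real_nat_ceiling_ge[of s] by auto
     show "{..<2 ^ n * nat \<lceil>s\<rceil>} \<subseteq> {..<2 ^ n * T}" by (auto simp: T_def intro: less_le_trans)
    qed simp
    finally show "(\<Sum>k<2^n * nat \<lceil>s\<rceil>. d N (Inr s) (bmidx n k) * d N (Inr t) (bmidx n k)) = (\<Sum>k<2^n*T. bmcoef n k s * bmcoef n k t)" .
   qed
   then show ?thesis using bmcoef_cov_lim[of s T t] st sT * by (simp add: jointK_def)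
  qed
 qed
qed

lemma grid_step: "real (Suc l) * T / real n = real l * T / real n + T / real n"
 by (simp add: distrib_right add_divide_distrib)

lemma grid_le: "l \<le> n ==> 0 \<le> T ==> real l * T / real n \<le> T"
 using mult_right_mono[of "real l" "real n" T] by (cases "n = 0") (auto simp: divide_le_eq mult.commute)

text \<open>The increments of \<open>min t\<close> over the grid are the lengths of the cells cut off at
  \<open>t\<close>: the sums are Riemann sums of \<open>f\<close> over \<open>[0,t]\<close>. They are the
  covariances between \<open>bm t\<close> and the approximate Wiener integrals.\<close>

lemma riemann_stieltjes_min:
 fixes f F :: "real => real"
 assumes F: "\<And>x. (F has_real_derivative f x) (at x)" and L: "\<And>x y. x \<in> {0..T} ==> y \<in> {0..T} ==> \<bar>f x - f y\<bar> \<le> C * \<bar>x - y\<bar>"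
  and T: "0 < T" and t: "0 \<le> t" "t \<le> T"
 shows "(\<lambda>n. \<Sum>l<n. f (real l * T / n) * (min t (real (Suc l) * T / n) - min t (real l * T / n))) \<longlonglongrightarrow> F t - F 0"
proof -
 have C: "0 \<le> C" using L[of 0 T] T by (auto simp: zero_le_mult_iff dest: order_trans[OF abs_ge_zero])
 have b: "\<bar>(F t - F 0) - (\<Sum>l<n. f (real l * T / n) * (min t (real (Suc l) * T / n) - min t (real l * T / n)))\<bar> \<le> C * T\<^sup>2 / n"
  if n: "n > 0" for n :: nat
 proof -
  define u where "u l = min t (real l * T / n)" for l :: nat
  have tel: "(\<Sum>l<n. F (u (Suc l)) - F (u l)) = F t - F 0"
   using n t by (subst sum_lessThan_telescope) (auto simp: u_def)
  have each: "\<bar>F (u (Suc l)) - F (u l) - f (real l * T / n) * (u (Suc l) - u l)\<bar> \<le> C * (T / n) * (T / n)" if l: "l < n" for l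
  proof -
   let ?S = "{u l..u (Suc l)}"
   have lT: "real l * T / n \<le> T" "real (Suc l) * T / n \<le> T"
    using grid_le[of l n T] grid_le[of "Suc l" n T] l T by auto
   note diff = grid_step[of l T n]
   have h0: "0 < T / n" using T n by simp
   have ul: "u l \<le> u (Suc l)" unfolding u_def diff using h0 by linarith
   have ud: "u (Suc l) - u l \<le> T / n" unfolding u_def diff using h0 by linarith
   have bnd: "\<bar>f x - f (real l * T / n)\<bar> \<le> C * (T / n)" if x: "x \<in> ?S" and ne: "u l < u (Suc l)" for x
   proof -
    have "u l = real l * T / n" using ne by (auto simp: u_def diff min_def split: if_splits)
    hence x2: "real l * T / n \<le> x" "x \<le> real l * T / n + T / n" "x \<le> t" using x unfolding u_def diff by auto
    have "0 \<le> real l * T / n" using T by simp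
    hence "x \<in> {0..T}" "real l * T / n \<in> {0..T}"
     using x2 t lT unfolding atLeastAtMost_iff by (meson order_trans)+
    hence "\<bar>f x - f (real l * T / n)\<bar> \<le> C * \<bar>x - real l * T / n\<bar>" by (rule L)
    also have "\<dots> \<le> C * (T / n)" using x2 C by (intro mult_left_mono) auto
    finally show ?thesis .
   qed
   show ?thesis
   proof (cases "u l < u (Suc l)")
    case True
    have "norm ((F (u (Suc l)) - f (real l * T / n) * u (Suc l)) - (F (u l) - f (real l * T / n) * u l)) \<le> C * (T / n) * norm (u (Suc l) - u l)"
    proof (rule field_differentiable_bound[where S="?S" and f'="\<lambda>x. f x - f (real l * T / n)"])
     show "((\<lambda>x. F x - f (real l * T / n) * x) has_field_derivative f x - f (real l * T / n)) (at x within ?S)" for x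
      by (auto intro!: derivative_eq_intros has_field_derivative_at_within[OF F])
     show "norm (f x - f (real l * T / n)) \<le> C * (T / n)" if "x \<in> ?S" for x using bnd[OF that True] by simp
    qed (use ul in auto)
    also have "\<dots> \<le> C * (T / n) * (T / n)" using ud ul C T by (intro mult_left_mono) auto
    finally show ?thesis by (simp add: algebra_simps)
   next
    case False
    then have "u (Suc l) = u l" using ul by linarith
    then show ?thesis using C T by simp
   qed
  qed
  have "\<bar>(\<Sum>l<n. F (u (Suc l)) - F (u l)) - (\<Sum>l<n. f (real l * T / n) * (u (Suc l) - u l))\<bar> \<le> (\<Sum>l<n. C * (T / n) * (T / n))"
   unfolding sum_subtractf[symmetric] using each by (intro order_trans[OF sum_abs] sum_mono) auto
  also have "\<dots> = C * T\<^sup>2 / n" using n by (simp add: power2_eq_square)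
  finally show ?thesis unfolding tel by (simp only: u_def)
 qed
 have "(\<lambda>n. (F t - F 0) - (\<Sum>l<n. f (real l * T / n) * (min t (real (Suc l) * T / n) - min t (real l * T / n)))) \<longlonglongrightarrow> 0"
 proof (rule Lim_null_comparison)
  show "\<forall>\<^sub>F n in sequentially. norm ((F t - F 0) - (\<Sum>l<n. f (real l * T / n) * (min t (real (Suc l) * T / n) - min t (real l * T / n)))) \<le> C * T\<^sup>2 / n"
   using eventually_gt_at_top[of 0] by eventually_elim (use b in auto)
  show "(\<lambda>n. C * T\<^sup>2 / real n) \<longlonglongrightarrow> 0" by (rule lim_const_over_n)
 qed
 from tendsto_diff[OF tendsto_const[of "F t - F 0"] this] show ?thesis by simp
qed

lemma abel_sum: "(\<Sum>l<n. f l * (b (Suc l) - b l)) = f n * b n - f 0 * b 0 - (\<Sum>l<n. b (Suc l) * (f (Suc l) - f l))"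
 for f b :: "nat => real"
 by (induction n) (auto simp: algebra_simps)

text \<open>For a continuously differentiable integrand summation by parts turns the Wiener integral into an
  ordinary Riemann integral of the path, so it converges for every continuous path.\<close>

lemma wiener_integral_converges:
 fixes f f' b :: "real => real"
 assumes f: "\<And>x. (f has_real_derivative f' x) (at x)" and f': "continuous_on {0..T} f'" and b: "continuous_on {0..T} b" and T: "0 < T"
 shows "convergent (\<lambda>n. \<Sum>l<n. f (real l * T / n) * (b (real (Suc l) * T / n) - b (real l * T / n)))"
proof -
 have cc: "continuous_on {0..T} (\<lambda>s. b s * f' s)" by (intro continuous_intros b f')
 obtain H where H: "\<And>x. x \<in> {0..T} ==> (H has_vector_derivative b x * f' x) (at x within {0..T})"
  using antiderivative_continuous[OF cc] by blast
 have H': "(H has_real_derivative b x * f' x) (at x within {0..T})" if "x \<in> {0..T}" for x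
  using H[OF that] by (simp add: has_real_derivative_iff_has_vector_derivative)
 obtain C where C: "C > 0" "\<And>x. x \<in> {0..T} ==> \<bar>f' x\<bar> \<le> C"
  using compact_imp_bounded[OF compact_continuous_image[OF f' compact_Icc]] unfolding bounded_pos by auto
 have uc: "uniformly_continuous_on {0..T} b" by (rule compact_uniformly_continuous[OF b compact_Icc])
 have lim: "(\<lambda>n. \<Sum>l<n. b (real (Suc l) * T / n) * (f (real (Suc l) * T / n) - f (real l * T / n))) \<longlonglongrightarrow> H T - H 0"
 proof (rule LIMSEQ_I)
  fix e :: real assume e: "e > 0"
  define e' where "e' = e / (2 * C * T)"
  have e': "e' > 0" using e C T by (simp add: e'_def)
  obtain \<delta> where \<delta>: "\<delta> > 0" "\<And>x y. x \<in> {0..T} ==> y \<in> {0..T} ==> \<bar>y - x\<bar> < \<delta> ==> \<bar>b y - b x\<bar> < e'"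
   using uc e' unfolding uniformly_continuous_on_def dist_real_def by metis
  obtain N :: nat where N: "T / \<delta> < real N" using reals_Archimedean2 by blast
  show "\<exists>no. \<forall>n\<ge>no. norm ((\<Sum>l<n. b (real (Suc l) * T / n) * (f (real (Suc l) * T / n) - f (real l * T / n))) - (H T - H 0)) < e"
  proof (intro exI allI impI)
   fix n assume "n \<ge> max 1 N"
   hence n: "n > 0" "T / n < \<delta>" using N \<delta> T by (auto simp: field_simps) (smt (verit) mult_right_mono of_nat_mono mult.commute)
   define u where "u l = real l * T / n" for l :: nat
   have tel: "(\<Sum>l<n. H (u (Suc l)) - H (u l)) = H T - H 0"
    using n by (subst sum_lessThan_telescope) (auto simp: u_def)
   have each: "\<bar>b (u (Suc l)) * (f (u (Suc l)) - f (u l)) - (H (u (Suc l)) - H (u l))\<bar> \<le> e' * C * (T / n)" if l: "l < n" for l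
   proof -
    let ?S = "{u l..u (Suc l)}"
    have diff: "u (Suc l) = u l + T / n" unfolding u_def by (rule grid_step)
    have u0: "0 \<le> u l" "u (Suc l) \<le> T" using grid_le[of "Suc l" n T] l T by (auto simp: u_def)
    have sub: "?S \<subseteq> {0..T}" using u0 by auto
    have "norm ((b (u (Suc l)) * f (u (Suc l)) - H (u (Suc l))) - (b (u (Suc l)) * f (u l) - H (u l))) \<le> e' * C * norm (u (Suc l) - u l)"
    proof (rule field_differentiable_bound[where S="?S" and f'="\<lambda>x. b (u (Suc l)) * f' x - b x * f' x"])
     show "((\<lambda>x. b (u (Suc l)) * f x - H x) has_field_derivative b (u (Suc l)) * f' x - b x * f' x) (at x within ?S)" if "x \<in> ?S" for x
      using that sub by (auto intro!: derivative_eq_intros has_field_derivative_at_within[OF f] DERIV_subset[OF H'])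
     show "norm (b (u (Suc l)) * f' x - b x * f' x) \<le> e' * C" if x: "x \<in> ?S" for x
     proof -
      have "\<bar>b (u (Suc l)) - b x\<bar> \<le> e'"
       using \<delta>(2)[of x "u (Suc l)"] x sub u0 n diff by (auto simp: less_imp_le)
      moreover have "\<bar>f' x\<bar> \<le> C" using C x sub by auto
      ultimately have "\<bar>b (u (Suc l)) - b x\<bar> * \<bar>f' x\<bar> \<le> e' * C" using e' by (intro mult_mono) auto
      then show ?thesis by (simp add: abs_mult left_diff_distrib[symmetric])
     qed
    qed (use diff T n in auto)
    then show ?thesis using T by (simp add: diff algebra_simps)
   qed
   have "\<bar>(\<Sum>l<n. b (u (Suc l)) * (f (u (Suc l)) - f (u l))) - (\<Sum>l<n. H (u (Suc l)) - H (u l))\<bar> \<le> (\<Sum>l<n. e' * C * (T / n))"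
    unfolding sum_subtractf[symmetric] using each by (intro order_trans[OF sum_abs] sum_mono) auto
   also have "\<dots> = e / 2" using n C T by (simp add: e'_def)
   finally show "norm ((\<Sum>l<n. b (real (Suc l) * T / n) * (f (real (Suc l) * T / n) - f (real l * T / n))) - (H T - H 0)) < e"
    using e unfolding tel by (simp add: u_def)
  qed
 qed
 have ev: "\<forall>\<^sub>F n in sequentially. (\<Sum>l<n. f (real l * T / n) * (b (real (Suc l) * T / n) - b (real l * T / n)))
   = f T * b T - f 0 * b 0 - (\<Sum>l<n. b (real (Suc l) * T / n) * (f (real (Suc l) * T / n) - f (real l * T / n)))"
  using eventually_gt_at_top[of 0]
 proof eventually_elim
  case (elim n)
  then show ?case using abel_sum[of "\<lambda>l. f (real l * T / n)" "\<lambda>l. b (real l * T / n)" n] by simp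
 qed
 have "(\<lambda>n. f T * b T - f 0 * b 0 - (\<Sum>l<n. b (real (Suc l) * T / n) * (f (real (Suc l) * T / n) - f (real l * T / n)))) \<longlonglongrightarrow> f T * b T - f 0 * b 0 - (H T - H 0)"
  by (intro tendsto_intros lim)
 then show ?thesis unfolding convergent_def tendsto_cong[OF ev] by blast
qed

lemma sum_Plus: "finite A ==> finite B ==> (\<Sum>i\<in>A <+> B. f i) = (\<Sum>i\<in>A. f (Inl i)) + (\<Sum>i\<in>B. f (Inr i))"
 by (simp add: sum.Plus o_def)

text \<open>Let \<open>f\<close> be orthonormal in \<open>L\<^sup>2[0,T]\<close> with primitives
  \<open>F\<close>, and let \<open>J j\<close> be the Wiener integral of \<open>f j\<close>. Since \<open>F j
  t\<close> is the covariance of \<open>bm t\<close> and \<open>J j\<close>, the process \<open>bm t -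
  (\<Sum>j<d. J j * F j t)\<close> is independent of the \<open>J j\<close>; replacing the \<open>J j\<close>
  by independent standard normal coordinates therefore does not change the covariance. The covariance is
  computed for Riemann sums in place of \<open>J j\<close>, and the mesh then tends to zero.\<close>

theorem brownian_motion_with_coordinates:
 fixes f F f' :: "nat => real => real" and H :: "nat => nat => real => real"
 assumes T: "0 < T"
  and F: "\<And>j x. (F j has_real_derivative f j x) (at x)" "\<And>j. F j 0 = 0"
  and f: "\<And>j x. (f j has_real_derivative f' j x) (at x)" "\<And>j. continuous_on {0..T} (f' j)"
  and H: "\<And>i j x. (H i j has_real_derivative f i x * f j x) (at x)"
  and ortho: "\<And>i j. i < d ==> j < d ==> H i j T - H i j 0 = (if i = j then 1 else 0)"
 shows "\<exists>R. gfam Gsp (\<lambda>t \<omega>. (\<Sum>j<d. \<omega> (real j) * F j (min t T)) + R t \<omega>) min {0..} \<and>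
   (\<forall>\<omega>. (\<Sum>j<d. \<omega> (real j) * F j (min 0 T)) + R 0 \<omega> = 0 \<and>
    continuous_on {0..} (\<lambda>t. (\<Sum>j<d. \<omega> (real j) * F j (min t T)) + R t \<omega>)) \<and>
   (\<forall>t j b \<omega>. R t (fun_upd \<omega> (real j) b) = R t \<omega>) \<and> (\<forall>t. R t \<in> borel_measurable Gsp)"
proof -
 interpret prob_space Gsp by (rule prob_space_Gsp)
 define I where "I n j \<omega> = (\<Sum>l<n. f j (real l * T / n) * (bm (real (Suc l) * T / n) \<omega> - bm (real l * T / n) \<omega>))" for n j \<omega>
 define J where "J j \<omega> = lim (\<lambda>n. I n j \<omega>)" for j \<omega>
 have IJ: "(\<lambda>n. I n j \<omega>) \<longlonglongrightarrow> J j \<omega>" for j \<omega>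
 proof -
  have "convergent (\<lambda>n. I n j \<omega>)" unfolding I_def
   by (rule wiener_integral_converges[OF f(1) f(2) continuous_on_subset[OF continuous_bm] T]) auto
  then show ?thesis unfolding J_def by (simp add: convergent_LIMSEQ_iff)
 qed
 have mI[measurable]: "I n j \<in> borel_measurable Gsp" for n j unfolding I_def by measurable
 have mJ[measurable]: "J j \<in> borel_measurable Gsp" for j by (rule borel_measurable_LIMSEQ_real[OF IJ mI])
 define R where "R t \<omega> = bm t \<omega> - (\<Sum>j<d. J j \<omega> * F j (min t T))" for t \<omega>
 define W where "W t \<omega> = (\<Sum>j<d. \<omega> (real j) * F j (min t T)) + R t \<omega>" for t \<omega>
 define Wn where "Wn n t \<omega> = (\<Sum>j<d. \<omega> (real j) * F j (min t T)) + (bm t \<omega> - (\<Sum>j<d. I n j \<omega> * F j (min t T)))" for n t \<omega>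
 \<comment> \<open>the Gaussian family from which \<open>Wn\<close> is formed: free coordinates, grid increments and values of \<open>bm\<close>\<close>
 define E where "E n a \<omega> = (case a of Inl j => \<omega> (real j) | Inr (Inl l) => bm (real (Suc l) * T / n) \<omega> - bm (real l * T / n) \<omega> | Inr (Inr t) => bm t \<omega>)"
  for n :: nat and a :: "nat + nat + real" and \<omega> :: "real => real"
 define \<Delta> where "\<Delta> n l t = min t (real (Suc l) * T / n) - min t (real l * T / n)" for n l :: nat and t :: real
 define EK where "EK n a b = (case a of Inl i => (case b of Inl j => if i = j then 1 else 0 | Inr _ => 0)
   | Inr (Inl l) => (case b of Inl j => 0 | Inr (Inl m) => if l = m then T / n else 0 | Inr (Inr t) => \<Delta> n l t)
   | Inr (Inr s) => (case b of Inl j => 0 | Inr (Inl m) => \<Delta> n m s | Inr (Inr t) => min s t))"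
  for n :: nat and a b :: "nat + nat + real"
 have gE: "gfam Gsp (E n) (EK n) (UNIV <+> (UNIV <+> {0..}))" if n: "n > 0" for n
 proof (rule gfam_linear[OF gfam_joint,
   where F="\<lambda>a. case a of Inl j => {Inl j} | Inr (Inl l) => {Inr (real (Suc l) * T / n), Inr (real l * T / n)} | Inr (Inr t) => {Inr t}"
   and d="\<lambda>a i. case a of Inl j => (if i = Inl j then 1 else 0) | Inr (Inl l) => (if i = Inr (real (Suc l) * T / n) then 1 else if i = Inr (real l * T / n) then -1 else 0) | Inr (Inr t) => (if i = Inr t then 1 else 0)"])
  have r1: "real (Suc 0) = 1" by simp
  have ne: "real (Suc l) * T / n \<noteq> real l * T / n" for l unfolding grid_step using n T by simp
  have ne': "real l * T / n \<noteq> real (Suc l) * T / n" for l unfolding grid_step using n T by simp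
  fix a b :: "nat + nat + real"
  show "E n a \<omega> = (\<Sum>i\<in>(case a of Inl j => {Inl j} | Inr (Inl l) => {Inr (real (Suc l) * T / n), Inr (real l * T / n)} | Inr (Inr t) => {Inr t}).
    (case a of Inl j => (if i = Inl j then 1 else 0) | Inr (Inl l) => (if i = Inr (real (Suc l) * T / n) then 1 else if i = Inr (real l * T / n) then -1 else 0) | Inr (Inr t) => (if i = Inr t then 1 else 0)) *
    (case i of Inl j => \<omega> (real j) | Inr t => bm t \<omega>))" for \<omega>
   using ne ne' by (auto simp: E_def split: sum.split simp del: of_nat_Suc)
  have DD: "\<Delta> n l (real (Suc m) * T / n) - \<Delta> n l (real m * T / n) = (if l = m then T / n else 0)" for l m
  proof -
   define u where "u l = real l * T / n" for l :: nat
   have um: "u i \<le> u j" if "i \<le> j" for i j using that T by (auto simp: u_def intro!: divide_right_mono mult_right_mono)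
   have us: "u (Suc i) = u i + T / n" for i unfolding u_def by (rule grid_step)
   have tn: "0 < T / n" using n T by simp
   consider "l = m" | "Suc l \<le> m" | "Suc m \<le> l" by linarith
   then have "(min (u (Suc m)) (u (Suc l)) - min (u (Suc m)) (u l)) - (min (u m) (u (Suc l)) - min (u m) (u l)) = (if l = m then T / n else 0)"
    using um[of "Suc l" m] um[of "Suc m" l] us[of l] us[of m] tn by cases (auto simp: min_def)
   then show ?thesis by (simp only: \<Delta>_def u_def)
  qed
  show "EK n a b = (\<Sum>i\<in>(case a of Inl j => {Inl j} | Inr (Inl l) => {Inr (real (Suc l) * T / n), Inr (real l * T / n)} | Inr (Inr t) => {Inr t}).
    \<Sum>j\<in>(case b of Inl j => {Inl j} | Inr (Inl l) => {Inr (real (Suc l) * T / n), Inr (real l * T / n)} | Inr (Inr t) => {Inr t}).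
    (case a of Inl j => (if i = Inl j then 1 else 0) | Inr (Inl l) => (if i = Inr (real (Suc l) * T / n) then 1 else if i = Inr (real l * T / n) then -1 else 0) | Inr (Inr t) => (if i = Inr t then 1 else 0)) *
    (case b of Inl k => (if j = Inl k then 1 else 0) | Inr (Inl l) => (if j = Inr (real (Suc l) * T / n) then 1 else if j = Inr (real l * T / n) then -1 else 0) | Inr (Inr t) => (if j = Inr t then 1 else 0)) * jointK i j)"
  proof (cases a)
   case (Inl i)
   then show ?thesis using ne ne' by (cases b) (auto simp: EK_def jointK_def split: sum.split simp del: of_nat_Suc)
  next
   case (Inr a')
   show ?thesis
   proof (cases a')
    case (Inl l)
    show ?thesis
    proof (cases b)
     case (Inl j) then show ?thesis using \<open>a = Inr a'\<close> \<open>a' = Inl l\<close> ne ne' by (auto simp: EK_def jointK_def simp del: of_nat_Suc)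
    next
     case (Inr b')
     show ?thesis
     proof (cases b')
      case (Inl m)
      have "EK n a b = \<Delta> n l (real (Suc m) * T / n) - \<Delta> n l (real m * T / n)"
       using \<open>a = Inr a'\<close> \<open>a' = Inl l\<close> \<open>b = Inr b'\<close> \<open>b' = Inl m\<close> by (simp add: EK_def DD del: of_nat_Suc)
      then show ?thesis using \<open>a = Inr a'\<close> \<open>a' = Inl l\<close> \<open>b = Inr b'\<close> \<open>b' = Inl m\<close> ne ne'
       by (simp add: \<Delta>_def jointK_def min.commute del: of_nat_Suc)
     next
      case (Inr t)
      then show ?thesis using \<open>a = Inr a'\<close> \<open>a' = Inl l\<close> \<open>b = Inr b'\<close> ne ne'
       by (simp add: EK_def \<Delta>_def jointK_def min.commute del: of_nat_Suc)
     qed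
    qed
   next
    case (Inr s)
    then show ?thesis using \<open>a = Inr a'\<close> ne ne'
     by (auto simp: EK_def \<Delta>_def jointK_def r1 split: sum.split simp del: of_nat_Suc)
   qed
  qed
 next
  fix a :: "nat + nat + real" assume "a \<in> UNIV <+> (UNIV <+> {0::real..})"
  then show "finite (case a of Inl j => {Inl j} | Inr (Inl l) => {Inr (real (Suc l) * T / n), Inr (real l * T / n)} | Inr (Inr t) => {Inr t}) \<and>
   (case a of Inl j => {Inl j} | Inr (Inl l) => {Inr (real (Suc l) * T / n), Inr (real l * T / n)} | Inr (Inr t) => {Inr t}) \<subseteq> UNIV <+> {0..}"
   using T by (auto split: sum.splits simp del: of_nat_Suc)
 qed (auto split: sum.splits)
 define G where "G j t = F j (min t T)" for j t
 define K where "K n s t = (\<Sum>j<d. G j s * G j t) + min s t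
   - (\<Sum>j<d. G j t * (\<Sum>l<n. f j (real l * T / n) * \<Delta> n l s)) - (\<Sum>j<d. G j s * (\<Sum>l<n. f j (real l * T / n) * \<Delta> n l t))
   + (\<Sum>i<d. \<Sum>j<d. G i s * G j t * (\<Sum>l<n. f i (real l * T / n) * f j (real l * T / n) * (T / n)))" for n s t
 have gW: "gfam Gsp (Wn n) (K n) {0..}" if n: "n > 0" for n
 proof (rule gfam_linear[OF gE[OF n],
   where F="\<lambda>t. {..<d} <+> ({..<n} <+> {t})"
   and d="\<lambda>t i. case i of Inl j => if j < d then G j t else 0 | Inr (Inl l) => if l < n then - (\<Sum>j<d. G j t * f j (real l * T / n)) else 0 | Inr (Inr s) => if s = t then 1 else 0"])
  fix s t :: real
  have sw: "(\<Sum>j<d. (\<Sum>l<n. f j (real l * T / n) * x l) * G j t) = (\<Sum>l<n. (\<Sum>j<d. G j t * f j (real l * T / n)) * x l)" for x and t :: real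
   unfolding sum_distrib_right by (subst sum.swap) (simp add: mult_ac)
  show "Wn n t \<omega> = (\<Sum>i\<in>{..<d} <+> ({..<n} <+> {t}). (case i of Inl j => if j < d then G j t else 0 | Inr (Inl l) => if l < n then - (\<Sum>j<d. G j t * f j (real l * T / n)) else 0 | Inr (Inr s) => if s = t then 1 else 0) * E n i \<omega>)" for \<omega>
   unfolding Wn_def I_def G_def[symmetric] sw by (simp add: sum_Plus E_def sum_negf mult_ac)
  let ?D = "\<lambda>t i. case i of Inl j => if j < d then G j t else 0 | Inr (Inl l) => if l < n then - (\<Sum>j<d. G j t * f j (real l * T / n)) else 0 | Inr (Inr s) => if s = t then 1 else 0"
  have "(\<Sum>i\<in>{..<d} <+> ({..<n} <+> {s}). \<Sum>j\<in>{..<d} <+> ({..<n} <+> {t}). ?D s i * ?D t j * EK n i j)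
   = (\<Sum>j<d. G j s * G j t) + (\<Sum>l<n. (\<Sum>j<d. G j s * f j (real l * T / n)) * (\<Sum>j<d. G j t * f j (real l * T / n)) * (T / n))
    - (\<Sum>l<n. (\<Sum>j<d. G j s * f j (real l * T / n)) * \<Delta> n l t) - (\<Sum>l<n. (\<Sum>j<d. G j t * f j (real l * T / n)) * \<Delta> n l s) + min s t"
   by (simp add: sum_Plus EK_def if_distrib sum.delta sum.delta' sum_negf sum.distrib sum_subtractf cong: if_cong)
  also have "(\<Sum>l<n. (\<Sum>j<d. G j s * f j (real l * T / n)) * \<Delta> n l t) = (\<Sum>j<d. G j s * (\<Sum>l<n. f j (real l * T / n) * \<Delta> n l t))"
   unfolding sw[symmetric] by (simp add: mult_ac)
  also have "(\<Sum>l<n. (\<Sum>j<d. G j t * f j (real l * T / n)) * \<Delta> n l s) = (\<Sum>j<d. G j t * (\<Sum>l<n. f j (real l * T / n) * \<Delta> n l s))"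
   unfolding sw[symmetric] by (simp add: mult_ac)
  also have "(\<Sum>l<n. (\<Sum>j<d. G j s * f j (real l * T / n)) * (\<Sum>j<d. G j t * f j (real l * T / n)) * (T / n))
   = (\<Sum>l<n. \<Sum>i<d. \<Sum>j<d. G i s * G j t * (f i (real l * T / n) * f j (real l * T / n) * (T / n)))"
  proof (intro sum.cong refl)
   fix l
   show "(\<Sum>j<d. G j s * f j (real l * T / n)) * (\<Sum>j<d. G j t * f j (real l * T / n)) * (T / n)
    = (\<Sum>i<d. \<Sum>j<d. G i s * G j t * (f i (real l * T / n) * f j (real l * T / n) * (T / n)))"
    unfolding sum_product unfolding sum_distrib_right by (simp add: mult_ac)
  qed
  also have "\<dots> = (\<Sum>i<d. \<Sum>l<n. \<Sum>j<d. G i s * G j t * (f i (real l * T / n) * f j (real l * T / n) * (T / n)))"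
   by (rule sum.swap)
  also have "\<dots> = (\<Sum>i<d. \<Sum>j<d. \<Sum>l<n. G i s * G j t * (f i (real l * T / n) * f j (real l * T / n) * (T / n)))"
   by (intro sum.cong refl sum.swap)
  also have "\<dots> = (\<Sum>i<d. \<Sum>j<d. G i s * G j t * (\<Sum>l<n. f i (real l * T / n) * f j (real l * T / n) * (T / n)))"
   by (simp add: sum_distrib_left)
  finally show "K n s t = (\<Sum>i\<in>{..<d} <+> ({..<n} <+> {s}). \<Sum>j\<in>{..<d} <+> ({..<n} <+> {t}). ?D s i * ?D t j * EK n i j)"
   unfolding K_def by simp
 qed (auto split: sum.splits)
 have bnd: "\<exists>C. \<forall>x\<in>{0..T}. \<forall>y\<in>{0..T}. \<bar>g x - g y\<bar> \<le> C * \<bar>x - y\<bar>"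
  if g: "\<And>x. (g has_real_derivative g' x) (at x)" "continuous_on {0..T} g'" for g g' :: "real => real"
 proof -
  obtain C where "\<forall>y\<in>g' ` {0..T}. norm y \<le> C"
   using compact_imp_bounded[OF compact_continuous_image[OF g(2) compact_Icc]] unfolding bounded_iff by blast
  then have C: "\<And>x. x \<in> {0..T} ==> \<bar>g' x\<bar> \<le> C" by auto
  have "norm (g x - g y) \<le> C * norm (x - y)" if "x \<in> {0..T}" "y \<in> {0..T}" for x y
   by (rule field_differentiable_bound[OF convex_closed_interval, where f'=g']) (use C that g(1) in \<open>auto intro: has_field_derivative_at_within\<close>)
  then show ?thesis by (intro exI[of _ C]) auto
 qed
 have cf: "continuous_on {0..T} (f j)" for j
  by (rule DERIV_continuous_on[OF has_field_derivative_at_within[OF f(1)]])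
 have \<Delta>T: "\<Delta> n l t = \<Delta> n l (min t T)" if "l < n" for n l t
 proof -
  have "real (Suc l) * T / n \<le> T" "real l * T / n \<le> T" using grid_le[of "Suc l" n T] grid_le[of l n T] that T by auto
  then show ?thesis unfolding \<Delta>_def by linarith
 qed
 have l1: "(\<lambda>n. \<Sum>l<n. f j (real l * T / n) * \<Delta> n l t) \<longlonglongrightarrow> G j t" if t: "0 \<le> t" for j t
 proof -
  obtain C where C: "\<forall>x\<in>{0..T}. \<forall>y\<in>{0..T}. \<bar>f j x - f j y\<bar> \<le> C * \<bar>x - y\<bar>" using bnd[OF f] by blast
  have "(\<lambda>n. \<Sum>l<n. f j (real l * T / n) * \<Delta> n l (min t T)) \<longlonglongrightarrow> F j (min t T) - F j 0"
   unfolding \<Delta>_def by (rule riemann_stieltjes_min[OF F(1), where C=C]) (use C T t in auto)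
  moreover have "(\<Sum>l<n. f j (real l * T / n) * \<Delta> n l (min t T)) = (\<Sum>l<n. f j (real l * T / n) * \<Delta> n l t)" for n
  proof (rule sum.cong[OF refl])
   fix l assume "l \<in> {..<n}"
   then show "f j (real l * T / n) * \<Delta> n l (min t T) = f j (real l * T / n) * \<Delta> n l t"
    using \<Delta>T[of l n t] by simp
  qed
  ultimately show ?thesis by (simp add: F(2) G_def)
 qed
 have l2: "(\<lambda>n. \<Sum>l<n. f i (real l * T / n) * f j (real l * T / n) * (T / n)) \<longlonglongrightarrow> (if i = j then 1 else 0)" if ij: "i < d" "j < d" for i j
 proof -
  have "continuous_on {0..T} (\<lambda>x. f' i x * f j x + f' j x * f i x)" by (intro continuous_intros f(2) cf)
  moreover have "((\<lambda>x. f i x * f j x) has_real_derivative f' i x * f j x + f' j x * f i x) (at x)" for x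
   by (rule DERIV_mult[OF f(1) f(1)])
  ultimately obtain C where C: "\<forall>x\<in>{0..T}. \<forall>y\<in>{0..T}. \<bar>f i x * f j x - f i y * f j y\<bar> \<le> C * \<bar>x - y\<bar>"
   using bnd[of "\<lambda>x. f i x * f j x" "\<lambda>x. f' i x * f j x + f' j x * f i x"] by blast
  have "(\<lambda>n. \<Sum>l<n. (f i (real l * T / n) * f j (real l * T / n)) * \<Delta> n l T) \<longlonglongrightarrow> H i j T - H i j 0"
   unfolding \<Delta>_def by (rule riemann_stieltjes_min[OF H, where C=C]) (use C T in auto)
  moreover have "(\<Sum>l<n. (f i (real l * T / n) * f j (real l * T / n)) * \<Delta> n l T) = (\<Sum>l<n. f i (real l * T / n) * f j (real l * T / n) * (T / n))" for n
  proof (intro sum.cong refl)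
   fix l assume "l \<in> {..<n}"
   then have a: "real (Suc l) * T / n \<le> T" "real l * T / n \<le> T" using grid_le[of "Suc l" n T] grid_le[of l n T] T by auto
   have "\<Delta> n l T = T / n" unfolding \<Delta>_def min_absorb2[OF a(1)] min_absorb2[OF a(2)] by (subst grid_step) simp
   then show "(f i (real l * T / n) * f j (real l * T / n)) * \<Delta> n l T = f i (real l * T / n) * f j (real l * T / n) * (T / n)" by simp
  qed
  ultimately show ?thesis by (simp add: ortho ij)
 qed
 have gWW: "gfam Gsp W min {0..}"
 proof (rule gfam_lim[where X="\<lambda>n. Wn (Suc n)" and K="\<lambda>n. K (Suc n)", OF gW])
  show "W t \<in> borel_measurable Gsp" for t unfolding W_def R_def by measurable
  show "AE \<omega> in Gsp. (\<lambda>n. Wn (Suc n) t \<omega>) \<longlonglongrightarrow> W t \<omega>" for t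
  proof (intro AE_I2)
   fix \<omega>
   have "(\<lambda>n. Wn n t \<omega>) \<longlonglongrightarrow> W t \<omega>" unfolding Wn_def W_def R_def by (intro tendsto_intros IJ)
   then show "(\<lambda>n. Wn (Suc n) t \<omega>) \<longlonglongrightarrow> W t \<omega>" by (rule LIMSEQ_Suc)
  qed
  fix s t :: real assume st: "s \<in> {0..}" "t \<in> {0..}"
  have "(\<lambda>n. K n s t) \<longlonglongrightarrow> (\<Sum>j<d. G j s * G j t) + min s t
   - (\<Sum>j<d. G j t * G j s) - (\<Sum>j<d. G j s * G j t)
   + (\<Sum>i<d. \<Sum>j<d. G i s * G j t * (if i = j then 1 else 0))"
   unfolding K_def using st by (intro tendsto_intros l1 l2) auto
  also have "(\<Sum>i<d. \<Sum>j<d. G i s * G j t * (if i = j then 1 else 0)) = (\<Sum>j<d. G j s * G j t)"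
   by (simp add: if_distrib sum.delta cong: if_cong)
  finally have "(\<lambda>n. K n s t) \<longlonglongrightarrow> min s t" by (simp add: mult.commute)
  then show "(\<lambda>n. K (Suc n) s t) \<longlonglongrightarrow> min s t" by (rule LIMSEQ_Suc)
 qed auto
 have "W 0 \<omega> = 0 \<and> continuous_on {0..} (\<lambda>t. W t \<omega>)" for \<omega>
 proof -
  have "continuous_on UNIV (F j)" for j
   by (rule DERIV_continuous_on[OF F(1)])
  then have "continuous_on {0..} (\<lambda>t. F j (min t T))" for j
   by (rule continuous_on_compose2) (auto intro!: continuous_intros)
  then show "W 0 \<omega> = 0 \<and> continuous_on {0..} (\<lambda>t. W t \<omega>)"
   using T F(2) unfolding W_def R_def by (auto simp: bm_zero intro!: continuous_intros continuous_bm)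
 qed
 moreover have "R t (fun_upd \<omega> (real j) b) = R t \<omega>" for t j b \<omega>
  unfolding R_def J_def I_def by (simp add: bm_irrelevant)
 moreover have "R t \<in> borel_measurable Gsp" for t unfolding R_def by measurable
 ultimately show ?thesis using gWW unfolding W_def[abs_def] by blast
qed

section \<open>Poisson configurations and Mecke's formula\<close>

lemma PiM_iid_swap:
 assumes "prob_space M"
 shows "distr (PiM (UNIV :: nat set) (\<lambda>_. M)) (PiM UNIV (\<lambda>_. M)) (\<lambda>P. P \<circ> Transposition.transpose 0 i) = PiM UNIV (\<lambda>_. M)"
proof -
 have "distr (PiM UNIV (\<lambda>_. M)) (PiM UNIV (\<lambda>_. M)) (\<lambda>P. \<lambda>n\<in>UNIV. P (Transposition.transpose 0 i n)) = PiM UNIV (\<lambda>_. M)"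
  by (rule distr_PiM_reindex) (use assms in \<open>auto intro: inj_transpose\<close>)
 then show ?thesis by (simp add: o_def restrict_def)
qed

text \<open>An i.i.d. sequence with a further independent point put in front is again i.i.d.\<close>

lemma PiM_iid_cons:
 assumes "prob_space M" and f[measurable]: "f \<in> borel_measurable (PiM (UNIV :: nat set) (\<lambda>_. M))"
 shows "(\<integral>\<^sup>+P. f P \<partial>PiM UNIV (\<lambda>_. M)) = (\<integral>\<^sup>+p. \<integral>\<^sup>+P. f (case_nat p P) \<partial>PiM UNIV (\<lambda>_. M) \<partial>M)"
proof -
 interpret prob_space M by fact
 interpret S: sequence_space M ..
 have "(\<integral>\<^sup>+P. f P \<partial>PiM UNIV (\<lambda>_. M)) = (\<integral>\<^sup>+P. f P \<partial>distr (M \<Otimes>\<^sub>M S.S) S.S (\<lambda>(s, cf). case_nat s cf))"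
  by (simp only: S.PiM_iter)
 also have "\<dots> = (\<integral>\<^sup>+x. f (case_nat (fst x) (snd x)) \<partial>(M \<Otimes>\<^sub>M S.S))"
  by (subst nn_integral_distr) (auto simp: case_prod_unfold)
 also have "\<dots> = (\<integral>\<^sup>+p. \<integral>\<^sup>+P. f (case_nat p P) \<partial>S.S \<partial>M)"
  by (subst S.nn_integral_fst[symmetric]) auto
 finally show ?thesis .
qed

text \<open>A Poisson number of i.i.d. points. The sequence is infinite and the points beyond the count are
  ignored, which keeps the space a product.\<close>

definition poisson_cell :: "real => 'p measure => (nat \<times> (nat => 'p)) measure" where
 "poisson_cell r D = measure_pmf (poisson_pmf r) \<Otimes>\<^sub>M PiM UNIV (\<lambda>_. D)"

lemma prob_space_poisson_cell: "prob_space D ==> prob_space (poisson_cell r D)"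
 unfolding poisson_cell_def
 by (intro prob_space_pair prob_space_measure_pmf prob_space_PiM) auto

lemma measurable_poisson_cell:
 assumes "prob_space D"
 shows "f \<in> measurable (poisson_cell r D) N \<longleftrightarrow> (\<forall>n. (\<lambda>P. f (n, P)) \<in> measurable (PiM UNIV (\<lambda>_. D)) N)"
proof
 assume f: "f \<in> measurable (poisson_cell r D) N"
 show "\<forall>n. (\<lambda>P. f (n, P)) \<in> measurable (PiM UNIV (\<lambda>_. D)) N"
  using f unfolding poisson_cell_def by (auto intro: measurable_compose[OF measurable_Pair1'])
next
 assume f: "\<forall>n. (\<lambda>P. f (n, P)) \<in> measurable (PiM UNIV (\<lambda>_. D)) N"
 have "f \<in> measurable (count_space UNIV \<Otimes>\<^sub>M PiM UNIV (\<lambda>_. D)) N"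
  using f by (intro measurable_pair_measure_countable1) auto
 then show "f \<in> measurable (poisson_cell r D) N"
  unfolding poisson_cell_def by (simp cong: measurable_cong_sets sets_pair_measure_cong)
qed

lemma nn_integral_poisson_cell:
 assumes D: "prob_space D" and f: "f \<in> borel_measurable (poisson_cell r D)"
 shows "(\<integral>\<^sup>+x. f x \<partial>poisson_cell r D) = (\<Sum>n. ennreal (pmf (poisson_pmf r) n) * (\<integral>\<^sup>+P. f (n, P) \<partial>PiM UNIV (\<lambda>_. D)))"
proof -
 interpret P: prob_space "PiM UNIV (\<lambda>_. D)" using D by (intro prob_space_PiM)
 show ?thesis using f unfolding poisson_cell_def
  by (subst P.nn_integral_fst[symmetric]) (auto simp: nn_integral_measure_pmf nn_integral_count_space_nat)
qed

text \<open>The Poisson weights satisfy \<open>n * pmf n = r * pmf (n - 1)\<close>. By symmetry each of the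
  \<open>n\<close> summands equals the first one, and splitting off the first point leaves a cell with one
  point fewer.\<close>

lemma mecke_cell:
 assumes r: "0 < r" and D: "prob_space D"
  and \<Phi>: "(\<lambda>(p, x). \<Phi> p x) \<in> borel_measurable (D \<Otimes>\<^sub>M poisson_cell r D)"
  and sym: "\<And>p n P i. i < n ==> \<Phi> p (n, P \<circ> Transposition.transpose 0 i) = \<Phi> p (n, P)"
 shows "(\<integral>\<^sup>+x. (\<Sum>i<fst x. \<Phi> (snd x i) x) \<partial>poisson_cell r D)
  = ennreal r * (\<integral>\<^sup>+x. \<integral>\<^sup>+p. \<Phi> p (Suc (fst x), case_nat p (snd x)) \<partial>D \<partial>poisson_cell r D)"
proof -
 let ?S = "PiM (UNIV :: nat set) (\<lambda>_. D)"
 interpret D: prob_space D by fact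
 interpret S: prob_space ?S using D by (intro prob_space_PiM)
 have \<Phi>n[measurable]: "(\<lambda>x. \<Phi> (fst x) (n, snd x)) \<in> borel_measurable (D \<Otimes>\<^sub>M ?S)" for n
 proof -
  have "(\<lambda>x. (fst x, (n, snd x))) \<in> measurable (D \<Otimes>\<^sub>M ?S) (D \<Otimes>\<^sub>M poisson_cell r D)"
   unfolding poisson_cell_def by measurable
  from measurable_compose[OF this \<Phi>] show ?thesis by simp
 qed
 have \<Phi>i[measurable]: "(\<lambda>P. \<Phi> (P i) (n, P)) \<in> borel_measurable ?S" for n i
 proof -
  have "(\<lambda>P. (P i, P)) \<in> measurable ?S (D \<Otimes>\<^sub>M ?S)" by measurable
  from measurable_compose[OF this \<Phi>n] show ?thesis by simp
 qed
 have \<Phi>c[measurable]: "(\<lambda>x. \<Phi> (fst x) (n, case_nat (fst x) (snd x))) \<in> borel_measurable (D \<Otimes>\<^sub>M ?S)" for n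
 proof -
  have "(\<lambda>x. (fst x, case_nat (fst x) (snd x))) \<in> measurable (D \<Otimes>\<^sub>M ?S) (D \<Otimes>\<^sub>M ?S)" by measurable
  from measurable_compose[OF this \<Phi>n] show ?thesis by simp
 qed
 have \<Phi>c'[measurable]: "(\<lambda>x. \<Phi> (snd x) (n, case_nat (snd x) (fst x))) \<in> borel_measurable (?S \<Otimes>\<^sub>M D)" for n
  using measurable_compose[OF measurable_pair_swap' \<Phi>c] by (simp add: case_prod_unfold)
 define a where "a n = (\<integral>\<^sup>+p. \<integral>\<^sup>+P. \<Phi> p (n, case_nat p P) \<partial>?S \<partial>D)" for n
 have one: "(\<integral>\<^sup>+P. \<Phi> (P i) (n, P) \<partial>?S) = a n" if i: "i < n" for i n
 proof -
  have "(\<integral>\<^sup>+P. \<Phi> (P i) (n, P) \<partial>?S) = (\<integral>\<^sup>+P. \<Phi> ((P \<circ> Transposition.transpose 0 i) 0) (n, P \<circ> Transposition.transpose 0 i) \<partial>?S)"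
   by (intro nn_integral_cong) (simp add: sym[OF i])
  also have "\<dots> = (\<integral>\<^sup>+P. \<Phi> (P 0) (n, P) \<partial>distr ?S ?S (\<lambda>P. P \<circ> Transposition.transpose 0 i))"
   by (subst nn_integral_distr) (auto simp: o_def space_PiM PiE_iff intro!: measurable_PiM_single')
  also have "\<dots> = (\<integral>\<^sup>+P. \<Phi> (P 0) (n, P) \<partial>?S)" by (simp only: PiM_iid_swap[OF D])
  also have "\<dots> = a n" unfolding a_def by (subst PiM_iid_cons[OF D]) auto
  finally show ?thesis .
 qed
 have m1: "(\<lambda>x. \<Sum>i<fst x. \<Phi> (snd x i) x) \<in> borel_measurable (poisson_cell r D)"
  by (subst measurable_poisson_cell[OF D]) auto
 have m2: "(\<lambda>x. \<integral>\<^sup>+p. \<Phi> p (Suc (fst x), case_nat p (snd x)) \<partial>D) \<in> borel_measurable (poisson_cell r D)"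
  by (subst measurable_poisson_cell[OF D]) (auto intro!: D.borel_measurable_nn_integral simp: case_prod_unfold)
 have sw: "(\<integral>\<^sup>+P. \<integral>\<^sup>+p. \<Phi> p (n, case_nat p P) \<partial>D \<partial>?S) = a n" for n
 proof -
  interpret pair_sigma_finite D ?S ..
  show ?thesis unfolding a_def by (rule Fubini') (auto simp: case_prod_unfold)
 qed
 have "(\<integral>\<^sup>+x. (\<Sum>i<fst x. \<Phi> (snd x i) x) \<partial>poisson_cell r D)
  = (\<Sum>n. ennreal (pmf (poisson_pmf r) n) * (\<Sum>i<n. a n))"
  by (subst nn_integral_poisson_cell[OF D m1]) (simp add: nn_integral_sum one)
 also have "\<dots> = (\<Sum>n. ennreal (pmf (poisson_pmf r) (Suc n)) * (of_nat (Suc n) * a (Suc n)))"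
  by (subst suminf_offset[where i=1]) (simp_all add: algebra_simps)
 also have "\<dots> = (\<Sum>n. ennreal r * (ennreal (pmf (poisson_pmf r) n) * a (Suc n)))"
 proof (rule suminf_cong)
  fix n
  have "pmf (poisson_pmf r) (Suc n) * real (Suc n) = r * pmf (poisson_pmf r) n"
   using r by (simp add: field_simps del: of_nat_Suc)
  hence "ennreal (pmf (poisson_pmf r) (Suc n)) * of_nat (Suc n) = ennreal r * ennreal (pmf (poisson_pmf r) n)"
   using r by (simp only: ennreal_of_nat_eq_real_of_nat ennreal_mult[symmetric] pmf_nonneg less_imp_le of_nat_0_le_iff)
  then show "ennreal (pmf (poisson_pmf r) (Suc n)) * (of_nat (Suc n) * a (Suc n)) = ennreal r * (ennreal (pmf (poisson_pmf r) n) * a (Suc n))"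
   by (simp only: mult.assoc[symmetric])
 qed
 also have "\<dots> = ennreal r * (\<Sum>n. ennreal (pmf (poisson_pmf r) n) * a (Suc n))" by simp
 also have "(\<Sum>n. ennreal (pmf (poisson_pmf r) n) * a (Suc n)) = (\<integral>\<^sup>+x. \<integral>\<^sup>+p. \<Phi> p (Suc (fst x), case_nat p (snd x)) \<partial>D \<partial>poisson_cell r D)"
  by (subst nn_integral_poisson_cell[OF D m2]) (simp add: sw)
 finally show ?thesis .
qed

lemma nn_integral_PiM_resample:
 assumes M: "\<And>i. i \<in> I ==> prob_space (M i)" and i: "i \<in> I" and f: "f \<in> borel_measurable (PiM I M)"
 shows "(\<integral>\<^sup>+cf. f cf \<partial>PiM I M) = (\<integral>\<^sup>+cf. \<integral>\<^sup>+x. f (fun_upd cf i x) \<partial>M i \<partial>PiM I M)"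
proof -
 interpret Mi: prob_space "M i" using M i by auto
 interpret P: prob_space "PiM I M" using M by (intro prob_space_PiM)
 interpret pair_sigma_finite "M i" "PiM I M" ..
 have m: "(\<lambda>(x, X). fun_upd X i x) \<in> measurable (M i \<Otimes>\<^sub>M PiM I M) (PiM I M)"
  using i measurable_fun_upd[of I I i "snd" "M i \<Otimes>\<^sub>M PiM I M" M fst] by (auto simp: case_prod_unfold insert_absorb)
 have "(\<integral>\<^sup>+cf. f cf \<partial>PiM I M) = (\<integral>\<^sup>+cf. f cf \<partial>distr (M i \<Otimes>\<^sub>M PiM I M) (PiM I M) (\<lambda>(x, X). fun_upd X i x))"
  using distr_PiM_resample[of I M i] M i by simp
 also have "\<dots> = (\<integral>\<^sup>+z. f (fun_upd (snd z) i (fst z)) \<partial>(M i \<Otimes>\<^sub>M PiM I M))"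
  using m f by (subst nn_integral_distr) (auto simp: case_prod_unfold)
 also have "\<dots> = (\<integral>\<^sup>+cf. \<integral>\<^sup>+x. f (fun_upd cf i x) \<partial>M i \<partial>PiM I M)"
  using measurable_compose[OF m f] by (subst nn_integral_snd[symmetric]) (auto simp: case_prod_unfold)
 finally show ?thesis .
qed

text \<open>One cell for each pair \<open>(m, k)\<close>: the atoms with time in \<open>(m, m + 1)\<close> and
  jump size in the \<open>k\<close>-th band. A cell consists of the number of its atoms and a sequence of
  positions \<open>(time - m, size)\<close>. Configurations are denoted by \<open>cf\<close>.\<close>

type_synonym config = "nat \<times> nat => nat \<times> (nat => real \<times> real)"

text \<open>The jump sizes are cut into bands at radii \<open>e k\<close> decreasing to zero. The radii are
  chosen so small that the jumps below \<open>e k\<close> carry variance at most \<open>(1/8)^k\<close>; the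
  maximal inequality with threshold \<open>(1/2)^k\<close> then has summable right-hand sides.\<close>

locale levy_cells =
 fixes \<Lambda> :: "real measure" and e :: "nat => real"
 assumes sets_\<Lambda>[measurable_cong]: "sets \<Lambda> = sets borel"
  and \<Lambda>0: "emeasure \<Lambda> {0} = 0"
  and \<Lambda>2: "(\<integral>\<^sup>+ x. ennreal (x\<^sup>2) \<partial>\<Lambda>) = 1"
  and e_pos: "\<And>k. 0 < e k" and e_dec: "\<And>k. e (Suc k) \<le> e k" and e_lim: "e \<longlonglongrightarrow> 0"
  and e_small: "\<And>k. (\<integral>\<^sup>+ x. ennreal (x\<^sup>2) * indicator {x. \<bar>x\<bar> \<le> e k} x \<partial>\<Lambda>) \<le> ennreal ((1/8)^k)"
begin

lemma space_\<Lambda>: "space \<Lambda> = UNIV" using sets_eq_imp_space_eq[OF sets_\<Lambda>] by simp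

lemma tail_finite: assumes "0 < \<epsilon>" shows "emeasure \<Lambda> {x. \<epsilon> < \<bar>x\<bar>} \<le> ennreal (1 / \<epsilon>\<^sup>2)"
proof -
 have "emeasure \<Lambda> {x. \<epsilon> < \<bar>x\<bar>} = (\<integral>\<^sup>+ x. indicator {x. \<epsilon> < \<bar>x\<bar>} x \<partial>\<Lambda>)" by simp
 also have "\<dots> \<le> (\<integral>\<^sup>+ x. ennreal (1 / \<epsilon>\<^sup>2) * ennreal (x\<^sup>2) \<partial>\<Lambda>)"
 proof (rule nn_integral_mono)
  fix x :: real
  have "1 \<le> 1 / \<epsilon>\<^sup>2 * x\<^sup>2" if "\<epsilon> < \<bar>x\<bar>"
  proof -
   have "\<epsilon>\<^sup>2 \<le> \<bar>x\<bar>\<^sup>2" using that assms by (intro power_mono) auto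
   then show ?thesis using assms by (simp add: field_simps)
  qed
  then show "indicator {x. \<epsilon> < \<bar>x\<bar>} x \<le> ennreal (1 / \<epsilon>\<^sup>2) * ennreal (x\<^sup>2)"
   by (auto simp: indicator_def ennreal_mult[symmetric] intro: ennreal_leI[of 1, simplified])
 qed
 also have "\<dots> = ennreal (1 / \<epsilon>\<^sup>2)" proof -
  have [measurable]: "(\<lambda>x. ennreal (x\<^sup>2)) \<in> borel_measurable \<Lambda>" unfolding measurable_cong_sets[OF sets_\<Lambda> refl] by measurable
  then show ?thesis by (simp only: nn_integral_cmult \<Lambda>2 mult_1_right)
 qed
 finally show ?thesis .
qed

definition band :: "nat => real set" where
 "band k = (case k of 0 => {x. e 0 < \<bar>x\<bar>} | Suc j => {x. e (Suc j) < \<bar>x\<bar> \<and> \<bar>x\<bar> \<le> e j})"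

lemma band_sets[measurable]: "band k \<in> sets borel"
 by (cases k) (auto simp: band_def)

lemma band_sub: "band k \<subseteq> {x. e k < \<bar>x\<bar>}" by (cases k) (auto simp: band_def)

lemma e_mono: "i \<le> j ==> e j \<le> e i"
 by (rule lift_Suc_antimono_le[of e]) (auto simp: e_dec)

lemma ex_band: assumes "x \<noteq> 0" shows "\<exists>!k. x \<in> band k"
proof -
 have "\<forall>\<^sub>F k in sequentially. e k < \<bar>x\<bar>" using order_tendstoD(2)[OF e_lim, of "\<bar>x\<bar>"] assms by simp
 then have ex: "\<exists>k. e k < \<bar>x\<bar>" by (auto simp: eventually_sequentially)
 define k where "k = (LEAST k. e k < \<bar>x\<bar>)"
 have k: "e k < \<bar>x\<bar>" unfolding k_def by (rule LeastI_ex[OF ex])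
 have nk: "\<bar>x\<bar> \<le> e j" if "j < k" for j using not_less_Least[of j "\<lambda>k. e k < \<bar>x\<bar>"] that by (auto simp: k_def)
 show ?thesis
 proof (rule ex1I[of _ k])
  show "x \<in> band k" using k nk by (cases k) (auto simp: band_def)
  fix l assume l: "x \<in> band l"
  show "l = k"
  proof (rule linorder_cases[of l k])
   assume "l < k" then show ?thesis using nk[of l] band_sub[of l] l by auto
  next
   assume "k < l"
   then obtain j where j: "l = Suc j" "k \<le> j" by (cases l) auto
   then show ?thesis using l k e_mono[of k j] by (auto simp: band_def)
  qed
 qed
qed

lemma band_zero: "0 \<notin> band k" using band_sub[of k] e_pos[of k] by auto

lemma band_finite: "emeasure \<Lambda> (band k) < \<infinity>"
proof -
 have "emeasure \<Lambda> (band k) \<le> emeasure \<Lambda> {x. e k < \<bar>x\<bar>}" by (rule emeasure_mono[OF band_sub]) simp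
 also have "\<dots> \<le> ennreal (1 / (e k)\<^sup>2)" by (rule tail_finite[OF e_pos])
 finally show ?thesis by (rule le_less_trans) simp
qed

lemma sigma_finite_\<Lambda>: "sigma_finite_measure \<Lambda>"
proof
 show "\<exists>A. countable A \<and> A \<subseteq> sets \<Lambda> \<and> \<Union>A = space \<Lambda> \<and> (\<forall>a\<in>A. emeasure \<Lambda> a \<noteq> \<infinity>)"
 proof (intro exI conjI)
  show "\<Union> (insert {0} (range band)) = space \<Lambda>" using ex_band space_\<Lambda> by auto blast
 qed (use band_finite in \<open>auto simp: \<Lambda>0 sets_\<Lambda> less_top\<close>)
qed

sublocale \<Lambda>: sigma_finite_measure \<Lambda> by (rule sigma_finite_\<Lambda>)

text \<open>A band of mass zero gets one phantom atom of size \<open>0\<close>, so that every rate is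
  positive. Atoms of size \<open>0\<close> are discarded wherever configurations are evaluated.\<close>

definition rate :: "nat => real" where
 "rate k = (if measure \<Lambda> (band k) = 0 then 1 else measure \<Lambda> (band k))"

definition mark :: "nat => real measure" where
 "mark k = (if measure \<Lambda> (band k) = 0 then return borel 0 else uniform_measure \<Lambda> (band k))"

lemma rate_pos: "0 < rate k" by (simp add: rate_def zero_less_measure_iff)

lemma emeasure_band: "emeasure \<Lambda> (band k) = ennreal (measure \<Lambda> (band k))"
 using band_finite[of k] by (intro emeasure_eq_ennreal_measure) auto

lemma prob_space_mark: "prob_space (mark k)"
 unfolding mark_def using band_finite[of k]
 by (auto intro!: prob_space_return prob_space_uniform_measure simp: emeasure_band)

lemma sets_mark[measurable_cong]: "sets (mark k) = sets borel" by (simp add: mark_def sets_\<Lambda>)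

lemma nn_integral_mark:
 assumes f[measurable]: "f \<in> borel_measurable borel" and f0: "f 0 = 0"
 shows "ennreal (rate k) * (\<integral>\<^sup>+x. f x \<partial>mark k) = (\<integral>\<^sup>+x. f x * indicator (band k) x \<partial>\<Lambda>)"
proof (cases "measure \<Lambda> (band k) = 0")
 case True
 have "AE x in \<Lambda>. x \<notin> band k"
  using True emeasure_band[of k] by (intro AE_not_in) (auto simp: null_sets_def sets_\<Lambda>)
 then have "(\<integral>\<^sup>+x. f x * indicator (band k) x \<partial>\<Lambda>) = (\<integral>\<^sup>+x. 0 \<partial>\<Lambda>)"
  by (intro nn_integral_cong_AE) (auto elim: eventually_mono)
 then show ?thesis using True f0 by (simp add: mark_def nn_integral_return)
next
 case False
 have [measurable]: "f \<in> borel_measurable \<Lambda>" "band k \<in> sets \<Lambda>" by (simp_all add: sets_\<Lambda> measurable_cong_sets[OF sets_\<Lambda>])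
 have "(\<integral>\<^sup>+x. f x \<partial>uniform_measure \<Lambda> (band k)) = (\<integral>\<^sup>+x. f x * indicator (band k) x \<partial>\<Lambda>) / emeasure \<Lambda> (band k)"
  by (rule nn_integral_uniform_measure) measurable
 moreover have "emeasure \<Lambda> (band k) \<noteq> 0" "emeasure \<Lambda> (band k) \<noteq> \<top>"
  using False band_finite[of k] by (auto simp: emeasure_band zero_less_measure_iff)
 ultimately show ?thesis using False
  by (simp add: mark_def rate_def emeasure_band[symmetric] ennreal_times_divide ennreal_mult_divide_eq mult.commute[of "emeasure \<Lambda> (band k)"])
qed

definition unif :: "real measure" where "unif = uniform_measure lborel {0<..<1}"

lemma prob_space_unif: "prob_space unif"
 unfolding unif_def by (intro prob_space_uniform_measure) auto
lemma sets_unif[measurable_cong]: "sets unif = sets borel" by (simp add: unif_def)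

lemma nn_integral_unif: "f \<in> borel_measurable borel ==> (\<integral>\<^sup>+u. f u \<partial>unif) = (\<integral>\<^sup>+u. f u * indicator {0<..<1} u \<partial>lborel)"
 unfolding unif_def by (subst nn_integral_uniform_measure) (auto simp: divide_ennreal_def)

definition point :: "nat => (real \<times> real) measure" where "point k = unif \<Otimes>\<^sub>M mark k"

lemma prob_space_point: "prob_space (point k)"
 unfolding point_def by (intro prob_space_pair prob_space_unif prob_space_mark)
lemma sets_point[measurable_cong]: "sets (point k) = sets (borel \<Otimes>\<^sub>M borel)"
 unfolding point_def by (intro sets_pair_measure_cong sets_unif sets_mark)
lemma sets_point'[measurable_cong]: "sets (point k) = sets borel"
 using sets_point unfolding borel_prod .

definition cell :: "nat \<times> nat => (nat \<times> (nat => real \<times> real)) measure" where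
 "cell c = poisson_cell (rate (snd c)) (point (snd c))"

definition L :: "config measure" where
 "L = PiM UNIV cell"

lemma prob_space_cell: "prob_space (cell c)"
 unfolding cell_def by (rule prob_space_poisson_cell[OF prob_space_point])

sublocale L: prob_space L unfolding L_def by (rule prob_space_PiM[OF prob_space_cell])

lemma space_poisson_cell_UNIV: "space (cell c) = UNIV"
 using sets_eq_imp_space_eq[OF sets_point] by (auto simp: cell_def poisson_cell_def space_pair_measure space_PiM)

lemma space_L: "space L = UNIV" by (auto simp: L_def space_PiM space_poisson_cell_UNIV)

lemma measurable_num[measurable]: "(\<lambda>cf. fst (cf c)) \<in> measurable L (count_space UNIV)"
proof -
 have "(\<lambda>cf. cf c) \<in> measurable L (cell c)" unfolding L_def by measurable
 moreover have "fst \<in> measurable (cell c) (count_space UNIV)"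
  unfolding cell_def by (subst measurable_poisson_cell[OF prob_space_point]) auto
 ultimately show ?thesis by (rule measurable_compose)
qed

lemma measurable_pt[measurable]: "(\<lambda>cf. snd (cf c) i) \<in> measurable L (borel \<Otimes>\<^sub>M borel)"
proof -
 have "(\<lambda>cf. cf c) \<in> measurable L (cell c)" unfolding L_def by measurable
 moreover have "(\<lambda>x. snd x i) \<in> measurable (cell c) (point (snd c))"
  unfolding cell_def by (subst measurable_poisson_cell[OF prob_space_point]) auto
 ultimately have "(\<lambda>cf. snd (cf c) i) \<in> measurable L (point (snd c))" by (rule measurable_compose)
 then show ?thesis by (simp cong: measurable_cong_sets add: sets_point)
qed

text \<open>From the position relative to a cell to absolute time.\<close>

definition tim :: "nat \<times> nat => real \<times> real => real \<times> real" where
 "tim c p = (real (fst c) + fst p, snd p)"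

lemma measurable_tim[measurable]: "tim c \<in> measurable (borel \<Otimes>\<^sub>M borel) (borel \<Otimes>\<^sub>M borel)"
 unfolding tim_def by measurable

definition cellJ :: "nat \<times> nat => config => (real \<times> real => ennreal) => ennreal" where
 "cellJ c cf F = (\<Sum>i<fst (cf c). if snd (snd (cf c) i) = 0 then 0 else F (tim c (snd (cf c) i)))"

text \<open>The integral of \<open>F\<close> against the Poisson random measure.\<close>

definition J :: "config => (real \<times> real => ennreal) => ennreal" where
 "J cf F = (\<Sum>n. cellJ (prod_decode n) cf F)"

text \<open>Insert an atom at the head of a cell. Functionals of the atoms cannot see the order inside a cell;
  this is the invariance under \<open>swp\<close> below.\<close>

definition add :: "nat \<times> nat => real \<times> real => config => config" where
 "add c p cf = fun_upd cf c (Suc (fst (cf c)), case_nat p (snd (cf c)))"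

definition swp :: "nat \<times> nat => nat => config => config" where
 "swp c i cf = fun_upd cf c (fst (cf c), snd (cf c) \<circ> Transposition.transpose 0 i)"

lemma cellJ_swp: "i < fst (cf c) ==> cellJ c' (swp c i cf) F = cellJ c' cf F"
proof (cases "c' = c")
 case True
 assume i: "i < fst (cf c)"
 have "bij_betw (Transposition.transpose 0 i) {..<fst (cf c)} {..<fst (cf c)}"
  using i by (intro bij_betw_byWitness[where f'="Transposition.transpose 0 i"]) (auto simp: Transposition.transpose_def)
 then show ?thesis using True
  by (auto simp: cellJ_def swp_def o_def cong: if_cong intro!: sum.reindex_bij_betw[where g="\<lambda>j. if snd (snd (cf c) j) = 0 then 0 else F (tim c (snd (cf c) j))"])
qed (simp add: cellJ_def swp_def cong: if_cong)

lemma J_swp: "i < fst (cf c) ==> J (swp c i cf) F = J cf F"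
 by (simp add: J_def cellJ_swp)

lemma cellJ_add: "cellJ c' (add c p cf) F = (if c' = c then if snd p = 0 then 0 else F (tim c p) else 0) + cellJ c' cf F"
 by (cases "c' = c") (simp_all add: cellJ_def add_def sum.lessThan_Suc_shift del: sum.lessThan_Suc cong: if_cong)

lemma J_add: "J (add c p cf) F = (if snd p = 0 then 0 else F (tim c p)) + J cf F"
proof -
 have "(\<Sum>n. if prod_decode n = c then a else 0) = a" for a :: ennreal
 proof -
  have "(\<Sum>n. if prod_decode n = c then a else 0) = (\<Sum>n\<in>{prod_encode c}. if prod_decode n = c then a else 0)"
   by (rule suminf_finite) auto
  then show ?thesis by simp
 qed
 then show ?thesis unfolding J_def cellJ_add by (subst suminf_add[symmetric]) auto
qed

lemma measurable_J:
 assumes F[measurable]: "(\<lambda>(cf, p). F cf p) \<in> borel_measurable (N \<Otimes>\<^sub>M (borel \<Otimes>\<^sub>M borel))" and g[measurable]: "g \<in> measurable N L"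
 shows "(\<lambda>cf. J (g cf) (F cf)) \<in> borel_measurable N"
proof -
 have "cellJ c (g cf) (F cf) = (\<Sum>i. if i < fst (g cf c) then (if snd (snd (g cf c) i) = 0 then 0 else F cf (tim c (snd (g cf c) i))) else 0)" for c cf
  unfolding cellJ_def by (subst suminf_finite[of "{..<fst (g cf c)}"]) auto
 moreover have "(\<lambda>cf. snd (g cf c) i) \<in> measurable N (borel \<Otimes>\<^sub>M borel)" for c i
  by (rule measurable_compose[OF g measurable_pt])
 moreover have "(\<lambda>cf. fst (g cf c)) \<in> measurable N (count_space UNIV)" for c
  by (rule measurable_compose[OF g measurable_num])
 moreover have "(\<lambda>cf. F cf (tim c (snd (g cf c) i))) \<in> borel_measurable N" for c i
  using measurable_compose[OF measurable_Pair[OF measurable_id[of N] measurable_compose[OF measurable_compose[OF g measurable_pt[of c i]] measurable_tim[of c]]] F] by simp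
 ultimately show ?thesis unfolding J_def by (simp only:) measurable
qed

lemma measurable_J'[measurable]: "F \<in> borel_measurable (borel \<Otimes>\<^sub>M borel) ==> (\<lambda>cf. J cf F) \<in> borel_measurable L"
 by (rule measurable_J) auto

lemma measurable_add: "(\<lambda>(p, cf). add c p cf) \<in> measurable (point (snd c) \<Otimes>\<^sub>M L) L"
proof -
 have 1: "(\<lambda>(p, x). (Suc (fst x), case_nat p (snd x))) \<in> measurable (point (snd c) \<Otimes>\<^sub>M cell c) (cell c)"
  unfolding cell_def poisson_cell_def case_prod_unfold by measurable
 have 2: "(\<lambda>(p, cf). (p, cf c)) \<in> measurable (point (snd c) \<Otimes>\<^sub>M L) (point (snd c) \<Otimes>\<^sub>M cell c)"
  unfolding L_def by measurable
 show ?thesis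
  using measurable_fun_upd[of UNIV UNIV c snd "point (snd c) \<Otimes>\<^sub>M L" cell, OF _ _ measurable_compose[OF 2 1]]
  by (auto simp: L_def add_def case_prod_unfold)
qed

lemma mecke_one:
 assumes \<Phi>[measurable]: "(\<lambda>(p, cf). \<Phi> p cf) \<in> borel_measurable ((borel \<Otimes>\<^sub>M borel) \<Otimes>\<^sub>M L)"
  and sym: "\<And>p cf i. i < fst (cf c) ==> \<Phi> p (swp c i cf) = \<Phi> p cf"
 shows "(\<integral>\<^sup>+cf. (\<Sum>i<fst (cf c). \<Phi> (snd (cf c) i) cf) \<partial>L) = ennreal (rate (snd c)) * (\<integral>\<^sup>+cf. \<integral>\<^sup>+p. \<Phi> p (add c p cf) \<partial>point (snd c) \<partial>L)"
proof -
 have mf: "(\<lambda>cf. (\<Sum>i<fst (cf c). \<Phi> (snd (cf c) i) cf)) \<in> borel_measurable L"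
 proof -
  have "(\<Sum>i<fst (cf c). \<Phi> (snd (cf c) i) cf) = (\<Sum>i. if i < fst (cf c) then \<Phi> (snd (cf c) i) cf else 0)" for cf
   by (subst suminf_finite[of "{..<fst (cf c)}"]) auto
  moreover have "(\<lambda>cf. \<Phi> (snd (cf c) i) cf) \<in> borel_measurable L" for i
   using measurable_compose[OF measurable_Pair[OF measurable_pt[of c i] measurable_id[of L]] \<Phi>] by simp
  ultimately show ?thesis by simp
 qed
 interpret pt: prob_space "point (snd c)" by (rule prob_space_point)
 have \<Phi>': "(\<lambda>(p, cf). \<Phi> p cf) \<in> borel_measurable (point (snd c) \<Otimes>\<^sub>M L)"
  using \<Phi> by (simp cong: measurable_cong_sets sets_pair_measure_cong add: sets_point)
 have \<Phi>a: "(\<lambda>(p, cf). \<Phi> p (add c p cf)) \<in> borel_measurable (point (snd c) \<Otimes>\<^sub>M L)"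
 proof -
  have "(\<lambda>x. (fst x, add c (fst x) (snd x))) \<in> measurable (point (snd c) \<Otimes>\<^sub>M L) (point (snd c) \<Otimes>\<^sub>M L)"
   using measurable_add[of c] by (intro measurable_Pair) (auto simp: case_prod_unfold)
  from measurable_compose[OF this \<Phi>'] show ?thesis by (simp add: case_prod_unfold)
 qed
 have mg: "(\<lambda>cf. \<integral>\<^sup>+p. \<Phi> p (add c p cf) \<partial>point (snd c)) \<in> borel_measurable L"
  using measurable_compose[OF measurable_pair_swap' \<Phi>a] by (intro pt.borel_measurable_nn_integral) (auto simp: case_prod_unfold)
 have "(\<integral>\<^sup>+cf. (\<Sum>i<fst (cf c). \<Phi> (snd (cf c) i) cf) \<partial>L) = (\<integral>\<^sup>+cf. \<integral>\<^sup>+x. (\<Sum>i<fst x. \<Phi> (snd x i) (fun_upd cf c x)) \<partial>cell c \<partial>L)"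
  using mf unfolding L_def by (subst nn_integral_PiM_resample[of UNIV cell c]) (auto simp: prob_space_cell)
 also have "\<dots> = (\<integral>\<^sup>+cf. ennreal (rate (snd c)) * (\<integral>\<^sup>+x. \<integral>\<^sup>+p. \<Phi> p (fun_upd cf c (Suc (fst x), case_nat p (snd x))) \<partial>point (snd c) \<partial>cell c) \<partial>L)"
 proof (rule nn_integral_cong)
  fix cf
  have m: "(\<lambda>(p, x). \<Phi> p (fun_upd cf c x)) \<in> borel_measurable (point (snd c) \<Otimes>\<^sub>M cell c)"
  proof -
   have "(\<lambda>x. (fst x, fun_upd cf c (snd x))) \<in> measurable (point (snd c) \<Otimes>\<^sub>M cell c) (point (snd c) \<Otimes>\<^sub>M L)"
    unfolding L_def by (intro measurable_Pair measurable_fun_upd[of UNIV UNIV]) (auto simp: space_PiM space_poisson_cell_UNIV)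
   from measurable_compose[OF this \<Phi>'] show ?thesis by (simp add: case_prod_unfold)
  qed
  show "(\<integral>\<^sup>+x. (\<Sum>i<fst x. \<Phi> (snd x i) (fun_upd cf c x)) \<partial>cell c) = ennreal (rate (snd c)) * (\<integral>\<^sup>+x. \<integral>\<^sup>+p. \<Phi> p (fun_upd cf c (Suc (fst x), case_nat p (snd x))) \<partial>point (snd c) \<partial>cell c)"
   unfolding cell_def
  proof (rule mecke_cell[OF rate_pos prob_space_point])
   show "(\<lambda>(p, x). \<Phi> p (fun_upd cf c x)) \<in> borel_measurable (point (snd c) \<Otimes>\<^sub>M poisson_cell (rate (snd c)) (point (snd c)))"
    using m unfolding cell_def .
   show "\<Phi> p (fun_upd cf c (n, P \<circ> Transposition.transpose 0 i)) = \<Phi> p (fun_upd cf c (n, P))" if "i < n" for p n P i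
    using sym[of i "fun_upd cf c (n, P)" p] that by (simp add: swp_def)
  qed
 qed
 also have "\<dots> = ennreal (rate (snd c)) * (\<integral>\<^sup>+cf. (\<integral>\<^sup>+x. (\<integral>\<^sup>+p. \<Phi> p (add c p (fun_upd cf c x)) \<partial>point (snd c)) \<partial>cell c) \<partial>L)"
 proof (subst nn_integral_cmult)
  have "(\<lambda>(cf, x). fun_upd cf c x) \<in> measurable (L \<Otimes>\<^sub>M cell c) L"
   using measurable_fun_upd[of UNIV UNIV c fst "L \<Otimes>\<^sub>M cell c" cell snd] by (auto simp: L_def case_prod_unfold)
  from measurable_compose[OF this mg]
  have "(\<lambda>(cf, x). \<integral>\<^sup>+p. \<Phi> p (add c p (fun_upd cf c x)) \<partial>point (snd c)) \<in> borel_measurable (L \<Otimes>\<^sub>M cell c)" by (simp add: case_prod_unfold)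
  then show "(\<lambda>cf. \<integral>\<^sup>+x. \<integral>\<^sup>+p. \<Phi> p (fun_upd cf c (Suc (fst x), case_nat p (snd x))) \<partial>point (snd c) \<partial>cell c) \<in> borel_measurable L"
   using sigma_finite_measure.borel_measurable_nn_integral[of "cell c", OF prob_space_imp_sigma_finite[OF prob_space_cell]]
   by (auto simp: add_def)
 qed (simp add: add_def)
 also have "(\<integral>\<^sup>+cf. (\<integral>\<^sup>+x. (\<integral>\<^sup>+p. \<Phi> p (add c p (fun_upd cf c x)) \<partial>point (snd c)) \<partial>cell c) \<partial>L) = (\<integral>\<^sup>+cf. \<integral>\<^sup>+p. \<Phi> p (add c p cf) \<partial>point (snd c) \<partial>L)"
  using mg unfolding L_def by (subst (2) nn_integral_PiM_resample[of UNIV cell c]) (auto simp: prob_space_cell)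
 finally show ?thesis .
qed

lemma measurable_to_\<Lambda>: "f \<in> borel_measurable borel ==> f \<in> borel_measurable \<Lambda>"
 by (simp add: measurable_cong_sets[OF sets_\<Lambda> refl])

lemma nn_integral_compensator:
 assumes F[measurable]: "F \<in> borel_measurable (borel \<Otimes>\<^sub>M borel)"
 shows "(\<integral>\<^sup>+p. F p \<partial>levy_compensator \<Lambda>) = (\<integral>\<^sup>+s. indicator {0<..} s * (\<integral>\<^sup>+x. F (s, x) \<partial>\<Lambda>) \<partial>lborel)"
proof -
 have s: "sets (density lborel (indicator {0<..}) \<Otimes>\<^sub>M \<Lambda>) = sets (borel \<Otimes>\<^sub>M borel)"
  by (intro sets_pair_measure_cong) (auto simp: sets_\<Lambda>)
 have F': "F \<in> borel_measurable (density lborel (indicator {0<..}) \<Otimes>\<^sub>M \<Lambda>)" by (simp add: measurable_cong_sets[OF s refl])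
 have F'': "F \<in> borel_measurable (lborel \<Otimes>\<^sub>M \<Lambda>)"
  using F by (simp cong: measurable_cong_sets sets_pair_measure_cong add: sets_\<Lambda>)
 show ?thesis
  unfolding levy_compensator_def \<Lambda>.nn_integral_fst[OF F', symmetric]
  by (subst nn_integral_density) (auto intro!: \<Lambda>.borel_measurable_nn_integral simp: F'' case_prod_unfold)
qed

text \<open>The intensities of the cells add up to \<open>ds \<Lambda>(dx)\<close> on positive times, since
  the cells partition the positive times and the nonzero sizes up to null sets.\<close>

lemma sum_cells_compensator:
 assumes F[measurable]: "F \<in> borel_measurable (borel \<Otimes>\<^sub>M borel)"
 shows "(\<Sum>n. let c = prod_decode n in ennreal (rate (snd c)) * (\<integral>\<^sup>+p. (if snd p = 0 then 0 else F (tim c p)) \<partial>point (snd c)))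
  = (\<integral>\<^sup>+p. F p \<partial>levy_compensator \<Lambda>)"
proof -
 have F\<Lambda>[measurable]: "F \<in> borel_measurable (borel \<Otimes>\<^sub>M \<Lambda>)"
  using F by (simp cong: measurable_cong_sets sets_pair_measure_cong add: sets_\<Lambda>)
 define H where "H t = (\<integral>\<^sup>+x. F (t, x) \<partial>\<Lambda>)" for t
 have H[measurable]: "H \<in> borel_measurable borel" unfolding H_def by measurable
 define Hk where "Hk k t = (\<integral>\<^sup>+x. F (t, x) * indicator (band k) x \<partial>\<Lambda>)" for k t
 have bm: "(\<lambda>x. indicator (band k) (snd x)) \<in> borel_measurable (borel \<Otimes>\<^sub>M \<Lambda>)" for k
  by (rule measurable_compose[OF measurable_snd]) (simp add: measurable_to_\<Lambda>)
 have Hk[measurable]: "Hk k \<in> borel_measurable borel" for k unfolding Hk_def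
  by (intro \<Lambda>.borel_measurable_nn_integral) (auto simp: case_prod_unfold intro!: borel_measurable_times_ennreal bm)
 have Hsum: "(\<Sum>k. Hk k t) = H t" for t
 proof -
  have Ft: "(\<lambda>x. F (t, x)) \<in> borel_measurable borel" by measurable
  have "(\<Sum>k. Hk k t) = (\<integral>\<^sup>+x. (\<Sum>k. F (t, x) * indicator (band k) x) \<partial>\<Lambda>)"
   unfolding Hk_def by (rule nn_integral_suminf[symmetric]) (intro measurable_to_\<Lambda>, measurable)
  also have "\<dots> = H t" unfolding H_def
  proof (rule nn_integral_cong_AE)
   have "AE x in \<Lambda>. x \<notin> {0}" by (rule AE_not_in) (simp add: null_sets_def \<Lambda>0 sets_\<Lambda>)
   then show "AE x in \<Lambda>. (\<Sum>k. F (t, x) * indicator (band k) x) = F (t, x)"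
   proof eventually_elim
    case (elim x)
    then obtain k where k: "x \<in> band k" "\<And>l. x \<in> band l ==> l = k" using ex_band[of x] by auto
    have "(\<Sum>k. F (t, x) * indicator (band k) x) = (\<Sum>l\<in>{k}. F (t, x) * indicator (band l) x)"
    proof (rule suminf_finite)
     fix l assume "l \<notin> {k}"
     then have "x \<notin> band l" using k(2)[of l] by blast
     then show "F (t, x) * indicator (band l) x = 0" by simp
    qed simp
    then show ?case using k(1) by simp
   qed
  qed
  finally show ?thesis .
 qed
 have one: "ennreal (rate k) * (\<integral>\<^sup>+p. (if snd p = 0 then 0 else F (tim (m, k) p)) \<partial>point k) = (\<integral>\<^sup>+u. Hk k (real m + u) \<partial>unif)" for m k
 proof -
  interpret mk: prob_space "mark k" by (rule prob_space_mark)
  have m1: "(\<lambda>p. (if snd p = 0 then 0 else F (tim (m, k) p))) \<in> borel_measurable (borel \<Otimes>\<^sub>M borel)" by measurable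
  then have m2: "(\<lambda>p. (if snd p = 0 then 0 else F (tim (m, k) p))) \<in> borel_measurable (unif \<Otimes>\<^sub>M mark k)"
   by (simp cong: measurable_cong_sets sets_pair_measure_cong add: sets_unif sets_mark)
  have "ennreal (rate k) * (\<integral>\<^sup>+p. (if snd p = 0 then 0 else F (tim (m, k) p)) \<partial>point k)
   = ennreal (rate k) * (\<integral>\<^sup>+u. \<integral>\<^sup>+x. (if x = 0 then 0 else F (real m + u, x)) \<partial>mark k \<partial>unif)"
   unfolding point_def by (subst mk.nn_integral_fst[OF m2, symmetric]) (simp add: tim_def cong: if_cong)
  also have "\<dots> = (\<integral>\<^sup>+u. ennreal (rate k) * (\<integral>\<^sup>+x. (if x = 0 then 0 else F (real m + u, x)) \<partial>mark k) \<partial>unif)"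
   by (rule nn_integral_cmult[symmetric]) (use mk.borel_measurable_nn_integral_fst[OF m2] in \<open>simp add: tim_def\<close>)
  also have "\<dots> = (\<integral>\<^sup>+u. Hk k (real m + u) \<partial>unif)"
  proof (rule nn_integral_cong)
   fix u
   have "ennreal (rate k) * (\<integral>\<^sup>+x. (if x = 0 then 0 else F (real m + u, x)) \<partial>mark k) = (\<integral>\<^sup>+x. (if x = 0 then 0 else F (real m + u, x)) * indicator (band k) x \<partial>\<Lambda>)"
    by (rule nn_integral_mark) auto
   also have "\<dots> = Hk k (real m + u)" unfolding Hk_def
    using band_zero[of k] by (intro nn_integral_cong) (auto simp: indicator_def)
   finally show "ennreal (rate k) * (\<integral>\<^sup>+x. (if x = 0 then 0 else F (real m + u, x)) \<partial>mark k) = Hk k (real m + u)" .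
  qed
  finally show ?thesis .
 qed
 have mH: "(\<Sum>k. \<integral>\<^sup>+u. Hk k (real m + u) \<partial>unif) = (\<integral>\<^sup>+t. H t * indicator {real m<..<real m + 1} t \<partial>lborel)" for m
 proof -
  have "(\<Sum>k. \<integral>\<^sup>+u. Hk k (real m + u) \<partial>unif) = (\<integral>\<^sup>+u. (\<Sum>k. Hk k (real m + u)) \<partial>unif)"
   by (rule nn_integral_suminf[symmetric])
     (rule measurable_compose[OF _ Hk], simp add: measurable_cong_sets[OF sets_unif refl])
  also have "\<dots> = (\<integral>\<^sup>+u. H (real m + u) * indicator {0<..<1} u \<partial>lborel)"
   unfolding Hsum by (rule nn_integral_unif) measurable
  also have "\<dots> = (\<integral>\<^sup>+t. H t * indicator {real m<..<real m + 1} t \<partial>lborel)"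
   by (subst (2) nn_integral_real_affine[where c=1 and t="real m"]) (auto intro!: nn_integral_cong simp: indicator_def)
  finally show ?thesis .
 qed
 have "(\<Sum>n. let c = prod_decode n in ennreal (rate (snd c)) * (\<integral>\<^sup>+p. (if snd p = 0 then 0 else F (tim c p)) \<partial>point (snd c)))
  = (\<Sum>m. \<Sum>k. \<integral>\<^sup>+u. Hk k (real m + u) \<partial>unif)"
  unfolding Let_def
  by (rule suminf_ennreal_2dimen[of _ "\<lambda>c. ennreal (rate (snd c)) * (\<integral>\<^sup>+p. (if snd p = 0 then 0 else F (tim c p)) \<partial>point (snd c))"])
    (simp only: snd_conv one)
 also have "\<dots> = (\<integral>\<^sup>+t. (\<Sum>m. H t * indicator {real m<..<real m + 1} t) \<partial>lborel)"
  unfolding mH by (rule nn_integral_suminf[symmetric]) simp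
 also have "\<dots> = (\<integral>\<^sup>+t. indicator {0<..} t * H t \<partial>lborel)"
 proof (rule nn_integral_cong_AE)
  have "AE t in lborel. t \<notin> range real" by (rule AE_not_in) (simp add: countable_imp_null_set_lborel)
  then show "AE t in lborel. (\<Sum>m. H t * indicator {real m<..<real m + 1} t) = indicator {0<..} t * H t"
  proof eventually_elim
   case (elim t)
   show ?case
   proof (cases "0 < t")
    case True
    define m where "m = nat \<lfloor>t\<rfloor>"
    have le: "real m \<le> t" "t < real m + 1" using True floor_correct[of t] by (simp_all add: m_def)
    have "t \<noteq> real m" using elim by auto
    with le have k: "real m < t" "t < real m + 1" by auto
    have u: "l = m" if "real l < t" "t < real l + 1" for l using that k by linarith
    have "(\<Sum>m. H t * indicator {real m<..<real m + 1} t) = (\<Sum>l\<in>{m}. H t * indicator {real l<..<real l + 1} t)"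
     by (rule suminf_finite) (use u in \<open>auto simp: indicator_def\<close>)
    then show ?thesis using k True by simp
   next
    case False
    then have "indicator {real m<..<real m + 1} t = (0::ennreal)" for m :: nat
    proof -
     have "\<not> real m < t" using False of_nat_0_le_iff[of m, where 'a=real] by linarith
     then show ?thesis by simp
    qed
    then show ?thesis using False by simp
   qed
  qed
 qed
 also have "\<dots> = (\<integral>\<^sup>+p. F p \<partial>levy_compensator \<Lambda>)" unfolding H_def by (rule nn_integral_compensator[OF F, symmetric])
 finally show ?thesis .
qed

text \<open>Mecke's formula: summing over the atoms of the configuration amounts to inserting one more atom
  according to the intensity. The function \<open>\<Psi>\<close> is what \<open>\<Phi>\<close> becomes after
  the insertion; it may ignore null sets of insertion points, such as coinciding times.\<close>

theorem mecke:
 assumes \<Phi>[measurable]: "(\<lambda>(p, cf). \<Phi> p cf) \<in> borel_measurable ((borel \<Otimes>\<^sub>M borel) \<Otimes>\<^sub>M L)"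
  and \<Psi>[measurable]: "(\<lambda>(p, cf). \<Psi> p cf) \<in> borel_measurable ((borel \<Otimes>\<^sub>M borel) \<Otimes>\<^sub>M L)"
  and sym: "\<And>p cf c i. i < fst (cf c) ==> \<Phi> p (swp c i cf) = \<Phi> p cf"
  and ad: "\<And>c. AE cf in L. AE p in point (snd c). snd p \<noteq> 0 \<longrightarrow> \<Phi> (tim c p) (add c p cf) = \<Psi> (tim c p) cf"
 shows "(\<integral>\<^sup>+cf. J cf (\<lambda>p. \<Phi> p cf) \<partial>L) = (\<integral>\<^sup>+cf. \<integral>\<^sup>+p. \<Psi> p cf \<partial>levy_compensator \<Lambda> \<partial>L)"
proof -
 define \<Phi>' where "\<Phi>' c p cf = (if snd p = 0 then 0 else \<Phi> (tim c p) cf)" for c p cf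
 define \<Psi>' where "\<Psi>' c p cf = (if snd p = 0 then 0 else \<Psi> (tim c p) cf)" for c p cf
 have tm: "(\<lambda>x. (tim c (fst x), snd x)) \<in> measurable ((borel \<Otimes>\<^sub>M borel) \<Otimes>\<^sub>M L) ((borel \<Otimes>\<^sub>M borel) \<Otimes>\<^sub>M L)" for c
  by measurable
 have m1[measurable]: "(\<lambda>(p, cf). \<Phi>' c p cf) \<in> borel_measurable ((borel \<Otimes>\<^sub>M borel) \<Otimes>\<^sub>M L)" for c
  using measurable_compose[OF tm \<Phi>] unfolding \<Phi>'_def case_prod_unfold fst_conv snd_conv by measurable
 have m2[measurable]: "(\<lambda>(p, cf). \<Psi>' c p cf) \<in> borel_measurable ((borel \<Otimes>\<^sub>M borel) \<Otimes>\<^sub>M L)" for c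
  using measurable_compose[OF tm \<Psi>] unfolding \<Psi>'_def case_prod_unfold fst_conv snd_conv by measurable
 have cJ: "cellJ c cf (\<lambda>p. \<Phi> p cf) = (\<Sum>i<fst (cf c). \<Phi>' c (snd (cf c) i) cf)" for c cf
  by (simp add: cellJ_def \<Phi>'_def)
 have mJ: "(\<lambda>cf. cellJ c cf (\<lambda>p. \<Phi> p cf)) \<in> borel_measurable L" for c
 proof -
  have "(\<Sum>i<fst (cf c). \<Phi>' c (snd (cf c) i) cf) = (\<Sum>i. if i < fst (cf c) then \<Phi>' c (snd (cf c) i) cf else 0)" for cf
   by (subst suminf_finite[of "{..<fst (cf c)}"]) auto
  moreover have "(\<lambda>cf. \<Phi>' c (snd (cf c) i) cf) \<in> borel_measurable L" for i
   using measurable_compose[OF measurable_Pair[OF measurable_pt[of c i] measurable_id[of L]] m1] by simp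
  ultimately show ?thesis unfolding cJ by simp
 qed
 have "(\<integral>\<^sup>+cf. J cf (\<lambda>p. \<Phi> p cf) \<partial>L) = (\<Sum>n. \<integral>\<^sup>+cf. cellJ (prod_decode n) cf (\<lambda>p. \<Phi> p cf) \<partial>L)"
  unfolding J_def by (rule nn_integral_suminf[OF mJ])
 also have "\<dots> = (\<Sum>n. \<integral>\<^sup>+cf. (let c = prod_decode n in ennreal (rate (snd c)) * (\<integral>\<^sup>+p. \<Psi>' c p cf \<partial>point (snd c))) \<partial>L)"
 proof (rule suminf_cong)
  fix n
  define c where "c = prod_decode n"
  interpret pt: prob_space "point (snd c)" by (rule prob_space_point)
  have m3: "(\<lambda>(cf, p). \<Psi>' c p cf) \<in> borel_measurable (L \<Otimes>\<^sub>M point (snd c))"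
  proof -
   have "(\<lambda>(cf, p). \<Psi>' c p cf) \<in> borel_measurable (L \<Otimes>\<^sub>M (borel \<Otimes>\<^sub>M borel))"
    using measurable_compose[OF measurable_pair_swap' m2[of c]] by (simp add: case_prod_unfold)
   then show ?thesis by (simp cong: measurable_cong_sets sets_pair_measure_cong add: sets_point)
  qed
  have "(\<integral>\<^sup>+cf. cellJ c cf (\<lambda>p. \<Phi> p cf) \<partial>L) = ennreal (rate (snd c)) * (\<integral>\<^sup>+cf. \<integral>\<^sup>+p. \<Phi>' c p (add c p cf) \<partial>point (snd c) \<partial>L)"
   unfolding cJ by (rule mecke_one[OF m1]) (simp add: \<Phi>'_def sym)
  also have "(\<integral>\<^sup>+cf. \<integral>\<^sup>+p. \<Phi>' c p (add c p cf) \<partial>point (snd c) \<partial>L) = (\<integral>\<^sup>+cf. \<integral>\<^sup>+p. \<Psi>' c p cf \<partial>point (snd c) \<partial>L)"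
  proof (rule nn_integral_cong_AE)
   show "AE cf in L. (\<integral>\<^sup>+p. \<Phi>' c p (add c p cf) \<partial>point (snd c)) = (\<integral>\<^sup>+p. \<Psi>' c p cf \<partial>point (snd c))"
    using ad[of c]
   proof eventually_elim
    case (elim cf)
    then show ?case
     by (intro nn_integral_cong_AE) (auto elim!: eventually_mono simp: \<Phi>'_def \<Psi>'_def)
   qed
  qed
  also have "ennreal (rate (snd c)) * (\<integral>\<^sup>+cf. \<integral>\<^sup>+p. \<Psi>' c p cf \<partial>point (snd c) \<partial>L) = (\<integral>\<^sup>+cf. ennreal (rate (snd c)) * (\<integral>\<^sup>+p. \<Psi>' c p cf \<partial>point (snd c)) \<partial>L)"
   by (rule nn_integral_cmult[symmetric]) (rule pt.borel_measurable_nn_integral[OF m3])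
  finally show "(\<integral>\<^sup>+cf. cellJ (prod_decode n) cf (\<lambda>p. \<Phi> p cf) \<partial>L) = (\<integral>\<^sup>+cf. (let c = prod_decode n in ennreal (rate (snd c)) * (\<integral>\<^sup>+p. \<Psi>' c p cf \<partial>point (snd c))) \<partial>L)"
   by (simp add: c_def Let_def)
 qed
 also have "\<dots> = (\<integral>\<^sup>+cf. (\<Sum>n. let c = prod_decode n in ennreal (rate (snd c)) * (\<integral>\<^sup>+p. \<Psi>' c p cf \<partial>point (snd c))) \<partial>L)"
 proof (rule nn_integral_suminf[symmetric])
  fix n
  define c where "c = prod_decode n"
  interpret pt: prob_space "point (snd c)" by (rule prob_space_point)
  have m3: "(\<lambda>(cf, p). \<Psi>' c p cf) \<in> borel_measurable (L \<Otimes>\<^sub>M point (snd c))"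
  proof -
   have "(\<lambda>(cf, p). \<Psi>' c p cf) \<in> borel_measurable (L \<Otimes>\<^sub>M (borel \<Otimes>\<^sub>M borel))"
    using measurable_compose[OF measurable_pair_swap' m2[of c]] by (simp add: case_prod_unfold)
   then show ?thesis by (simp cong: measurable_cong_sets sets_pair_measure_cong add: sets_point)
  qed
  show "(\<lambda>cf. let c = prod_decode n in ennreal (rate (snd c)) * (\<integral>\<^sup>+p. \<Psi>' c p cf \<partial>point (snd c))) \<in> borel_measurable L"
   unfolding Let_def c_def[symmetric] by (intro borel_measurable_times_ennreal pt.borel_measurable_nn_integral[OF m3]) simp
 qed
 also have "\<dots> = (\<integral>\<^sup>+cf. \<integral>\<^sup>+p. \<Psi> p cf \<partial>levy_compensator \<Lambda> \<partial>L)"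
 proof (rule nn_integral_cong)
  fix cf assume "cf \<in> space L"
  then have "(\<lambda>p. \<Psi> p cf) \<in> borel_measurable (borel \<Otimes>\<^sub>M borel)"
   using measurable_compose[OF measurable_Pair2'[of cf L "borel \<Otimes>\<^sub>M borel"] \<Psi>] by simp
  from sum_cells_compensator[OF this] show "(\<Sum>n. let c = prod_decode n in ennreal (rate (snd c)) * (\<integral>\<^sup>+p. \<Psi>' c p cf \<partial>point (snd c))) = (\<integral>\<^sup>+p. \<Psi> p cf \<partial>levy_compensator \<Lambda>)"
   unfolding \<Psi>'_def .
 qed
 finally show ?thesis .
qed

lemma sets_compensator: "sets (levy_compensator \<Lambda>) = sets (borel \<Otimes>\<^sub>M borel)"
 unfolding levy_compensator_def by (intro sets_pair_measure_cong) (auto simp: sets_\<Lambda>)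

lemma cellJ_add_fun: "cellJ c cf (\<lambda>p. F p + G p) = cellJ c cf F + cellJ c cf G"
 unfolding cellJ_def by (subst sum.distrib[symmetric]) (auto intro!: sum.cong)

lemma J_add_fun: "J cf (\<lambda>p. F p + G p) = J cf F + J cf G"
 unfolding J_def cellJ_add_fun by (rule suminf_add[symmetric]) auto

lemma J_cmult: "J cf (\<lambda>p. c * F p) = c * J cf F"
proof -
 have "cellJ k cf (\<lambda>p. c * F p) = c * cellJ k cf F" for k
  unfolding cellJ_def sum_distrib_left by (auto intro!: sum.cong)
 then show ?thesis unfolding J_def by simp
qed

text \<open>If an insertion where \<open>F\<close> lives does not affect \<open>G\<close>, then
  \<open>G\<close> and the sum of \<open>F\<close> over the atoms are uncorrelated: the source of the
  compensator and of orthogonal increments.\<close>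

lemma mecke_past:
 assumes G[measurable]: "G \<in> borel_measurable L" and F[measurable]: "F \<in> borel_measurable (borel \<Otimes>\<^sub>M borel)"
  and sym: "\<And>cf c i. i < fst (cf c) ==> G (swp c i cf) = G cf"
  and ad: "\<And>c. AE cf in L. AE p in point (snd c). F (tim c p) \<noteq> 0 \<longrightarrow> G (add c p cf) = G cf"
 shows "(\<integral>\<^sup>+cf. G cf * J cf F \<partial>L) = (\<integral>\<^sup>+cf. G cf \<partial>L) * (\<integral>\<^sup>+p. F p \<partial>levy_compensator \<Lambda>)"
proof -
 have F': "F \<in> borel_measurable (levy_compensator \<Lambda>)" using F by (simp cong: measurable_cong_sets add: sets_compensator)
 have "(\<integral>\<^sup>+cf. J cf (\<lambda>p. G cf * F p) \<partial>L) = (\<integral>\<^sup>+cf. \<integral>\<^sup>+p. G cf * F p \<partial>levy_compensator \<Lambda> \<partial>L)"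
 proof (rule mecke)
  fix c
  show "AE cf in L. AE p in point (snd c). snd p \<noteq> 0 \<longrightarrow> G (add c p cf) * F (tim c p) = G cf * F (tim c p)"
   using ad[of c] by eventually_elim (auto elim!: eventually_mono)
 qed (auto simp: sym)
 also have "\<dots> = (\<integral>\<^sup>+cf. G cf * (\<integral>\<^sup>+p. F p \<partial>levy_compensator \<Lambda>) \<partial>L)"
  by (intro nn_integral_cong nn_integral_cmult F')
 also have "\<dots> = (\<integral>\<^sup>+cf. G cf \<partial>L) * (\<integral>\<^sup>+p. F p \<partial>levy_compensator \<Lambda>)" by (rule nn_integral_multc) simp
 finally show ?thesis by (simp add: J_cmult)
qed

lemma J_mean:
 assumes F[measurable]: "F \<in> borel_measurable (borel \<Otimes>\<^sub>M borel)"
 shows "(\<integral>\<^sup>+cf. J cf F \<partial>L) = (\<integral>\<^sup>+p. F p \<partial>levy_compensator \<Lambda>)"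
 using mecke_past[of "\<lambda>_. 1" F] by (simp add: L.emeasure_space_1)

lemma J_second_moment:
 assumes F[measurable]: "F \<in> borel_measurable (borel \<Otimes>\<^sub>M borel)"
 shows "(\<integral>\<^sup>+cf. J cf F * J cf F \<partial>L) = (\<integral>\<^sup>+p. F p * F p \<partial>levy_compensator \<Lambda>) + (\<integral>\<^sup>+p. F p \<partial>levy_compensator \<Lambda>) * (\<integral>\<^sup>+p. F p \<partial>levy_compensator \<Lambda>)"
proof -
 have F': "F \<in> borel_measurable (levy_compensator \<Lambda>)" using F by (simp cong: measurable_cong_sets add: sets_compensator)
 have "(\<integral>\<^sup>+cf. J cf (\<lambda>p. J cf F * F p) \<partial>L) = (\<integral>\<^sup>+cf. \<integral>\<^sup>+p. (F p + J cf F) * F p \<partial>levy_compensator \<Lambda> \<partial>L)"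
 proof (rule mecke)
  show "(\<lambda>(p, cf). J cf F * F p) \<in> borel_measurable ((borel \<Otimes>\<^sub>M borel) \<Otimes>\<^sub>M L)"
   "(\<lambda>(p, cf). (F p + J cf F) * F p) \<in> borel_measurable ((borel \<Otimes>\<^sub>M borel) \<Otimes>\<^sub>M L)" by measurable
 qed (auto simp: J_swp J_add)
 also have "\<dots> = (\<integral>\<^sup>+cf. (\<integral>\<^sup>+p. F p * F p \<partial>levy_compensator \<Lambda>) + J cf F * (\<integral>\<^sup>+p. F p \<partial>levy_compensator \<Lambda>) \<partial>L)"
  using F' by (intro nn_integral_cong) (simp add: distrib_right nn_integral_add nn_integral_cmult)
 also have "\<dots> = (\<integral>\<^sup>+p. F p * F p \<partial>levy_compensator \<Lambda>) + (\<integral>\<^sup>+p. F p \<partial>levy_compensator \<Lambda>) * (\<integral>\<^sup>+p. F p \<partial>levy_compensator \<Lambda>)"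
  by (subst nn_integral_add) (auto simp: nn_integral_multc J_mean L.emeasure_space_1)
 finally show ?thesis by (simp add: J_cmult)
qed

end

section \<open>Compensated sums of jumps\<close>

text \<open>Split according to the first index at which \<open>c\<close> is exceeded. On each such event the
  hypothesis of orthogonality gives \<open>E Y n\<^sup>2 \<ge> E Y i\<^sup>2 \<ge> c\<^sup>2 P\<close>, a
  martingale argument without martingales.\<close>

lemma (in prob_space) kolmogorov_maximal:
 fixes Y :: "nat => 'a => real"
 assumes Y: "\<And>i. i \<le> n ==> Y i \<in> borel_measurable M" and Y2: "\<And>i. i \<le> n ==> integrable M (\<lambda>cf. (Y i cf)\<^sup>2)" and c: "0 < c"
  and orth: "\<And>i. i \<le> n ==> (LINT cf|M. indicator {cf. c < \<bar>Y i cf\<bar> \<and> (\<forall>j<i. \<bar>Y j cf\<bar> \<le> c)} cf * Y i cf * (Y n cf - Y i cf)) = 0"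
 shows "prob {cf\<in>space M. \<exists>i\<le>n. c < \<bar>Y i cf\<bar>} \<le> (LINT cf|M. (Y n cf)\<^sup>2) / c\<^sup>2"
proof -
 define A where "A i = {cf. c < \<bar>Y i cf\<bar> \<and> (\<forall>j<i. \<bar>Y j cf\<bar> \<le> c)}" for i
 have mA: "(\<lambda>cf. indicator (A i) cf :: real) \<in> borel_measurable M" if "i \<le> n" for i
 proof -
  have [measurable]: "j \<le> i ==> Y j \<in> borel_measurable M" for j using Y that by auto
  have "Measurable.pred M (\<lambda>cf. c < \<bar>Y i cf\<bar> \<and> (\<forall>j\<in>{..<i}. \<bar>Y j cf\<bar> \<le> c))"
   by (intro pred_intros_logic pred_intros_finite) (auto intro!: borel_measurable_le borel_measurable_less)
  then show ?thesis unfolding A_def indicator_def by (auto simp: Ball_def)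
 qed
 define E where "E = {cf\<in>space M. \<exists>i\<le>n. c < \<bar>Y i cf\<bar>}"
 have E: "E \<in> events"
 proof -
  have "E = (\<Union>i\<in>{..n}. {cf\<in>space M. c < \<bar>Y i cf\<bar>})" by (auto simp: E_def)
  moreover have "{cf\<in>space M. c < \<bar>Y i cf\<bar>} \<in> events" if "i \<le> n" for i using Y[OF that] by measurable
  ultimately show ?thesis by auto
 qed
 define W where "W i cf = indicator (A i) cf * Y i cf * (Y n cf - Y i cf)" for i cf
 have Wi: "integrable M (W i)" if i: "i \<le> n" for i
 proof (rule Bochner_Integration.integrable_bound)
  show "integrable M (\<lambda>cf. 2 * (Y i cf)\<^sup>2 + (Y n cf)\<^sup>2)" using Y2 i by auto
  show "W i \<in> borel_measurable M" unfolding W_def using mA[OF i] Y[OF i] Y[of n] by measurable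
  show "AE cf in M. norm (W i cf) \<le> norm (2 * (Y i cf)\<^sup>2 + (Y n cf)\<^sup>2)"
  proof (intro AE_I2)
   fix cf
   have "\<bar>y * (x - y)\<bar> \<le> 2 * y\<^sup>2 + x\<^sup>2" for x y :: real
   proof -
    have "0 \<le> (x - y)\<^sup>2" "0 \<le> (x + y)\<^sup>2" "0 \<le> x\<^sup>2" "0 \<le> y\<^sup>2" by auto
    then have "2 * \<bar>x * y\<bar> \<le> x\<^sup>2 + y\<^sup>2" by (auto simp: abs_if power2_eq_square algebra_simps)
    moreover have "\<bar>y * (x - y)\<bar> \<le> \<bar>x * y\<bar> + y\<^sup>2"
     using abs_triangle_ineq4[of "x * y" "y\<^sup>2"] by (simp add: power2_eq_square algebra_simps)
    ultimately show ?thesis using \<open>0 \<le> x\<^sup>2\<close> \<open>0 \<le> y\<^sup>2\<close> by linarith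
   qed
   from this[of "Y i cf" "Y n cf"] show "norm (W i cf) \<le> norm (2 * (Y i cf)\<^sup>2 + (Y n cf)\<^sup>2)"
    by (auto simp: W_def indicator_def)
  qed
 qed
 have pw: "c\<^sup>2 * indicator E cf + (\<Sum>i\<le>n. 2 * W i cf) \<le> (Y n cf)\<^sup>2" if w: "cf \<in> space M" for cf
 proof (cases "\<exists>i\<le>n. c < \<bar>Y i cf\<bar>")
  case True
  define i where "i = (LEAST i. c < \<bar>Y i cf\<bar>)"
  have i1: "c < \<bar>Y i cf\<bar>" unfolding i_def using True by (auto intro: LeastI)
  have i2: "\<bar>Y j cf\<bar> \<le> c" if "j < i" for j using not_less_Least[of j "\<lambda>i. c < \<bar>Y i cf\<bar>"] that by (auto simp: i_def)
  have i3: "i \<le> n" using True Least_le[of "\<lambda>i. c < \<bar>Y i cf\<bar>"] unfolding i_def by (meson order_trans)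
  have un: "cf \<in> A j \<longleftrightarrow> j = i" for j
  proof
   assume j: "cf \<in> A j"
   show "j = i"
    by (rule linorder_cases[of i j]) (use j i1 i2[of j] in \<open>auto simp: A_def\<close>)
  qed (use i1 i2 in \<open>auto simp: A_def\<close>)
  have "(\<Sum>j\<le>n. 2 * W j cf) = (\<Sum>j\<in>{i}. 2 * W j cf)"
   using i3 un by (intro sum.mono_neutral_right) (auto simp: W_def)
  also have "\<dots> = 2 * (Y i cf * (Y n cf - Y i cf))" using un by (simp add: W_def)
  finally have s: "(\<Sum>j\<le>n. 2 * W j cf) = 2 * (Y i cf * (Y n cf - Y i cf))" .
  have "c\<^sup>2 \<le> \<bar>Y i cf\<bar>\<^sup>2" using i1 c by (intro power_mono) auto
  moreover have "0 \<le> (Y n cf - Y i cf)\<^sup>2" by simp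
  ultimately have "c\<^sup>2 + 2 * (Y i cf * (Y n cf - Y i cf)) \<le> (Y n cf)\<^sup>2"
   by (simp add: power2_eq_square algebra_simps)
  then show ?thesis unfolding s using True w by (simp add: E_def)
 next
  case False
  then have "W i cf = 0" if "i \<le> n" for i using that by (auto simp: W_def A_def indicator_def)
  moreover have "cf \<notin> E" using False by (simp add: E_def)
  ultimately show ?thesis by simp
 qed
 have "(LINT cf|M. c\<^sup>2 * indicator E cf + (\<Sum>i\<le>n. 2 * W i cf)) \<le> (LINT cf|M. (Y n cf)\<^sup>2)"
  using pw E Wi Y2[of n] by (intro integral_mono) (auto intro!: Bochner_Integration.integrable_sum Bochner_Integration.integrable_add integrable_mult_right integrable_real_indicator simp: emeasure_eq_measure)
 also have "(LINT cf|M. c\<^sup>2 * indicator E cf + (\<Sum>i\<le>n. 2 * W i cf)) = c\<^sup>2 * prob E + (\<Sum>i\<le>n. 2 * (LINT cf|M. W i cf))"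
  using E Wi by (subst Bochner_Integration.integral_add) (auto intro!: Bochner_Integration.integrable_sum integrable_real_indicator simp: emeasure_eq_measure Bochner_Integration.integral_sum)
 also have "(\<Sum>i\<le>n. 2 * (LINT cf|M. W i cf)) = 0"
  using orth unfolding W_def A_def by (intro sum.neutral) auto
 finally show ?thesis using c unfolding E_def[symmetric] by (simp add: field_simps)
qed

lemma (in prob_space) second_moment_enn2real:
 fixes Y :: "'a => ennreal"
 assumes Y[measurable]: "Y \<in> borel_measurable M" and a: "(\<integral>\<^sup>+cf. Y cf \<partial>M) = ennreal a" "0 \<le> a"
  and b: "(\<integral>\<^sup>+cf. Y cf * Y cf \<partial>M) = ennreal b" "0 \<le> b"
 shows "integrable M (\<lambda>cf. enn2real (Y cf))" "integrable M (\<lambda>cf. (enn2real (Y cf) - a)\<^sup>2)"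
  "(LINT cf|M. (enn2real (Y cf) - a)\<^sup>2) = b - a\<^sup>2"
proof -
 have "AE cf in M. Y cf \<noteq> \<infinity>" by (rule nn_integral_PInf_AE) (simp_all add: a)
 then have fin: "AE cf in M. Y cf = ennreal (enn2real (Y cf))"
  by eventually_elim (simp add: less_top)
 have "(\<integral>\<^sup>+cf. ennreal (enn2real (Y cf)) \<partial>M) = ennreal a"
  unfolding a(1)[symmetric] using fin by (intro nn_integral_cong_AE) (auto elim: eventually_mono)
 then have i1: "integrable M (\<lambda>cf. enn2real (Y cf))" and e1: "(LINT cf|M. enn2real (Y cf)) = a"
  using nn_integral_eq_integrable[of "\<lambda>cf. enn2real (Y cf)" M a] a by auto
 have "(\<integral>\<^sup>+cf. ennreal ((enn2real (Y cf))\<^sup>2) \<partial>M) = ennreal b"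
  unfolding b(1)[symmetric] using fin
  by (intro nn_integral_cong_AE) (auto elim!: eventually_mono simp: power2_eq_square ennreal_mult)
 then have i2: "integrable M (\<lambda>cf. (enn2real (Y cf))\<^sup>2)" and e2: "(LINT cf|M. (enn2real (Y cf))\<^sup>2) = b"
  using nn_integral_eq_integrable[of "\<lambda>cf. (enn2real (Y cf))\<^sup>2" M b] b by auto
 have eq: "(enn2real (Y cf) - a)\<^sup>2 = (enn2real (Y cf))\<^sup>2 - 2 * a * enn2real (Y cf) + a\<^sup>2" for cf
  by (simp add: power2_eq_square algebra_simps)
 show "integrable M (\<lambda>cf. enn2real (Y cf))" by fact
 show "integrable M (\<lambda>cf. (enn2real (Y cf) - a)\<^sup>2)" unfolding eq using i1 i2 by auto
 show "(LINT cf|M. (enn2real (Y cf) - a)\<^sup>2) = b - a\<^sup>2"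
  unfolding eq using i1 i2 e1 e2 by (simp add: prob_space power2_eq_square)
qed

context levy_cells begin

definition seg :: "real => real => (real => real) => real \<times> real => ennreal" where
 "seg a b f p = indicator {a<..b} (fst p) * ennreal (f (snd p))"

lemma measurable_seg[measurable]:
 assumes [measurable]: "f \<in> borel_measurable borel"
 shows "seg a b f \<in> borel_measurable (borel \<Otimes>\<^sub>M borel)"
 unfolding seg_def[abs_def] by measurable

lemma compensator_seg:
 assumes f[measurable]: "f \<in> borel_measurable borel" and ab: "0 \<le> a" "a \<le> b"
 shows "(\<integral>\<^sup>+p. seg a b f p \<partial>levy_compensator \<Lambda>) = ennreal (b - a) * (\<integral>\<^sup>+x. ennreal (f x) \<partial>\<Lambda>)"
proof -
 have "(\<integral>\<^sup>+p. seg a b f p \<partial>levy_compensator \<Lambda>) = (\<integral>\<^sup>+s. indicator {0<..} s * (\<integral>\<^sup>+x. seg a b f (s, x) \<partial>\<Lambda>) \<partial>lborel)"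
  by (rule nn_integral_compensator) simp
 also have "\<dots> = (\<integral>\<^sup>+s. (\<integral>\<^sup>+x. ennreal (f x) \<partial>\<Lambda>) * indicator {a<..b} s \<partial>lborel)"
 proof (rule nn_integral_cong)
  fix s :: real
  have m: "(\<lambda>x. ennreal (f x)) \<in> borel_measurable \<Lambda>" by (rule measurable_to_\<Lambda>) simp
  show "indicator {0<..} s * (\<integral>\<^sup>+x. seg a b f (s, x) \<partial>\<Lambda>) = (\<integral>\<^sup>+x. ennreal (f x) \<partial>\<Lambda>) * indicator {a<..b} s"
   using ab by (cases "s \<in> {a<..b}") (auto simp: seg_def)
 qed
 also have "\<dots> = ennreal (b - a) * (\<integral>\<^sup>+x. ennreal (f x) \<partial>\<Lambda>)"
  using ab by (subst nn_integral_cmult) (auto simp: mult.commute)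
 finally show ?thesis .
qed

lemma seg_sq: "(\<And>x. 0 \<le> f x) ==> seg a b f p * seg a b f p = seg a b (\<lambda>x. (f x)\<^sup>2) p"
 by (auto simp: seg_def indicator_def power2_eq_square ennreal_mult)

lemma seg_split: "a \<le> s ==> s \<le> b ==> seg a b f p = seg a s f p + seg s b f p"
 by (auto simp: seg_def indicator_def)

text \<open>The compensated sum of \<open>f\<close> over the jumps up to time \<open>t\<close>, where
  \<open>m\<close> will be the integral of \<open>f\<close> against the Levy measure. Integrals of extended
  nonnegative functions are used throughout; signed sums are differences of two of these.\<close>

definition cpt :: "(real => real) => real => real => config => real" where
 "cpt f m t cf = enn2real (J cf (seg 0 t f)) - t * m"

lemma measurable_cpt[measurable]:
 assumes [measurable]: "f \<in> borel_measurable borel"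
 shows "cpt f m t \<in> borel_measurable L"
 unfolding cpt_def by measurable

lemma cpt_swp: "i < fst (cf c) ==> cpt f m t (swp c i cf) = cpt f m t cf"
 by (simp add: cpt_def J_swp)

lemma cpt_add: "t < fst (tim c p) ==> cpt f m t (add c p cf) = cpt f m t cf"
 by (simp add: cpt_def J_add seg_def)

context
 fixes f :: "real => real" and m v :: real
 assumes f[measurable]: "f \<in> borel_measurable borel" and f0: "\<And>x. 0 \<le> f x"
  and m: "(\<integral>\<^sup>+x. ennreal (f x) \<partial>\<Lambda>) = ennreal m" "0 \<le> m"
  and v: "(\<integral>\<^sup>+x. ennreal ((f x)\<^sup>2) \<partial>\<Lambda>) = ennreal v" "0 \<le> v"
begin

lemma J_seg_finite: "0 \<le> a ==> a \<le> b ==> AE cf in L. J cf (seg a b f) \<noteq> \<infinity>"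
proof (rule nn_integral_PInf_AE)
 assume ab: "0 \<le> a" "a \<le> b"
 show "(\<integral>\<^sup>+cf. J cf (seg a b f) \<partial>L) \<noteq> \<infinity>"
  using ab by (simp add: J_mean compensator_seg m ennreal_mult_eq_top_iff)
qed simp

lemma cpt_moments:
 assumes t: "0 \<le> t"
 shows "integrable L (cpt f m t)" "integrable L (\<lambda>cf. (cpt f m t cf)\<^sup>2)" "(LINT cf|L. (cpt f m t cf)\<^sup>2) = t * v"
proof -
 have 1: "(\<integral>\<^sup>+cf. J cf (seg 0 t f) \<partial>L) = ennreal (t * m)"
  using t m by (simp add: J_mean compensator_seg ennreal_mult)
 have 2: "(\<integral>\<^sup>+cf. J cf (seg 0 t f) * J cf (seg 0 t f) \<partial>L) = ennreal (t * v + (t * m)\<^sup>2)"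
  using t m v by (simp add: J_second_moment seg_sq[OF f0] compensator_seg ennreal_mult ennreal_plus power2_eq_square mult_ac)
 have ge: "0 \<le> t * m" "0 \<le> t * v + (t * m)\<^sup>2" using t m v by auto
 note * = L.second_moment_enn2real[OF measurable_J'[OF measurable_seg[OF f]] 1 ge(1) 2 ge(2)]
 show "integrable L (cpt f m t)" unfolding cpt_def using *(1) by auto
 show "integrable L (\<lambda>cf. (cpt f m t cf)\<^sup>2)" unfolding cpt_def by (rule *(2))
 show "(LINT cf|L. (cpt f m t cf)\<^sup>2) = t * v" unfolding cpt_def using *(3) by simp
qed

lemma cpt_orthogonal:
 assumes st: "0 \<le> s" "s \<le> t" and X[measurable]: "X \<in> borel_measurable L" and Xi: "integrable L X"
  and sym: "\<And>cf c i. i < fst (cf c) ==> X (swp c i cf) = X cf"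
  and ad: "\<And>cf c p. s < fst (tim c p) ==> X (add c p cf) = X cf"
 shows "(LINT cf|L. X cf * (cpt f m t cf - cpt f m s cf)) = (0::real)"
proof -
 define d where "d cf = enn2real (J cf (seg s t f))" for cf
 have d[measurable]: "d \<in> borel_measurable L" unfolding d_def by measurable
 have pos: "integrable L (\<lambda>cf. G cf * d cf) \<and> (LINT cf|L. G cf * d cf) = (LINT cf|L. G cf) * ((t - s) * m)"
  if G[measurable]: "G \<in> borel_measurable L" and Gi: "integrable L G" and G0: "\<And>cf. 0 \<le> G cf"
  and symG: "\<And>cf c i. i < fst (cf c) ==> G (swp c i cf) = G cf"
  and adG: "\<And>cf c p. s < fst (tim c p) ==> G (add c p cf) = G cf" for G :: "_ => real"
 proof -
  have "(\<integral>\<^sup>+cf. ennreal (G cf * d cf) \<partial>L) = (\<integral>\<^sup>+cf. ennreal (G cf) * J cf (seg s t f) \<partial>L)"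
  proof (rule nn_integral_cong_AE)
   show "AE cf in L. ennreal (G cf * d cf) = ennreal (G cf) * J cf (seg s t f)"
    using J_seg_finite[OF st] by eventually_elim (simp add: d_def ennreal_mult G0 less_top)
  qed
  also have "\<dots> = (\<integral>\<^sup>+cf. ennreal (G cf) \<partial>L) * (\<integral>\<^sup>+p. seg s t f p \<partial>levy_compensator \<Lambda>)"
  proof (rule mecke_past)
   fix c
   show "AE cf in L. AE p in point (snd c). seg s t f (tim c p) \<noteq> 0 \<longrightarrow> ennreal (G (add c p cf)) = ennreal (G cf)"
   proof (intro AE_I2 impI)
    fix cf p assume "seg s t f (tim c p) \<noteq> 0"
    then have "s < fst (tim c p)" by (auto simp: seg_def indicator_def split: if_splits)
    then show "ennreal (G (add c p cf)) = ennreal (G cf)" by (simp add: adG)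
   qed
  qed (auto simp: symG)
  also have "\<dots> = ennreal (LINT cf|L. G cf) * ennreal ((t - s) * m)"
   using st m G0 by (simp add: compensator_seg ennreal_mult nn_integral_eq_integral[OF Gi])
  also have "\<dots> = ennreal ((LINT cf|L. G cf) * ((t - s) * m))"
   using st m G0 by (intro ennreal_mult[symmetric]) (auto intro!: integral_nonneg_AE)
  finally have eq: "(\<integral>\<^sup>+cf. ennreal (G cf * d cf) \<partial>L) = ennreal ((LINT cf|L. G cf) * ((t - s) * m))" .
  have nn: "0 \<le> (LINT cf|L. G cf) * ((t - s) * m)" using st m G0 by (auto intro!: mult_nonneg_nonneg integral_nonneg_AE)
  have "AE cf in L. 0 \<le> G cf * d cf" using G0 by (auto simp: d_def)
  from nn_integral_eq_integrable[OF _ this nn] eq show ?thesis by auto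
 qed
 have Xp: "integrable L (\<lambda>cf. max 0 (X cf))" "integrable L (\<lambda>cf. max 0 (- X cf))" using Xi by auto
 have p: "integrable L (\<lambda>cf. max 0 (X cf) * d cf) \<and> (LINT cf|L. max 0 (X cf) * d cf) = (LINT cf|L. max 0 (X cf)) * ((t - s) * m)"
  by (rule pos) (auto simp: Xp sym ad)
 have n: "integrable L (\<lambda>cf. max 0 (- X cf) * d cf) \<and> (LINT cf|L. max 0 (- X cf) * d cf) = (LINT cf|L. max 0 (- X cf)) * ((t - s) * m)"
  by (rule pos) (auto simp: Xp sym ad)
 have "(LINT cf|L. X cf * (cpt f m t cf - cpt f m s cf)) = (LINT cf|L. (max 0 (X cf) * d cf - max 0 (- X cf) * d cf) - (t - s) * m * (max 0 (X cf) - max 0 (- X cf)))"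
 proof (rule integral_cong_AE)
  show "AE cf in L. X cf * (cpt f m t cf - cpt f m s cf) = (max 0 (X cf) * d cf - max 0 (- X cf) * d cf) - (t - s) * m * (max 0 (X cf) - max 0 (- X cf))"
   using J_seg_finite[OF st] J_seg_finite[OF order_refl st(1)]
  proof eventually_elim
   case (elim cf)
   have "J cf (seg 0 t f) = J cf (seg 0 s f) + J cf (seg s t f)"
    unfolding J_add_fun[symmetric] using seg_split[OF st, of f] by metis
   then have e: "cpt f m t cf - cpt f m s cf = d cf - (t - s) * m"
    using elim by (simp add: cpt_def d_def enn2real_plus less_top algebra_simps)
   have "X cf = max 0 (X cf) - max 0 (- X cf)" by auto
   then show ?case unfolding e by (smt (verit) left_diff_distrib right_diff_distrib mult.commute)
  qed
 qed measurable
 also have "\<dots> = 0" using p n Xp by (simp add: algebra_simps)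
 finally show ?thesis .
qed

lemma cpt_maximal_finite:
 assumes R: "finite R" "R \<subseteq> {0..T}" and T: "0 \<le> T" and c: "0 < c"
 shows "measure L {cf\<in>space L. \<exists>r\<in>R. c < \<bar>cpt f m r cf\<bar>} \<le> T * v / c\<^sup>2"
proof (cases "R = {}")
 case False
 define l where "l = sorted_list_of_set R"
 have l: "sorted l" "set l = R" "l \<noteq> []" using R False by (auto simp: l_def)
 define n where "n = length l - 1"
 have n: "i < length l \<longleftrightarrow> i \<le> n" for i using l by (cases l) (auto simp: n_def)
 have r: "l ! i \<in> {0..T}" if "i \<le> n" for i using that n R l nth_mem by blast
 have so: "l ! i \<le> l ! j" if "i \<le> j" "j \<le> n" for i j using sorted_nth_mono[OF l(1)] that n by auto
 define Y where "Y i = cpt f m (l ! i)" for i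
 have mY: "Y i \<in> borel_measurable L" for i unfolding Y_def by simp
 have "L.prob {cf\<in>space L. \<exists>i\<le>n. c < \<bar>Y i cf\<bar>} \<le> (LINT cf|L. (Y n cf)\<^sup>2) / c\<^sup>2"
 proof (rule L.kolmogorov_maximal[OF mY _ c])
  show "integrable L (\<lambda>cf. (Y i cf)\<^sup>2)" if "i \<le> n" for i using r[OF that] cpt_moments(2)[of "l ! i"] by (simp add: Y_def)
  fix i assume i: "i \<le> n"
  define A where "A = {cf. c < \<bar>Y i cf\<bar> \<and> (\<forall>j<i. \<bar>Y j cf\<bar> \<le> c)}"
  define X where "X cf = indicator A cf * Y i cf" for cf
  have "Measurable.pred L (\<lambda>cf. c < \<bar>Y i cf\<bar> \<and> (\<forall>j\<in>{..<i}. \<bar>Y j cf\<bar> \<le> c))"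
   using mY by (intro pred_intros_logic pred_intros_finite) (auto intro!: borel_measurable_le borel_measurable_less)
  then have mA: "(\<lambda>cf. indicator A cf :: real) \<in> borel_measurable L" unfolding A_def indicator_def by (auto simp: Ball_def)
  have mX: "X \<in> borel_measurable L" unfolding X_def using mA mY by measurable
  have "(LINT cf|L. X cf * (cpt f m (l ! n) cf - cpt f m (l ! i) cf)) = 0"
  proof (rule cpt_orthogonal[OF _ _ mX])
   show "0 \<le> l ! i" "l ! i \<le> l ! n" using r[OF i] so[OF i] by auto
   show "integrable L X"
   proof (rule Bochner_Integration.integrable_bound[of _ "Y i"])
    show "integrable L (Y i)" unfolding Y_def using r[OF i] cpt_moments(1)[of "l ! i"] by simp
   qed (auto simp: mX X_def indicator_def)
   show "X (swp c' k cf) = X cf" if "k < fst (cf c')" for cf c' k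
    using that by (simp add: X_def A_def Y_def cpt_swp indicator_def)
   show "X (add c' p cf) = X cf" if p: "l ! i < fst (tim c' p)" for cf c' p
   proof -
    have "Y j (add c' p cf) = Y j cf" if "j \<le> i" for j
     unfolding Y_def using so[OF that i] p by (intro cpt_add) auto
    then show ?thesis by (simp add: X_def A_def indicator_def)
   qed
  qed
  then show "(LINT cf|L. indicator {cf. c < \<bar>Y i cf\<bar> \<and> (\<forall>j<i. \<bar>Y j cf\<bar> \<le> c)} cf * Y i cf * (Y n cf - Y i cf)) = 0"
   by (simp add: X_def A_def Y_def)
 qed
 also have "(LINT cf|L. (Y n cf)\<^sup>2) / c\<^sup>2 \<le> T * v / c\<^sup>2"
  using r[of n] v unfolding Y_def by (subst cpt_moments(3)) (auto intro!: divide_right_mono mult_right_mono)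
 also have "{cf\<in>space L. \<exists>i\<le>n. c < \<bar>Y i cf\<bar>} = {cf\<in>space L. \<exists>r\<in>R. c < \<bar>cpt f m r cf\<bar>}"
 proof -
  have "(\<exists>i\<le>n. c < \<bar>Y i cf\<bar>) \<longleftrightarrow> (\<exists>r\<in>R. c < \<bar>cpt f m r cf\<bar>)" for cf
   unfolding Y_def l(2)[symmetric] by (metis in_set_conv_nth n)
  then show ?thesis by simp
 qed
 finally show ?thesis .
next
 case True
 then show ?thesis using v c T by (auto simp: R)
qed

text \<open>Applied with the rational times, this controls whole paths.\<close>

lemma cpt_maximal:
 assumes R: "countable R" "R \<subseteq> {0..T}" and T: "0 \<le> T" and c: "0 < c"
 shows "measure L {cf\<in>space L. \<exists>r\<in>R. c < \<bar>cpt f m r cf\<bar>} \<le> T * v / c\<^sup>2"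
proof (cases "R = {}")
 case False
 define A where "A n = {cf\<in>space L. \<exists>r\<in>from_nat_into R ` {..n}. c < \<bar>cpt f m r cf\<bar>}" for n :: nat
 have UA: "(\<Union>n. A n) = {cf\<in>space L. \<exists>r\<in>R. c < \<bar>cpt f m r cf\<bar>}"
 proof (intro equalityI subsetI)
  fix cf assume "cf \<in> (\<Union>n. A n)"
  then obtain j where "cf \<in> space L" "c < \<bar>cpt f m (from_nat_into R j) cf\<bar>" unfolding A_def by blast
  then show "cf \<in> {cf\<in>space L. \<exists>r\<in>R. c < \<bar>cpt f m r cf\<bar>}" using from_nat_into[OF False, of j] by blast
 next
  fix cf assume "cf \<in> {cf\<in>space L. \<exists>r\<in>R. c < \<bar>cpt f m r cf\<bar>}"
  then obtain r where r: "cf \<in> space L" "r \<in> R" "c < \<bar>cpt f m r cf\<bar>" by blast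
  obtain j where "from_nat_into R j = r" using from_nat_into_surj[OF R(1) r(2)] by blast
  with r have "cf \<in> A j" unfolding A_def by blast
  then show "cf \<in> (\<Union>n. A n)" by blast
 qed
 have "A n = (\<Union>r\<in>from_nat_into R ` {..n}. {cf\<in>space L. c < \<bar>cpt f m r cf\<bar>})" for n by (auto simp: A_def)
 then have mA: "range A \<subseteq> sets L" by auto
 have "incseq A"
 proof (rule incseq_SucI)
  fix n
  have "from_nat_into R ` {..n} \<subseteq> from_nat_into R ` {..Suc n}" by (intro image_mono) auto
  then show "A n \<le> A (Suc n)" unfolding A_def by blast
 qed
 from L.finite_Lim_measure_incseq[OF mA this] have "(\<lambda>n. measure L (A n)) \<longlonglongrightarrow> measure L (\<Union>n. A n)" .
 moreover have "measure L (A n) \<le> T * v / c\<^sup>2" for n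
  unfolding A_def by (rule cpt_maximal_finite) (use from_nat_into[OF False] R c T in auto)
 ultimately show ?thesis unfolding UA by (intro LIMSEQ_le_const2) auto
qed (use v T in auto)

end

text \<open>Points beyond the count of their cell and phantom atoms are inactive.\<close>

definition act :: "config => ((nat \<times> nat) \<times> nat) set" where
 "act cf = {q. snd q < fst (cf (fst q)) \<and> snd (snd (cf (fst q)) (snd q)) \<noteq> 0}"

definition pos :: "config => (nat \<times> nat) \<times> nat => real \<times> real" where
 "pos cf q = tim (fst q) (snd (cf (fst q)) (snd q))"

lemma act_nonzero: "q \<in> act cf ==> snd (pos cf q) \<noteq> 0" by (simp add: act_def pos_def tim_def)

lemma J_eq_sum_active: "J cf F = (\<integral>\<^sup>+q. F (pos cf q) \<partial>count_space (act cf))"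
proof -
 let ?f = "\<lambda>q. if q \<in> act cf then F (pos cf q) else 0"
 have "J cf F = (\<integral>\<^sup>+n. cellJ (prod_decode n) cf F \<partial>count_space UNIV)"
  unfolding J_def by (rule nn_integral_count_space_nat[symmetric])
 also have "\<dots> = (\<integral>\<^sup>+c. cellJ c cf F \<partial>count_space UNIV)"
  by (rule nn_integral_bij_count_space[OF bij_prod_decode, of "\<lambda>c. cellJ c cf F"])
 also have "\<dots> = (\<integral>\<^sup>+c. \<integral>\<^sup>+i. ?f (c, i) \<partial>count_space UNIV \<partial>count_space UNIV)"
 proof (rule nn_integral_cong)
  fix c
  have "(\<integral>\<^sup>+i. ?f (c, i) \<partial>count_space UNIV) = (\<Sum>i<fst (cf c). ?f (c, i))"
   by (rule nn_integral_count_space') (auto simp: act_def)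
  then show "cellJ c cf F = (\<integral>\<^sup>+i. ?f (c, i) \<partial>count_space UNIV)"
   by (auto simp: cellJ_def act_def pos_def intro!: sum.cong)
 qed
 also have "\<dots> = (\<integral>\<^sup>+q. ?f q \<partial>count_space UNIV)" by (rule nn_integral_fst_count_space)
 also have "\<dots> = (\<integral>\<^sup>+q. F (pos cf q) \<partial>count_space (act cf))"
 proof -
  have "(\<integral>\<^sup>+q. F (pos cf q) \<partial>count_space (act cf)) = (\<integral>\<^sup>+q. ?f q \<partial>count_space (act cf))"
   by (intro nn_integral_cong) simp
  also have "\<dots> = (\<integral>\<^sup>+q. ?f q \<partial>count_space UNIV)"
   by (rule nn_integral_count_space_eq) auto
  finally show ?thesis by simp
 qed
 finally show ?thesis .
qed

definition big :: "nat => nat => real \<times> real => ennreal" where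
 "big n K p = indicator {0<..real n} (fst p) * indicator {x. e K < \<bar>x\<bar>} (snd p)"

lemma measurable_big[measurable]: "big n K \<in> borel_measurable (borel \<Otimes>\<^sub>M borel)"
proof -
 have [measurable]: "{x. e K < \<bar>x\<bar>} \<in> sets borel" by simp
 show ?thesis unfolding big_def[abs_def] by measurable
qed

definition actK :: "nat => nat => config => ((nat \<times> nat) \<times> nat) set" where
 "actK n K cf = {q\<in>act cf. 0 < fst (pos cf q) \<and> fst (pos cf q) \<le> real n \<and> e K < \<bar>snd (pos cf q)\<bar>}"

text \<open>Finitely many jumps larger than \<open>e K\<close> on bounded time intervals.\<close>

definition locfin :: "config => bool" where
 "locfin cf \<longleftrightarrow> (\<forall>n K. J cf (big n K) < \<top>)"

lemma pred_locfin[measurable]: "Measurable.pred L locfin"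
 unfolding locfin_def[abs_def] by measurable

lemma finite_actK: "locfin cf ==> finite (actK n K cf)"
proof -
 assume "locfin cf"
 hence f: "J cf (big n K) < \<top>" by (simp add: locfin_def)
 have "J cf (big n K) = (\<integral>\<^sup>+q. indicator (actK n K cf) q \<partial>count_space (act cf))"
  unfolding J_eq_sum_active by (intro nn_integral_cong) (auto simp: big_def actK_def indicator_def)
 also have "\<dots> = emeasure (count_space (act cf)) (actK n K cf)"
  by (rule nn_integral_indicator) (auto simp: actK_def)
 finally have "emeasure (count_space (act cf)) (actK n K cf) < \<top>" using f by simp
 moreover have "actK n K cf \<subseteq> act cf" by (auto simp: actK_def)
 ultimately show ?thesis using emeasure_count_space_infinite[of "actK n K cf" "act cf"] by (metis infinity_ennreal_def less_irrefl)
qed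

lemma AE_locfin: "AE cf in L. locfin cf"
proof -
 have "AE cf in L. J cf (big n K) \<noteq> \<infinity>" for n K
 proof (rule nn_integral_PInf_AE)
  have [measurable]: "{x. e K < \<bar>x\<bar>} \<in> sets borel" by simp
  have b: "big n K = seg 0 (real n) (indicat_real {x. e K < \<bar>x\<bar>})"
   by (auto simp: big_def seg_def fun_eq_iff indicator_def)
  have "(\<integral>\<^sup>+x. ennreal (indicat_real {x. e K < \<bar>x\<bar>} x) \<partial>\<Lambda>) = emeasure \<Lambda> {x. e K < \<bar>x\<bar>}"
   by (simp add: ennreal_indicator sets_\<Lambda>)
  also have "\<dots> < \<top>" using tail_finite[OF e_pos, of K] by (rule le_less_trans) simp
  finally have "(\<integral>\<^sup>+cf. J cf (big n K) \<partial>L) < \<infinity>"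
   unfolding b by (simp add: J_mean compensator_seg ennreal_mult_less_top)
  then show "(\<integral>\<^sup>+cf. J cf (big n K) \<partial>L) \<noteq> \<infinity>" by simp
 qed simp
 hence "AE cf in L. \<forall>n K. J cf (big n K) \<noteq> \<infinity>" by (simp add: AE_all_countable)
 then show ?thesis by eventually_elim (simp add: locfin_def less_top)
qed

lemma J_finite_sum:
 assumes lf: "locfin cf" and t: "t \<le> real n" and f0: "\<And>x. 0 \<le> f x" and fz: "\<And>x. \<bar>x\<bar> \<le> e K ==> f x = 0"
 shows "J cf (seg 0 t f) = ennreal (\<Sum>q\<in>actK n K cf. indicator {0<..t} (fst (pos cf q)) * f (snd (pos cf q)))"
proof -
 have "J cf (seg 0 t f) = (\<Sum>q\<in>actK n K cf. seg 0 t f (pos cf q))"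
  unfolding J_eq_sum_active
 proof (rule nn_integral_count_space'[OF finite_actK[OF lf]])
  fix q assume "q \<in> act cf" "q \<notin> actK n K cf"
  then show "seg 0 t f (pos cf q) = 0" using t fz[of "snd (pos cf q)"] by (auto simp: actK_def seg_def indicator_def)
 qed (auto simp: actK_def)
 also have "\<dots> = ennreal (\<Sum>q\<in>actK n K cf. indicator {0<..t} (fst (pos cf q)) * f (snd (pos cf q)))"
  by (subst sum_ennreal[symmetric]) (auto simp: seg_def f0 ennreal_mult ennreal_indicator intro!: sum.cong)
 finally show ?thesis .
qed

lemma cpt_finite_sum:
 assumes lf: "locfin cf" and t: "t \<le> real n" and f0: "\<And>x. 0 \<le> f x" and fz: "\<And>x. \<bar>x\<bar> \<le> e K ==> f x = 0"
 shows "cpt f m t cf = (\<Sum>q\<in>actK n K cf. indicator {0<..t} (fst (pos cf q)) * f (snd (pos cf q))) - t * m"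
proof -
 have "J cf (seg 0 t f) = ennreal (\<Sum>q\<in>actK n K cf. indicator {0<..t} (fst (pos cf q)) * f (snd (pos cf q)))"
  by (rule J_finite_sum[OF lf t f0 fz])
 then show ?thesis by (simp add: cpt_def f0 sum_nonneg)
qed

text \<open>The part of the jump size of sign \<open>\<sigma>\<close>, restricted to jumps larger than
  \<open>e K\<close> here and to a single band in the next definition.\<close>

definition fs :: "real => nat => real => real" where
 "fs \<sigma> K x = (if e K < \<bar>x\<bar> then max 0 (\<sigma> * x) else 0)"
definition gs :: "real => nat => real => real" where
 "gs \<sigma> K x = (if e (Suc K) < \<bar>x\<bar> \<and> \<bar>x\<bar> \<le> e K then max 0 (\<sigma> * x) else 0)"
definition Ms :: "real => nat => real" where "Ms \<sigma> K = enn2real (\<integral>\<^sup>+x. ennreal (fs \<sigma> K x) \<partial>\<Lambda>)"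
definition Mg :: "real => nat => real" where "Mg \<sigma> K = enn2real (\<integral>\<^sup>+x. ennreal (gs \<sigma> K x) \<partial>\<Lambda>)"

lemma measurable_fs[measurable]: "fs \<sigma> K \<in> borel_measurable borel" unfolding fs_def[abs_def] by measurable
lemma measurable_gs[measurable]: "gs \<sigma> K \<in> borel_measurable borel" unfolding gs_def[abs_def] by measurable
lemma fs_nonneg: "0 \<le> fs \<sigma> K x" and gs_nonneg: "0 \<le> gs \<sigma> K x" by (auto simp: fs_def gs_def)
lemma fs_Suc: "fs \<sigma> (Suc K) x = fs \<sigma> K x + gs \<sigma> K x"
 using e_dec[of K] by (auto simp: fs_def gs_def)

lemma tail_first_moment:
 assumes f: "f \<in> borel_measurable borel" and fb: "\<And>x. f x \<le> \<bar>x\<bar>" and fz: "\<And>x. \<bar>x\<bar> \<le> \<epsilon> ==> f x = 0" and \<epsilon>: "0 < \<epsilon>"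
 shows "(\<integral>\<^sup>+x. ennreal (f x) \<partial>\<Lambda>) < \<top>"
proof -
 have "(\<integral>\<^sup>+x. ennreal (f x) \<partial>\<Lambda>) \<le> (\<integral>\<^sup>+x. ennreal (1 / \<epsilon>) * ennreal (x\<^sup>2) \<partial>\<Lambda>)"
 proof (rule nn_integral_mono)
  fix x
  have "f x \<le> 1 / \<epsilon> * x\<^sup>2"
  proof (cases "\<bar>x\<bar> \<le> \<epsilon>")
   case True then show ?thesis using fz[OF True] \<epsilon> by simp
  next
   case False
   have "\<epsilon> * \<bar>x\<bar> \<le> \<bar>x\<bar> * \<bar>x\<bar>" using False by (intro mult_right_mono) auto
   hence "\<bar>x\<bar> \<le> 1 / \<epsilon> * x\<^sup>2" using \<epsilon> by (simp add: field_simps power2_eq_square)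
   then show ?thesis using fb[of x] by linarith
  qed
  then show "ennreal (f x) \<le> ennreal (1 / \<epsilon>) * ennreal (x\<^sup>2)"
   using \<epsilon> by (simp add: ennreal_mult[symmetric] ennreal_leI)
 qed
 also have "\<dots> = ennreal (1 / \<epsilon>)"
 proof -
  have "(\<lambda>x. ennreal (x\<^sup>2)) \<in> borel_measurable \<Lambda>" by (rule measurable_to_\<Lambda>) measurable
  then show ?thesis by (simp only: nn_integral_cmult \<Lambda>2 mult_1_right)
 qed
 finally show ?thesis by (rule le_less_trans) simp
qed

lemma Ms_eq: "\<bar>\<sigma>\<bar> = 1 ==> (\<integral>\<^sup>+x. ennreal (fs \<sigma> K x) \<partial>\<Lambda>) = ennreal (Ms \<sigma> K)"
 unfolding Ms_def using tail_first_moment[of "fs \<sigma> K" "e K"] e_pos[of K]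
 by (subst ennreal_enn2real) (auto simp: fs_def abs_if split: if_splits)

lemma Mg_eq: "\<bar>\<sigma>\<bar> = 1 ==> (\<integral>\<^sup>+x. ennreal (gs \<sigma> K x) \<partial>\<Lambda>) = ennreal (Mg \<sigma> K)"
 unfolding Mg_def using tail_first_moment[of "gs \<sigma> K" "e (Suc K)"] e_pos[of "Suc K"]
 by (subst ennreal_enn2real) (auto simp: gs_def abs_if split: if_splits)

lemma Ms_Suc: "\<bar>\<sigma>\<bar> = 1 ==> Ms \<sigma> (Suc K) = Ms \<sigma> K + Mg \<sigma> K"
proof -
 assume s: "\<bar>\<sigma>\<bar> = 1"
 have "ennreal (Ms \<sigma> (Suc K)) = (\<integral>\<^sup>+x. ennreal (fs \<sigma> K x) + ennreal (gs \<sigma> K x) \<partial>\<Lambda>)"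
  by (simp add: Ms_eq[OF s, symmetric] fs_Suc ennreal_plus fs_nonneg gs_nonneg)
 also have "\<dots> = ennreal (Ms \<sigma> K) + ennreal (Mg \<sigma> K)"
  by (subst nn_integral_add) (auto simp: Ms_eq[OF s] Mg_eq[OF s] intro!: measurable_to_\<Lambda>)
 also have "\<dots> = ennreal (Ms \<sigma> K + Mg \<sigma> K)" by (rule ennreal_plus[symmetric]) (auto simp: Ms_def Mg_def)
 finally show ?thesis by (subst (asm) ennreal_inj) (auto simp: Ms_def Mg_def)
qed

lemma gs_second: "\<bar>\<sigma>\<bar> = 1 ==> (\<integral>\<^sup>+x. ennreal ((gs \<sigma> K x)\<^sup>2) \<partial>\<Lambda>) \<le> ennreal ((1/8)^K)"
proof -
 assume s: "\<bar>\<sigma>\<bar> = 1"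
 have "(\<integral>\<^sup>+x. ennreal ((gs \<sigma> K x)\<^sup>2) \<partial>\<Lambda>) \<le> (\<integral>\<^sup>+ x. ennreal (x\<^sup>2) * indicator {x. \<bar>x\<bar> \<le> e K} x \<partial>\<Lambda>)"
 proof (rule nn_integral_mono)
  fix x
  have "(gs \<sigma> K x)\<^sup>2 \<le> x\<^sup>2"
   using s by (auto simp: gs_def max_def power_mult_distrib abs_if split: if_splits)
  moreover have "gs \<sigma> K x = 0" if "\<not> \<bar>x\<bar> \<le> e K" using that by (simp add: gs_def)
  ultimately show "ennreal ((gs \<sigma> K x)\<^sup>2) \<le> ennreal (x\<^sup>2) * indicator {x. \<bar>x\<bar> \<le> e K} x"
   by (auto simp: indicator_def ennreal_leI)
 qed
 also have "\<dots> \<le> ennreal ((1/8)^K)" by (rule e_small)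
 finally show ?thesis .
qed

text \<open>The compensated sum of the jumps larger than \<open>e K\<close>.\<close>

definition zK :: "nat => real => config => real" where
 "zK K t cf = cpt (fs 1 K) (Ms 1 K) t cf - cpt (fs (-1) K) (Ms (-1) K) t cf"

lemma measurable_zK[measurable]: "zK K t \<in> borel_measurable L" unfolding zK_def by measurable

lemma zK_finite_sum:
 assumes lf: "locfin cf" and t: "t \<le> real n" and K: "K \<le> K'"
 shows "zK K t cf = (\<Sum>q\<in>actK n K' cf. indicator {0<..t} (fst (pos cf q)) * (if e K < \<bar>snd (pos cf q)\<bar> then snd (pos cf q) else 0)) - t * (Ms 1 K - Ms (-1) K)"
proof -
 have z: "\<bar>x\<bar> \<le> e K' ==> fs \<sigma> K x = 0" for x \<sigma> using e_mono[OF K] by (auto simp: fs_def)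
 have d: "fs 1 K x - fs (-1) K x = (if e K < \<bar>x\<bar> then x else 0)" for x by (auto simp: fs_def)
 have "zK K t cf = (\<Sum>q\<in>actK n K' cf. indicator {0<..t} (fst (pos cf q)) * (fs 1 K (snd (pos cf q)) - fs (-1) K (snd (pos cf q)))) - t * (Ms 1 K - Ms (-1) K)"
 proof -
  have "cpt (fs \<sigma> K) (Ms \<sigma> K) t cf = (\<Sum>q\<in>actK n K' cf. indicator {0<..t} (fst (pos cf q)) * fs \<sigma> K (snd (pos cf q))) - t * Ms \<sigma> K" for \<sigma>
   by (rule cpt_finite_sum[OF lf t fs_nonneg z])
  from this[of 1] this[of "-1"] show ?thesis
   unfolding zK_def by (simp add: right_diff_distrib sum_subtractf)
 qed
 then show ?thesis unfolding d .
qed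

lemma zK_Suc: "locfin cf ==> zK (Suc K) t cf - zK K t cf = cpt (gs 1 K) (Mg 1 K) t cf - cpt (gs (-1) K) (Mg (-1) K) t cf"
proof -
 assume lf: "locfin cf"
 have t: "t \<le> real (nat \<lceil>t\<rceil>)" by (rule real_nat_ceiling_ge)
 have z1: "\<bar>x\<bar> \<le> e (Suc K) ==> fs \<sigma> (Suc K) x = 0" for x \<sigma> by (auto simp: fs_def)
 have z2: "\<bar>x\<bar> \<le> e (Suc K) ==> fs \<sigma> K x = 0" for x \<sigma> using e_dec[of K] by (auto simp: fs_def)
 have z3: "\<bar>x\<bar> \<le> e (Suc K) ==> gs \<sigma> K x = 0" for x \<sigma> by (auto simp: gs_def)
 have "cpt (fs \<sigma> (Suc K)) (Ms \<sigma> (Suc K)) t cf - cpt (fs \<sigma> K) (Ms \<sigma> K) t cf = cpt (gs \<sigma> K) (Mg \<sigma> K) t cf" if "\<bar>\<sigma>\<bar> = 1" for \<sigma>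
 proof -
  let ?S = "\<lambda>f. \<Sum>q\<in>actK (nat \<lceil>t\<rceil>) (Suc K) cf. indicator {0<..t} (fst (pos cf q)) * f (snd (pos cf q))"
  have "cpt (fs \<sigma> (Suc K)) (Ms \<sigma> (Suc K)) t cf = ?S (fs \<sigma> (Suc K)) - t * Ms \<sigma> (Suc K)"
   by (rule cpt_finite_sum[OF lf t fs_nonneg z1])
  moreover have "cpt (fs \<sigma> K) (Ms \<sigma> K) t cf = ?S (fs \<sigma> K) - t * Ms \<sigma> K"
   by (rule cpt_finite_sum[OF lf t fs_nonneg z2])
  moreover have "cpt (gs \<sigma> K) (Mg \<sigma> K) t cf = ?S (gs \<sigma> K) - t * Mg \<sigma> K"
   by (rule cpt_finite_sum[OF lf t gs_nonneg z3])
  moreover have "?S (fs \<sigma> (Suc K)) = ?S (fs \<sigma> K) + ?S (gs \<sigma> K)"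
   by (simp add: fs_Suc distrib_left sum.distrib)
  ultimately show ?thesis by (simp add: Ms_Suc[OF that] distrib_left)
 qed
 from this[of 1] this[of "-1"] show ?thesis by (simp add: zK_def)
qed

text \<open>Locally uniform Cauchy convergence of \<open>zK\<close> as \<open>K\<close> grows, expressed by
  rational times to keep it measurable.\<close>

definition cau :: "config => bool" where
 "cau cf \<longleftrightarrow> (\<forall>n j :: nat. \<exists>K0. \<forall>K. K0 \<le> K \<longrightarrow> (\<forall>r :: rat. 0 \<le> r \<and> r \<le> of_nat n \<longrightarrow>
   \<bar>zK K (of_rat r) cf - zK K0 (of_rat r) cf\<bar> \<le> 1 / real (Suc j)))"

lemma pred_cau[measurable]: "Measurable.pred L cau"
 unfolding cau_def[abs_def] by measurable

text \<open>Borel-Cantelli: the maximal inequality bounds the probability of the \<open>K\<close>-th event by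
  a multiple of \<open>(1/8)^K / (1/4)^K\<close>.\<close>

lemma AE_band_small:
 assumes s: "\<bar>\<sigma>\<bar> = 1"
 shows "AE cf in L. eventually (\<lambda>K. \<forall>r :: rat. 0 \<le> r \<and> r \<le> of_nat n \<longrightarrow> \<bar>cpt (gs \<sigma> K) (Mg \<sigma> K) (of_rat r) cf\<bar> \<le> (1/2)^K) sequentially"
proof -
 define R where "R = {x :: real. \<exists>r :: rat. x = of_rat r \<and> 0 \<le> r \<and> r \<le> of_nat n}"
 have R: "countable R" "R \<subseteq> {0..real n}"
 proof -
  have "R \<subseteq> range (of_rat :: rat => real)" by (auto simp: R_def)
  then show "countable R" by (rule countable_subset) simp
  show "R \<subseteq> {0..real n}"
   unfolding R_def by (auto simp: zero_le_of_rat_iff) (metis of_rat_less_eq of_rat_of_nat_eq)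
 qed
 define A where "A K = {cf\<in>space L. \<exists>r\<in>R. (1/2)^K < \<bar>cpt (gs \<sigma> K) (Mg \<sigma> K) r cf\<bar>}" for K
 have mA: "A K \<in> sets L" for K
 proof -
  have "A K = (\<Union>r\<in>R. {cf\<in>space L. (1/2)^K < \<bar>cpt (gs \<sigma> K) (Mg \<sigma> K) r cf\<bar>})" by (auto simp: A_def)
  then show ?thesis using R by auto
 qed
 have bA: "measure L (A K) \<le> real n * (1/2)^K" for K
 proof -
  define v where "v = enn2real (\<integral>\<^sup>+x. ennreal ((gs \<sigma> K x)\<^sup>2) \<partial>\<Lambda>)"
  have v: "(\<integral>\<^sup>+x. ennreal ((gs \<sigma> K x)\<^sup>2) \<partial>\<Lambda>) = ennreal v" "0 \<le> v"
   unfolding v_def using le_less_trans[OF gs_second[OF s, of K]] by (simp_all add: less_top)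
  have v8: "v \<le> (1/8)^K" using gs_second[OF s, of K] v by simp
  have "measure L (A K) \<le> real n * v / ((1/2)^K)\<^sup>2"
   unfolding A_def by (rule cpt_maximal[OF _ gs_nonneg Mg_eq[OF s] _ v R]) (auto simp: Mg_def)
  also have "\<dots> \<le> real n * (1/8)^K / ((1/2)^K)\<^sup>2" using v8 by (intro divide_right_mono mult_left_mono) auto
  also have "(1/8)^K / ((1/2)^K)\<^sup>2 = (1/2 :: real)^K"
  proof -
   have "(1/8 :: real)^K = (1/2)^K * ((1/2)^K)\<^sup>2" by (simp add: power2_eq_square flip: power_mult_distrib)
   then show ?thesis by simp
  qed
  then have "real n * (1/8)^K / ((1/2)^K)\<^sup>2 = real n * (1/2)^K" by (metis times_divide_eq_right)
  finally show ?thesis .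
 qed
 have "summable (\<lambda>K. measure L (A K))"
  by (rule summable_comparison_test'[of "\<lambda>K. real n * (1/2)^K" 0]) (use bA in \<open>auto intro!: summable_mult summable_geometric\<close>)
 from borel_cantelli_AE1[OF mA _ this] have "AE cf in L. \<forall>\<^sub>F K in sequentially. cf \<in> space L - A K" by (auto simp: L.emeasure_eq_measure)
 then show ?thesis
 proof eventually_elim
  case (elim cf)
  then show ?case by eventually_elim (fastforce simp: A_def R_def not_less)
 qed
qed

lemma AE_cau: "AE cf in L. cau cf"
proof -
 have "AE cf in L. \<forall>n. eventually (\<lambda>K. \<forall>r :: rat. 0 \<le> r \<and> r \<le> of_nat n \<longrightarrow> \<bar>cpt (gs 1 K) (Mg 1 K) (of_rat r) cf\<bar> \<le> (1/2)^K) sequentially"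
  "AE cf in L. \<forall>n. eventually (\<lambda>K. \<forall>r :: rat. 0 \<le> r \<and> r \<le> of_nat n \<longrightarrow> \<bar>cpt (gs (-1) K) (Mg (-1) K) (of_rat r) cf\<bar> \<le> (1/2)^K) sequentially"
  unfolding AE_all_countable using AE_band_small[of 1] AE_band_small[of "-1"] by auto
 then show ?thesis using AE_locfin
 proof eventually_elim
  case (elim cf)
  show "cau cf" unfolding cau_def
  proof (intro allI)
   fix n j :: nat
   from elim(1)[rule_format, of n] elim(2)[rule_format, of n]
   have "eventually (\<lambda>K. \<forall>r :: rat. 0 \<le> r \<and> r \<le> of_nat n \<longrightarrow> \<bar>zK (Suc K) (of_rat r) cf - zK K (of_rat r) cf\<bar> \<le> 2 * (1/2)^K) sequentially"
    by eventually_elim (simp add: zK_Suc[OF elim(3)], smt (verit))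
   then obtain K1 where K1: "\<And>K r. K1 \<le> K ==> 0 \<le> (r :: rat) ==> r \<le> of_nat n ==> \<bar>zK (Suc K) (of_rat r) cf - zK K (of_rat r) cf\<bar> \<le> 2 * (1/2)^K"
    unfolding eventually_sequentially by blast
   have "(\<lambda>K. 4 * (1/2)^K) \<longlonglongrightarrow> (0 :: real)" by (intro tendsto_mult_right_zero LIMSEQ_realpow_zero) auto
   then have "eventually (\<lambda>K. 4 * (1/2)^K < 1 / real (Suc j)) sequentially" by (rule order_tendstoD) simp
   then obtain K2 where K2: "\<And>K. K2 \<le> K ==> 4 * (1/2)^K < 1 / real (Suc j)" unfolding eventually_sequentially by blast
   define K0 where "K0 = max K1 K2"
   have "\<bar>zK (K0 + i) (of_rat r) cf - zK K0 (of_rat r) cf\<bar> \<le> 4 * (1/2)^K0 - 4 * (1/2)^(K0 + i)" if r: "0 \<le> r" "r \<le> of_nat n" for i and r :: rat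
   proof (induction i)
    case (Suc i)
    have "\<bar>zK (Suc (K0 + i)) (of_rat r) cf - zK (K0 + i) (of_rat r) cf\<bar> \<le> 2 * (1/2)^(K0 + i)"
     by (rule K1) (use r in \<open>auto simp: K0_def\<close>)
    then show ?case using Suc by simp
   qed simp
   note step = this
   have bnd: "4 * (1/2)^K0 - 4 * (1/2)^(K0 + i) \<le> 1 / real (Suc j)" for i
   proof -
    have "0 \<le> 4 * (1/2 :: real)^(K0 + i)" by simp
    moreover have "4 * (1/2)^K0 < 1 / real (Suc j)" by (rule K2) (simp add: K0_def)
    ultimately show ?thesis by linarith
   qed
   have "\<bar>zK K (of_rat r) cf - zK K0 (of_rat r) cf\<bar> \<le> 1 / real (Suc j)" if "K0 \<le> K" "0 \<le> r \<and> r \<le> of_nat n" for K and r :: rat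
   proof -
    have "K = K0 + (K - K0)" using that by simp
    then obtain i where "K = K0 + i" by blast
    then show ?thesis using order_trans[OF step[of r i] bnd] that by simp
   qed
   then show "\<exists>K0. \<forall>K\<ge>K0. \<forall>r :: rat. 0 \<le> r \<and> r \<le> of_nat n \<longrightarrow> \<bar>zK K (of_rat r) cf - zK K0 (of_rat r) cf\<bar> \<le> 1 / real (Suc j)" by blast
  qed
 qed
qed

end

section \<open>The jump process of a configuration\<close>

context levy_cells begin

text \<open>Replace the position of a single point; its law is invariant when the new position is drawn
  afresh.\<close>

definition upd :: "config => (nat \<times> nat) \<times> nat => real \<times> real => config" where
 "upd cf q p = fun_upd cf (fst q) (fst (cf (fst q)), fun_upd (snd (cf (fst q))) (snd q) p)"

lemma nn_integral_resample_point:
 assumes f: "f \<in> borel_measurable L"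
 shows "(\<integral>\<^sup>+cf. f cf \<partial>L) = (\<integral>\<^sup>+cf. \<integral>\<^sup>+p. f (upd cf q p) \<partial>point (snd (fst q)) \<partial>L)"
proof -
 obtain c i where q: "q = (c, i)" by (cases q)
 interpret pt: prob_space "point (snd c)" by (rule prob_space_point)
 interpret cl: prob_space "cell c" by (rule prob_space_cell)
 have mcell: "(\<lambda>(cf, x). fun_upd cf c x) \<in> measurable (L \<Otimes>\<^sub>M cell c) L"
  using measurable_fun_upd[of UNIV UNIV c fst "L \<Otimes>\<^sub>M cell c" cell snd] by (auto simp: L_def case_prod_unfold)
 have mu: "(\<lambda>(x, p). (fst x, fun_upd (snd x) i p)) \<in> measurable (cell c \<Otimes>\<^sub>M point (snd c)) (cell c)"
 proof -
  have "(\<lambda>z. fun_upd (snd (fst z)) i (snd z)) \<in> measurable ((measure_pmf (poisson_pmf (rate (snd c))) \<Otimes>\<^sub>M PiM (UNIV :: nat set) (\<lambda>_. point (snd c))) \<Otimes>\<^sub>M point (snd c)) (PiM UNIV (\<lambda>_. point (snd c)))"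
   by (rule measurable_fun_upd[of UNIV UNIV]) auto
  then show ?thesis unfolding cell_def poisson_cell_def case_prod_unfold by measurable
 qed
 have mL: "(\<lambda>cf. cf c) \<in> measurable L (cell c)" unfolding L_def by measurable
 have mupd: "(\<lambda>(cf, p). upd cf q p) \<in> measurable (L \<Otimes>\<^sub>M point (snd c)) L"
 proof -
  have "(\<lambda>z. (fst z, (fst (fst z c), fun_upd (snd (fst z c)) i (snd z)))) \<in> measurable (L \<Otimes>\<^sub>M point (snd c)) (L \<Otimes>\<^sub>M cell c)"
   using measurable_compose[OF measurable_Pair[OF measurable_compose[OF measurable_fst mL] measurable_snd] mu]
   by (intro measurable_Pair) (auto simp: case_prod_unfold)
  from measurable_compose[OF this mcell] show ?thesis by (simp add: upd_def q case_prod_unfold)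
 qed
 have g: "(\<lambda>cf. \<integral>\<^sup>+p. f (upd cf q p) \<partial>point (snd c)) \<in> borel_measurable L"
  using measurable_compose[OF mupd f] by (intro pt.borel_measurable_nn_integral) (simp add: case_prod_unfold)
 have "(\<integral>\<^sup>+cf. f cf \<partial>L) = (\<integral>\<^sup>+cf. \<integral>\<^sup>+x. f (fun_upd cf c x) \<partial>cell c \<partial>L)"
  using f unfolding L_def by (subst nn_integral_PiM_resample[of UNIV cell c]) (auto simp: prob_space_cell)
 also have "\<dots> = (\<integral>\<^sup>+cf. \<integral>\<^sup>+x. (\<integral>\<^sup>+p. f (upd (fun_upd cf c x) q p) \<partial>point (snd c)) \<partial>cell c \<partial>L)"
 proof (rule nn_integral_cong)
  fix cf assume w: "cf \<in> space L"
  have m1: "(\<lambda>x. fun_upd cf c x) \<in> measurable (cell c) L"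
   using measurable_compose[OF measurable_Pair1'[OF w] mcell] by simp
  have m2: "(\<lambda>x. f (fun_upd cf c x)) \<in> borel_measurable (cell c)" by (rule measurable_compose[OF m1 f])
  have m3: "(\<lambda>x. \<integral>\<^sup>+p. f (upd (fun_upd cf c x) q p) \<partial>point (snd c)) \<in> borel_measurable (cell c)"
   by (rule measurable_compose[OF m1 g])
  have "(\<integral>\<^sup>+x. f (fun_upd cf c x) \<partial>cell c) = (\<Sum>n. ennreal (pmf (poisson_pmf (rate (snd c))) n) * (\<integral>\<^sup>+P. f (fun_upd cf c (n, P)) \<partial>PiM UNIV (\<lambda>_. point (snd c))))"
   using m2 unfolding cell_def by (rule nn_integral_poisson_cell[OF prob_space_point])
  also have "\<dots> = (\<Sum>n. ennreal (pmf (poisson_pmf (rate (snd c))) n) * (\<integral>\<^sup>+P. \<integral>\<^sup>+p. f (fun_upd cf c (n, fun_upd P i p)) \<partial>point (snd c) \<partial>PiM UNIV (\<lambda>_. point (snd c))))"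
  proof (intro suminf_cong arg_cong2[where f="(*)"] refl)
   fix n
   have "(\<lambda>P. f (fun_upd cf c (n, P))) \<in> borel_measurable (PiM UNIV (\<lambda>_. point (snd c)))"
    using m2 unfolding cell_def measurable_poisson_cell[OF prob_space_point] by blast
   then show "(\<integral>\<^sup>+P. f (fun_upd cf c (n, P)) \<partial>PiM UNIV (\<lambda>_. point (snd c))) = (\<integral>\<^sup>+P. \<integral>\<^sup>+p. f (fun_upd cf c (n, fun_upd P i p)) \<partial>point (snd c) \<partial>PiM UNIV (\<lambda>_. point (snd c)))"
    by (subst nn_integral_PiM_resample[of UNIV "\<lambda>_. point (snd c)" i]) (auto simp: prob_space_point)
  qed
  also have "\<dots> = (\<integral>\<^sup>+x. (\<integral>\<^sup>+p. f (upd (fun_upd cf c x) q p) \<partial>point (snd c)) \<partial>cell c)"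
   using m3 unfolding cell_def by (subst nn_integral_poisson_cell[OF prob_space_point]) (simp_all add: upd_def q)
  finally show "(\<integral>\<^sup>+x. f (fun_upd cf c x) \<partial>cell c) = (\<integral>\<^sup>+x. (\<integral>\<^sup>+p. f (upd (fun_upd cf c x) q p) \<partial>point (snd c)) \<partial>cell c)" .
 qed
 also have "\<dots> = (\<integral>\<^sup>+cf. \<integral>\<^sup>+p. f (upd cf q p) \<partial>point (snd c) \<partial>L)"
  using g unfolding L_def by (subst (2) nn_integral_PiM_resample[of UNIV cell c]) (auto simp: prob_space_cell)
 finally show ?thesis by (simp add: q)
qed

lemma measurable_pos[measurable]: "(\<lambda>cf. pos cf q) \<in> measurable L (borel \<Otimes>\<^sub>M borel)"
 unfolding pos_def by (rule measurable_compose[OF measurable_pt measurable_tim])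

lemma AE_point: "AE p in point k. fst p \<noteq> s \<and> 0 < fst p"
proof -
 interpret mk: prob_space "mark k" by (rule prob_space_mark)
 interpret un: prob_space unif by (rule prob_space_unif)
 interpret pair_sigma_finite unif "mark k" ..
 have "AE u in unif. u \<noteq> s \<and> 0 < u"
 proof -
  have "AE u in lborel. u \<noteq> s" by (rule AE_lborel_singleton)
  then have "AE u in uniform_measure lborel {0<..<1}. u \<noteq> s" by (intro AE_uniform_measureI) auto
  moreover have "AE u in uniform_measure lborel {0<..<1::real}. 0 < u" by (intro AE_uniform_measureI) auto
  ultimately show ?thesis unfolding unif_def by eventually_elim simp
 qed
 then have "AE u in unif. AE x in mark k. (fst (u, x) \<noteq> s \<and> 0 < fst (u, x))" by eventually_elim simp
 moreover have "{x \<in> space (unif \<Otimes>\<^sub>M mark k). fst x \<noteq> s \<and> 0 < fst x} \<in> sets (unif \<Otimes>\<^sub>M mark k)" by measurable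
 ultimately show ?thesis unfolding point_def by (subst AE_pair_iff[symmetric]) auto
qed

text \<open>No two points, active or not, share a time.\<close>

definition distt :: "config => bool" where
 "distt cf \<longleftrightarrow> (\<forall>q. 0 < fst (pos cf q)) \<and> (\<forall>q q'. q \<noteq> q' \<longrightarrow> fst (pos cf q) \<noteq> fst (pos cf q'))"

lemma disttD: assumes "distt cf"
 shows "0 < fst (pos cf q)" "q \<noteq> q' ==> fst (pos cf q) \<noteq> fst (pos cf q')"
proof -
 show "0 < fst (pos cf q)" by (rule assms[unfolded distt_def, THEN conjunct1, THEN spec])
 show "q \<noteq> q' ==> fst (pos cf q) \<noteq> fst (pos cf q')"
  by (rule assms[unfolded distt_def, THEN conjunct2, THEN spec, THEN spec, THEN mp])
qed

lemma pred_times: "Measurable.pred L (\<lambda>cf. 0 < fst (pos cf q))"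
 "Measurable.pred L (\<lambda>cf. q \<noteq> q' \<longrightarrow> fst (pos cf q) \<noteq> fst (pos cf q'))"
proof -
 have m: "(\<lambda>cf. fst (pos cf q)) \<in> borel_measurable L" for q
  by (rule measurable_compose[OF measurable_pos measurable_fst])
 show "Measurable.pred L (\<lambda>cf. 0 < fst (pos cf q))" unfolding pred_def by (rule borel_measurable_less[OF borel_measurable_const m])
 have "Measurable.pred L (\<lambda>cf. fst (pos cf q) \<noteq> fst (pos cf q'))" unfolding pred_def using m m by (rule borel_measurable_neq)
 then show "Measurable.pred L (\<lambda>cf. q \<noteq> q' \<longrightarrow> fst (pos cf q) \<noteq> fst (pos cf q'))" by (cases "q = q'") simp_all
qed

lemma pred_distt[measurable]: "Measurable.pred L distt"
 unfolding distt_def[abs_def] by (intro pred_intros_logic(3) pred_intros_countable pred_times)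

lemma AE_resample:
 assumes Q[measurable]: "Measurable.pred L Q" and ae: "\<And>cf. AE p in point (snd (fst q)). Q (upd cf q p)"
 shows "AE cf in L. Q cf"
proof -
 have "(\<integral>\<^sup>+cf. indicator {cf. \<not> Q cf} cf \<partial>L) = (\<integral>\<^sup>+cf. \<integral>\<^sup>+p. indicator {cf. \<not> Q cf} (upd cf q p) \<partial>point (snd (fst q)) \<partial>L)"
  by (rule nn_integral_resample_point) measurable
 also have "\<dots> = (\<integral>\<^sup>+cf. 0 \<partial>L)"
 proof (rule nn_integral_cong)
  fix cf
  have "(\<integral>\<^sup>+p. indicator {cf. \<not> Q cf} (upd cf q p) \<partial>point (snd (fst q))) = (\<integral>\<^sup>+p. 0 \<partial>point (snd (fst q)))"
   using ae[of cf] by (intro nn_integral_cong_AE) (auto elim!: eventually_mono)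
  then show "(\<integral>\<^sup>+p. indicator {cf. \<not> Q cf} (upd cf q p) \<partial>point (snd (fst q))) = 0" by simp
 qed
 finally have "(\<integral>\<^sup>+cf. indicator {cf. \<not> Q cf} cf \<partial>L) = 0" by simp
 then have "AE cf in L. indicator {cf. \<not> Q cf} cf = (0::ennreal)"
  by (subst (asm) nn_integral_0_iff_AE) (auto, measurable)
 then show ?thesis by eventually_elim (auto simp: indicator_def split: if_splits)
qed

lemma pos_upd: "pos (upd cf q p) q' = (if q' = q then tim (fst q) p else pos cf q')"
 by (cases q; cases q') (auto simp: pos_def upd_def)

text \<open>Given all other points, a freshly drawn time avoids each of their countably many times.\<close>

lemma AE_distt: "AE cf in L. distt cf"
proof -
 have 1: "AE cf in L. 0 < fst (pos cf q)" for q
 proof (rule AE_resample[where q=q, OF pred_times(1)])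
  show "AE p in point (snd (fst q)). 0 < fst (pos (upd cf q p) q)" for cf
   using AE_point[where k="snd (fst q)" and s=0] by eventually_elim (auto simp: pos_upd tim_def)
 qed
 have 2: "AE cf in L. q \<noteq> q' \<longrightarrow> fst (pos cf q) \<noteq> fst (pos cf q')" for q q'
 proof (rule AE_resample[where q=q, OF pred_times(2)])
  show "AE p in point (snd (fst q)). q \<noteq> q' \<longrightarrow> fst (pos (upd cf q p) q) \<noteq> fst (pos (upd cf q p) q')" for cf
   using AE_point[where k="snd (fst q)" and s="fst (pos cf q') - real (fst (fst q))"] by eventually_elim (auto simp: pos_upd tim_def)
 qed
 have "AE cf in L. \<forall>q. 0 < fst (pos cf q)"
  by (rule AE_all_countable[THEN iffD2], rule allI, rule 1)
 moreover have "AE cf in L. \<forall>q. \<forall>q'. q \<noteq> q' \<longrightarrow> fst (pos cf q) \<noteq> fst (pos cf q')"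
  by (rule AE_all_countable[THEN iffD2], rule allI, rule AE_all_countable[THEN iffD2], rule allI, rule 2)
 ultimately show ?thesis by eventually_elim (unfold distt_def, iprover)
qed

definition good :: "config => bool" where
 "good cf \<longleftrightarrow> distt cf \<and> locfin cf \<and> cau cf"

text \<open>Outside the measurable set of good configurations, which has probability one, the path is zero.
  All statements about single paths below hold for every good configuration.\<close>

definition lev :: "real => config => real" where
 "lev t cf = (if good cf then lim (\<lambda>K. zK K t cf) else 0)"

lemma pred_good[measurable]: "Measurable.pred L good" unfolding good_def[abs_def] by measurable

lemma measurable_lev[measurable]: "lev t \<in> borel_measurable L"
 unfolding lev_def[abs_def] by measurable

lemma AE_good: "AE cf in L. good cf"
 using AE_distt AE_locfin AE_cau by eventually_elim (simp add: good_def)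

section \<open>Reordering and inserting jumps\<close>

lemma pos_swp: "pos (swp c i cf) q = pos cf (fst q, if fst q = c then Transposition.transpose 0 i (snd q) else snd q)"
 by (cases q) (auto simp: pos_def swp_def)

lemma locfin_swp: "i < fst (cf c) ==> locfin (swp c i cf) = locfin cf" by (simp add: locfin_def J_swp)
lemma zK_swp: "i < fst (cf c) ==> zK K t (swp c i cf) = zK K t cf" by (simp add: zK_def cpt_swp)
lemma cau_swp: "i < fst (cf c) ==> cau (swp c i cf) = cau cf" by (simp add: cau_def zK_swp)

lemma distt_swp: "distt (swp c i cf) = distt cf"
proof -
 define \<tau> where "\<tau> q = (fst q :: nat \<times> nat, if fst q = c then Transposition.transpose 0 i (snd q) else snd q)" for q
 have tt: "\<tau> (\<tau> q) = q" for q by (cases q) (auto simp: \<tau>_def)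
 have p: "pos (swp c i cf) q = pos cf (\<tau> q)" for q by (simp add: pos_swp \<tau>_def)
 show ?thesis unfolding distt_def p by (metis tt)
qed

lemma good_swp: "i < fst (cf c) ==> good (swp c i cf) = good cf" by (simp add: good_def distt_swp locfin_swp cau_swp)
lemma lev_swp: "i < fst (cf c) ==> lev t (swp c i cf) = lev t cf" by (simp add: lev_def good_swp zK_swp)

lemma pos_add: "pos (add c p cf) q = (if fst q = c then (case snd q of 0 => tim c p | Suc i => pos cf (c, i)) else pos cf q)"
 by (cases q) (auto simp: pos_def add_def split: nat.split)

lemma distt_add:
 assumes d: "distt cf" and p: "0 < fst (tim c p)" "\<And>q. fst (tim c p) \<noteq> fst (pos cf q)"
 shows "distt (add c p cf)"
 unfolding distt_def
proof (intro conjI allI impI)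
 have d1: "0 < fst (pos cf q)" and d2: "q \<noteq> q' ==> fst (pos cf q) \<noteq> fst (pos cf q')" for q q'
  by (rule disttD(1)[OF d], rule disttD(2)[OF d])
 show "0 < fst (pos (add c p cf) q)" for q using d1 p by (auto simp: pos_add split: nat.split)
 fix q q' :: "(nat \<times> nat) \<times> nat" assume ne: "q \<noteq> q'"
 show "fst (pos (add c p cf) q) \<noteq> fst (pos (add c p cf) q')"
  using ne p(2) p(2)[symmetric] by (cases q; cases q') (auto simp: pos_add split: nat.split intro!: d2)
qed

lemma locfin_add: "locfin cf ==> locfin (add c p cf)"
proof -
 have b: "big n K p < \<top>" for n K p by (auto simp: big_def indicator_def)
 assume "locfin cf"
 then show ?thesis by (auto simp: locfin_def J_add b)
qed

lemma zK_add:
 assumes lf: "locfin cf"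
 shows "zK K t (add c p cf) = zK K t cf + indicator {0<..t} (fst (tim c p)) * (if e K < \<bar>snd p\<bar> then snd p else 0)"
proof -
 have z: "\<bar>x\<bar> \<le> e K ==> fs \<sigma> K x = 0" for x \<sigma> by (auto simp: fs_def)
 have c: "cpt (fs \<sigma> K) m t (add c p cf) = cpt (fs \<sigma> K) m t cf + indicator {0<..t} (fst (tim c p)) * fs \<sigma> K (snd p)" for \<sigma> m
 proof -
  have J: "J cf (seg 0 t (fs \<sigma> K)) < \<top>"
   using J_finite_sum[OF lf real_nat_ceiling_ge fs_nonneg z] by simp
  have s: "seg 0 t (fs \<sigma> K) (tim c p) = ennreal (indicator {0<..t} (fst (tim c p)) * fs \<sigma> K (snd p))"
   by (simp add: seg_def tim_def indicator_def)
  have "fs \<sigma> K (snd p) = 0" if "snd p = 0" using that by (simp add: fs_def)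
  then show ?thesis using J
   by (cases "snd p = 0") (simp_all add: cpt_def J_add s enn2real_plus fs_nonneg)
 qed
 have d: "(if e K < \<bar>snd p\<bar> then snd p else 0) = fs 1 K (snd p) - fs (-1) K (snd p)" by (auto simp: fs_def)
 show ?thesis unfolding zK_def c d right_diff_distrib by linarith
qed

lemma cau_add:
 assumes lf: "locfin cf" and cu: "cau cf"
 shows "cau (add c p cf)"
 unfolding cau_def
proof (intro allI)
 fix n j :: nat
 obtain K0 where K0: "\<And>K r. K0 \<le> K ==> 0 \<le> (r::rat) ==> r \<le> of_nat n ==> \<bar>zK K (of_rat r) cf - zK K0 (of_rat r) cf\<bar> \<le> 1 / real (Suc (2 * j + 1))"
  using cu[unfolded cau_def, rule_format, of n "2 * j + 1"] by blast
 obtain K1 where K1: "snd p = 0 \<or> e K1 < \<bar>snd p\<bar>" using ex_band[of "snd p"] band_sub by blast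
 have eq: "(if e K < \<bar>snd p\<bar> then snd p else 0) = snd p" if "K1 \<le> K" for K
 proof (cases "snd p = 0")
  case False
  then have "e K < \<bar>snd p\<bar>" using K1 e_mono[OF that] by linarith
  then show ?thesis by simp
 qed simp
 define K2 where "K2 = max K0 K1"
 show "\<exists>K0. \<forall>K\<ge>K0. \<forall>r :: rat. 0 \<le> r \<and> r \<le> of_nat n \<longrightarrow> \<bar>zK K (of_rat r) (add c p cf) - zK K0 (of_rat r) (add c p cf)\<bar> \<le> 1 / real (Suc j)"
 proof (intro exI[of _ K2] allI impI)
  fix K and r :: rat assume K: "K2 \<le> K" and r: "0 \<le> r \<and> r \<le> of_nat n"
  have "zK K (of_rat r) (add c p cf) - zK K2 (of_rat r) (add c p cf) = zK K (of_rat r) cf - zK K2 (of_rat r) cf"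
   using K eq[of K] eq[of K2] by (simp add: zK_add[OF lf] K2_def)
  also have "\<bar>\<dots>\<bar> \<le> \<bar>zK K (of_rat r) cf - zK K0 (of_rat r) cf\<bar> + \<bar>zK K2 (of_rat r) cf - zK K0 (of_rat r) cf\<bar>" by linarith
  also have "\<dots> \<le> 1 / real (Suc (2 * j + 1)) + 1 / real (Suc (2 * j + 1))"
   using K r by (intro add_mono K0) (auto simp: K2_def)
  also have "\<dots> = 1 / real (Suc j)" by (simp add: field_simps)
  finally show "\<bar>zK K (of_rat r) (add c p cf) - zK K2 (of_rat r) (add c p cf)\<bar> \<le> 1 / real (Suc j)" .
 qed
qed

text \<open>A jump inserted after time \<open>t\<close> does not affect the path up to \<open>t\<close>: the
  configuration is adapted.\<close>

lemma lev_add: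
 assumes g: "good cf" and p: "0 < fst (tim c p)" "\<And>q. fst (tim c p) \<noteq> fst (pos cf q)" and t: "t < fst (tim c p)"
 shows "lev t (add c p cf) = lev t cf"
proof -
 have "good (add c p cf)" using g p by (auto simp: good_def intro!: distt_add locfin_add cau_add)
 moreover have "zK K t (add c p cf) = zK K t cf" for K using g t by (simp add: zK_add good_def)
 ultimately show ?thesis using g by (simp add: lev_def)
qed

lemma AE_add_ok: "AE p in point (snd c). 0 < fst (tim c p) \<and> (\<forall>q. fst (tim c p) \<noteq> fst (pos cf q))"
proof -
 have "AE p in point (snd c). \<forall>q. fst p \<noteq> fst (pos cf q) - real (fst c) \<and> 0 < fst p"
  unfolding AE_all_countable using AE_point by blast
 then show ?thesis
 proof eventually_elim
  case (elim p)
  then have e: "fst p \<noteq> fst (pos cf q) - real (fst c) \<and> 0 < fst p" for q by (rule spec)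
  show ?case
  proof (intro conjI allI notI)
   show "0 < fst (tim c p)" using e[of undefined] by (simp add: tim_def)
   fix q assume "fst (tim c p) = fst (pos cf q)"
   then show False using e[of q] by (simp add: tim_def)
  qed
 qed
qed

section \<open>Path regularity and the jump measure\<close>

lemma tendsto_indicator_right: fixes t T :: real shows "((\<lambda>s. indicat_real {0<..s} T) \<longlongrightarrow> indicat_real {0<..t} T) (at t within (A \<inter> {t<..}))"
proof (rule tendsto_eventually)
 have "eventually (\<lambda>s. T \<le> t \<or> s < T) (at t within (A \<inter> {t<..}))"
 proof (cases "T \<le> t")
  case False
  then have "eventually (\<lambda>s. s < T) (at t within (A \<inter> {t<..}))"
   using order_tendstoD(2)[OF tendsto_ident_at, of t T "A \<inter> {t<..}"] by simp
  then show ?thesis by eventually_elim simp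
 qed simp
 moreover have "eventually (\<lambda>s. s \<in> A \<inter> {t<..}) (at t within (A \<inter> {t<..}))" by (simp add: eventually_at_filter)
 ultimately show "\<forall>\<^sub>F s in at t within A \<inter> {t<..}. indicat_real {0<..s} T = indicat_real {0<..t} T"
  by eventually_elim (auto simp: indicator_def)
qed

lemma tendsto_indicator_left: fixes t T :: real shows "((\<lambda>s. indicat_real {0<..s} T) \<longlongrightarrow> indicat_real {0<..<t} T) (at t within (A \<inter> {..<t}))"
proof (rule tendsto_eventually)
 have "eventually (\<lambda>s. t \<le> T \<or> T < s) (at t within (A \<inter> {..<t}))"
 proof (cases "t \<le> T")
  case False
  then have "eventually (\<lambda>s. T < s) (at t within (A \<inter> {..<t}))"
   using order_tendstoD(1)[OF tendsto_ident_at, of T t "A \<inter> {..<t}"] by simp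
  then show ?thesis by eventually_elim simp
 qed simp
 moreover have "eventually (\<lambda>s. s \<in> A \<inter> {..<t}) (at t within (A \<inter> {..<t}))" by (simp add: eventually_at_filter)
 ultimately show "\<forall>\<^sub>F s in at t within A \<inter> {..<t}. indicat_real {0<..s} T = indicat_real {0<..<t} T"
  by eventually_elim (auto simp: indicator_def)
qed

text \<open>The jump that the configuration prescribes at time \<open>t\<close>; distinctness of times makes
  the choice unambiguous.\<close>

definition xat :: "config => real => real" where
 "xat cf t = (if \<exists>q\<in>act cf. fst (pos cf q) = t then snd (pos cf (SOME q. q \<in> act cf \<and> fst (pos cf q) = t)) else 0)"

context
 fixes cf assumes g: "good cf"
begin

lemma lf: "locfin cf" and ds: "distt cf" and cu: "cau cf" using g by (auto simp: good_def)

lemma time_inj: "fst (pos cf q) = fst (pos cf q') ==> q = q'" and time_pos: "0 < fst (pos cf q)"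
proof -
 show "fst (pos cf q) = fst (pos cf q') ==> q = q'" using disttD(2)[OF ds, of q q'] by blast
 show "0 < fst (pos cf q)" by (rule disttD(1)[OF ds])
qed

lemma xat_act: "q \<in> act cf ==> xat cf (fst (pos cf q)) = snd (pos cf q)"
proof -
 assume q: "q \<in> act cf"
 have "(SOME q'. q' \<in> act cf \<and> fst (pos cf q') = fst (pos cf q)) = q"
  by (rule some_equality) (use q time_inj in auto)
 then show ?thesis using q by (auto simp: xat_def)
qed

lemma zK_sum: "t \<le> real n ==> zK K t cf = (\<Sum>q\<in>actK n K cf. indicator {0<..t} (fst (pos cf q)) * snd (pos cf q)) - t * (Ms 1 K - Ms (-1) K)"
proof -
 assume t: "t \<le> real n"
 have "zK K t cf = (\<Sum>q\<in>actK n K cf. indicator {0<..t} (fst (pos cf q)) * (if e K < \<bar>snd (pos cf q)\<bar> then snd (pos cf q) else 0)) - t * (Ms 1 K - Ms (-1) K)"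
  by (rule zK_finite_sum[OF lf t order_refl])
 also have "(\<Sum>q\<in>actK n K cf. indicator {0<..t} (fst (pos cf q)) * (if e K < \<bar>snd (pos cf q)\<bar> then snd (pos cf q) else 0)) = (\<Sum>q\<in>actK n K cf. indicator {0<..t} (fst (pos cf q)) * snd (pos cf q))"
  by (intro sum.cong) (auto simp: actK_def)
 finally show ?thesis .
qed

lemma zK_limits:
 assumes t: "t < real n"
 shows "((\<lambda>s. zK K s cf) \<longlongrightarrow> zK K t cf) (at t within ({0..real n} \<inter> {t<..}))"
  and "((\<lambda>s. zK K s cf) \<longlongrightarrow> zK K t cf - (\<Sum>q\<in>actK n K cf. if fst (pos cf q) = t then snd (pos cf q) else 0)) (at t within ({0..real n} \<inter> {..<t}))"
proof -
 let ?S = "\<lambda>I. \<Sum>q\<in>actK n K cf. indicat_real I (fst (pos cf q)) * snd (pos cf q)"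
 let ?f = "\<lambda>s. ?S {0<..s} - s * (Ms 1 K - Ms (-1) K)"
 have e: "eventually (\<lambda>s. zK K s cf = ?f s) (at t within ({0..real n} \<inter> A))" for A
  by (auto simp: eventually_at_filter zK_sum)
 have "(?f \<longlongrightarrow> ?S {0<..t} - t * (Ms 1 K - Ms (-1) K)) (at t within ({0..real n} \<inter> {t<..}))"
  by (intro tendsto_intros tendsto_indicator_right)
 then show "((\<lambda>s. zK K s cf) \<longlongrightarrow> zK K t cf) (at t within ({0..real n} \<inter> {t<..}))"
  unfolding tendsto_cong[OF e] zK_sum[OF less_imp_le[OF t]] .
 have "(?f \<longlongrightarrow> ?S {0<..<t} - t * (Ms 1 K - Ms (-1) K)) (at t within ({0..real n} \<inter> {..<t}))"
  by (intro tendsto_intros tendsto_indicator_left)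
 moreover have "?S {0<..t} = ?S {0<..<t} + (\<Sum>q\<in>actK n K cf. if fst (pos cf q) = t then snd (pos cf q) else 0)"
  unfolding sum.distrib[symmetric] using time_pos by (intro sum.cong) (auto simp: indicator_def)
 ultimately show "((\<lambda>s. zK K s cf) \<longlongrightarrow> zK K t cf - (\<Sum>q\<in>actK n K cf. if fst (pos cf q) = t then snd (pos cf q) else 0)) (at t within ({0..real n} \<inter> {..<t}))"
  unfolding tendsto_cong[OF e] zK_sum[OF less_imp_le[OF t]] by (simp add: algebra_simps)
qed

text \<open>Each \<open>zK\<close> is right-continuous, so the bounds at rational times extend to all
  times.\<close>

lemma cau_real:
 "\<exists>K0. \<forall>K\<ge>K0. \<forall>t\<in>{0..real n}. \<bar>zK K t cf - zK K0 t cf\<bar> \<le> 1 / real (Suc j)"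
proof -
 obtain K0 where K0: "\<And>K r. K0 \<le> K ==> 0 \<le> (r::rat) ==> r \<le> of_nat (Suc n) ==> \<bar>zK K (of_rat r) cf - zK K0 (of_rat r) cf\<bar> \<le> 1 / real (Suc j)"
  using cu[unfolded cau_def, rule_format, of "Suc n" j] by blast
 show ?thesis
 proof (intro exI[of _ K0] allI impI ballI, rule ccontr)
  fix K t assume K: "K0 \<le> K" and t: "t \<in> {0..real n}" and n: "\<not> \<bar>zK K t cf - zK K0 t cf\<bar> \<le> 1 / real (Suc j)"
  let ?F = "at t within ({0..real (Suc n)} \<inter> {t<..})"
  have tn: "t < real (Suc n)" using t by auto
  have "((\<lambda>s. \<bar>zK K s cf - zK K0 s cf\<bar>) \<longlongrightarrow> \<bar>zK K t cf - zK K0 t cf\<bar>) ?F"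
   by (intro tendsto_intros zK_limits(1)[OF tn])
  then have "eventually (\<lambda>s. 1 / real (Suc j) < \<bar>zK K s cf - zK K0 s cf\<bar>) ?F"
   by (rule order_tendstoD) (use n in auto)
  then obtain d where d: "d > 0" "\<And>s. s \<in> {0..real (Suc n)} \<inter> {t<..} ==> s \<noteq> t ==> dist s t < d ==> 1 / real (Suc j) < \<bar>zK K s cf - zK K0 s cf\<bar>"
   unfolding eventually_at by auto
  obtain r where r: "t < of_rat r" "of_rat r < min (t + d) (real (Suc n))"
   using of_rat_dense[of t "min (t + d) (real (Suc n))"] d(1) tn by auto
  have r0: "0 \<le> r"
  proof -
   have "0 < real_of_rat r" using r(1) t unfolding atLeastAtMost_iff by linarith
   then show ?thesis by (simp only: zero_less_of_rat_iff less_imp_le)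
  qed
  have "1 / real (Suc j) < \<bar>zK K (of_rat r) cf - zK K0 (of_rat r) cf\<bar>"
   using r t r0 by (intro d(2)) (auto simp: dist_real_def)
  moreover note r0
  moreover have "r \<le> of_nat (Suc n)"
   using r(2) by (metis less_eq_real_def min_less_iff_conj of_rat_less_eq of_rat_of_nat_eq)
  ultimately show False using K0[OF K, of r] by linarith
 qed
qed

lemma lev_uniform: "uniform_limit {0..real n} (\<lambda>K t. zK K t cf) (\<lambda>t. lev t cf) sequentially"
proof -
 have "uniformly_Cauchy_on {0..real n} (\<lambda>K t. zK K t cf)"
  unfolding uniformly_Cauchy_on_def
 proof (intro allI impI)
  fix \<epsilon> :: real assume "\<epsilon> > 0"
  then obtain j where j: "1 / real (Suc j) < \<epsilon> / 2" using nat_approx_posE[of "\<epsilon>/2"] by (metis half_gt_zero of_nat_Suc)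
  obtain K0 where K0: "\<And>K t. K0 \<le> K ==> t \<in> {0..real n} ==> \<bar>zK K t cf - zK K0 t cf\<bar> \<le> 1 / real (Suc j)"
   using cau_real[of n j] by blast
  show "\<exists>M. \<forall>t\<in>{0..real n}. \<forall>m\<ge>M. \<forall>k\<ge>M. dist (zK m t cf) (zK k t cf) < \<epsilon>"
  proof (intro exI[of _ K0] ballI allI impI)
   fix t m k assume "t \<in> {0..real n}" "K0 \<le> m" "K0 \<le> k"
   then show "dist (zK m t cf) (zK k t cf) < \<epsilon>"
    using K0[of m t] K0[of k t] j unfolding dist_real_def by linarith
  qed
 qed
 from Cauchy_uniformly_convergent[OF this] show ?thesis
  using g unfolding uniformly_convergent_uniform_limit_iff lev_def by simp
qed

lemma lev_tendsto: "0 \<le> t ==> (\<lambda>K. zK K t cf) \<longlonglongrightarrow> lev t cf"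
 using tendsto_uniform_limitI[OF lev_uniform[of "nat \<lceil>t\<rceil>"], of t] real_nat_ceiling_ge[of t] by auto

lemma at_within_restrict: "t < real n ==> at t within ({0..real n} \<inter> A) = at t within ({0..} \<inter> A)"
 by (rule at_within_nhd[of t "{..<real n}"]) auto

lemma lev_right: "0 \<le> t ==> ((\<lambda>s. lev s cf) \<longlongrightarrow> lev t cf) (at t within ({0..} \<inter> {t<..}))"
proof -
 assume t0: "0 \<le> t"
 define n where "n = nat \<lceil>t\<rceil> + 1"
 have t: "t < real n" using real_nat_ceiling_ge[of t] by (simp add: n_def)
 have "((\<lambda>s. lev s cf) \<longlongrightarrow> lev t cf) (at t within ({0..real n} \<inter> {t<..}))"
 proof (rule swap_uniform_limit[where F=sequentially and f="\<lambda>K s. zK K s cf" and g="\<lambda>K. zK K t cf"])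
  show "\<forall>\<^sub>F K in sequentially. ((\<lambda>s. zK K s cf) \<longlongrightarrow> zK K t cf) (at t within ({0..real n} \<inter> {t<..}))"
   using zK_limits(1)[OF t] by simp
  show "uniform_limit ({0..real n} \<inter> {t<..}) (\<lambda>K s. zK K s cf) (\<lambda>s. lev s cf) sequentially"
   by (rule uniform_limit_on_subset[OF lev_uniform]) auto
 qed (use lev_tendsto[OF t0] in auto)
 then show ?thesis unfolding at_within_restrict[OF t] .
qed

text \<open>Left limits pass to the uniform limit of the \<open>zK\<close>. At a given time there is at most
  one jump, and \<open>zK\<close> contains it as soon as \<open>e K\<close> is below its size.\<close>

lemma lev_left: "0 < t ==> ((\<lambda>s. lev s cf) \<longlongrightarrow> lev t cf - xat cf t) (at t within ({0..} \<inter> {..<t}))"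
proof -
 assume t0: "0 < t"
 define n where "n = nat \<lceil>t\<rceil> + 1"
 have t: "t < real n" using real_nat_ceiling_ge[of t] by (simp add: n_def)
 define h where "h K = (\<Sum>q\<in>actK n K cf. if fst (pos cf q) = t then snd (pos cf q) else 0)" for K
 have h: "h \<longlonglongrightarrow> xat cf t"
 proof (cases "\<exists>q\<in>act cf. fst (pos cf q) = t")
  case True
  then obtain q where q: "q \<in> act cf" "fst (pos cf q) = t" by blast
  have x: "xat cf t = snd (pos cf q)" using xat_act[OF q(1)] q by simp
  have "\<forall>\<^sub>F K in sequentially. e K < \<bar>snd (pos cf q)\<bar>"
   using order_tendstoD(2)[OF e_lim, of "\<bar>snd (pos cf q)\<bar>"] act_nonzero[OF q(1)] by simp
  then have "\<forall>\<^sub>F K in sequentially. h K = xat cf t"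
  proof eventually_elim
   case (elim K)
   have "q \<in> actK n K cf" using q elim t t0 by (simp add: actK_def)
   moreover have "fst (pos cf q') = t ==> q' = q" for q' using q time_inj[of q' q] by simp
   ultimately have "h K = (\<Sum>q'\<in>{q}. if fst (pos cf q') = t then snd (pos cf q') else 0)"
    unfolding h_def by (intro sum.mono_neutral_right finite_actK[OF lf]) auto
   then show ?case using q x by simp
  qed
  then show ?thesis by (rule tendsto_eventually)
 next
  case False
  then have "h = (\<lambda>K. 0)" unfolding h_def fun_eq_iff by (intro allI sum.neutral) (auto simp: actK_def)
  moreover have "xat cf t = 0" using False by (simp add: xat_def)
  ultimately show ?thesis by (simp only: tendsto_const)
 qed
 have "((\<lambda>s. lev s cf) \<longlongrightarrow> lev t cf - xat cf t) (at t within ({0..real n} \<inter> {..<t}))"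
 proof (rule swap_uniform_limit[where F=sequentially and f="\<lambda>K s. zK K s cf" and g="\<lambda>K. zK K t cf - h K"])
  show "\<forall>\<^sub>F K in sequentially. ((\<lambda>s. zK K s cf) \<longlongrightarrow> zK K t cf - h K) (at t within ({0..real n} \<inter> {..<t}))"
   using zK_limits(2)[OF t] by (simp add: h_def)
  show "uniform_limit ({0..real n} \<inter> {..<t}) (\<lambda>K s. zK K s cf) (\<lambda>s. lev s cf) sequentially"
   by (rule uniform_limit_on_subset[OF lev_uniform]) auto
  show "(\<lambda>K. zK K t cf - h K) \<longlonglongrightarrow> lev t cf - xat cf t"
   by (rule tendsto_diff[OF lev_tendsto[OF less_imp_le[OF t0]] h])
 qed simp
 then show ?thesis unfolding at_within_restrict[OF t] .
qed

lemma jump_lev: "0 < t ==> jump (\<lambda>t. lev t cf) t = xat cf t"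
proof -
 assume t: "0 < t"
 have "at t within ({0..} \<inter> {..<t}) = at_left t"
  by (rule at_within_nhd[of t "{0<..}"]) (use t in auto)
 then have "((\<lambda>s. lev s cf) \<longlongrightarrow> lev t cf - xat cf t) (at_left t)" using lev_left[OF t] by simp
 then have "Lim (at_left t) (\<lambda>s. lev s cf) = lev t cf - xat cf t" by (intro tendsto_Lim) auto
 then show ?thesis by (simp add: jump_def)
qed

text \<open>The path jumps exactly at the times of the active points, so its jump measure is the Poisson
  random measure.\<close>

lemma jumps_bij: "bij_betw (\<lambda>q. fst (pos cf q)) (act cf) {s. 0 < s \<and> jump (\<lambda>t. lev t cf) s \<noteq> 0}"
 unfolding bij_betw_def
proof
 show "inj_on (\<lambda>q. fst (pos cf q)) (act cf)" using time_inj by (auto intro!: inj_onI)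
 show "(\<lambda>q. fst (pos cf q)) ` act cf = {s. 0 < s \<and> jump (\<lambda>t. lev t cf) s \<noteq> 0}"
 proof (intro equalityI subsetI)
  fix s assume "s \<in> (\<lambda>q. fst (pos cf q)) ` act cf"
  then obtain q where q: "q \<in> act cf" "s = fst (pos cf q)" by auto
  then show "s \<in> {s. 0 < s \<and> jump (\<lambda>t. lev t cf) s \<noteq> 0}"
   using time_pos[of q] xat_act[OF q(1)] act_nonzero[OF q(1)] by (simp add: jump_lev)
 next
  fix s assume "s \<in> {s. 0 < s \<and> jump (\<lambda>t. lev t cf) s \<noteq> 0}"
  then have "xat cf s \<noteq> 0" by (auto simp: jump_lev)
  then show "s \<in> (\<lambda>q. fst (pos cf q)) ` act cf" by (auto simp: xat_def split: if_splits)
 qed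
qed

lemma pos_jump: "q \<in> act cf ==> (fst (pos cf q), jump (\<lambda>t. lev t cf) (fst (pos cf q))) = pos cf q"
 using time_pos[of q] xat_act[of q] by (simp add: jump_lev)

lemma nn_integral_jump_measure:
 assumes W: "W \<in> borel_measurable borel"
 shows "(\<integral>\<^sup>+p. W p \<partial>jump_measure (\<lambda>t. lev t cf)) = J cf W"
proof -
 let ?S = "{s. 0 < s \<and> jump (\<lambda>t. lev t cf) s \<noteq> 0}"
 have "(\<integral>\<^sup>+p. W p \<partial>jump_measure (\<lambda>t. lev t cf)) = (\<integral>\<^sup>+s. W (s, jump (\<lambda>t. lev t cf) s) \<partial>count_space ?S)"
  unfolding jump_measure_def using W by (subst nn_integral_distr) auto
 also have "\<dots> = (\<integral>\<^sup>+q. W (fst (pos cf q), jump (\<lambda>t. lev t cf) (fst (pos cf q))) \<partial>count_space (act cf))"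
  by (rule nn_integral_bij_count_space[OF jumps_bij, symmetric])
 also have "\<dots> = J cf W"
  unfolding J_eq_sum_active by (intro nn_integral_cong) (simp only: pos_jump space_count_space)
 finally show ?thesis .
qed

lemma integral_jump_measure:
 assumes W: "W \<in> borel_measurable borel" and z: "\<And>q. q \<in> act cf - actK n K cf ==> W (pos cf q) = 0"
 shows "(LINT p|jump_measure (\<lambda>t. lev t cf). W p) = (\<Sum>q\<in>actK n K cf. W (pos cf q) :: real)"
proof -
 let ?S = "{s. 0 < s \<and> jump (\<lambda>t. lev t cf) s \<noteq> 0}"
 have "(LINT p|jump_measure (\<lambda>t. lev t cf). W p) = (LINT s|count_space ?S. W (s, jump (\<lambda>t. lev t cf) s))"
  unfolding jump_measure_def using W by (subst integral_distr) auto
 also have "\<dots> = (LINT q|count_space (act cf). W (fst (pos cf q), jump (\<lambda>t. lev t cf) (fst (pos cf q))))"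
  by (rule integral_bij_count_space[OF jumps_bij, symmetric])
 also have "\<dots> = (LINT q|count_space (act cf). W (pos cf q))"
  by (intro Bochner_Integration.integral_cong refl) (simp only: pos_jump space_count_space)
 also have "\<dots> = (\<Sum>q | q \<in> act cf \<and> W (pos cf q) \<noteq> 0. W (pos cf q))"
  by (rule lebesgue_integral_count_space_finite_support) (rule finite_subset[OF _ finite_actK[OF lf, of n K]], use z in auto)
 also have "\<dots> = (\<Sum>q\<in>actK n K cf. W (pos cf q))"
  using z by (intro sum.mono_neutral_left finite_actK[OF lf]) (auto simp: actK_def)
 finally show ?thesis .
qed

end

lemma cadlag_lev: "cadlag_on {0..} (\<lambda>t. lev t cf)"
proof (cases "good cf")
 case True
 show ?thesis unfolding cadlag_on_def
 proof (intro ballI conjI)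
  fix t :: real assume t: "t \<in> {0..}"
  show "((\<lambda>t. lev t cf) \<longlongrightarrow> lev t cf) (at t within ({0..} \<inter> {t<..}))" using lev_right[OF True] t by simp
  show "\<exists>l. ((\<lambda>t. lev t cf) \<longlongrightarrow> l) (at t within ({0..} \<inter> {..<t}))"
  proof (cases "t = 0")
   case True
   have "{0..} \<inter> {..<0 :: real} = {}" by auto
   then show ?thesis unfolding True by simp
  next
   case False then show ?thesis using lev_left[OF True, of t] t by auto
  qed
 qed
qed (auto simp: cadlag_on_def lev_def)

lemma nn_integral_jump_measure_bad:
 "\<not> good cf ==> W \<in> borel_measurable borel ==> (\<integral>\<^sup>+p. W p \<partial>jump_measure (\<lambda>t. lev t cf)) = 0"
proof -
 assume b: "\<not> good cf" and W: "W \<in> borel_measurable borel"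
 have "Lim (at_left t) (\<lambda>t. 0 :: real) = 0" for t :: real by (intro tendsto_Lim) auto
 then have "{s. 0 < s \<and> jump (\<lambda>t. lev t cf) s \<noteq> 0} = {}" using b by (auto simp: lev_def jump_def)
 then show ?thesis using W unfolding jump_measure_def by (subst nn_integral_distr) (auto simp: nn_integral_empty)
qed

lemma nn_integral_jumps:
 "W \<in> borel_measurable borel ==> (\<integral>\<^sup>+p. W p \<partial>jump_measure (\<lambda>t. lev t cf)) = (if good cf then J cf W else 0)"
 using nn_integral_jump_measure nn_integral_jump_measure_bad by simp

lemma natural_filtration_past:
 assumes A: "A \<in> natural_filtration L lev s"
 shows "(\<forall>u. 0 \<le> u \<longrightarrow> u \<le> s \<longrightarrow> lev u cf = lev u cf') ==> cf \<in> A \<longleftrightarrow> cf' \<in> A"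
 using A unfolding natural_filtration_def
proof (induction rule: sigma_sets.induct)
 case (Basic a)
 then show ?case by (auto simp: space_L)
qed (auto simp: space_L)

lemma natural_filtration_sets: "A \<in> natural_filtration L lev s ==> A \<in> sets L"
 unfolding natural_filtration_def
 by (erule sigma_sets.induct) (auto intro!: measurable_sets)

text \<open>Mecke's formula with \<open>G\<close> the indicator of an event before time \<open>s\<close> and
  \<open>F\<close> supported by times after \<open>s\<close>.\<close>

lemma compensator_rectangles:
 assumes st: "0 \<le> s" "s \<le> t" and A: "A \<in> natural_filtration L lev s" and B[measurable]: "B \<in> sets borel"
 shows "(\<integral>\<^sup>+cf. indicator A cf * (\<integral>\<^sup>+p. indicator ({s<..t} \<times> B) p \<partial>jump_measure (\<lambda>t. lev t cf)) \<partial>L)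
  = emeasure L A * (\<integral>\<^sup>+p. indicator ({s<..t} \<times> B) p \<partial>levy_compensator \<Lambda>)"
proof -
 have A'[measurable]: "A \<in> sets L" by (rule natural_filtration_sets[OF A])
 have m: "indicator ({s<..t} \<times> B) \<in> borel_measurable (borel \<Otimes>\<^sub>M borel)" by (intro borel_measurable_indicator pair_measureI) auto
 have m': "indicator ({s<..t} \<times> B) \<in> borel_measurable (borel :: (real \<times> real) measure)" using m by (simp add: borel_prod)
 have "(\<integral>\<^sup>+cf. indicator A cf * (\<integral>\<^sup>+p. indicator ({s<..t} \<times> B) p \<partial>jump_measure (\<lambda>t. lev t cf)) \<partial>L) = (\<integral>\<^sup>+cf. indicator A cf * J cf (indicator ({s<..t} \<times> B)) \<partial>L)"
  using AE_good by (intro nn_integral_cong_AE) (auto elim!: eventually_mono simp: nn_integral_jumps[OF m'])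
 also have "\<dots> = (\<integral>\<^sup>+cf. indicator A cf \<partial>L) * (\<integral>\<^sup>+p. indicator ({s<..t} \<times> B) p \<partial>levy_compensator \<Lambda>)"
 proof (rule mecke_past[OF _ m])
  show "indicator A (swp c i cf) = (indicator A cf :: ennreal)" if "i < fst (cf c)" for cf c i
   using natural_filtration_past[OF A, of "swp c i cf" cf] that by (auto simp: lev_swp indicator_def)
  fix c
  show "AE cf in L. AE p in point (snd c). indicator ({s<..t} \<times> B) (tim c p) \<noteq> (0::ennreal) \<longrightarrow> indicator A (add c p cf) = (indicator A cf :: ennreal)"
   using AE_good
  proof eventually_elim
   case (elim cf)
   show ?case using AE_add_ok[of c cf]
   proof eventually_elim
    case (elim p)
    show ?case
    proof
     assume "indicator ({s<..t} \<times> B) (tim c p) \<noteq> (0::ennreal)"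
     then have "s < fst (tim c p)" by (auto simp: indicator_def split: if_splits)
     then have "lev u (add c p cf) = lev u cf" if "u \<le> s" for u
      using that elim \<open>good cf\<close> by (intro lev_add) auto
     then show "indicator A (add c p cf) = (indicator A cf :: ennreal)"
      using natural_filtration_past[OF A, of "add c p cf" cf] by (auto simp: indicator_def)
    qed
   qed
  qed
 qed measurable
 finally show ?thesis by simp
qed

end

section \<open>Mean-square approximation by large jumps\<close>

context levy_cells begin

text \<open>Like \<open>fs\<close>, for an arbitrary threshold \<open>\<epsilon>\<close>; \<open>h2\<close> is
  the part between the threshold \<open>e K\<close> and \<open>\<epsilon>\<close>.\<close>

definition fe :: "real => real => real => real" where
 "fe \<sigma> \<epsilon> x = (if \<epsilon> < \<bar>x\<bar> then max 0 (\<sigma> * x) else 0)"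
definition Me :: "real => real => real" where "Me \<sigma> \<epsilon> = enn2real (\<integral>\<^sup>+x. ennreal (fe \<sigma> \<epsilon> x) \<partial>\<Lambda>)"
definition h2 :: "real => real => nat => real => real" where
 "h2 \<sigma> \<epsilon> K x = (if e K < \<bar>x\<bar> \<and> \<bar>x\<bar> \<le> \<epsilon> then max 0 (\<sigma> * x) else 0)"
definition Mh :: "real => real => nat => real" where "Mh \<sigma> \<epsilon> K = enn2real (\<integral>\<^sup>+x. ennreal (h2 \<sigma> \<epsilon> K x) \<partial>\<Lambda>)"
definition small :: "real => ennreal" where "small \<epsilon> = (\<integral>\<^sup>+ x. ennreal (x\<^sup>2) * indicator {x. \<bar>x\<bar> \<le> \<epsilon>} x \<partial>\<Lambda>)"

lemma measurable_fe[measurable]: "fe \<sigma> \<epsilon> \<in> borel_measurable borel" unfolding fe_def[abs_def] by measurable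
lemma measurable_h2[measurable]: "h2 \<sigma> \<epsilon> K \<in> borel_measurable borel" unfolding h2_def[abs_def] by measurable
lemma fe_nonneg: "0 \<le> fe \<sigma> \<epsilon> x" and h2_nonneg: "0 \<le> h2 \<sigma> \<epsilon> K x" by (auto simp: fe_def h2_def)
lemma fs_split: "e K \<le> \<epsilon> ==> fs \<sigma> K x = fe \<sigma> \<epsilon> x + h2 \<sigma> \<epsilon> K x" by (auto simp: fs_def fe_def h2_def)

lemma Me_eq: "\<bar>\<sigma>\<bar> = 1 ==> 0 < \<epsilon> ==> (\<integral>\<^sup>+x. ennreal (fe \<sigma> \<epsilon> x) \<partial>\<Lambda>) = ennreal (Me \<sigma> \<epsilon>)"
 unfolding Me_def using tail_first_moment[of "fe \<sigma> \<epsilon>" \<epsilon>]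
 by (subst ennreal_enn2real) (auto simp: fe_def abs_if split: if_splits)

lemma Mh_eq: "\<bar>\<sigma>\<bar> = 1 ==> (\<integral>\<^sup>+x. ennreal (h2 \<sigma> \<epsilon> K x) \<partial>\<Lambda>) = ennreal (Mh \<sigma> \<epsilon> K)"
 unfolding Mh_def using tail_first_moment[of "h2 \<sigma> \<epsilon> K" "e K"] e_pos[of K]
 by (subst ennreal_enn2real) (auto simp: h2_def abs_if split: if_splits)

lemma Ms_split: "\<bar>\<sigma>\<bar> = 1 ==> 0 < \<epsilon> ==> e K \<le> \<epsilon> ==> Ms \<sigma> K = Me \<sigma> \<epsilon> + Mh \<sigma> \<epsilon> K"
proof -
 assume s: "\<bar>\<sigma>\<bar> = 1" and e0: "0 < \<epsilon>" and eK: "e K \<le> \<epsilon>"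
 have "ennreal (Ms \<sigma> K) = (\<integral>\<^sup>+x. ennreal (fe \<sigma> \<epsilon> x) + ennreal (h2 \<sigma> \<epsilon> K x) \<partial>\<Lambda>)"
  by (simp add: Ms_eq[OF s, symmetric] fs_split[OF eK] ennreal_plus fe_nonneg h2_nonneg)
 also have "\<dots> = ennreal (Me \<sigma> \<epsilon>) + ennreal (Mh \<sigma> \<epsilon> K)"
  by (subst nn_integral_add) (auto simp: Me_eq[OF s e0] Mh_eq[OF s] intro!: measurable_to_\<Lambda>)
 also have "\<dots> = ennreal (Me \<sigma> \<epsilon> + Mh \<sigma> \<epsilon> K)" by (rule ennreal_plus[symmetric]) (auto simp: Me_def Mh_def)
 finally show ?thesis by (subst (asm) ennreal_inj) (auto simp: Me_def Mh_def Ms_def)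
qed

lemma small_mono: "\<epsilon> \<le> \<epsilon>' ==> small \<epsilon> \<le> small \<epsilon>'"
 unfolding small_def by (intro nn_integral_mono mult_left_mono) (auto simp: indicator_def)

lemma small_le_1: "small \<epsilon> \<le> 1"
 unfolding small_def \<Lambda>2[symmetric] by (intro nn_integral_mono) (auto simp: indicator_def)

lemma h2_second: "\<bar>\<sigma>\<bar> = 1 ==> (\<integral>\<^sup>+x. ennreal ((h2 \<sigma> \<epsilon> K x)\<^sup>2) \<partial>\<Lambda>) \<le> small \<epsilon>"
 unfolding small_def
proof (rule nn_integral_mono)
 fix x assume s: "\<bar>\<sigma>\<bar> = 1"
 have "(h2 \<sigma> \<epsilon> K x)\<^sup>2 \<le> x\<^sup>2"
  using s by (auto simp: h2_def max_def power_mult_distrib abs_if split: if_splits)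
 moreover have "h2 \<sigma> \<epsilon> K x = 0" if "\<not> \<bar>x\<bar> \<le> \<epsilon>" using that by (simp add: h2_def)
 ultimately show "ennreal ((h2 \<sigma> \<epsilon> K x)\<^sup>2) \<le> ennreal (x\<^sup>2) * indicator {x. \<bar>x\<bar> \<le> \<epsilon>} x"
  by (auto simp: indicator_def ennreal_leI)
qed

definition big_jumps :: "real => real => config => real" where
 "big_jumps \<epsilon> t cf = cpt (fe 1 \<epsilon>) (Me 1 \<epsilon>) t cf - cpt (fe (-1) \<epsilon>) (Me (-1) \<epsilon>) t cf"

lemma measurable_big_jumps[measurable]: "big_jumps \<epsilon> t \<in> borel_measurable L"
 unfolding big_jumps_def[abs_def] by measurable

lemma big_jumps_eq:
 assumes g: "good cf" and t: "0 \<le> t" and e0: "0 < \<epsilon>"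
 shows "(LINT p:{0<..t} \<times> {x. \<epsilon> < \<bar>x\<bar>}|jump_measure (\<lambda>t. lev t cf). snd p) - t * (LINT x:{x. \<epsilon> < \<bar>x\<bar>}|\<Lambda>. x) = big_jumps \<epsilon> t cf"
proof -
 define n where "n = nat \<lceil>t\<rceil>"
 have tn: "t \<le> real n" unfolding n_def by (rule real_nat_ceiling_ge)
 obtain K where K: "e K < \<epsilon>" using order_tendstoD(2)[OF e_lim e0] by (auto simp: eventually_sequentially)
 have m: "(\<lambda>p. indicat_real ({0<..t} \<times> {x. \<epsilon> < \<bar>x\<bar>}) p * snd p) \<in> borel_measurable borel"
 proof -
  have "{x::real. \<epsilon> < \<bar>x\<bar>} \<in> sets borel" by simp
  then have "{0<..t} \<times> {x. \<epsilon> < \<bar>x\<bar>} \<in> sets (borel \<Otimes>\<^sub>M borel)" by auto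
  then have "{0<..t} \<times> {x. \<epsilon> < \<bar>x\<bar>} \<in> sets borel" by (simp only: borel_prod)
  moreover have "snd \<in> borel_measurable (borel :: (real \<times> real) measure)" by (intro borel_measurable_continuous_onI continuous_intros)
  ultimately show ?thesis by (intro borel_measurable_times borel_measurable_indicator)
 qed
 have "(LINT p:{0<..t} \<times> {x. \<epsilon> < \<bar>x\<bar>}|jump_measure (\<lambda>t. lev t cf). snd p) = (LINT p|jump_measure (\<lambda>t. lev t cf). indicat_real ({0<..t} \<times> {x. \<epsilon> < \<bar>x\<bar>}) p * snd p)"
  by (simp add: set_lebesgue_integral_def)
 also have "\<dots> = (\<Sum>q\<in>actK n K cf. indicat_real ({0<..t} \<times> {x. \<epsilon> < \<bar>x\<bar>}) (pos cf q) * snd (pos cf q))"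
  by (rule integral_jump_measure[OF g m]) (use tn K in \<open>auto simp: actK_def indicator_def\<close>)
 also have "\<dots> = (\<Sum>q\<in>actK n K cf. indicator {0<..t} (fst (pos cf q)) * fe 1 \<epsilon> (snd (pos cf q))) - (\<Sum>q\<in>actK n K cf. indicator {0<..t} (fst (pos cf q)) * fe (-1) \<epsilon> (snd (pos cf q)))"
  unfolding sum_subtractf[symmetric]
 proof (rule sum.cong[OF refl])
  fix q
  have "fe 1 \<epsilon> x - fe (-1) \<epsilon> x = (if \<epsilon> < \<bar>x\<bar> then x else 0)" for x by (auto simp: fe_def)
  then show "indicat_real ({0<..t} \<times> {x. \<epsilon> < \<bar>x\<bar>}) (pos cf q) * snd (pos cf q) = indicator {0<..t} (fst (pos cf q)) * fe 1 \<epsilon> (snd (pos cf q)) - indicator {0<..t} (fst (pos cf q)) * fe (-1) \<epsilon> (snd (pos cf q))"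
   unfolding right_diff_distrib[symmetric] by (cases "pos cf q") (auto simp: indicator_def)
 qed
 finally have 1: "(LINT p:{0<..t} \<times> {x. \<epsilon> < \<bar>x\<bar>}|jump_measure (\<lambda>t. lev t cf). snd p) = (\<Sum>q\<in>actK n K cf. indicator {0<..t} (fst (pos cf q)) * fe 1 \<epsilon> (snd (pos cf q))) - (\<Sum>q\<in>actK n K cf. indicator {0<..t} (fst (pos cf q)) * fe (-1) \<epsilon> (snd (pos cf q)))" .
 have i: "integrable \<Lambda> (fe \<sigma> \<epsilon>)" "(LINT x|\<Lambda>. fe \<sigma> \<epsilon> x) = Me \<sigma> \<epsilon>" if "\<bar>\<sigma>\<bar> = 1" for \<sigma>
 proof -
  have m: "fe \<sigma> \<epsilon> \<in> borel_measurable \<Lambda>" by (rule measurable_to_\<Lambda>[OF measurable_fe])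
  have ae: "AE x in \<Lambda>. 0 \<le> fe \<sigma> \<epsilon> x" by (rule AE_I2) (rule fe_nonneg)
  have nn: "0 \<le> Me \<sigma> \<epsilon>" unfolding Me_def by (rule enn2real_nonneg)
  have "integrable \<Lambda> (fe \<sigma> \<epsilon>) \<and> (LINT x|\<Lambda>. fe \<sigma> \<epsilon> x) = Me \<sigma> \<epsilon>"
   by (rule iffD1[OF nn_integral_eq_integrable[OF m ae nn] Me_eq[OF that e0]])
  then show "integrable \<Lambda> (fe \<sigma> \<epsilon>)" "(LINT x|\<Lambda>. fe \<sigma> \<epsilon> x) = Me \<sigma> \<epsilon>" by simp_all
 qed
 have "(LINT x:{x. \<epsilon> < \<bar>x\<bar>}|\<Lambda>. x) = (LINT x|\<Lambda>. fe 1 \<epsilon> x - fe (-1) \<epsilon> x)"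
  unfolding set_lebesgue_integral_def by (intro Bochner_Integration.integral_cong) (auto simp: fe_def indicator_def)
 also have "\<dots> = Me 1 \<epsilon> - Me (-1) \<epsilon>" using i[of 1] i[of "-1"] by simp
 finally have 2: "(LINT x:{x. \<epsilon> < \<bar>x\<bar>}|\<Lambda>. x) = Me 1 \<epsilon> - Me (-1) \<epsilon>" .
 have lf: "locfin cf" using g by (simp add: good_def)
 have z: "\<bar>x\<bar> \<le> e K ==> fe \<sigma> \<epsilon> x = 0" for x \<sigma> using K by (auto simp: fe_def)
 have c: "cpt (fe \<sigma> \<epsilon>) m t cf = (\<Sum>q\<in>actK n K cf. indicator {0<..t} (fst (pos cf q)) * fe \<sigma> \<epsilon> (snd (pos cf q))) - t * m" for \<sigma> m
  by (rule cpt_finite_sum[OF lf tn fe_nonneg z])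
 show ?thesis unfolding 1 2 big_jumps_def c by (simp add: right_diff_distrib)
qed

text \<open>Between \<open>\<epsilon>\<close> and \<open>e K\<close> the difference is a compensated sum over
  the jumps in that range, whose variance is bounded by that of all jumps below \<open>\<epsilon>\<close>, up
  to a constant; Fatou's lemma lets \<open>K\<close> tend to infinity.\<close>

lemma big_jumps_L2:
 assumes t: "0 \<le> t" and e0: "0 < \<epsilon>"
 shows "(\<integral>\<^sup>+cf. ennreal ((big_jumps \<epsilon> t cf - lev t cf)\<^sup>2) \<partial>L) \<le> ennreal (4 * t) * small \<epsilon>"
proof -
 obtain K1 where K1: "\<And>K. K1 \<le> K ==> e K < \<epsilon>" using order_tendstoD(2)[OF e_lim e0] by (auto simp: eventually_sequentially)
 define H where "H K cf = cpt (h2 1 \<epsilon> K) (Mh 1 \<epsilon> K) t cf - cpt (h2 (-1) \<epsilon> K) (Mh (-1) \<epsilon> K) t cf" for K cf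
 have mH[measurable]: "H K \<in> borel_measurable L" for K unfolding H_def by measurable
 have H: "zK K t cf - big_jumps \<epsilon> t cf = H K cf" if g: "good cf" and K: "K1 \<le> K" for cf K
 proof -
  have lf: "locfin cf" using g by (simp add: good_def)
  have eK: "e K \<le> \<epsilon>" using K1[OF K] by simp
  have tn: "t \<le> real (nat \<lceil>t\<rceil>)" by (rule real_nat_ceiling_ge)
  have z: "\<bar>x\<bar> \<le> e K ==> fe \<sigma> \<epsilon> x = 0" "\<bar>x\<bar> \<le> e K ==> h2 \<sigma> \<epsilon> K x = 0" "\<bar>x\<bar> \<le> e K ==> fs \<sigma> K x = 0" for x \<sigma>
   using eK by (auto simp: fe_def h2_def fs_def)
  have "cpt (fs \<sigma> K) (Ms \<sigma> K) t cf - cpt (fe \<sigma> \<epsilon>) (Me \<sigma> \<epsilon>) t cf = cpt (h2 \<sigma> \<epsilon> K) (Mh \<sigma> \<epsilon> K) t cf" if s: "\<bar>\<sigma>\<bar> = 1" for \<sigma>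
  proof -
   let ?S = "\<lambda>f. \<Sum>q\<in>actK (nat \<lceil>t\<rceil>) K cf. indicator {0<..t} (fst (pos cf q)) * f (snd (pos cf q))"
   have "cpt (fs \<sigma> K) (Ms \<sigma> K) t cf = ?S (fs \<sigma> K) - t * Ms \<sigma> K" by (rule cpt_finite_sum[OF lf tn fs_nonneg z(3)])
   moreover have "cpt (fe \<sigma> \<epsilon>) (Me \<sigma> \<epsilon>) t cf = ?S (fe \<sigma> \<epsilon>) - t * Me \<sigma> \<epsilon>" by (rule cpt_finite_sum[OF lf tn fe_nonneg z(1)])
   moreover have "cpt (h2 \<sigma> \<epsilon> K) (Mh \<sigma> \<epsilon> K) t cf = ?S (h2 \<sigma> \<epsilon> K) - t * Mh \<sigma> \<epsilon> K" by (rule cpt_finite_sum[OF lf tn h2_nonneg z(2)])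
   moreover have "?S (fs \<sigma> K) = ?S (fe \<sigma> \<epsilon>) + ?S (h2 \<sigma> \<epsilon> K)" by (simp add: fs_split[OF eK] distrib_left sum.distrib)
   ultimately show ?thesis by (simp add: Ms_split[OF s e0 eK] distrib_left)
  qed
  from this[of 1] this[of "-1"] show ?thesis by (simp add: zK_def big_jumps_def H_def)
 qed
 have HH: "(\<integral>\<^sup>+cf. ennreal ((H K cf)\<^sup>2) \<partial>L) \<le> ennreal (4 * t) * small \<epsilon>" for K
 proof -
  have one: "integrable L (\<lambda>cf. (cpt (h2 \<sigma> \<epsilon> K) (Mh \<sigma> \<epsilon> K) t cf)\<^sup>2) \<and> (LINT cf|L. (cpt (h2 \<sigma> \<epsilon> K) (Mh \<sigma> \<epsilon> K) t cf)\<^sup>2) \<le> t * enn2real (small \<epsilon>)" if s: "\<bar>\<sigma>\<bar> = 1" for \<sigma>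
  proof -
   define v where "v = enn2real (\<integral>\<^sup>+x. ennreal ((h2 \<sigma> \<epsilon> K x)\<^sup>2) \<partial>\<Lambda>)"
   have le: "(\<integral>\<^sup>+x. ennreal ((h2 \<sigma> \<epsilon> K x)\<^sup>2) \<partial>\<Lambda>) \<le> 1" using h2_second[OF s] small_le_1 by (rule order_trans)
   have v: "(\<integral>\<^sup>+x. ennreal ((h2 \<sigma> \<epsilon> K x)\<^sup>2) \<partial>\<Lambda>) = ennreal v" "0 \<le> v"
    unfolding v_def using le_less_trans[OF le] by (simp_all add: less_top)
   have "v \<le> enn2real (small \<epsilon>)"
    unfolding v_def using h2_second[OF s] small_le_1[of \<epsilon>] by (intro enn2real_mono) (auto intro: le_less_trans)
   then show ?thesis
    using cpt_moments(2,3)[OF measurable_h2 h2_nonneg Mh_eq[OF s] _ v t] t by (simp add: Mh_def mult_left_mono)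
  qed
  note p = one[of 1, simplified] and n = one[of "-1", simplified]
  have "(\<integral>\<^sup>+cf. ennreal ((H K cf)\<^sup>2) \<partial>L) \<le> (\<integral>\<^sup>+cf. ennreal (2 * (cpt (h2 1 \<epsilon> K) (Mh 1 \<epsilon> K) t cf)\<^sup>2 + 2 * (cpt (h2 (-1) \<epsilon> K) (Mh (-1) \<epsilon> K) t cf)\<^sup>2) \<partial>L)"
  proof (intro nn_integral_mono ennreal_leI)
   fix cf
   have "(a - b)\<^sup>2 \<le> 2 * a\<^sup>2 + 2 * b\<^sup>2" for a b :: real
    using zero_le_power2[of "a + b"] by (simp add: power2_eq_square algebra_simps)
   then show "(H K cf)\<^sup>2 \<le> 2 * (cpt (h2 1 \<epsilon> K) (Mh 1 \<epsilon> K) t cf)\<^sup>2 + 2 * (cpt (h2 (-1) \<epsilon> K) (Mh (-1) \<epsilon> K) t cf)\<^sup>2"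
    unfolding H_def .
  qed
  also have "\<dots> = ennreal (LINT cf|L. 2 * (cpt (h2 1 \<epsilon> K) (Mh 1 \<epsilon> K) t cf)\<^sup>2 + 2 * (cpt (h2 (-1) \<epsilon> K) (Mh (-1) \<epsilon> K) t cf)\<^sup>2)"
   using p n by (intro nn_integral_eq_integral) auto
  also have "\<dots> \<le> ennreal (4 * t * enn2real (small \<epsilon>))" using p n by (intro ennreal_leI) simp
  also have "\<dots> = ennreal (4 * t) * small \<epsilon>"
   using t le_less_trans[OF small_le_1[of \<epsilon>]] by (subst ennreal_mult) (auto simp: less_top)
  finally show ?thesis .
 qed
 have "(\<integral>\<^sup>+cf. ennreal ((big_jumps \<epsilon> t cf - lev t cf)\<^sup>2) \<partial>L) = (\<integral>\<^sup>+cf. liminf (\<lambda>K. ennreal ((H (K + K1) cf)\<^sup>2)) \<partial>L)"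
 proof (rule nn_integral_cong_AE)
  show "AE cf in L. ennreal ((big_jumps \<epsilon> t cf - lev t cf)\<^sup>2) = liminf (\<lambda>K. ennreal ((H (K + K1) cf)\<^sup>2))"
   using AE_good
  proof eventually_elim
   case (elim cf)
   have "(\<lambda>K. ennreal ((zK (K + K1) t cf - big_jumps \<epsilon> t cf)\<^sup>2)) \<longlonglongrightarrow> ennreal ((lev t cf - big_jumps \<epsilon> t cf)\<^sup>2)"
    by (intro tendsto_intros LIMSEQ_ignore_initial_segment lev_tendsto[OF elim t])
   then have "(\<lambda>K. ennreal ((H (K + K1) cf)\<^sup>2)) \<longlonglongrightarrow> ennreal ((big_jumps \<epsilon> t cf - lev t cf)\<^sup>2)"
    by (simp add: H[OF elim] power2_commute)
   then show ?case by (intro lim_imp_Liminf[symmetric]) auto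
  qed
 qed
 also have "\<dots> \<le> liminf (\<lambda>K. \<integral>\<^sup>+cf. ennreal ((H (K + K1) cf)\<^sup>2) \<partial>L)" by (rule nn_integral_liminf) measurable
 also have "\<dots> \<le> liminf (\<lambda>K. ennreal (4 * t) * small \<epsilon>)" by (intro Liminf_mono always_eventually allI HH)
 finally show ?thesis by (simp add: Liminf_const)
qed

lemma big_jumps_tendsto:
 assumes t: "0 \<le> t"
 shows "((\<lambda>\<epsilon>. \<integral>\<^sup>+cf. ennreal ((big_jumps \<epsilon> t cf - lev t cf)\<^sup>2) \<partial>L) \<longlongrightarrow> 0) (at_right 0)"
proof (rule order_tendstoI)
 fix y :: ennreal assume y: "0 < y"
 have "(\<lambda>K. ennreal (4 * t * (1/8)^K)) \<longlonglongrightarrow> ennreal 0"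
  by (intro tendsto_intros tendsto_mult_right_zero LIMSEQ_realpow_zero) auto
 then have "eventually (\<lambda>K. ennreal (4 * t * (1/8)^K) < y) sequentially" by (rule order_tendstoD) (use y in simp)
 then obtain K where K: "ennreal (4 * t * (1/8)^K) < y" by (auto simp: eventually_sequentially)
 have "eventually (\<lambda>\<epsilon>. \<epsilon> \<in> {0<..<e K}) (at_right 0)" by (rule eventually_at_right_real[OF e_pos])
 then show "eventually (\<lambda>\<epsilon>. (\<integral>\<^sup>+cf. ennreal ((big_jumps \<epsilon> t cf - lev t cf)\<^sup>2) \<partial>L) < y) (at_right 0)"
 proof eventually_elim
  case (elim \<epsilon>)
  have "(\<integral>\<^sup>+cf. ennreal ((big_jumps \<epsilon> t cf - lev t cf)\<^sup>2) \<partial>L) \<le> ennreal (4 * t) * small \<epsilon>"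
   using elim by (intro big_jumps_L2[OF t]) auto
  also have "\<dots> \<le> ennreal (4 * t) * small (e K)" using elim by (intro mult_left_mono small_mono) auto
  also have "\<dots> \<le> ennreal (4 * t) * ennreal ((1/8)^K)" unfolding small_def by (intro mult_left_mono e_small) auto
  also have "\<dots> = ennreal (4 * t * (1/8)^K)" using t by (intro ennreal_mult[symmetric]) auto
  finally show ?case using K by simp
 qed
qed simp

section \<open>Existence of the noise\<close>

text \<open>The noise distributions are images of measures on pairs of functions \<open>real => real\<close>.
  The configuration is therefore coded by such a function, which stores its entries at natural
  numbers.\<close>

definition idx :: "nat \<times> nat => nat => nat => real" where
 "idx c i q = real (prod_encode (prod_encode c, prod_encode (i, q)))"

definition dec :: "(real => real) => config" where
 "dec x c = (nat \<lfloor>x (idx c 0 0)\<rfloor>, \<lambda>i. (x (idx c i 1), x (idx c i 2)))"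

definition enc :: "config => (real => real)" where
 "enc cf r = (let (c', iq) = prod_decode (nat \<lfloor>r\<rfloor>); (i, q) = prod_decode iq; c = prod_decode c'
   in if q = 0 then real (fst (cf c)) else if q = 1 then fst (snd (cf c) i) else snd (snd (cf c) i))"

lemma dec_enc: "dec (enc cf) = cf"
 by (rule ext) (auto simp: dec_def enc_def idx_def Let_def)

text \<open>The code carries the coarsest \<open>\<sigma>\<close>-algebra for which decoding is measurable, so
  that no measurability question about the coding itself arises.\<close>

definition coded :: "(real => real) measure" where
 "coded = distr L (vimage_algebra UNIV dec L) enc"

lemma measurable_dec: "dec \<in> measurable coded L"
 unfolding coded_def by (simp add: space_L measurable_vimage_algebra1)

lemma measurable_enc: "enc \<in> measurable L (vimage_algebra UNIV dec L)"
 by (rule measurable_vimage_algebra2) (auto simp: dec_enc)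

lemma prob_space_coded: "prob_space coded"
 unfolding coded_def by (rule L.prob_space_distr[OF measurable_enc])

lemma distr_dec: "distr coded L dec = L"
proof -
 have "distr coded L dec = distr L L (dec \<circ> enc)"
  unfolding coded_def by (rule distr_distr) (auto simp: space_L measurable_vimage_algebra1 measurable_enc)
 then show ?thesis by (simp add: o_def dec_enc distr_id2)
qed

end

text \<open>The semidirect product of \<open>M\<close> with a kernel, characterised by iterated
  integrals.\<close>

lemma kernel_measure_exists:
 fixes \<kappa> :: "'w => 'b measure"
 assumes s: "\<And>\<omega>. sets (\<kappa> \<omega>) = sets N"
  and m: "\<And>W :: _ => ennreal. W \<in> borel_measurable (M \<Otimes>\<^sub>M N) ==> (\<lambda>\<omega>. \<integral>\<^sup>+p. W (\<omega>, p) \<partial>\<kappa> \<omega>) \<in> borel_measurable M"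
 shows "\<exists>K. sets K = sets (M \<Otimes>\<^sub>M N) \<and> (\<forall>W\<in>borel_measurable (M \<Otimes>\<^sub>M N). (\<integral>\<^sup>+x. W x \<partial>K) = (\<integral>\<^sup>+\<omega>. \<integral>\<^sup>+p. W (\<omega>, p) \<partial>\<kappa> \<omega> \<partial>M))"
proof -
 let ?P = "M \<Otimes>\<^sub>M N"
 define \<mu> where "\<mu> X = (\<integral>\<^sup>+\<omega>. \<integral>\<^sup>+p. indicator X (\<omega>, p) \<partial>\<kappa> \<omega> \<partial>M)" for X
 define K where "K = measure_of (space ?P) (sets ?P) \<mu>"
 have sK: "sets K = sets ?P" by (simp add: K_def)
 have sec: "(\<lambda>p. W (\<omega>, p)) \<in> borel_measurable (\<kappa> \<omega>)" if "W \<in> borel_measurable ?P" "\<omega> \<in> space M" for W :: "_ => ennreal" and \<omega>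
  using measurable_compose[OF measurable_Pair1'[OF that(2)] that(1)] by (simp add: measurable_cong_sets[OF s refl])
 have eK: "emeasure K X = \<mu> X" if X: "X \<in> sets ?P" for X
  unfolding K_def
 proof (rule emeasure_measure_of_sigma[OF sets.sigma_algebra_axioms _ _ X])
  show "positive (sets ?P) \<mu>" by (simp add: positive_def \<mu>_def)
  show "countably_additive (sets ?P) \<mu>"
  proof (rule countably_additiveI)
   fix A :: "nat => _" assume A: "range A \<subseteq> sets ?P" "disjoint_family A"
   have i: "(indicator (\<Union>i. A i) x :: ennreal) = (\<Sum>i. indicator (A i) x)" for x using suminf_indicator[OF A(2)] by simp
   have Am: "indicator (A i) \<in> borel_measurable ?P" for i using A by auto
   have "\<mu> (\<Union>i. A i) = (\<integral>\<^sup>+\<omega>. (\<Sum>i. \<integral>\<^sup>+p. indicator (A i) (\<omega>, p) \<partial>\<kappa> \<omega>) \<partial>M)"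
    unfolding \<mu>_def i by (intro nn_integral_cong nn_integral_suminf sec Am)
   also have "\<dots> = (\<Sum>i. \<mu> (A i))" unfolding \<mu>_def by (intro nn_integral_suminf m Am)
   finally show "(\<Sum>i. \<mu> (A i)) = \<mu> (\<Union>i. A i)" ..
  qed
 qed
 have "(\<integral>\<^sup>+x. W x \<partial>K) = (\<integral>\<^sup>+\<omega>. \<integral>\<^sup>+p. W (\<omega>, p) \<partial>\<kappa> \<omega> \<partial>M)" if "W \<in> borel_measurable ?P" for W
  using that
 proof (induction rule: borel_measurable_induct)
  case (cong f g)
  have "(\<integral>\<^sup>+x. f x \<partial>K) = (\<integral>\<^sup>+x. g x \<partial>K)"
   using cong(3) sets_eq_imp_space_eq[OF sK] by (intro nn_integral_cong) simp
  moreover have "(\<integral>\<^sup>+\<omega>. \<integral>\<^sup>+p. f (\<omega>, p) \<partial>\<kappa> \<omega> \<partial>M) = (\<integral>\<^sup>+\<omega>. \<integral>\<^sup>+p. g (\<omega>, p) \<partial>\<kappa> \<omega> \<partial>M)"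
   by (intro nn_integral_cong cong(3)) (simp add: space_pair_measure sets_eq_imp_space_eq[OF s])
  ultimately show ?case using cong(4) by simp
 next
  case (set A)
  then show ?case by (simp add: eK \<mu>_def sK)
 next
  case (mult u c)
  then show ?case by (simp add: nn_integral_cmult sec m sK measurable_cong_sets[OF sK refl] cong: nn_integral_cong)
 next
  case (add u v)
  then show ?case by (simp add: nn_integral_add sec m measurable_cong_sets[OF sK refl] cong: nn_integral_cong)
 next
  case (seq U)
  have S: "Sup (range U) x = (SUP i. U i x)" for x by (simp add: image_image)
  have "(\<integral>\<^sup>+x. (SUP i. U i x) \<partial>K) = (SUP i. \<integral>\<^sup>+x. U i x \<partial>K)"
   using seq by (intro nn_integral_monotone_convergence_SUP) (simp_all add: measurable_cong_sets[OF sK refl])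
  also have "\<dots> = (SUP i. \<integral>\<^sup>+\<omega>. \<integral>\<^sup>+p. U i (\<omega>, p) \<partial>\<kappa> \<omega> \<partial>M)" using seq by simp
  also have "\<dots> = (\<integral>\<^sup>+\<omega>. (SUP i. \<integral>\<^sup>+p. U i (\<omega>, p) \<partial>\<kappa> \<omega>) \<partial>M)"
   using seq by (intro nn_integral_monotone_convergence_SUP[symmetric] m) (auto simp: incseq_def le_fun_def intro!: nn_integral_mono)
  also have "\<dots> = (\<integral>\<^sup>+\<omega>. \<integral>\<^sup>+p. (SUP i. U i (\<omega>, p)) \<partial>\<kappa> \<omega> \<partial>M)"
   using seq by (intro nn_integral_cong nn_integral_monotone_convergence_SUP[symmetric] sec) (auto simp: incseq_def le_fun_def)
  finally show ?case unfolding S .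
 qed
 then show ?thesis using sK by blast
qed

text \<open>Rectangles generate the predictable \<open>\<sigma>\<close>-algebra and are closed under
  intersections. The two measures to be compared, \<open>M\<close> times the random measure and
  \<open>M\<close> times its compensator, are \<open>\<sigma>\<close>-finite on the times \<open>s > 0\<close>
  and sizes \<open>x \<noteq> 0\<close>, and null outside, so the uniqueness theorem for measures
  applies.\<close>

lemma has_compensator_rectangles:
 fixes M :: "'w measure" and \<mu> :: "'w => (real \<times> real) measure" and \<nu> :: "(real \<times> real) measure" and C :: "nat => real set"
 assumes M: "prob_space M"
  and z: "\<And>t. 0 \<le> t ==> z t \<in> borel_measurable M"
  and m\<mu>: "\<And>W :: _ => ennreal. W \<in> borel_measurable (M \<Otimes>\<^sub>M borel) ==> (\<lambda>\<omega>. \<integral>\<^sup>+p. W (\<omega>, p) \<partial>\<mu> \<omega>) \<in> borel_measurable M"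
  and s\<mu>: "\<And>\<omega>. sets (\<mu> \<omega>) = sets borel" and s\<nu>: "sets \<nu> = sets borel"
  and C: "\<And>n. C n \<in> sets borel" "(\<Union>n. C n) = UNIV - {0}"
  and fin: "\<And>i j. emeasure \<nu> ({0<..real i} \<times> C j) < \<infinity>"
  and supp\<mu>: "\<And>\<omega>. emeasure (\<mu> \<omega>) (- ({0<..} \<times> (UNIV - {0}))) = 0"
  and supp\<nu>: "emeasure \<nu> (- ({0<..} \<times> (UNIV - {0}))) = 0"
  and rect: "\<And>s t A B. 0 \<le> s ==> s \<le> t ==> A \<in> natural_filtration M z s ==> B \<in> sets borel ==>
   (\<integral>\<^sup>+\<omega>. indicator A \<omega> * (\<integral>\<^sup>+p. indicator ({s<..t} \<times> B) p \<partial>\<mu> \<omega>) \<partial>M) = emeasure M A * (\<integral>\<^sup>+p. indicator ({s<..t} \<times> B) p \<partial>\<nu>)"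
 shows "has_compensator M (natural_filtration M z) \<mu> \<nu>"
proof -
 interpret M: prob_space M by fact
 let ?F = "natural_filtration M z" and ?P = "M \<Otimes>\<^sub>M (borel :: (real \<times> real) measure)" and ?T = "{0<..} \<times> (UNIV - {0}) :: (real \<times> real) set"
 let ?D = "predictable_marked M ?F"
 define G where "G = {A \<times> ({s<..t} \<times> B) | A s t B. 0 \<le> s \<and> s \<le> t \<and> A \<in> ?F s \<and> B \<in> sets (borel :: real measure)}"
 have F_alg: "sigma_algebra (space M) (?F s)" for s unfolding natural_filtration_def by (rule sigma_algebra_sigma_sets) auto
 have F_sets: "A \<in> ?F s ==> A \<in> sets M" for A s
  unfolding natural_filtration_def by (erule sigma_sets.induct) (auto intro!: measurable_sets z)
 have F_mono: "?F s \<subseteq> ?F s'" if "s \<le> s'" for s s'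
  unfolding natural_filtration_def using that by (intro sigma_sets_mono') fastforce
 have F_space: "space M \<in> ?F s" for s unfolding natural_filtration_def by (rule sigma_sets_top)
 have Gsub: "G \<subseteq> Pow (space M \<times> UNIV)" using F_sets sets.sets_into_space by (fastforce simp: G_def)
 have sp: "sets ?D = sigma_sets (space M \<times> UNIV) G" "space ?D = space M \<times> UNIV"
  unfolding predictable_marked_def G_def[symmetric] using Gsub by auto
 have rb: "X \<times> B \<in> sets borel" if "X \<in> sets borel" "B \<in> sets borel" for X B :: "real set"
  using pair_measureI[OF that] by (simp only: borel_prod)
 have spP: "space ?P = space M \<times> UNIV" by (simp add: space_pair_measure)
 have "G \<subseteq> sets ?P" using F_sets rb by (auto simp: G_def)
 then have sub: "sets ?D \<subseteq> sets ?P" unfolding sp using sets.sigma_sets_subset[of G ?P] spP by simp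
 have intst: "Int_stable G"
 proof (rule Int_stableI)
  fix a b assume "a \<in> G" "b \<in> G"
  then obtain A s t B A' s' t' B' where a: "a = A \<times> ({s<..t} \<times> B)" "0 \<le> s" "s \<le> t" "A \<in> ?F s" "B \<in> sets borel"
   and b: "b = A' \<times> ({s'<..t'} \<times> B')" "0 \<le> s'" "s' \<le> t'" "A' \<in> ?F s'" "B' \<in> sets borel"
   unfolding G_def by blast
  define s2 where "s2 = max s s'"
  define t2 where "t2 = max s2 (min t t')"
  interpret F: sigma_algebra "space M" "?F s2" by (rule F_alg)
  have "{s<..t} \<inter> {s'<..t'} = {s2<..t2}" unfolding s2_def t2_def by auto
  then have "a \<inter> b = (A \<inter> A') \<times> ({s2<..t2} \<times> (B \<inter> B'))" unfolding a b by (auto simp: Times_Int_Times)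
  moreover have "A \<inter> A' \<in> ?F s2" using a b F_mono[of s s2] F_mono[of s' s2] by (intro F.Int) (auto simp: s2_def)
  moreover have "0 \<le> s2" "s2 \<le> t2" "B \<inter> B' \<in> sets borel" using a b by (auto simp: s2_def t2_def)
  ultimately show "a \<inter> b \<in> G" unfolding G_def by blast
 qed
 \<comment> \<open>sets of finite intensity that exhaust the positive times and the nonzero sizes\<close>
 define E where "E i j = {0<..real i} \<times> C j" for i j :: nat
 have E: "E i j \<in> sets borel" for i j unfolding E_def using C rb by auto
 have EU: "(\<Union>i. \<Union>j. E i j) = ?T"
 proof -
  have "(\<Union>i. {0<..real i}) = {0<..}" by (auto intro: real_arch_simple)
  then show ?thesis unfolding E_def C(2)[symmetric] by blast
 qed
 have Tb: "?T \<in> sets borel" unfolding EU[symmetric] using E by auto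
 interpret \<nu>: sigma_finite_measure \<nu>
 proof
  show "\<exists>A. countable A \<and> A \<subseteq> sets \<nu> \<and> \<Union>A = space \<nu> \<and> (\<forall>a\<in>A. emeasure \<nu> a \<noteq> \<infinity>)"
  proof (intro exI[of _ "insert (- ?T) (range (case_prod E))"] conjI)
   show "\<Union> (insert (- ?T) (range (case_prod E))) = space \<nu>" using EU sets_eq_imp_space_eq[OF s\<nu>] by auto
   show "\<forall>a\<in>insert (- ?T) (range (case_prod E)). emeasure \<nu> a \<noteq> \<infinity>" using fin supp\<nu> by (auto simp: E_def less_top)
  qed (use Tb E s\<nu> in auto)
 qed
 define I where "I \<kappa> X = (\<integral>\<^sup>+\<omega>. \<integral>\<^sup>+p. indicator X (\<omega>, p) \<partial>\<kappa> \<omega> \<partial>M)" for \<kappa> :: "'w => (real \<times> real) measure" and X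
 obtain K1 where K1: "sets K1 = sets ?P" "\<And>W. W \<in> borel_measurable ?P ==> (\<integral>\<^sup>+x. W x \<partial>K1) = (\<integral>\<^sup>+\<omega>. \<integral>\<^sup>+p. W (\<omega>, p) \<partial>\<mu> \<omega> \<partial>M)"
  using kernel_measure_exists[of \<mu> borel M, OF s\<mu> m\<mu>] by blast
 have K2: "sets (M \<Otimes>\<^sub>M \<nu>) = sets ?P" by (intro sets_pair_measure_cong refl s\<nu>)
 have iK2: "(\<integral>\<^sup>+x. W x \<partial>(M \<Otimes>\<^sub>M \<nu>)) = (\<integral>\<^sup>+\<omega>. \<integral>\<^sup>+p. W (\<omega>, p) \<partial>\<nu> \<partial>M)" if "W \<in> borel_measurable ?P" for W
  using \<nu>.nn_integral_fst[of W M] that by (simp add: measurable_cong_sets[OF K2 refl])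
 have idm: "(\<lambda>x. x) \<in> measurable K ?D" if "sets K = sets ?P" for K
  using sub that sets_eq_imp_space_eq[OF that] spP sp(2) by (auto simp: measurable_def)
 define D1 where "D1 = distr K1 ?D (\<lambda>x. x)"
 define D2 where "D2 = distr (M \<Otimes>\<^sub>M \<nu>) ?D (\<lambda>x. x)"
 have eD: "emeasure D1 X = I \<mu> X" "emeasure D2 X = I (\<lambda>_. \<nu>) X" if X: "X \<in> sets ?D" for X
 proof -
  have i: "indicator X \<in> borel_measurable ?P" "X \<in> sets K1" "X \<in> sets (M \<Otimes>\<^sub>M \<nu>)" using X sub K1(1) K2 by auto
  show "emeasure D1 X = I \<mu> X" "emeasure D2 X = I (\<lambda>_. \<nu>) X"
   using i K1(2)[OF i(1)] iK2[OF i(1)] X idm[OF K1(1)] idm[OF K2] sets.sets_into_space[OF i(2)] sets.sets_into_space[OF i(3)]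
   by (simp_all add: D1_def D2_def emeasure_distr I_def Int_absorb2)
 qed
 have prod: "I \<kappa> (A \<times> R) = (\<integral>\<^sup>+\<omega>. indicator A \<omega> * (\<integral>\<^sup>+p. indicator R p \<partial>\<kappa> \<omega>) \<partial>M)" if "R \<in> sets borel" "\<And>\<omega>. sets (\<kappa> \<omega>) = sets borel" for \<kappa> A R
 proof -
  have "(\<integral>\<^sup>+p. indicator (A \<times> R) (\<omega>, p) \<partial>\<kappa> \<omega>) = indicator A \<omega> * (\<integral>\<^sup>+p. indicator R p \<partial>\<kappa> \<omega>)" for \<omega>
   using that by (simp add: indicator_times nn_integral_cmult_indicator)
  then show ?thesis unfolding I_def by simp
 qed
 have rect_eq: "A \<times> ({s<..t} \<times> B) \<in> sets ?D \<and> emeasure D1 (A \<times> ({s<..t} \<times> B)) = emeasure D2 (A \<times> ({s<..t} \<times> B))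
   \<and> emeasure D1 (A \<times> ({s<..t} \<times> B)) = emeasure M A * (\<integral>\<^sup>+p. indicator ({s<..t} \<times> B) p \<partial>\<nu>)"
  if h: "0 \<le> s" "s \<le> t" "A \<in> ?F s" "B \<in> sets borel" for s t A B
 proof -
  have g: "A \<times> ({s<..t} \<times> B) \<in> sets ?D" unfolding sp using h by (intro sigma_sets.Basic) (auto simp: G_def)
  have b: "{s<..t} \<times> B \<in> sets borel" using h by (intro rb) auto
  show ?thesis using g rect[OF h] F_sets[OF h(3)]
   by (simp add: eD[OF g] prod[OF b s\<mu>] prod[OF b, of "\<lambda>_. \<nu>"] s\<nu> nn_integral_multc)
 qed
 let ?\<Omega> = "space M \<times> ?T"
 let ?E = "{(\<lambda>x. x) -` a \<inter> ?\<Omega> | a. a \<in> G}"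
 have rE: "space M \<times> E i j \<in> G" for i j
  unfolding E_def G_def mem_Collect_eq
  by (rule exI[of _ "space M"], rule exI[of _ 0], rule exI[of _ "real i"], rule exI[of _ "C j"]) (use F_space[of 0] C in simp)
 have \<Omega>E: "?\<Omega> = (\<Union>i. \<Union>j. space M \<times> E i j)" unfolding EU[symmetric] by blast
 have \<Omega>D: "?\<Omega> \<in> sets ?D" unfolding \<Omega>E sp by (intro sigma_sets.Union sigma_sets.Basic rE)
 have rs: "sets (restrict_space D ?\<Omega>) = sigma_sets ?\<Omega> ?E" if "sets D = sets ?D" for D
 proof -
  have "sets (restrict_space D ?\<Omega>) = {(\<lambda>x. x) -` a \<inter> ?\<Omega> | a. a \<in> sigma_sets (space M \<times> UNIV) G}"
   unfolding sets_restrict_space that sp by auto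
  also have "\<dots> = sigma_sets ?\<Omega> ?E" by (rule sigma_sets_vimage_commute) auto
  finally show ?thesis .
 qed
 have ae: "AE x in D. x \<in> ?\<Omega>" if "sets D = sets ?D" "emeasure D (space M \<times> - ?T) = 0" for D
 proof (rule AE_I[of _ _ "space M \<times> - ?T"])
  show "{x \<in> space D. x \<notin> ?\<Omega>} \<subseteq> space M \<times> - ?T" using sets_eq_imp_space_eq[OF that(1)] sp(2) by auto
  have "space M \<times> - ?T = space ?D - ?\<Omega>" unfolding sp by auto
  then show "space M \<times> - ?T \<in> sets D" using that(1) sets.compl_sets[OF \<Omega>D] by simp
 qed (rule that(2))
 have "space M \<times> - ?T = space ?D - ?\<Omega>" unfolding sp by auto
 then have null: "space M \<times> - ?T \<in> sets ?D" using sets.compl_sets[OF \<Omega>D] by simp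
 have D: "sets D1 = sets ?D" "sets D2 = sets ?D" by (simp_all add: D1_def D2_def)
 have "D1 = D2"
 proof (rule measure_eqI_restrict_generator[where E="?E" and \<Omega>="?\<Omega>" and A="range (\<lambda>(i, j). space M \<times> E i j)"])
  show "Int_stable ?E"
  proof (rule Int_stableI)
   fix a b assume "a \<in> ?E" "b \<in> ?E"
   then obtain a' b' where "a = a' \<inter> ?\<Omega>" "b = b' \<inter> ?\<Omega>" "a' \<in> G" "b' \<in> G" by auto
   then show "a \<inter> b \<in> ?E" using intst by (auto simp: Int_stable_def intro!: exI[of _ "a' \<inter> b'"])
  qed
  fix X assume "X \<in> ?E"
  then obtain A s t B where X: "X = A \<times> ({s<..t} \<times> B) \<inter> ?\<Omega>" and h: "0 \<le> s" "s \<le> t" "A \<in> ?F s" "B \<in> sets borel" unfolding G_def by auto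
  have "X = A \<times> ({s<..t} \<times> (B - {0}))" unfolding X using h(1) sets.sets_into_space[OF F_sets[OF h(3)]] by auto
  then show "emeasure D1 X = emeasure D2 X" using rect_eq[OF h(1-3), of "B - {0}"] h(4) by simp
 next
  show "AE x in D1. x \<in> ?\<Omega>" "AE x in D2. x \<in> ?\<Omega>"
   using Tb s\<mu> s\<nu> supp\<mu> supp\<nu> by (auto intro!: ae simp: D eD[OF null] prod)
  show "range (\<lambda>(i, j). space M \<times> E i j) \<subseteq> ?E"
  proof clarify
   fix i j
   have "space M \<times> E i j = (\<lambda>x. x) -` (space M \<times> E i j) \<inter> ?\<Omega>" unfolding \<Omega>E by blast
   then show "\<exists>a. space M \<times> E i j = (\<lambda>x. x) -` a \<inter> ?\<Omega> \<and> a \<in> G" using rE by blast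
  qed
  show "\<Union> (range (\<lambda>(i, j). space M \<times> E i j)) = ?\<Omega>" unfolding \<Omega>E by auto
  fix a assume "a \<in> range (\<lambda>(i, j). space M \<times> E i j)"
  then obtain i j where a: "a = space M \<times> ({0<..real i} \<times> C j)" by (auto simp: E_def)
  show "emeasure D1 a \<noteq> \<infinity>"
   using rect_eq[of 0 "real i" "space M" "C j"] F_space C(1) fin[of i j] E[of i j] s\<nu> unfolding a E_def
   by (auto simp: M.emeasure_space_1 less_top)
 qed (use D \<Omega>D rs in auto)
 then show ?thesis
  unfolding has_compensator_def
 proof (intro allI impI)
  fix W :: "'w \<times> real \<times> real => ennreal" assume W: "W \<in> borel_measurable ?D"
  have Wm: "W \<in> borel_measurable ?P" using measurable_compose[OF idm[OF refl] W] .
  show "(\<integral>\<^sup>+\<omega>. (\<integral>\<^sup>+p. W (\<omega>, p) \<partial>\<mu> \<omega>) \<partial>M) = (\<integral>\<^sup>+\<omega>. (\<integral>\<^sup>+p. W (\<omega>, p) \<partial>\<nu>) \<partial>M)"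
   using nn_integral_distr[OF idm[OF K1(1)], of W] nn_integral_distr[OF idm[OF K2], of W] W \<open>D1 = D2\<close>
   by (simp add: D1_def D2_def K1(2)[OF Wm] iK2[OF Wm])
 qed
qed

text \<open>The measure with density \<open>x\<^sup>2\<close> is a probability measure without an atom at
  \<open>0\<close>, so its mass near \<open>0\<close> tends to zero.\<close>

lemma band_radii_exist:
 fixes \<Lambda> :: "real measure"
 assumes s: "sets \<Lambda> = sets borel" and z: "emeasure \<Lambda> {0} = 0" and two: "(\<integral>\<^sup>+ x. ennreal (x\<^sup>2) \<partial>\<Lambda>) = 1"
 shows "\<exists>e. levy_cells \<Lambda> e"
proof -
 have to\<Lambda>: "f \<in> borel_measurable borel ==> f \<in> borel_measurable \<Lambda>" for f :: "real => ennreal"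
  by (simp add: measurable_cong_sets[OF s refl])
 define D where "D = density \<Lambda> (\<lambda>x. ennreal (x\<^sup>2))"
 have mx: "(\<lambda>x. ennreal (x\<^sup>2)) \<in> borel_measurable \<Lambda>" by (rule to\<Lambda>) measurable
 have sD: "sets D = sets borel" "space D = UNIV" using sets_eq_imp_space_eq[OF s] by (auto simp: D_def s)
 interpret D: prob_space D
 proof
  have "emeasure D (space D) = (\<integral>\<^sup>+ x. ennreal (x\<^sup>2) * indicator (space \<Lambda>) x \<partial>\<Lambda>)"
   unfolding D_def by (subst emeasure_density[OF mx]) auto
  also have "\<dots> = (\<integral>\<^sup>+ x. ennreal (x\<^sup>2) \<partial>\<Lambda>)" by (intro nn_integral_cong) simp
  finally show "emeasure D (space D) = 1" using two by simp
 qed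
 have eD: "emeasure D {x. \<bar>x\<bar> \<le> \<epsilon>} = (\<integral>\<^sup>+ x. ennreal (x\<^sup>2) * indicator {x. \<bar>x\<bar> \<le> \<epsilon>} x \<partial>\<Lambda>)" for \<epsilon> :: real
  unfolding D_def by (rule emeasure_density[OF mx]) (simp add: s)
 have "(\<lambda>n. measure D {x. \<bar>x\<bar> \<le> 1 / real (Suc n)}) \<longlonglongrightarrow> measure D (\<Inter>n. {x. \<bar>x\<bar> \<le> 1 / real (Suc n)})"
 proof (rule D.finite_Lim_measure_decseq)
  show "range (\<lambda>n. {x :: real. \<bar>x\<bar> \<le> 1 / real (Suc n)}) \<subseteq> D.events" by (auto simp: sD)
  show "decseq (\<lambda>n. {x :: real. \<bar>x\<bar> \<le> 1 / real (Suc n)})"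
  proof (rule decseq_SucI)
   fix n
   have "1 / real (Suc (Suc n)) \<le> 1 / real (Suc n)" by (simp add: field_simps)
   then show "{x :: real. \<bar>x\<bar> \<le> 1 / real (Suc (Suc n))} \<subseteq> {x. \<bar>x\<bar> \<le> 1 / real (Suc n)}" by (auto intro: order_trans)
  qed
 qed
 moreover have "(\<Inter>n. {x :: real. \<bar>x\<bar> \<le> 1 / real (Suc n)}) = {0}"
 proof (intro equalityI subsetI)
  fix x :: real assume x: "x \<in> (\<Inter>n. {x. \<bar>x\<bar> \<le> 1 / real (Suc n)})"
  show "x \<in> {0}"
  proof (rule ccontr)
   assume "x \<notin> {0}"
   then obtain n where "1 / real (Suc n) < \<bar>x\<bar>" using nat_approx_posE[of "\<bar>x\<bar>"] by (auto simp: inverse_eq_divide)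
   moreover have "\<bar>x\<bar> \<le> 1 / real (Suc n)" using x by blast
   ultimately show False by linarith
  qed
 qed auto
 moreover have "measure D {0} = 0"
 proof -
  have "emeasure D {0} = (\<integral>\<^sup>+ x. ennreal (x\<^sup>2) * indicator {0} x \<partial>\<Lambda>)"
   unfolding D_def by (rule emeasure_density[OF mx]) (simp add: s)
  also have "\<dots> = (\<integral>\<^sup>+ x. 0 \<partial>\<Lambda>)" by (intro nn_integral_cong) (auto simp: indicator_def)
  finally show ?thesis by (simp add: measure_def)
 qed
 ultimately have lim: "(\<lambda>n. measure D {x. \<bar>x\<bar> \<le> 1 / real (Suc n)}) \<longlonglongrightarrow> 0" by simp
 have ex: "\<exists>\<delta>>0. measure D {x. \<bar>x\<bar> \<le> \<delta>} \<le> (1/8)^k" for k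
 proof -
  have "eventually (\<lambda>n. measure D {x. \<bar>x\<bar> \<le> 1 / real (Suc n)} < (1/8)^k) sequentially"
   by (rule order_tendstoD(2)[OF lim]) simp
  then obtain n where "measure D {x. \<bar>x\<bar> \<le> 1 / real (Suc n)} < (1/8)^k" by (auto simp: eventually_sequentially)
  then show ?thesis by (intro exI[of _ "1 / real (Suc n)"]) auto
 qed
 then obtain \<delta> where \<delta>: "\<And>k. 0 < \<delta> k" "\<And>k. measure D {x. \<bar>x\<bar> \<le> \<delta> k} \<le> (1/8)^k" by metis
 define e where "e k = Min ((\<lambda>j. min (\<delta> j) (1 / real (Suc j))) ` {..k})" for k
 have e_le: "e k \<le> \<delta> k" "e k \<le> 1 / real (Suc k)" for k
 proof -
  have "e k \<le> min (\<delta> k) (1 / real (Suc k))" unfolding e_def by (rule Min_le) auto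
  then show "e k \<le> \<delta> k" "e k \<le> 1 / real (Suc k)" by auto
 qed
 have e_pos: "0 < e k" for k unfolding e_def using \<delta>(1) by (subst Min_gr_iff) auto
 have "levy_cells \<Lambda> e"
 proof
  show "sets \<Lambda> = sets borel" by (rule s)
  show "emeasure \<Lambda> {0} = 0" by (rule z)
  show "(\<integral>\<^sup>+ x. ennreal (x\<^sup>2) \<partial>\<Lambda>) = 1" by (rule two)
  show "0 < e k" for k by (rule e_pos)
  show "e (Suc k) \<le> e k" for k unfolding e_def by (intro Min_antimono image_mono) auto
  show "e \<longlonglongrightarrow> 0"
  proof (rule tendsto_sandwich[where f="\<lambda>_. 0" and h="\<lambda>k. 1 / real (Suc k)"])
   show "(\<lambda>k. 1 / real (Suc k)) \<longlonglongrightarrow> 0" using LIMSEQ_inverse_real_of_nat by (simp add: inverse_eq_divide)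
  qed (use e_pos e_le in \<open>auto intro!: always_eventually less_imp_le\<close>)
  fix k
  have "emeasure D {x. \<bar>x\<bar> \<le> e k} \<le> emeasure D {x. \<bar>x\<bar> \<le> \<delta> k}"
   using e_le(1)[of k] by (intro emeasure_mono) (auto simp: sD intro: order_trans)
  also have "\<dots> \<le> ennreal ((1/8)^k)" using \<delta>(2)[of k] by (simp add: D.emeasure_eq_measure ennreal_leI)
  finally show "(\<integral>\<^sup>+ x. ennreal (x\<^sup>2) * indicator {x. \<bar>x\<bar> \<le> e k} x \<partial>\<Lambda>) \<le> ennreal ((1/8)^k)" unfolding eD .
 qed
 then show ?thesis by blast
qed

lemma gauss_compose:
 assumes X: "gauss N X v" and \<pi>: "\<pi> \<in> measurable M N" and d: "distr M N \<pi> = N"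
 shows "gauss M (\<lambda>\<omega>. X (\<pi> \<omega>)) v"
 unfolding gauss_def
proof (intro conjI allI)
 have Xm: "X \<in> borel_measurable N" using X by (simp add: gauss_def)
 show "(\<lambda>\<omega>. X (\<pi> \<omega>)) \<in> borel_measurable M" by (rule measurable_compose[OF \<pi> Xm])
 fix t
 have "(CLINT \<omega>|M. iexp (t * X (\<pi> \<omega>))) = (CLINT x|distr M N \<pi>. iexp (t * X x))"
  using Xm by (intro integral_distr[symmetric] \<pi>) simp
 then show "(CLINT \<omega>|M. iexp (t * X (\<pi> \<omega>))) = complex_of_real (exp (- (t\<^sup>2 * v / 2)))"
  using X by (simp add: d gauss_def)
qed

lemma gfam_compose:
 "gfam N X K S ==> \<pi> \<in> measurable M N ==> distr M N \<pi> = N ==> gfam M (\<lambda>i \<omega>. X i (\<pi> \<omega>)) K S"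
 unfolding gfam_def
proof (intro allI impI)
 assume h: "\<forall>F c. finite F \<and> F \<subseteq> S \<longrightarrow> gauss N (\<lambda>\<omega>. \<Sum>i\<in>F. c i * X i \<omega>) (\<Sum>i\<in>F. \<Sum>j\<in>F. c i * c j * K i j)"
  and \<pi>: "\<pi> \<in> measurable M N" and d: "distr M N \<pi> = N"
 fix F c assume "finite F \<and> F \<subseteq> S"
 then have g: "gauss N (\<lambda>\<omega>. \<Sum>i\<in>F. c i * X i \<omega>) (\<Sum>i\<in>F. \<Sum>j\<in>F. c i * c j * K i j)" using h by blast
 show "gauss M (\<lambda>\<omega>. \<Sum>i\<in>F. c i * X i (\<pi> \<omega>)) (\<Sum>i\<in>F. \<Sum>j\<in>F. c i * c j * K i j)"
  by (rule gauss_compose[OF g \<pi> d])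
qed

lemma (in pair_prob_space) distr_snd: "distr (M1 \<Otimes>\<^sub>M M2) M2 snd = M2"
proof (rule measure_eqI)
 fix A assume "A \<in> sets (distr (M1 \<Otimes>\<^sub>M M2) M2 snd)"
 then have A: "A \<in> sets M2" by simp
 have "snd -` A \<inter> space (M1 \<Otimes>\<^sub>M M2) = space M1 \<times> A"
  using sets.sets_into_space[OF A] by (auto simp: space_pair_measure)
 then show "emeasure (distr (M1 \<Otimes>\<^sub>M M2) M2 snd) A = emeasure M2 A"
  using A by (simp add: emeasure_distr M2.emeasure_pair_measure_Times M1.emeasure_space_1)
qed simp

text \<open>Place the Brownian motion and the configuration on the two factors of a product. This makes
  \<open>w\<close> independent of the jump measure; everything concerning the jump process is pulled back from
  the configurations along the second projection.\<close>

theorem gaussian_noise_exists: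
 fixes \<Lambda> :: "real measure"
 assumes lm: "levy_measure \<Lambda>" and two: "(\<integral>\<^sup>+ x. ennreal (x\<^sup>2) \<partial>\<Lambda>) = 1"
 shows "\<exists>N :: (real => real) measure. prob_space N \<and>
  (\<forall>W \<rho>. gfam Gsp W min {0..} \<longrightarrow> (\<forall>\<omega>. W 0 \<omega> = 0 \<and> continuous_on {0..} (\<lambda>t. W t \<omega>)) \<longrightarrow>
    ou_levy_noise (Gsp \<Otimes>\<^sub>M N) \<Lambda> 0 \<rho> 0 (\<lambda>t \<omega>. \<rho> * W t (fst \<omega>)))"
proof -
 from band_radii_exist[OF _ _ two] lm obtain e where "levy_cells \<Lambda> e" by (auto simp: levy_measure_def)
 then interpret levy_cells \<Lambda> e .
 interpret G: prob_space Gsp by (rule prob_space_Gsp)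
 interpret N: prob_space coded by (rule prob_space_coded)
 interpret P: pair_prob_space Gsp coded ..
 let ?M = "Gsp \<Otimes>\<^sub>M coded"
 define \<eta> where "\<eta> \<omega> = dec (snd \<omega>)" for \<omega> :: "(real => real) \<times> (real => real)"
 have \<eta>: "\<eta> \<in> measurable ?M L" unfolding \<eta>_def by (rule measurable_compose[OF measurable_snd measurable_dec])
 have d\<eta>: "distr ?M L \<eta> = L"
 proof -
  have "distr ?M L \<eta> = distr (distr ?M coded snd) L dec"
   unfolding \<eta>_def by (subst distr_distr) (auto simp: measurable_dec o_def)
  then show ?thesis by (simp only: P.distr_snd distr_dec)
 qed
 have nn: "(\<integral>\<^sup>+\<omega>. f (\<eta> \<omega>) \<partial>?M) = (\<integral>\<^sup>+\<omega>. f \<omega> \<partial>L)" if "f \<in> borel_measurable L" for f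
  using nn_integral_distr[OF \<eta>, of f] that by (simp add: d\<eta>)
 have aeg: "AE \<omega> in ?M. good (\<eta> \<omega>)"
  using AE_distrD[OF \<eta>, of good] AE_good by (simp only: d\<eta>)
 define z where "z t \<omega> = lev t (\<eta> \<omega>)" for t \<omega>
 define \<mu> where "\<mu> \<omega> = jump_measure (\<lambda>t. z t \<omega>)" for \<omega>
 have zm: "z t \<in> borel_measurable ?M" for t unfolding z_def by (rule measurable_compose[OF \<eta> measurable_lev])
 have \<mu>nn: "(\<integral>\<^sup>+p. W p \<partial>\<mu> \<omega>) = (if good (\<eta> \<omega>) then J (\<eta> \<omega>) W else 0)" if "W \<in> borel_measurable borel" for W \<omega>
  unfolding \<mu>_def z_def by (rule nn_integral_jumps[OF that])
 have \<mu>s: "sets (\<mu> \<omega>) = sets borel" for \<omega> by (simp add: \<mu>_def jump_measure_def)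
 have m\<mu>: "(\<lambda>\<omega>. \<integral>\<^sup>+p. W (\<omega>, p) \<partial>\<mu> \<omega>) \<in> borel_measurable ?M" if W: "W \<in> borel_measurable (?M \<Otimes>\<^sub>M borel)" for W
 proof -
  have W': "(\<lambda>(\<omega>, p). W (\<omega>, p)) \<in> borel_measurable (?M \<Otimes>\<^sub>M (borel \<Otimes>\<^sub>M borel))" using W by (simp add: borel_prod)
  have "(\<lambda>\<omega>. J (\<eta> \<omega>) (\<lambda>p. W (\<omega>, p))) \<in> borel_measurable ?M" by (rule measurable_J[OF W' \<eta>])
  moreover have "Measurable.pred ?M (\<lambda>\<omega>. good (\<eta> \<omega>))" by (rule measurable_compose[OF \<eta> pred_good])
  ultimately have "(\<lambda>\<omega>. if good (\<eta> \<omega>) then J (\<eta> \<omega>) (\<lambda>p. W (\<omega>, p)) else 0) \<in> borel_measurable ?M" by measurable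
  moreover have "(\<lambda>p. W (\<omega>, p)) \<in> borel_measurable borel" if "\<omega> \<in> space ?M" for \<omega>
   using measurable_compose[OF measurable_Pair1'[OF that] W] .
  ultimately show ?thesis by (simp add: \<mu>nn cong: measurable_cong)
 qed
 have filt: "\<exists>A'\<in>natural_filtration L lev s. A = \<eta> -` A' \<inter> space ?M" if "A \<in> natural_filtration ?M z s" for A s
 proof -
  have "{z u -` B \<inter> space ?M | u B. 0 \<le> u \<and> u \<le> s \<and> B \<in> sets borel} = {\<eta> -` A' \<inter> space ?M | A'. A' \<in> {lev u -` B \<inter> space L | u B. 0 \<le> u \<and> u \<le> s \<and> B \<in> sets borel}}"
   unfolding z_def space_L by (auto simp: vimage_def)
  then have "natural_filtration ?M z s = {\<eta> -` A' \<inter> space ?M | A'. A' \<in> natural_filtration L lev s}"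
   unfolding natural_filtration_def using sigma_sets_vimage_commute[of \<eta> "space ?M" "space L"] by (simp add: space_L)
  then show ?thesis using that by blast
 qed
 have rb: "{s<..t} \<times> B \<in> sets borel" if "B \<in> sets borel" for s t :: real and B :: "real set"
 proof -
  have "{s<..t} \<times> B \<in> sets (borel \<Otimes>\<^sub>M borel)" using that by auto
  then show ?thesis by (simp only: borel_prod)
 qed
 have comp: "has_compensator ?M (natural_filtration ?M z) \<mu> (levy_compensator \<Lambda>)"
 proof (rule has_compensator_rectangles[where C="\<lambda>n. {x. e n < \<bar>x\<bar>}", OF P.prob_space_axioms zm m\<mu> \<mu>s])
  show sc: "sets (levy_compensator \<Lambda>) = sets borel" by (simp only: sets_compensator borel_prod)
  show "{x. e n < \<bar>x\<bar>} \<in> sets borel" for n by measurable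
  show "(\<Union>n. {x. e n < \<bar>x\<bar>}) = UNIV - {0}"
  proof (intro equalityI subsetI)
   fix x :: real assume "x \<in> UNIV - {0}"
   then show "x \<in> (\<Union>n. {x. e n < \<bar>x\<bar>})" using ex_band[of x] band_sub by blast
  next
   fix x assume "x \<in> (\<Union>n. {x. e n < \<bar>x\<bar>})"
   then obtain n where "e n < \<bar>x\<bar>" by auto
   then show "x \<in> UNIV - {0}" using e_pos[of n] by auto
  qed
  have ec: "emeasure (levy_compensator \<Lambda>) X = (\<integral>\<^sup>+s. indicator {0<..} s * (\<integral>\<^sup>+x. indicator X (s, x) \<partial>\<Lambda>) \<partial>lborel)" if X: "X \<in> sets borel" for X
  proof -
   have "indicator X \<in> borel_measurable (borel \<Otimes>\<^sub>M borel)" using X by (simp add: borel_prod)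
   from nn_integral_compensator[OF this] show ?thesis using X by (simp add: sc)
  qed
  show "emeasure (levy_compensator \<Lambda>) ({0<..real i} \<times> {x. e n < \<bar>x\<bar>}) < \<infinity>" for i n
  proof -
   have "{x :: real. e n < \<bar>x\<bar>} \<in> sets borel" by simp
   from ec[OF rb[OF this]] have "emeasure (levy_compensator \<Lambda>) ({0<..real i} \<times> {x. e n < \<bar>x\<bar>}) = (\<integral>\<^sup>+s. indicator {0<..} s * (\<integral>\<^sup>+x. indicator ({0<..real i} \<times> {x. e n < \<bar>x\<bar>}) (s, x) \<partial>\<Lambda>) \<partial>lborel)" .
   also have "\<dots> = (\<integral>\<^sup>+s. emeasure \<Lambda> {x. e n < \<bar>x\<bar>} * indicator {0<..real i} s \<partial>lborel)"
   proof (rule nn_integral_cong)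
    fix s :: real
    have "(\<integral>\<^sup>+x. indicator ({0<..real i} \<times> {x. e n < \<bar>x\<bar>}) (s, x) \<partial>\<Lambda>) = (\<integral>\<^sup>+x. indicator {0<..real i} s * indicator {x. e n < \<bar>x\<bar>} x \<partial>\<Lambda>)"
     by (intro nn_integral_cong) (simp add: indicator_times)
    also have "\<dots> = indicator {0<..real i} s * emeasure \<Lambda> {x. e n < \<bar>x\<bar>}" by (subst nn_integral_cmult) (simp_all add: sets_\<Lambda> measurable_cong_sets[OF sets_\<Lambda> refl])
    finally have i: "(\<integral>\<^sup>+x. indicator ({0<..real i} \<times> {x. e n < \<bar>x\<bar>}) (s, x) \<partial>\<Lambda>) = indicator {0<..real i} s * emeasure \<Lambda> {x. e n < \<bar>x\<bar>}" .
    show "indicator {0<..} s * (\<integral>\<^sup>+x. indicator ({0<..real i} \<times> {x. e n < \<bar>x\<bar>}) (s, x) \<partial>\<Lambda>) = emeasure \<Lambda> {x. e n < \<bar>x\<bar>} * indicator {0<..real i} s"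
     unfolding i by (cases "0 < s") (simp_all add: mult.commute)
   qed
   also have "\<dots> = emeasure \<Lambda> {x. e n < \<bar>x\<bar>} * ennreal (real i)" by (simp add: nn_integral_cmult)
   also have "\<dots> < \<infinity>" using le_less_trans[OF tail_finite[OF e_pos, of n], of \<top>] by (simp add: ennreal_mult_less_top)
   finally show ?thesis .
  qed
  have op: "- ({0<..} \<times> (UNIV - {0})) \<in> sets (borel :: (real \<times> real) measure)"
  proof -
   have "{0 :: real<..} \<times> (UNIV - {0 :: real}) \<in> sets (borel \<Otimes>\<^sub>M borel)" by (intro pair_measureI) auto
   then have "{0<..} \<times> (UNIV - {0}) \<in> sets (borel :: (real \<times> real) measure)" by (simp only: borel_prod)
   then show ?thesis by (rule borel_comp)
  qed
  show "emeasure (\<mu> \<omega>) (- ({0<..} \<times> (UNIV - {0}))) = 0" for \<omega>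
  proof -
   have "emeasure (\<mu> \<omega>) (- ({0<..} \<times> (UNIV - {0}))) = emeasure (count_space {s. 0 < s \<and> jump (\<lambda>t. z t \<omega>) s \<noteq> 0}) ((\<lambda>s. (s, jump (\<lambda>t. z t \<omega>) s)) -` (- ({0<..} \<times> (UNIV - {0}))) \<inter> {s. 0 < s \<and> jump (\<lambda>t. z t \<omega>) s \<noteq> 0})"
    unfolding \<mu>_def jump_measure_def using op by (subst emeasure_distr) auto
   also have "((\<lambda>s. (s, jump (\<lambda>t. z t \<omega>) s)) -` (- ({0<..} \<times> (UNIV - {0}))) \<inter> {s. 0 < s \<and> jump (\<lambda>t. z t \<omega>) s \<noteq> 0}) = {}" by auto
   finally show ?thesis by simp
  qed
  show "emeasure (levy_compensator \<Lambda>) (- ({0<..} \<times> (UNIV - {0}))) = 0"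
  proof -
   have "(\<integral>\<^sup>+x. indicator (- ({0<..} \<times> (UNIV - {0}))) (s, x) \<partial>\<Lambda>) = (\<integral>\<^sup>+x. indicator {0} x \<partial>\<Lambda>)" if "0 < s" for s :: real
    using that by (intro nn_integral_cong) (auto simp: indicator_def)
   then have "indicator {0<..} s * (\<integral>\<^sup>+x. indicator (- ({0<..} \<times> (UNIV - {0}))) (s, x) \<partial>\<Lambda>) = (0 :: ennreal)" for s :: real
    using \<Lambda>0 by (cases "0 < s") (auto simp: sets_\<Lambda>)
   then have "emeasure (levy_compensator \<Lambda>) (- ({0<..} \<times> (UNIV - {0}))) = (\<integral>\<^sup>+s. 0 \<partial>(lborel :: real measure))"
    unfolding ec[OF op] by (intro nn_integral_cong)
   then show ?thesis by simp
  qed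
  fix s t A B assume st: "0 \<le> s" "s \<le> t" and A: "A \<in> natural_filtration ?M z s" and B: "B \<in> sets (borel :: real measure)"
  obtain A' where A': "A' \<in> natural_filtration L lev s" "A = \<eta> -` A' \<inter> space ?M" using filt[OF A] by blast
  have A's: "A' \<in> sets L" by (rule natural_filtration_sets[OF A'(1)])
  have ind: "indicator ({s<..t} \<times> B) \<in> borel_measurable (borel :: (real \<times> real) measure)" using rb[OF B] by simp
  have ind': "indicator ({s<..t} \<times> B) \<in> borel_measurable (borel \<Otimes>\<^sub>M (borel :: real measure))" using ind by (simp add: borel_prod)
  define f where "f \<omega> = (indicator A' \<omega> * (if good \<omega> then J \<omega> (indicator ({s<..t} \<times> B)) else 0) :: ennreal)" for \<omega>
  have fm: "f \<in> borel_measurable L" unfolding f_def using A's measurable_J'[OF ind'] by measurable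
  have "(\<integral>\<^sup>+\<omega>. indicator A \<omega> * (\<integral>\<^sup>+p. indicator ({s<..t} \<times> B) p \<partial>\<mu> \<omega>) \<partial>?M) = (\<integral>\<^sup>+\<omega>. f (\<eta> \<omega>) \<partial>?M)"
  proof (rule nn_integral_cong)
   fix \<omega> assume w: "\<omega> \<in> space ?M"
   have "indicator A \<omega> = (indicator A' (\<eta> \<omega>) :: ennreal)" unfolding A'(2) indicator_def using w by simp
   then show "indicator A \<omega> * (\<integral>\<^sup>+p. indicator ({s<..t} \<times> B) p \<partial>\<mu> \<omega>) = f (\<eta> \<omega>)"
    by (simp only: f_def \<mu>nn[OF ind])
  qed
  also have "\<dots> = (\<integral>\<^sup>+\<omega>. f \<omega> \<partial>L)" by (rule nn[OF fm])
  also have "\<dots> = (\<integral>\<^sup>+\<omega>. indicator A' \<omega> * (\<integral>\<^sup>+p. indicator ({s<..t} \<times> B) p \<partial>jump_measure (\<lambda>t. lev t \<omega>)) \<partial>L)"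
   unfolding f_def nn_integral_jumps[OF ind] ..
  also have "\<dots> = emeasure L A' * (\<integral>\<^sup>+p. indicator ({s<..t} \<times> B) p \<partial>levy_compensator \<Lambda>)"
   by (rule compensator_rectangles[OF st A'(1) B])
  also have "emeasure L A' = emeasure ?M A"
   using emeasure_distr[OF \<eta>, of A'] A's by (simp add: d\<eta> A'(2))
  finally show "(\<integral>\<^sup>+\<omega>. indicator A \<omega> * (\<integral>\<^sup>+p. indicator ({s<..t} \<times> B) p \<partial>\<mu> \<omega>) \<partial>?M) = emeasure ?M A * (\<integral>\<^sup>+p. indicator ({s<..t} \<times> B) p \<partial>levy_compensator \<Lambda>)" .
 qed
 have cint: "compensated_integral ?M \<mu> \<Lambda> z"
  unfolding compensated_integral_def
 proof (intro allI impI)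
  fix t :: real assume t: "0 \<le> t"
  have "eventually (\<lambda>\<epsilon>. (\<integral>\<^sup>+ \<omega>. ennreal (((LINT p:{0<..t} \<times> {x. \<epsilon> < \<bar>x\<bar>}|\<mu> \<omega>. snd p) - t * (LINT x:{x. \<epsilon> < \<bar>x\<bar>}|\<Lambda>. x) - z t \<omega>)\<^sup>2) \<partial>?M)
    = (\<integral>\<^sup>+\<omega>. ennreal ((big_jumps \<epsilon> t \<omega> - lev t \<omega>)\<^sup>2) \<partial>L)) (at_right 0)"
   using eventually_at_right_less
  proof eventually_elim
   case (elim \<epsilon>)
   have "(\<integral>\<^sup>+ \<omega>. ennreal (((LINT p:{0<..t} \<times> {x. \<epsilon> < \<bar>x\<bar>}|\<mu> \<omega>. snd p) - t * (LINT x:{x. \<epsilon> < \<bar>x\<bar>}|\<Lambda>. x) - z t \<omega>)\<^sup>2) \<partial>?M)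
    = (\<integral>\<^sup>+\<omega>. ennreal ((big_jumps \<epsilon> t (\<eta> \<omega>) - lev t (\<eta> \<omega>))\<^sup>2) \<partial>?M)"
    using aeg by (intro nn_integral_cong_AE) (auto elim!: eventually_mono simp: \<mu>_def z_def big_jumps_eq[OF _ t elim])
   also have "\<dots> = (\<integral>\<^sup>+\<omega>. ennreal ((big_jumps \<epsilon> t \<omega> - lev t \<omega>)\<^sup>2) \<partial>L)" by (rule nn) measurable
   finally show ?case .
  qed
  from tendsto_cong[OF this] show "((\<lambda>\<epsilon>. \<integral>\<^sup>+ \<omega>. ennreal (((LINT p:{0<..t} \<times> {x. \<epsilon> < \<bar>x\<bar>}|\<mu> \<omega>. snd p) - t * (LINT x:{x. \<epsilon> < \<bar>x\<bar>}|\<Lambda>. x) - z t \<omega>)\<^sup>2) \<partial>?M) \<longlongrightarrow> 0) (at_right 0)"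
   using big_jumps_tendsto[OF t] by simp
 qed
 have ind: "P.indep_set
   (sigma_sets (space ?M) {(\<lambda>\<omega>. W t (fst \<omega>)) -` B \<inter> space ?M | t B. 0 \<le> t \<and> B \<in> sets borel})
   (sigma_sets (space ?M) {(\<lambda>\<omega>. emeasure (\<mu> \<omega>) A) -` B \<inter> space ?M | A B. A \<in> sets borel \<and> B \<in> sets borel})"
  if Wm: "\<And>t. 0 \<le> t ==> W t \<in> borel_measurable Gsp" for W :: "real => _ => real"
 proof -
  have 1: "\<exists>A'\<in>sets Gsp. A = A' \<times> space coded" if A: "A \<in> sigma_sets (space ?M) {(\<lambda>\<omega>. W t (fst \<omega>)) -` B \<inter> space ?M | t B. 0 \<le> t \<and> B \<in> sets borel}" for A
  proof -
   have "{(\<lambda>\<omega>. W t (fst \<omega>)) -` B \<inter> space ?M | t B. 0 \<le> t \<and> B \<in> sets borel} \<subseteq> sets (vimage_algebra (space ?M) fst Gsp)"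
   proof clarify
    fix t :: real and B :: "real set" assume "0 \<le> t" "B \<in> sets borel"
    then show "(\<lambda>\<omega>. W t (fst \<omega>)) -` B \<inter> space ?M \<in> sets (vimage_algebra (space ?M) fst Gsp)"
     using in_vimage_algebra[OF measurable_sets[OF Wm], of t B fst "space ?M"] by (simp add: vimage_def space_PiM Int_def)
   qed
   from sets.sigma_sets_subset[OF this] A have "A \<in> sets (vimage_algebra (space ?M) fst Gsp)" by auto
   then obtain A' where "A' \<in> sets Gsp" "A = fst -` A' \<inter> space ?M" by (subst (asm) sets_vimage_algebra2) (auto simp: space_pair_measure)
   then show ?thesis using sets.sets_into_space[of A' Gsp] by (intro bexI[of _ A']) (auto simp: space_pair_measure)
  qed
  have 2: "\<exists>A'\<in>sets coded. A = space Gsp \<times> A'" if A: "A \<in> sigma_sets (space ?M) {(\<lambda>\<omega>. emeasure (\<mu> \<omega>) A) -` B \<inter> space ?M | A B. A \<in> sets borel \<and> B \<in> sets borel}" for A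
  proof -
   have "{(\<lambda>\<omega>. emeasure (\<mu> \<omega>) A) -` B \<inter> space ?M | A B. A \<in> sets borel \<and> B \<in> sets borel} \<subseteq> sets (vimage_algebra (space ?M) snd coded)"
   proof clarify
    fix A :: "(real \<times> real) set" and B :: "ennreal set" assume a: "A \<in> sets borel" "B \<in> sets borel"
    define f where "f x = (if good (dec x) then J (dec x) (indicator A) else 0)" for x
    have iA: "indicator A \<in> borel_measurable (borel \<Otimes>\<^sub>M borel)" using a(1) by (simp add: borel_prod)
    have "(\<lambda>\<omega>. if good \<omega> then J \<omega> (indicator A) else 0) \<in> borel_measurable L" using measurable_J'[OF iA] by measurable
    then have f: "f \<in> borel_measurable coded" unfolding f_def by (rule measurable_compose[OF measurable_dec])
    have e: "emeasure (\<mu> \<omega>) A = f (snd \<omega>)" for \<omega>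
     using \<mu>nn[of "indicator A" \<omega>] a(1) by (simp add: \<mu>s f_def \<eta>_def)
    have "(\<lambda>\<omega>. emeasure (\<mu> \<omega>) A) -` B \<inter> space ?M = snd -` (f -` B \<inter> space coded) \<inter> space ?M"
     unfolding e by (auto simp: space_pair_measure)
    then show "(\<lambda>\<omega>. emeasure (\<mu> \<omega>) A) -` B \<inter> space ?M \<in> sets (vimage_algebra (space ?M) snd coded)"
     using in_vimage_algebra[OF measurable_sets[OF f a(2)]] by simp
   qed
   from sets.sigma_sets_subset[OF this] A have "A \<in> sets (vimage_algebra (space ?M) snd coded)" by auto
   then obtain A' where "A' \<in> sets coded" "A = snd -` A' \<inter> space ?M" by (subst (asm) sets_vimage_algebra2) (auto simp: space_pair_measure)
   then show ?thesis using sets.sets_into_space[of A' coded] by (intro bexI[of _ A']) (auto simp: space_pair_measure)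
  qed
  show ?thesis
   unfolding P.indep_sets2_eq
  proof (intro conjI ballI subsetI)
   fix A assume A: "A \<in> sigma_sets (space ?M) {(\<lambda>\<omega>. W t (fst \<omega>)) -` B \<inter> space ?M | t B. 0 \<le> t \<and> B \<in> sets borel}"
   obtain A' where A': "A' \<in> sets Gsp" "A = A' \<times> space coded" using 1[OF A] by blast
   show "A \<in> P.events" using A' by auto
   fix B assume B: "B \<in> sigma_sets (space ?M) {(\<lambda>\<omega>. emeasure (\<mu> \<omega>) A) -` B \<inter> space ?M | A B. A \<in> sets borel \<and> B \<in> sets borel}"
   obtain B' where B': "B' \<in> sets coded" "B = space Gsp \<times> B'" using 2[OF B] by blast
   have "A \<inter> B = A' \<times> B'" using A' B' sets.sets_into_space[OF A'(1)] sets.sets_into_space[OF B'(1)] by auto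
   moreover have pr: "P.prob (X \<times> Y) = G.prob X * N.prob Y" if "X \<in> sets Gsp" "Y \<in> sets coded" for X Y
    using N.emeasure_pair_measure_Times[OF that] by (simp add: measure_def enn2real_mult)
   moreover have "P.prob A = G.prob A'" "P.prob B = N.prob B'"
    unfolding A'(2) B'(2) by (simp_all only: pr[OF A'(1) sets.top] pr[OF sets.top B'(1)] G.prob_space N.prob_space mult_1 mult_1_right)
   ultimately show "P.prob (A \<inter> B) = P.prob A * P.prob B" using A'(1) B'(1) by (simp only: pr)
  next
   fix B assume B: "B \<in> sigma_sets (space ?M) {(\<lambda>\<omega>. emeasure (\<mu> \<omega>) A) -` B \<inter> space ?M | A B. A \<in> sets borel \<and> B \<in> sets borel}"
   obtain B' where B': "B' \<in> sets coded" "B = space Gsp \<times> B'" using 2[OF B] by blast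
   then show "B \<in> P.events" by auto
  qed
 qed
 show ?thesis
 proof (intro exI[of _ coded] conjI allI impI prob_space_coded)
  fix W :: "real => (real => real) => real" and \<rho> :: real
  assume W: "gfam Gsp W min {0..}" and Wc: "\<forall>\<omega>. W 0 \<omega> = 0 \<and> continuous_on {0..} (\<lambda>t. W t \<omega>)"
  have Wm: "W t \<in> borel_measurable Gsp" if "0 \<le> t" for t using gfam_measurable[OF W] that by simp
  have bmw: "brownian_motion ?M (\<lambda>t \<omega>. W t (fst \<omega>))"
  proof (rule P.brownian_motion_of_gfam)
   show "gfam ?M (\<lambda>t \<omega>. W t (fst \<omega>)) min {0..}"
    by (rule gfam_compose[OF W _ N.distr_pair_fst]) simp
  qed (use Wc in auto)
  show "ou_levy_noise ?M \<Lambda> 0 \<rho> 0 (\<lambda>t \<omega>. \<rho> * W t (fst \<omega>))"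
   unfolding ou_levy_noise_def Let_def
  proof (rule conjI[OF P.prob_space_axioms], rule exI[of _ "\<lambda>t \<omega>. W t (fst \<omega>)"], rule exI[of _ z], intro conjI)
   show "brownian_motion ?M (\<lambda>t \<omega>. W t (fst \<omega>))" by (rule bmw)
   show "\<forall>t\<ge>0. z t \<in> borel_measurable ?M" using zm by simp
   show "\<forall>\<omega>\<in>space ?M. cadlag_on {0..} (\<lambda>t. z t \<omega>)" unfolding z_def by (simp add: cadlag_lev)
   show "has_compensator ?M (natural_filtration ?M z) (\<lambda>\<omega>. jump_measure (\<lambda>t. z t \<omega>)) (levy_compensator \<Lambda>)"
    using comp unfolding \<mu>_def .
   show "compensated_integral ?M (\<lambda>\<omega>. jump_measure (\<lambda>t. z t \<omega>)) \<Lambda> z" using cint unfolding \<mu>_def .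
   show "P.indep_set
     (sigma_sets (space ?M) {(\<lambda>\<omega>. W t (fst \<omega>)) -` B \<inter> space ?M | t B. 0 \<le> t \<and> B \<in> sets borel})
     (sigma_sets (space ?M) {(\<lambda>\<omega>. emeasure (jump_measure (\<lambda>t. z t \<omega>)) A) -` B \<inter> space ?M | A B. A \<in> sets borel \<and> B \<in> sets borel})"
    by (rule ind[unfolded \<mu>_def]) (rule Wm)
   show "\<forall>t\<ge>0. (\<lambda>\<omega>. \<rho> * W t (fst \<omega>)) \<in> borel_measurable ?M"
    using Wm measurable_compose[OF measurable_fst] by (intro allI impI borel_measurable_times borel_measurable_const) blast
   show "\<forall>\<omega>\<in>space ?M. cadlag_on {0..} (\<lambda>t. \<rho> * W t (fst \<omega>))"
   proof
    fix \<omega> :: "(real => real) \<times> (real => real)"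
    have "continuous_on {0..} (\<lambda>t. \<rho> * W t (fst \<omega>))" using Wc by (auto intro: continuous_intros)
    then have "((\<lambda>t. \<rho> * W t (fst \<omega>)) \<longlongrightarrow> \<rho> * W t (fst \<omega>)) (at t within {0..})" if "t \<in> {0..}" for t
     using that by (auto simp: continuous_on_def)
    then show "cadlag_on {0..} (\<lambda>t. \<rho> * W t (fst \<omega>))"
     unfolding cadlag_on_def by (blast intro: tendsto_within_subset)
   qed
   show "AE \<omega> in ?M. \<rho> * W 0 (fst \<omega>) = 0 \<and> (\<forall>t\<ge>0. \<rho> * W t (fst \<omega>) = 0 * (LBINT s:{0..t}. \<rho> * W s (fst \<omega>)) + (\<rho> * W t (fst \<omega>) + 0 * z t \<omega>))"
    using Wc by simp
  qed
 qed
qed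

section \<open>Gaussian integrals\<close>

abbreviation N01 :: "real measure" where "N01 \<equiv> std_normal_distribution"

lemma nn_integral_N01: "f \<in> borel_measurable borel ==> (\<integral>\<^sup>+x. f x \<partial>N01) = (\<integral>\<^sup>+x. ennreal (std_normal_density x) * f x \<partial>lborel)"
 by (subst nn_integral_density) auto

lemma nn_integral_normal_density: "0 < \<sigma> ==> (\<integral>\<^sup>+x. ennreal (normal_density \<mu> \<sigma> x) \<partial>lborel) = 1"
 using prob_space.emeasure_space_1[OF prob_space_normal_density, of \<sigma> \<mu>] by (simp add: emeasure_density)

lemma normal_square_lower: "ennreal (b\<^sup>2) \<le> (\<integral>\<^sup>+w. ennreal ((a - b * w)\<^sup>2) \<partial>N01)"
proof -
 have "has_bochner_integral lborel (\<lambda>w. a\<^sup>2 * (std_normal_density w * w ^ (2 * 0)) + (- 2 * a * b) * (std_normal_density w * w ^ (2 * 0 + 1)) + b\<^sup>2 * (std_normal_density w * w ^ (2 * 1)))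
   (a\<^sup>2 * (fact (2 * 0) / (2 ^ 0 * fact 0)) + (- 2 * a * b) * 0 + b\<^sup>2 * (fact (2 * 1) / (2 ^ 1 * fact 1)))"
  by (intro has_bochner_integral_add has_bochner_integral_mult_right std_normal_moment_even std_normal_moment_odd)
 then have "has_bochner_integral lborel (\<lambda>w. std_normal_density w * (a - b * w)\<^sup>2) (a\<^sup>2 + b\<^sup>2)"
  by (simp add: power2_eq_square algebra_simps)
 then have "(\<integral>\<^sup>+w. ennreal (std_normal_density w * (a - b * w)\<^sup>2) \<partial>lborel) = ennreal (a\<^sup>2 + b\<^sup>2)"
  by (subst nn_integral_eq_integral) (auto simp: has_bochner_integral_iff)
 then show ?thesis by (simp add: nn_integral_N01 ennreal_mult' ennreal_leI)
qed

text \<open>The joint density of \<open>\<theta> = sqrt s * g\<close> and \<open>x = \<theta> + \<epsilon>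
  z\<close> factors into the density of \<open>x\<close>, with variance \<open>D\<^sup>2 = s +
  \<epsilon>\<^sup>2\<close>, and the posterior of \<open>\<theta>\<close>, which is normal with variance
  \<open>s \<epsilon>\<^sup>2 / (s + \<epsilon>\<^sup>2)\<close>. No estimate computed from \<open>x\<close>
  does better than the posterior variance.\<close>

lemma bayes_1d:
 assumes t[measurable]: "t \<in> borel_measurable borel" and s: "0 < s" and \<epsilon>: "0 < \<epsilon>"
 shows "ennreal (s * \<epsilon>\<^sup>2 / (s + \<epsilon>\<^sup>2)) \<le> (\<integral>\<^sup>+g. \<integral>\<^sup>+z. ennreal ((t (sqrt s * g + \<epsilon> * z) - sqrt s * g)\<^sup>2) \<partial>N01 \<partial>N01)"
proof -
 define D where "D = sqrt (s + \<epsilon>\<^sup>2)"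
 have D: "0 < D" "D\<^sup>2 = s + \<epsilon>\<^sup>2" using s \<epsilon> by (auto simp: D_def add_pos_pos)
 define F where "F x g = ennreal ((t x - sqrt s * g)\<^sup>2)" for x g
 have [measurable]: "(\<lambda>p. F (fst p) (snd p)) \<in> borel_measurable (borel \<Otimes>\<^sub>M borel)" unfolding F_def by measurable
 have [measurable]: "(\<lambda>x. F (f x) (h x)) \<in> borel_measurable M" if "f \<in> borel_measurable M" "h \<in> borel_measurable M" for f h and M :: "'z measure"
  using that unfolding F_def by measurable
 define K where "K x g = ennreal (std_normal_density g * normal_density (sqrt s * g) \<epsilon> x) * F x g" for x g
 have [measurable]: "(\<lambda>x. normal_density (f x) \<sigma> (h x)) \<in> borel_measurable M" if "f \<in> borel_measurable M" "h \<in> borel_measurable M" for f h \<sigma> and M :: "'z measure"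
  using that unfolding normal_density_def by measurable
 have inner: "(\<integral>\<^sup>+z. F (sqrt s * g + \<epsilon> * z) g \<partial>N01) = (\<integral>\<^sup>+x. ennreal (normal_density (sqrt s * g) \<epsilon> x) * F x g \<partial>lborel)" for g
 proof -
  have n: "normal_density (sqrt s * g) \<epsilon> (sqrt s * g + \<epsilon> * z) * \<epsilon> = std_normal_density z" for z
   using \<epsilon> by (simp add: normal_density_def real_sqrt_mult power_mult_distrib)
  have e: "ennreal \<epsilon> * (ennreal (normal_density (sqrt s * g) \<epsilon> (sqrt s * g + \<epsilon> * z)) * c) = ennreal (std_normal_density z) * c" for z c
  proof -
   have "ennreal \<epsilon> * ennreal (normal_density (sqrt s * g) \<epsilon> (sqrt s * g + \<epsilon> * z)) = ennreal (\<epsilon> * normal_density (sqrt s * g) \<epsilon> (sqrt s * g + \<epsilon> * z))"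
    by (rule ennreal_mult[symmetric]) (use \<epsilon> in auto)
   then show ?thesis using n[of z] by (simp only: mult.assoc[symmetric] mult.commute[of \<epsilon>])
  qed
  show ?thesis
   by (subst nn_integral_real_affine[of _ \<epsilon> "sqrt s * g"])
     (use \<epsilon> in \<open>simp_all add: nn_integral_N01 nn_integral_cmult[symmetric] e\<close>)
 qed
 define c b where "c = sqrt s / D\<^sup>2" and "b = \<epsilon> / D"
 have b: "0 < b" using D \<epsilon> by (simp add: b_def)
 have dens: "std_normal_density (c * x + b * w) * normal_density (sqrt s * (c * x + b * w)) \<epsilon> x * b = normal_density 0 D x * std_normal_density w" for x w
 proof -
  have "\<epsilon>\<^sup>2 * (D\<^sup>2 * D\<^sup>2 * ((c * x + b * w)\<^sup>2 + (x - sqrt s * (c * x + b * w))\<^sup>2 / \<epsilon>\<^sup>2)) = \<epsilon>\<^sup>2 * (D\<^sup>2 * D\<^sup>2 * (x\<^sup>2 / D\<^sup>2 + w\<^sup>2))"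
  proof -
   define p q where "p = sqrt s * x" and "q = \<epsilon> * D * w"
   have g: "D\<^sup>2 * (c * x + b * w) = p + q" unfolding c_def b_def p_def q_def distrib_left using D(1) by (simp add: power2_eq_square)
   have x: "D\<^sup>2 * x = s * x + \<epsilon>\<^sup>2 * x" "sqrt s * p = s * x" using D s by (simp_all add: p_def distrib_right)
   have "\<epsilon>\<^sup>2 * (D\<^sup>2 * D\<^sup>2 * ((c * x + b * w)\<^sup>2 + (x - sqrt s * (c * x + b * w))\<^sup>2 / \<epsilon>\<^sup>2))
    = \<epsilon>\<^sup>2 * (D\<^sup>2 * (c * x + b * w))\<^sup>2 + (D\<^sup>2 * x - sqrt s * (D\<^sup>2 * (c * x + b * w)))\<^sup>2"
    using \<epsilon> by (simp add: field_simps power2_eq_square)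
   also have "\<dots> = \<epsilon>\<^sup>2 * (p + q)\<^sup>2 + (\<epsilon>\<^sup>2 * x - sqrt s * q)\<^sup>2" unfolding g using x by (simp add: distrib_left)
   also have "\<dots> = \<epsilon>\<^sup>2 * (p\<^sup>2 + q\<^sup>2 + \<epsilon>\<^sup>2 * x\<^sup>2) + (sqrt s)\<^sup>2 * q\<^sup>2"
    unfolding p_def by (simp add: power2_eq_square algebra_simps)
   also have "\<dots> = \<epsilon>\<^sup>2 * ((s + \<epsilon>\<^sup>2) * x\<^sup>2) + (\<epsilon>\<^sup>2 + s) * q\<^sup>2"
    unfolding p_def using s by (simp add: power_mult_distrib algebra_simps)
   also have "\<dots> = \<epsilon>\<^sup>2 * (D\<^sup>2 * D\<^sup>2 * (x\<^sup>2 / D\<^sup>2 + w\<^sup>2))"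
   proof -
    have "E * E * (y / E + z) = E * y + E * E * z" if "E > 0" for E y z :: real using that by (simp add: distrib_left)
    from this[of "D\<^sup>2" "x\<^sup>2" "w\<^sup>2"] show ?thesis
     using D(1) unfolding D(2)[symmetric] add.commute[of "\<epsilon>\<^sup>2" s] by (simp add: q_def power_mult_distrib algebra_simps)
   qed
   finally show ?thesis .
  qed
  then have ex: "(c * x + b * w)\<^sup>2 + (x - sqrt s * (c * x + b * w))\<^sup>2 / \<epsilon>\<^sup>2 = x\<^sup>2 / D\<^sup>2 + w\<^sup>2" using \<epsilon> D(1) by simp
  have "exp (- (c * x + b * w)\<^sup>2 / 2) * exp (- (x - sqrt s * (c * x + b * w))\<^sup>2 / (2 * \<epsilon>\<^sup>2)) = exp (- ((c * x + b * w)\<^sup>2 + (x - sqrt s * (c * x + b * w))\<^sup>2 / \<epsilon>\<^sup>2) / 2)"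
   by (simp add: mult_exp_exp field_simps)
  also have "\<dots> = exp (- x\<^sup>2 / (2 * D\<^sup>2)) * exp (- w\<^sup>2 / 2)" unfolding ex by (simp add: mult_exp_exp field_simps)
  finally have ex2: "exp (- (c * x + b * w)\<^sup>2 / 2) * exp (- (x - sqrt s * (c * x + b * w))\<^sup>2 / (2 * \<epsilon>\<^sup>2)) = exp (- x\<^sup>2 / (2 * D\<^sup>2)) * exp (- w\<^sup>2 / 2)" .
  have "std_normal_density (c * x + b * w) * normal_density (sqrt s * (c * x + b * w)) \<epsilon> x * b
   = (1 / sqrt (2 * pi)) * (1 / sqrt (2 * pi)) * (b / \<epsilon>) * (exp (- (c * x + b * w)\<^sup>2 / 2) * exp (- (x - sqrt s * (c * x + b * w))\<^sup>2 / (2 * \<epsilon>\<^sup>2)))"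
   using \<epsilon> by (simp add: normal_density_def real_sqrt_mult mult_ac)
  also have "\<dots> = normal_density 0 D x * std_normal_density w"
   unfolding ex2 using \<epsilon> D(1) by (simp add: normal_density_def real_sqrt_mult b_def)
  finally show ?thesis .
 qed
 have outer: "ennreal (normal_density 0 D x) * ennreal (s * b\<^sup>2) \<le> (\<integral>\<^sup>+g. K x g \<partial>lborel)" for x
 proof -
  have Kd: "ennreal b * K x (c * x + b * w) = ennreal (normal_density 0 D x) * (ennreal (std_normal_density w) * F x (c * x + b * w))" for w
  proof -
   let ?X = "std_normal_density (c * x + b * w) * normal_density (sqrt s * (c * x + b * w)) \<epsilon> x"
   have "ennreal b * ennreal ?X = ennreal (?X * b)" by (subst mult.commute[of ?X], rule ennreal_mult[symmetric]) (use b in auto)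
   also have "\<dots> = ennreal (normal_density 0 D x) * ennreal (std_normal_density w)" unfolding dens by (rule ennreal_mult) auto
   finally show ?thesis unfolding K_def by (simp only: mult.assoc[symmetric])
  qed
  have "ennreal (s * b\<^sup>2) = ennreal ((sqrt s * b)\<^sup>2)" using s by (simp add: power_mult_distrib)
  also have "\<dots> \<le> (\<integral>\<^sup>+w. F x (c * x + b * w) \<partial>N01)"
   using normal_square_lower[of "sqrt s * b" "t x - sqrt s * (c * x)"] by (simp add: F_def algebra_simps)
  finally have "ennreal (normal_density 0 D x) * ennreal (s * b\<^sup>2) \<le> ennreal (normal_density 0 D x) * (\<integral>\<^sup>+w. F x (c * x + b * w) \<partial>N01)"
   by (rule mult_left_mono) simp
  also have "\<dots> = (\<integral>\<^sup>+w. ennreal b * K x (c * x + b * w) \<partial>lborel)"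
   unfolding Kd by (simp add: nn_integral_N01 nn_integral_cmult)
  also have "\<dots> = (\<integral>\<^sup>+g. K x g \<partial>lborel)"
   unfolding K_def by (subst (2) nn_integral_real_affine[of _ b "c * x"]) (use b in \<open>simp_all add: nn_integral_cmult\<close>)
  finally show ?thesis .
 qed
 have "ennreal (s * \<epsilon>\<^sup>2 / (s + \<epsilon>\<^sup>2)) = (\<integral>\<^sup>+x. ennreal (normal_density 0 D x) \<partial>lborel) * ennreal (s * b\<^sup>2)"
  using D by (simp add: nn_integral_normal_density b_def power_divide)
 also have "\<dots> = (\<integral>\<^sup>+x. ennreal (normal_density 0 D x) * ennreal (s * b\<^sup>2) \<partial>lborel)"
  by (simp add: nn_integral_multc)
 also have "\<dots> \<le> (\<integral>\<^sup>+x. \<integral>\<^sup>+g. K x g \<partial>lborel \<partial>lborel)" by (intro nn_integral_mono outer)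
 also have "\<dots> = (\<integral>\<^sup>+g. \<integral>\<^sup>+x. K x g \<partial>lborel \<partial>lborel)"
  by (rule lborel_pair.Fubini') (unfold K_def case_prod_unfold, measurable)
 also have "\<dots> = (\<integral>\<^sup>+g. ennreal (std_normal_density g) * (\<integral>\<^sup>+z. F (sqrt s * g + \<epsilon> * z) g \<partial>N01) \<partial>lborel)"
  unfolding inner K_def by (simp add: nn_integral_cmult[symmetric] ennreal_mult' mult.assoc)
 also have "\<dots> = (\<integral>\<^sup>+g. \<integral>\<^sup>+z. F (sqrt s * g + \<epsilon> * z) g \<partial>N01 \<partial>N01)"
 proof (rule nn_integral_N01[symmetric])
  show "(\<lambda>g. \<integral>\<^sup>+z. F (sqrt s * g + \<epsilon> * z) g \<partial>N01) \<in> borel_measurable borel" unfolding inner by measurable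
 qed
 finally show ?thesis unfolding F_def .
qed

text \<open>The moment generating function of the squared normal is \<open>(1 - 2 a) powr (- 1/2)\<close>, and
  \<open>1 / (1 - x) \<le> exp (x / (1 - x))\<close>.\<close>

lemma chi_square_mgf:
 assumes a: "0 \<le> a" "2 * a \<le> \<delta>" and \<delta>: "\<delta> < 1"
 shows "(\<integral>\<^sup>+g. ennreal (exp (a * g\<^sup>2)) \<partial>N01) \<le> ennreal (exp (a / (1 - \<delta>)))"
proof -
 define \<sigma> where "\<sigma> = 1 / sqrt (1 - 2 * a)"
 have \<sigma>: "0 < \<sigma>" "\<sigma>\<^sup>2 = 1 / (1 - 2 * a)" using a \<delta> by (auto simp: \<sigma>_def power_divide)
 have d: "std_normal_density g * exp (a * g\<^sup>2) = \<sigma> * normal_density 0 \<sigma> g" for g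
 proof -
  have "exp (- g\<^sup>2 / 2) * exp (a * g\<^sup>2) = exp (- g\<^sup>2 / (2 * \<sigma>\<^sup>2))"
   using a \<delta> unfolding \<sigma>(2) by (simp add: mult_exp_exp field_simps)
  then show ?thesis using \<sigma>(1) by (simp add: normal_density_def real_sqrt_mult)
 qed
 have "(\<integral>\<^sup>+g. ennreal (exp (a * g\<^sup>2)) \<partial>N01) = ennreal \<sigma>"
  using \<sigma>(1) by (simp add: nn_integral_N01 ennreal_mult'[symmetric] d)
   (simp add: ennreal_mult' nn_integral_cmult nn_integral_normal_density)
 moreover have "\<sigma> \<le> exp (a / (1 - \<delta>))"
 proof (rule power2_le_imp_le)
  have "\<sigma>\<^sup>2 = 1 + 2 * a / (1 - 2 * a)" unfolding \<sigma>(2) using a \<delta> by (simp add: field_simps)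
  also have "\<dots> \<le> exp (2 * a / (1 - 2 * a))" by (rule exp_ge_add_one_self)
  also have "\<dots> \<le> exp (2 * (a / (1 - \<delta>)))" using a \<delta> by (auto intro!: divide_left_mono mult_pos_pos)
  also have "\<dots> = (exp (a / (1 - \<delta>)))\<^sup>2" by (rule exp_double)
  finally show "\<sigma>\<^sup>2 \<le> (exp (a / (1 - \<delta>)))\<^sup>2" .
 qed simp
 ultimately show ?thesis by (simp add: ennreal_leI)
qed

lemma prob_space_N01: "prob_space N01"
 by (simp add: prob_space_normal_density)

lemma Gsp_resample:
 "f \<in> borel_measurable Gsp ==> (\<integral>\<^sup>+\<omega>. f \<omega> \<partial>Gsp) = (\<integral>\<^sup>+\<omega>. \<integral>\<^sup>+x. f (fun_upd \<omega> i x) \<partial>N01 \<partial>Gsp)"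
 by (rule nn_integral_PiM_resample) (simp_all add: prob_space_N01)

lemma measurable_Gsp_upd[measurable]:
 assumes "f \<in> measurable M Gsp" "h \<in> borel_measurable M"
 shows "(\<lambda>x. fun_upd (f x) i (h x)) \<in> measurable M Gsp"
 using assms by (intro measurable_fun_upd[where J=UNIV]) (auto cong: measurable_cong_sets)

lemma nn_integral_Gsp_prod:
 fixes f :: "nat => real => ennreal"
 assumes f[measurable]: "\<And>j. f j \<in> borel_measurable borel"
 shows "(\<integral>\<^sup>+\<omega>. (\<Prod>j<d. f j (\<omega> (real j))) \<partial>Gsp) = (\<Prod>j<d. \<integral>\<^sup>+x. f j x \<partial>N01)"
proof (induction d)
 case 0 show ?case using prob_space.emeasure_space_1[OF prob_space_Gsp] by simp
next
 case (Suc d)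
 have "(\<integral>\<^sup>+\<omega>. (\<Prod>j<Suc d. f j (\<omega> (real j))) \<partial>Gsp) = (\<integral>\<^sup>+\<omega>. \<integral>\<^sup>+x. (\<Prod>j<Suc d. f j ((fun_upd \<omega> (real d) x) (real j))) \<partial>N01 \<partial>Gsp)"
  by (rule Gsp_resample) measurable
 also have "\<dots> = (\<integral>\<^sup>+\<omega>. \<integral>\<^sup>+x. (\<Prod>j<d. f j (\<omega> (real j))) * f d x \<partial>N01 \<partial>Gsp)" by simp
 also have "\<dots> = (\<Prod>j<Suc d. \<integral>\<^sup>+x. f j x \<partial>N01)"
  by (simp add: nn_integral_cmult nn_integral_multc Suc)
 finally show ?case .
qed

text \<open>The parameter is \<open>sqrt s * g i\<close> and the noise \<open>\<epsilon> * \<omega> i\<close>;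
  the estimator \<open>h\<close> may depend on all other coordinates, but on these two only through their sum.
  Resampling the two coordinates and fixing all the others leaves the one-dimensional problem.\<close>

lemma bayes_coordinate:
 assumes h: "(\<lambda>p. h (fst p) (snd p)) \<in> borel_measurable (Gsp \<Otimes>\<^sub>M Gsp)" and s: "0 < s" and \<epsilon>: "0 < \<epsilon>"
  and inv: "\<And>g \<omega> a b a' b'. sqrt s * a + \<epsilon> * b = sqrt s * a' + \<epsilon> * b' ==>
   h (fun_upd g i a) (fun_upd \<omega> i b) = h (fun_upd g i a') (fun_upd \<omega> i b')"
 shows "ennreal (s * \<epsilon>\<^sup>2 / (s + \<epsilon>\<^sup>2)) \<le> (\<integral>\<^sup>+g. \<integral>\<^sup>+\<omega>. ennreal ((h g \<omega> - sqrt s * g i)\<^sup>2) \<partial>Gsp \<partial>Gsp)"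
proof -
 interpret G: prob_space Gsp by (rule prob_space_Gsp)
 interpret N: prob_space N01 by (rule prob_space_N01)
 interpret P: pair_sigma_finite N01 Gsp ..
 define Q where "Q g \<omega> = ennreal ((h g \<omega> - sqrt s * g i)\<^sup>2)" for g \<omega>
 have hm[measurable]: "(\<lambda>x. h (f x) (f' x)) \<in> borel_measurable M" if "f \<in> measurable M Gsp" "f' \<in> measurable M Gsp" for f f' and M :: "'z measure"
  using measurable_compose[OF measurable_Pair[OF that] h] by simp
 have gm: "(\<lambda>x. f x i) \<in> borel_measurable M" if "f \<in> measurable M Gsp" for f and M :: "'z measure"
  by (rule measurable_compose[OF that measurable_Gsp_component])
 have Qm[measurable]: "(\<lambda>x. Q (f x) (f' x)) \<in> borel_measurable M" if "f \<in> measurable M Gsp" "f' \<in> measurable M Gsp" for f f' and M :: "'z measure"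
  unfolding Q_def using hm[OF that] gm[OF that(1)] by measurable
 have one: "ennreal (s * \<epsilon>\<^sup>2 / (s + \<epsilon>\<^sup>2)) \<le> (\<integral>\<^sup>+a. \<integral>\<^sup>+b. Q (fun_upd g i a) (fun_upd \<omega> i b) \<partial>N01 \<partial>N01)" for g \<omega>
 proof -
  define t where "t x = h (fun_upd g i (x / sqrt s)) (fun_upd \<omega> i 0)" for x
  have c: "(\<lambda>x. g) \<in> measurable borel Gsp" "(\<lambda>x. \<omega>) \<in> measurable borel Gsp" by (auto simp: space_PiM)
  have "t \<in> borel_measurable borel" unfolding t_def
   by (intro hm measurable_Gsp_upd c) auto
  from bayes_1d[OF this s \<epsilon>] have "ennreal (s * \<epsilon>\<^sup>2 / (s + \<epsilon>\<^sup>2)) \<le> (\<integral>\<^sup>+a. \<integral>\<^sup>+b. ennreal ((t (sqrt s * a + \<epsilon> * b) - sqrt s * a)\<^sup>2) \<partial>N01 \<partial>N01)" .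
  moreover have "h (fun_upd g i a) (fun_upd \<omega> i b) = t (sqrt s * a + \<epsilon> * b)" for a b
   unfolding t_def by (rule inv) (use s in simp)
  ultimately show ?thesis unfolding Q_def by simp
 qed
 have "ennreal (s * \<epsilon>\<^sup>2 / (s + \<epsilon>\<^sup>2)) \<le> (\<integral>\<^sup>+g. \<integral>\<^sup>+\<omega>. ennreal (s * \<epsilon>\<^sup>2 / (s + \<epsilon>\<^sup>2)) \<partial>Gsp \<partial>Gsp)"
  by (simp add: G.emeasure_space_1)
 also have "\<dots> \<le> (\<integral>\<^sup>+g. \<integral>\<^sup>+\<omega>. \<integral>\<^sup>+a. \<integral>\<^sup>+b. Q (fun_upd g i a) (fun_upd \<omega> i b) \<partial>N01 \<partial>N01 \<partial>Gsp \<partial>Gsp)"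
  by (intro nn_integral_mono one)
 also have "\<dots> = (\<integral>\<^sup>+g. \<integral>\<^sup>+a. \<integral>\<^sup>+\<omega>. \<integral>\<^sup>+b. Q (fun_upd g i a) (fun_upd \<omega> i b) \<partial>N01 \<partial>Gsp \<partial>N01 \<partial>Gsp)"
 proof (rule nn_integral_cong)
  fix g :: "real => real"
  have c: "(\<lambda>x. g) \<in> measurable M Gsp" for M :: "(((real \<times> (real => real)) \<times> real)) measure" by (auto simp: space_PiM)
  have m: "(\<lambda>x. Q (fun_upd g i (fst (fst x))) (fun_upd (snd (fst x)) i (snd x))) \<in> borel_measurable ((N01 \<Otimes>\<^sub>M Gsp) \<Otimes>\<^sub>M N01)"
   by (intro Qm measurable_Gsp_upd c) (auto cong: measurable_cong_sets)
  show "(\<integral>\<^sup>+\<omega>. \<integral>\<^sup>+a. \<integral>\<^sup>+b. Q (fun_upd g i a) (fun_upd \<omega> i b) \<partial>N01 \<partial>N01 \<partial>Gsp) = (\<integral>\<^sup>+a. \<integral>\<^sup>+\<omega>. \<integral>\<^sup>+b. Q (fun_upd g i a) (fun_upd \<omega> i b) \<partial>N01 \<partial>Gsp \<partial>N01)"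
   by (rule P.Fubini') (use N.borel_measurable_nn_integral_fst[OF m] in \<open>simp add: case_prod_unfold\<close>)
 qed
 also have "\<dots> = (\<integral>\<^sup>+g. \<integral>\<^sup>+a. \<integral>\<^sup>+\<omega>. Q (fun_upd g i a) \<omega> \<partial>Gsp \<partial>N01 \<partial>Gsp)"
 proof (rule nn_integral_cong, rule nn_integral_cong)
  fix g :: "real => real" and a :: real
  show "(\<integral>\<^sup>+\<omega>. \<integral>\<^sup>+b. Q (fun_upd g i a) (fun_upd \<omega> i b) \<partial>N01 \<partial>Gsp) = (\<integral>\<^sup>+\<omega>. Q (fun_upd g i a) \<omega> \<partial>Gsp)"
   by (rule Gsp_resample[symmetric], rule Qm) (auto simp: space_PiM)
 qed
 also have "\<dots> = (\<integral>\<^sup>+g. \<integral>\<^sup>+\<omega>. Q g \<omega> \<partial>Gsp \<partial>Gsp)"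
  by (rule Gsp_resample[symmetric], rule G.borel_measurable_nn_integral, unfold case_prod_unfold, rule Qm) auto
 finally show ?thesis unfolding Q_def .
qed

section \<open>Bessel's inequality\<close>

lemma bessel:
 fixes e :: "nat => 'a => real"
 assumes u: "u \<in> borel_measurable M" and em: "\<And>j. e j \<in> borel_measurable M"
  and ei: "\<And>i j. i < d ==> j < d ==> integrable M (\<lambda>x. e i x * e j x)"
  and on: "\<And>i j. i < d ==> j < d ==> (\<integral>x. e i x * e j x \<partial>M) = (if i = j then 1 else 0)"
  and fin: "(\<integral>\<^sup>+x. ennreal ((u x)\<^sup>2) \<partial>M) < \<infinity>"
 shows "j < d ==> integrable M (\<lambda>x. u x * e j x)"
  and "ennreal (\<Sum>j<d. (\<integral>x. u x * e j x \<partial>M)\<^sup>2) \<le> (\<integral>\<^sup>+x. ennreal ((u x)\<^sup>2) \<partial>M)"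
proof -
 have u2: "integrable M (\<lambda>x. (u x)\<^sup>2)" using u fin by (intro integrableI_bounded) auto
 have ue: "integrable M (\<lambda>x. u x * e j x)" if j: "j < d" for j
 proof (rule Bochner_Integration.integrable_bound[OF Bochner_Integration.integrable_add[OF u2 ei[OF j j]]])
  show "AE x in M. norm (u x * e j x) \<le> norm ((u x)\<^sup>2 + e j x * e j x)"
  proof (intro AE_I2)
   fix x
   have "0 \<le> (\<bar>u x\<bar> - \<bar>e j x\<bar>)\<^sup>2 + ((u x)\<^sup>2 + e j x * e j x)" by (simp add: power2_eq_square[symmetric])
   then have "\<bar>u x\<bar> * \<bar>e j x\<bar> \<le> (u x)\<^sup>2 + e j x * e j x" by (simp add: power2_diff power2_eq_square algebra_simps)
   then show "norm (u x * e j x) \<le> norm ((u x)\<^sup>2 + e j x * e j x)" by (simp add: abs_mult power2_eq_square)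
  qed
 qed (use u em in measurable)
 then show "j < d ==> integrable M (\<lambda>x. u x * e j x)" .
 define c where "c j = (\<integral>x. u x * e j x \<partial>M)" for j
 have sq: "(u x - (\<Sum>j<d. c j * e j x))\<^sup>2 = (u x)\<^sup>2 - 2 * (\<Sum>j<d. c j * (u x * e j x)) + (\<Sum>i<d. \<Sum>j<d. c i * c j * (e i x * e j x))" for x
  unfolding power2_diff by (simp add: power2_eq_square sum_product sum_distrib_left sum_distrib_right mult_ac)
 have "0 \<le> (\<integral>x. (u x - (\<Sum>j<d. c j * e j x))\<^sup>2 \<partial>M)" by simp
 also have "\<dots> = (\<integral>x. (u x)\<^sup>2 \<partial>M) - 2 * (\<Sum>j<d. c j * c j) + (\<Sum>i<d. \<Sum>j<d. c i * c j * (if i = j then 1 else 0))"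
 proof (rule has_bochner_integral_integral_eq)
  have "has_bochner_integral M (\<lambda>x. u x * e j x) (c j)" if "j < d" for j using ue[OF that] by (simp add: has_bochner_integral_iff c_def)
  moreover have "has_bochner_integral M (\<lambda>x. e i x * e j x) (if i = j then 1 else 0)" if "i < d" "j < d" for i j
   using ei[OF that] on[OF that] by (simp add: has_bochner_integral_iff)
  moreover have "has_bochner_integral M (\<lambda>x. (u x)\<^sup>2) (\<integral>x. (u x)\<^sup>2 \<partial>M)" using u2 by (simp add: has_bochner_integral_iff)
  ultimately show "has_bochner_integral M (\<lambda>x. (u x - (\<Sum>j<d. c j * e j x))\<^sup>2) ((\<integral>x. (u x)\<^sup>2 \<partial>M) - 2 * (\<Sum>j<d. c j * c j) + (\<Sum>i<d. \<Sum>j<d. c i * c j * (if i = j then 1 else 0)))"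
   unfolding sq by (intro has_bochner_integral_add has_bochner_integral_diff has_bochner_integral_mult_right has_bochner_integral_sum) auto
 qed
 also have "(\<Sum>i<d. \<Sum>j<d. c i * c j * (if i = j then 1 else 0)) = (\<Sum>j<d. c j * c j)"
  by (intro sum.cong refl) (simp add: if_distrib sum.delta cong: if_cong)
 finally have "(\<Sum>j<d. (c j)\<^sup>2) \<le> (\<integral>x. (u x)\<^sup>2 \<partial>M)" by (simp add: power2_eq_square)
 then show "ennreal (\<Sum>j<d. (\<integral>x. u x * e j x \<partial>M)\<^sup>2) \<le> (\<integral>\<^sup>+x. ennreal ((u x)\<^sup>2) \<partial>M)"
  using u2 by (simp add: nn_integral_eq_integral c_def ennreal_leI)
qed

section \<open>The trigonometric basis\<close>

text \<open>A phase instead of separate sines and cosines makes differentiation the shift \<open>c + pi /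
  2\<close>.\<close>

definition wave :: "nat => real => real => real" where
 "wave l c x = sqrt 2 * cos (2 * pi * real l * x + c)"

text \<open>A primitive of the product of two waves of positive frequency.\<close>

definition wave2 :: "nat => real => nat => real => real => real" where
 "wave2 l c l' c' x = (if l = l' then x * cos (c - c') else sin (2 * pi * (real l - real l') * x + (c - c')) / (2 * pi * (real l - real l')))
   + sin (2 * pi * (real l + real l') * x + (c + c')) / (2 * pi * (real l + real l'))"

lemma wave_deriv: "(wave l c has_real_derivative 2 * pi * real l * wave l (c + pi / 2) x) (at x)"
 unfolding wave_def by (auto intro!: derivative_eq_intros simp: cos_add sin_add algebra_simps)

lemma continuous_wave[continuous_intros]: "continuous_on A (wave l c)"
 unfolding wave_def by (intro continuous_intros)

lemma measurable_wave[measurable]: "wave l c \<in> borel_measurable borel"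
 by (intro borel_measurable_continuous_onI continuous_intros)

lemma cos_sin_period: "cos (2 * pi * real m + c) = cos c" "sin (2 * pi * of_int i + c) = sin c"
 using cos_add[of "2 * pi * real m" c] sin_add[of "2 * pi * of_int i" c] cos_int_2pin[of i] sin_int_2pin[of i]
  cos_int_2pin[of "int m"] sin_int_2pin[of "int m"] by auto

lemma wave_periodic: "wave l c (x + 1) = wave l c x"
 using cos_sin_period(1)[of l "2 * pi * real l * x + c"] by (simp add: wave_def algebra_simps)

lemma wave2_deriv:
 assumes "1 \<le> l" shows "(wave2 l c l' c' has_real_derivative wave l c x * wave l' c' x) (at x)"
proof -
 have "wave l c x * wave l' c' x = cos (2 * pi * (real l - real l') * x + (c - c')) + cos (2 * pi * (real l + real l') * x + (c + c'))"
 proof -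
  have "2 * (cos a * cos b) = cos (a - b) + cos (a + b)" for a b :: real by (simp add: cos_add cos_diff)
  note this[of "2 * pi * real l * x + c" "2 * pi * real l' * x + c'"]
  moreover have "sqrt 2 * a * (sqrt 2 * b) = (sqrt 2 * sqrt 2) * (a * b)" for a b by (simp only: mult_ac)
  then have "wave l c x * wave l' c' x = 2 * (cos (2 * pi * real l * x + c) * cos (2 * pi * real l' * x + c'))"
   unfolding wave_def by simp
  ultimately show ?thesis by (simp add: algebra_simps)
 qed
 moreover have "real l + real l' \<noteq> 0" using assms by simp
 ultimately show ?thesis unfolding wave2_def
  by (cases "l = l'") (auto intro!: derivative_eq_intros)
qed

lemma wave2_period: "wave2 l c l' c' (real n) - wave2 l c l' c' 0 = (if l = l' then real n * cos (c - c') else 0)"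
proof -
 have "sin (2 * pi * (real l - real l') * real n + b) = sin b" "sin (2 * pi * (real l + real l') * real n + b) = sin b" for b
  using cos_sin_period(2)[of "(int l - int l') * int n" b] cos_sin_period(2)[of "(int l + int l') * int n" b] by (simp_all add: mult.assoc)
 then show ?thesis by (simp add: wave2_def)
qed

text \<open>Coordinates \<open>2 l - 2\<close> and \<open>2 l - 1\<close> are the cosine and the sine of
  frequency \<open>l\<close>; the constant function is left out.\<close>

definition frq :: "nat => nat" where "frq j = j div 2 + 1"
definition phs :: "nat => real" where "phs j = - (real (j mod 2) * (pi / 2))"

lemma frq_pos: "1 \<le> frq j" "0 < real (frq j)" by (simp_all add: frq_def)

lemma wave2_orthogonal:
 "wave2 (frq i) (phs i + a) (frq j) (phs j + a) (real n) - wave2 (frq i) (phs i + a) (frq j) (phs j + a) 0 = (if i = j then real n else 0)"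
proof (cases "i = j")
 case False
 have "cos (phs i - phs j) = 0" if "frq i = frq j"
 proof -
  have "i mod 2 \<noteq> j mod 2" using that False by (metis frq_def add_right_cancel div_mult_mod_eq)
  then have "i mod 2 = 0 \<and> j mod 2 = 1 \<or> i mod 2 = 1 \<and> j mod 2 = 0" by presburger
  then show ?thesis by (auto simp: phs_def)
 qed
 then show ?thesis using False by (simp add: wave2_period)
qed (simp add: wave2_period)

abbreviation U01 :: "real measure" where "U01 \<equiv> restrict_space lborel {0..1}"

lemma U01_FTC:
 assumes F: "\<And>x. (F has_real_derivative f x) (at x)" and c: "continuous_on UNIV f"
 shows "has_bochner_integral U01 f (F 1 - F 0)"
proof -
 have "has_bochner_integral lborel (\<lambda>x. f x * indicator {0..1} x) (F 1 - F 0)"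
  using F c by (intro has_bochner_integral_FTC_Icc_real) (auto simp: continuous_on_eq_continuous_at)
 then show ?thesis
  by (simp add: has_bochner_integral_iff integrable_restrict_space integral_restrict_space mult.commute)
qed

lemma wave_integral: "has_bochner_integral U01 (\<lambda>x. wave (frq i) (phs i + a) x * wave (frq j) (phs j + a) x) (if i = j then 1 else 0)"
 using U01_FTC[OF wave2_deriv[OF frq_pos(1)], of i "phs i + a" "frq j" "phs j + a"] wave2_orthogonal[of i a j 1]
 by (cases "i = j") (simp_all add: continuous_on_mult continuous_wave)

lemma norm01_U01: "norm01_sq f = (\<integral>\<^sup>+t. ennreal ((f t)\<^sup>2) \<partial>U01)"
 unfolding norm01_sq_def by (subst nn_integral_restrict_space) auto

lemma parseval: "norm01_sq (\<lambda>x. \<Sum>j<d. b j * wave (frq j) (phs j + a) x) = ennreal (\<Sum>j<d. (b j)\<^sup>2)"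
proof -
 have sq: "(\<Sum>j<d. b j * wave (frq j) (phs j + a) x)\<^sup>2 = (\<Sum>i<d. \<Sum>j<d. b i * b j * (wave (frq i) (phs i + a) x * wave (frq j) (phs j + a) x))" for x
  by (simp add: power2_eq_square sum_product mult_ac)
 have "has_bochner_integral U01 (\<lambda>x. (\<Sum>j<d. b j * wave (frq j) (phs j + a) x)\<^sup>2) (\<Sum>i<d. \<Sum>j<d. b i * b j * (if i = j then 1 else 0))"
  unfolding sq by (intro has_bochner_integral_sum has_bochner_integral_mult_right wave_integral)
 also have "(\<Sum>i<d. \<Sum>j<d. b i * b j * (if i = j then 1 else 0)) = (\<Sum>j<d. (b j)\<^sup>2)"
  by (intro sum.cong refl) (simp add: if_distrib sum.delta power2_eq_square cong: if_cong)
 finally show ?thesis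
  by (subst norm01_U01) (auto simp: nn_integral_eq_integral has_bochner_integral_iff)
qed

lemma trig_sobolev_ball:
 assumes "(\<Sum>j<d. (\<theta> j)\<^sup>2 * (\<Sum>i\<le>k. (2 * pi * real (frq j)) ^ (2 * i))) \<le> r"
 shows "(\<lambda>x. \<Sum>j<d. \<theta> j * wave (frq j) (phs j) x) \<in> sobolev_ball k r"
proof -
 define f where "f i x = (\<Sum>j<d. (\<theta> j * (2 * pi * real (frq j)) ^ i) * wave (frq j) (phs j + real i * (pi / 2)) x)" for i x
 have fd: "(f i has_real_derivative f (Suc i) x) (at x)" for i x
  unfolding f_def by (rule DERIV_cong, rule DERIV_sum, rule DERIV_cmult, rule wave_deriv)
   (simp add: algebra_simps add_divide_distrib)
 have df: "(deriv ^^ i) (f 0) = f i" for i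
 proof (induction i)
  case (Suc i)
  have "deriv (f i) = f (Suc i)" by (rule ext) (rule DERIV_imp_deriv[OF fd])
  then show ?case using Suc by simp
 qed simp
 have per: "f i (x + 1) = f i x" for i x unfolding f_def wave_periodic ..
 have nf: "norm01_sq (f i) = ennreal (\<Sum>j<d. (\<theta> j)\<^sup>2 * (2 * pi * real (frq j)) ^ (2 * i))" for i
  unfolding f_def parseval by (simp add: power_mult_distrib power_mult[symmetric] mult.commute)
 have "(\<Sum>i\<le>k. norm01_sq (f i)) = ennreal (\<Sum>i\<le>k. \<Sum>j<d. (\<theta> j)\<^sup>2 * (2 * pi * real (frq j)) ^ (2 * i))"
  unfolding nf by (rule sum_ennreal) (auto intro!: sum_nonneg)
 also have "(\<Sum>i\<le>k. \<Sum>j<d. (\<theta> j)\<^sup>2 * (2 * pi * real (frq j)) ^ (2 * i)) = (\<Sum>j<d. (\<theta> j)\<^sup>2 * (\<Sum>i\<le>k. (2 * pi * real (frq j)) ^ (2 * i)))"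
  by (subst sum.swap) (simp add: sum_distrib_left)
 finally have "(\<Sum>i\<le>k. norm01_sq (f i)) \<le> ennreal r" using assms by (simp add: ennreal_leI)
 moreover have "f i differentiable (at x)" for i x using fd real_differentiable_def by blast
 moreover have "f i 0 = f i 1" for i using per[of i 0] by simp
 ultimately have "f 0 \<in> sobolev_ball k r" unfolding sobolev_ball_def Ckp_def df using per[of 0] by (simp add: df)
 then show ?thesis by (simp add: f_def[abs_def])
qed

section \<open>The risk under pure Gaussian noise\<close>

lemma cadlag_continuous_add:
 assumes f: "cadlag_on {0..T} f" and P: "continuous_on {0..T} P" and h: "\<And>t. t \<in> {0..T} ==> h t = P t + f t"
 shows "cadlag_on {0..T} h"
 unfolding cadlag_on_def
proof (intro ballI conjI)
 fix t assume t: "t \<in> {0..T}"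
 have Pt: "(P \<longlongrightarrow> P t) (at t within {0..T} \<inter> X)" for X
  using P t unfolding continuous_on_def by (blast intro: tendsto_within_subset)
 have ev: "eventually (\<lambda>x. P x + f x = h x) (at t within {0..T} \<inter> X)" for X
  using h by (auto simp: eventually_at_filter)
 show "(h \<longlongrightarrow> h t) (at t within {0..T} \<inter> {t<..})"
  using tendsto_add[OF Pt, of f "f t" "{t<..}"] f t tendsto_cong[OF ev] h[OF t] unfolding cadlag_on_def by simp
 obtain l where "(f \<longlongrightarrow> l) (at t within {0..T} \<inter> {..<t})" using f t unfolding cadlag_on_def by blast
 from tendsto_add[OF Pt this] show "\<exists>l. (h \<longlongrightarrow> l) (at t within {0..T} \<inter> {..<t})"
  using tendsto_cong[OF ev] by blast
qed

lemma cadlag_continuous: "continuous_on {0..T} P ==> (\<And>t. t \<in> {0..T} ==> h t = P t) ==> cadlag_on {0..T} h"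
 by (rule cadlag_continuous_add[of T "\<lambda>_. 0"]) (auto simp: cadlag_on_def)

lemma measurable_skorokhod:
 assumes "\<And>t. t \<in> {0..T} ==> X t \<in> borel_measurable M"
  and "\<And>\<omega>. \<omega> \<in> space M ==> cadlag_on {0..T} (\<lambda>t\<in>{0..T}. X t \<omega>)"
 shows "(\<lambda>\<omega>. \<lambda>t\<in>{0..T}. X t \<omega>) \<in> measurable M (skorokhod T)"
 unfolding skorokhod_def using assms by (intro measurable_restrict_space2 measurable_restrict) auto

lemma prob_space_U01: "prob_space U01"
 by (rule prob_spaceI) (simp add: emeasure_restrict_space space_restrict_space)

lemma measurable_estimator:
 assumes Se: "Se \<in> estimators T" and "f \<in> measurable M (skorokhod T)" "h \<in> measurable M U01"
 shows "(\<lambda>x. Se (f x) (h x)) \<in> borel_measurable M"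
proof -
 have "sets U01 = sets (restrict_space borel {0..1})" by (rule sets_restrict_space_cong) simp
 then have "(\<lambda>x. (f x, h x)) \<in> measurable M (skorokhod T \<Otimes>\<^sub>M restrict_space borel {0..1})"
  using assms(2,3) by (intro measurable_Pair) (auto cong: measurable_cong_sets)
 moreover have "(\<lambda>(y, t). Se y t) \<in> borel_measurable (skorokhod T \<Otimes>\<^sub>M restrict_space borel {0..1})" using Se by (simp add: estimators_def)
 ultimately have "(\<lambda>x. (\<lambda>(y, t). Se y t) (f x, h x)) \<in> borel_measurable M" by (rule measurable_compose)
 then show ?thesis by (simp only: prod.case)
qed

lemma measurable_loss:
 assumes "Se \<in> estimators T" and "S \<in> borel_measurable borel"
 shows "(\<lambda>y. norm01_sq (\<lambda>t. Se y t - S t)) \<in> borel_measurable (skorokhod T)"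
proof -
 interpret U: prob_space U01 by (rule prob_space_U01)
 have S: "(\<lambda>p. S (snd p)) \<in> borel_measurable (skorokhod T \<Otimes>\<^sub>M U01)"
  by (rule measurable_compose[OF measurable_snd]) (rule measurable_restrict_space1, use assms(2) in simp)
 have "(\<lambda>p. Se (fst p) (snd p)) \<in> borel_measurable (skorokhod T \<Otimes>\<^sub>M U01)"
  by (rule measurable_estimator[OF assms(1)]) auto
 then have "(\<lambda>p. ennreal ((Se (fst p) (snd p) - S (snd p))\<^sup>2)) \<in> borel_measurable (skorokhod T \<Otimes>\<^sub>M U01)"
  using S by measurable
 from U.borel_measurable_nn_integral_fst[OF this] show ?thesis by (simp add: norm01_U01)
qed

text \<open>The risk under the noise with \<open>a = 0\<close>, \<open>\<rho>1 = sqrt vs\<close>,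
  \<open>\<rho>2 = 0\<close>, written over the sample space of the Brownian motion.\<close>

lemma robust_risk_ge:
 assumes lm: "levy_measure \<Lambda>" "(\<integral>\<^sup>+ x. ennreal (x\<^sup>2) \<partial>\<Lambda>) = 1" and par: "0 \<le> amax" "rlow \<le> vs" "0 < vs" and T: "0 \<le> T"
  and W: "gfam Gsp W min {0..}" "\<forall>\<omega>. W 0 \<omega> = 0 \<and> continuous_on {0..} (\<lambda>t. W t \<omega>)"
  and P: "\<And>x. (P has_real_derivative S x) (at x)" "continuous_on UNIV S" "P 0 = 0" and Se: "Se \<in> estimators T"
 shows "(\<integral>\<^sup>+\<omega>. norm01_sq (\<lambda>t. Se (\<lambda>t\<in>{0..T}. P t + sqrt vs * W t \<omega>) t - S t) \<partial>Gsp)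
  \<le> robust_risk T (noise_laws T \<Lambda> amax rlow vs) Se S"
proof -
 obtain N :: "(real => real) measure" where N: "prob_space N" and
  noise: "ou_levy_noise (Gsp \<Otimes>\<^sub>M N) \<Lambda> 0 (sqrt vs) 0 (\<lambda>t \<omega>. sqrt vs * W t (fst \<omega>))"
  using gaussian_noise_exists[OF lm] W by metis
 interpret G: prob_space Gsp by (rule prob_space_Gsp)
 interpret N: prob_space N by (rule N)
 interpret PP: pair_prob_space Gsp N ..
 let ?M = "Gsp \<Otimes>\<^sub>M N"
 define path where "path = (\<lambda>\<omega> :: (real => real) \<times> (real => real). \<lambda>t\<in>{0..T}. sqrt vs * W t (fst \<omega>))"
 define Q where "Q = distr ?M (skorokhod T) path"
 define l where "l y = norm01_sq (\<lambda>t. Se y t - S t)" for y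
 define \<Phi> where "\<Phi> x = (\<lambda>t\<in>{0..T}. P t + x t)" for x :: "real => real"
 have Wm: "W t \<in> borel_measurable Gsp" if "0 \<le> t" for t using gfam_measurable[OF W(1)] that by simp
 have Wc: "continuous_on {0..T} (\<lambda>t. sqrt vs * W t \<omega>)" for \<omega>
  using W(2) by (intro continuous_on_mult_left) (auto intro: continuous_on_subset)
 have Pc: "continuous_on A P" for A using P(1) by (intro DERIV_continuous_on) (blast intro: has_field_derivative_at_within)
 have Sb: "S \<in> borel_measurable borel" using P(2) by (rule borel_measurable_continuous_onI)
 have lmeas: "l \<in> borel_measurable (skorokhod T)" unfolding l_def by (rule measurable_loss[OF Se Sb])
 have Qin: "Q \<in> noise_laws T \<Lambda> amax rlow vs"
 proof -
  have "- amax \<le> 0" "(0::real) \<le> 0" "rlow \<le> (sqrt vs)\<^sup>2" "(sqrt vs)\<^sup>2 + 0\<^sup>2 \<le> vs" using par by simp_all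
  then show ?thesis unfolding noise_laws_def Q_def path_def mem_Collect_eq
   by (rule_tac exI[of _ ?M], rule_tac exI[of _ "\<lambda>t \<omega>. sqrt vs * W t (fst \<omega>)"], rule_tac exI[of _ 0], rule_tac exI[of _ "sqrt vs"], rule_tac exI[of _ 0])
    (intro conjI refl noise)
 qed
 have path: "path \<in> measurable ?M (skorokhod T)"
  unfolding path_def
 proof (rule measurable_skorokhod)
  show "(\<lambda>\<omega>. sqrt vs * W t (fst \<omega>)) \<in> borel_measurable ?M" if "t \<in> {0..T}" for t
   using that by (intro borel_measurable_times borel_measurable_const measurable_compose[OF measurable_fst Wm]) simp
  show "cadlag_on {0..T} (\<lambda>t\<in>{0..T}. sqrt vs * W t (fst \<omega>))" for \<omega> :: "(real => real) \<times> (real => real)"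
   by (rule cadlag_continuous[OF Wc[of "fst \<omega>"]]) simp
 qed
 have \<Phi>: "\<Phi> \<in> measurable (skorokhod T) (skorokhod T)"
  unfolding \<Phi>_def
 proof (rule measurable_skorokhod)
  show "(\<lambda>x. P t + x t) \<in> borel_measurable (skorokhod T)" if "t \<in> {0..T}" for t
   unfolding skorokhod_def using that by (intro borel_measurable_add borel_measurable_const measurable_restrict_space1 measurable_component_singleton)
  show "cadlag_on {0..T} (\<lambda>t\<in>{0..T}. P t + x t)" if "x \<in> space (skorokhod T)" for x
  proof -
   have "cadlag_on {0..T} x" using that by (simp add: skorokhod_def space_restrict_space)
   from cadlag_continuous_add[OF this Pc] show ?thesis by simp
  qed
 qed
 have ob: "observation_law T S Q = distr Q (skorokhod T) \<Phi>"
 proof -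
  have "(LBINT s:{0..t}. S s) = P t" if "0 \<le> t" for t
   using integral_FTC_Icc_real[OF that P(1)] P(2,3)
   by (simp add: set_lebesgue_integral_def continuous_on_eq_continuous_at mult.commute)
  then have "(\<lambda>t\<in>{0..T}. (LBINT s:{0..t}. S s) + x t) = \<Phi> x" for x by (auto simp: \<Phi>_def)
  then show ?thesis by (simp add: observation_law_def)
 qed
 define f where "f \<omega> = norm01_sq (\<lambda>t. Se (\<lambda>t\<in>{0..T}. P t + sqrt vs * W t \<omega>) t - S t)" for \<omega>
 have fm: "f \<in> borel_measurable Gsp"
 proof -
  have "(\<lambda>\<omega>. \<lambda>t\<in>{0..T}. P t + sqrt vs * W t \<omega>) \<in> measurable Gsp (skorokhod T)"
  proof (rule measurable_skorokhod)
   show "(\<lambda>\<omega>. P t + sqrt vs * W t \<omega>) \<in> borel_measurable Gsp" if "t \<in> {0..T}" for t using Wm[of t] that by simp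
   show "cadlag_on {0..T} (\<lambda>t\<in>{0..T}. P t + sqrt vs * W t \<omega>)" for \<omega>
    by (rule cadlag_continuous[OF continuous_on_add[OF Pc Wc[of \<omega>]]]) simp
  qed
  from measurable_compose[OF this lmeas] show ?thesis by (simp add: f_def[abs_def] l_def)
 qed
 have e: "l (\<Phi> (path \<omega>)) = f (fst \<omega>)" for \<omega>
  unfolding l_def f_def \<Phi>_def path_def by (rule arg_cong[where f="\<lambda>y. norm01_sq (\<lambda>t. Se y t - S t)"]) auto
 have "(\<integral>\<^sup>+\<omega>. f \<omega> \<partial>Gsp) = (\<integral>\<^sup>+\<omega>. f (fst \<omega>) \<partial>?M)"
  using nn_integral_distr[OF measurable_fst, of f Gsp N] fm N.distr_pair_fst[of Gsp] by simp
 also have "\<dots> = (\<integral>\<^sup>+y. l y \<partial>observation_law T S Q)"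
  unfolding ob unfolding e[symmetric] Q_def using lmeas \<Phi> path
  by (subst nn_integral_distr, simp, simp) (subst nn_integral_distr, simp_all)
 also have "\<dots> \<le> robust_risk T (noise_laws T \<Lambda> amax rlow vs) Se S"
  unfolding robust_risk_def l_def using Qin by (rule SUP_upper)
 finally show ?thesis unfolding f_def .
qed

section \<open>Gaussian priors\<close>

text \<open>A coefficient vector of norm above \<open>2 sqrt r\<close> is further from a
  \<open>\<theta>\<close> of norm at most \<open>sqrt r\<close> than zero is.\<close>

lemma truncation_good:
 fixes c \<theta> :: "nat => real"
 assumes "(\<Sum>j<d. (\<theta> j)\<^sup>2) \<le> r"
 shows "(\<Sum>j<d. ((if (\<Sum>j<d. (c j)\<^sup>2) \<le> 4 * r then c j else 0) - \<theta> j)\<^sup>2) \<le> (\<Sum>j<d. (c j - \<theta> j)\<^sup>2)"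
proof (cases "(\<Sum>j<d. (c j)\<^sup>2) \<le> 4 * r")
 case False
 have "(c j)\<^sup>2 \<le> 2 * (c j - \<theta> j)\<^sup>2 + 2 * (\<theta> j)\<^sup>2" for j
  using zero_le_power2[of "c j - 2 * \<theta> j"] by (simp add: power2_eq_square algebra_simps)
 then have "(\<Sum>j<d. (c j)\<^sup>2) \<le> 2 * (\<Sum>j<d. (c j - \<theta> j)\<^sup>2) + 2 * (\<Sum>j<d. (\<theta> j)\<^sup>2)"
  unfolding sum_distrib_left sum.distrib[symmetric] by (intro sum_mono)
 then show ?thesis using False assms by simp
qed simp

lemma truncation_bad:
 fixes c \<theta> :: "nat => real"
 assumes r: "0 \<le> r"
 shows "(\<Sum>j<d. ((if (\<Sum>j<d. (c j)\<^sup>2) \<le> 4 * r then c j else 0) - \<theta> j)\<^sup>2) \<le> 8 * r + 2 * (\<Sum>j<d. (\<theta> j)\<^sup>2)"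
proof (cases "(\<Sum>j<d. (c j)\<^sup>2) \<le> 4 * r")
 case True
 have "(c j - \<theta> j)\<^sup>2 \<le> 2 * (c j)\<^sup>2 + 2 * (\<theta> j)\<^sup>2" for j
  using zero_le_power2[of "c j + \<theta> j"] by (simp add: power2_eq_square algebra_simps)
 then have "(\<Sum>j<d. (c j - \<theta> j)\<^sup>2) \<le> 2 * (\<Sum>j<d. (c j)\<^sup>2) + 2 * (\<Sum>j<d. (\<theta> j)\<^sup>2)"
  unfolding sum_distrib_left sum.distrib[symmetric] by (intro sum_mono)
 then show ?thesis using True by simp
next
 case False
 have "0 \<le> (\<Sum>j<d. (\<theta> j)\<^sup>2)" by (intro sum_nonneg) simp
 then show ?thesis using False r by simp
qed

text \<open>The quadratic form \<open>X g\<close> of the Gaussian prior is the Sobolev norm of the random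
  parameter. If \<open>X g \<le> r\<close>, the parameter lies in the ball and the truncated coefficients lose
  at most as much as the estimator. Otherwise their loss is at most \<open>8 r + 2 X g\<close>, and \<open>1
  \<le> \<kappa> r\<close> yields \<open>X g \<le> r exp (\<kappa> (X g - r))\<close>, whose expectation is a
  product of moment generating functions.\<close>

theorem bayes_risk_bound:
 fixes s :: "nat => real" and w :: "nat => real"
 assumes lm: "levy_measure \<Lambda>" "(\<integral>\<^sup>+ x. ennreal (x\<^sup>2) \<partial>\<Lambda>) = 1" and par: "0 \<le> amax" "rlow \<le> vs" "0 < vs" and n: "1 \<le> n"
  and Se: "Se \<in> estimators (real n)" and s: "\<And>j. j < d ==> 0 < s j" and r: "0 < r" and lam: "1 \<le> \<kappa> * r" and \<delta>: "\<delta> < 1"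
  and w: "\<And>j. w j = s j * (\<Sum>i\<le>k. (2 * pi * real (frq j)) ^ (2 * i))" and w\<delta>: "\<And>j. j < d ==> 2 * (\<kappa> * w j) \<le> \<delta>"
 shows "ennreal (\<Sum>j<d. s j * (vs / real n) / (s j + vs / real n)) \<le>
  (SUP S\<in>sobolev_ball k r. robust_risk (real n) (noise_laws (real n) \<Lambda> amax rlow vs) Se S)
   + ennreal (10 * r * exp (\<kappa> * ((\<Sum>j<d. w j) / (1 - \<delta>) - r)))"
  (is "_ \<le> ?SUP + _")
proof -
 interpret G: prob_space Gsp by (rule prob_space_Gsp)
 interpret GG: pair_prob_space Gsp Gsp ..
 interpret U: prob_space U01 by (rule prob_space_U01)
 define T where "T = real n"
 have T: "0 < T" using n by (simp add: T_def)
 define \<epsilon> where "\<epsilon> = sqrt (vs / T)"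
 have \<epsilon>: "0 < \<epsilon>" "\<epsilon>\<^sup>2 = vs / T" using par T by (simp_all add: \<epsilon>_def)
 define e where "e j = wave (frq j) (phs j)" for j
 define E where "E j x = (wave (frq j) (phs j - pi / 2) x - wave (frq j) (phs j - pi / 2) 0) / (2 * pi * real (frq j))" for j x
 have E': "(E j has_real_derivative e j x) (at x)" for j x
  unfolding E_def e_def using frq_pos[of j] wave_deriv[of "frq j" "phs j - pi / 2" x]
  by (auto intro!: derivative_eq_intros)
 have E0: "E j 0 = 0" for j by (simp add: E_def)
 have "\<exists>R. gfam Gsp (\<lambda>t \<omega>. (\<Sum>j<d. \<omega> (real j) * (E j (min t T) / sqrt T)) + R t \<omega>) min {0..} \<and>
   (\<forall>\<omega>. (\<Sum>j<d. \<omega> (real j) * (E j (min 0 T) / sqrt T)) + R 0 \<omega> = 0 \<and>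
    continuous_on {0..} (\<lambda>t. (\<Sum>j<d. \<omega> (real j) * (E j (min t T) / sqrt T)) + R t \<omega>)) \<and>
   (\<forall>t j b \<omega>. R t (fun_upd \<omega> (real j) b) = R t \<omega>) \<and> (\<forall>t. R t \<in> borel_measurable Gsp)"
 proof (rule brownian_motion_with_coordinates[where f="\<lambda>j x. e j x / sqrt T" and f'="\<lambda>j x. 2 * pi * real (frq j) * wave (frq j) (phs j + pi / 2) x / sqrt T"
   and H="\<lambda>i j x. wave2 (frq i) (phs i) (frq j) (phs j) x / T"])
  show "0 < T" by (rule T)
  show "((\<lambda>x. E j x / sqrt T) has_real_derivative e j x / sqrt T) (at x)" for j x by (rule DERIV_cdivide[OF E'])
  show "E j 0 / sqrt T = 0" for j by (simp add: E0)
  show "((\<lambda>x. e j x / sqrt T) has_real_derivative 2 * pi * real (frq j) * wave (frq j) (phs j + pi / 2) x / sqrt T) (at x)" for j x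
   unfolding e_def by (rule DERIV_cdivide[OF wave_deriv])
  show "continuous_on {0..T} (\<lambda>x. 2 * pi * real (frq j) * wave (frq j) (phs j + pi / 2) x / sqrt T)" for j
   using T by (intro continuous_intros) auto
  show "((\<lambda>x. wave2 (frq i) (phs i) (frq j) (phs j) x / T) has_real_derivative e i x / sqrt T * (e j x / sqrt T)) (at x)" for i j x
   using DERIV_cdivide[OF wave2_deriv[OF frq_pos(1)], of i "phs i" "frq j" "phs j" T x] T by (simp add: e_def)
  show "wave2 (frq i) (phs i) (frq j) (phs j) T / T - wave2 (frq i) (phs i) (frq j) (phs j) 0 / T = (if i = j then 1 else 0)" for i j
   using wave2_orthogonal[of i 0 j n] T by (simp add: T_def diff_divide_distrib[symmetric])
 qed
 then obtain R where R: "gfam Gsp (\<lambda>t \<omega>. (\<Sum>j<d. \<omega> (real j) * (E j (min t T) / sqrt T)) + R t \<omega>) min {0..}"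
   "\<And>\<omega>. (\<Sum>j<d. \<omega> (real j) * (E j (min 0 T) / sqrt T)) + R 0 \<omega> = 0"
   "\<And>\<omega>. continuous_on {0..} (\<lambda>t. (\<Sum>j<d. \<omega> (real j) * (E j (min t T) / sqrt T)) + R t \<omega>)"
   "\<And>t j b \<omega>. R t (fun_upd \<omega> (real j) b) = R t \<omega>" by blast
 define W where "W t \<omega> = (\<Sum>j<d. \<omega> (real j) * (E j (min t T) / sqrt T)) + R t \<omega>" for t \<omega>
 have W0: "W 0 \<omega> = 0" "continuous_on {0..} (\<lambda>t. W t \<omega>)" for \<omega> unfolding W_def by (rule R(2), rule R(3))
 have W: "gfam Gsp W min {0..}" "\<forall>\<omega>. W 0 \<omega> = 0 \<and> continuous_on {0..} (\<lambda>t. W t \<omega>)"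
  using R(1) unfolding W_def[abs_def, symmetric] by (simp_all only: W0 simp_thms)
 define \<theta> where "\<theta> g j = sqrt (s j) * g (real j)" for g :: "real => real" and j
 define P where "P g t = (\<Sum>j<d. \<theta> g j * E j t)" for g t
 define S where "S g t = (\<Sum>j<d. \<theta> g j * e j t)" for g t
 define y where "y g \<omega> = (\<lambda>t\<in>{0..T}. P g t + sqrt vs * W t \<omega>)" for g \<omega>
 have P': "(P g has_real_derivative S g x) (at x)" for g x
  unfolding P_def S_def by (rule DERIV_sum) (rule DERIV_cmult[OF E'])
 have ce: "continuous_on A (e j)" for A j unfolding e_def by (rule continuous_wave)
 have Sc: "continuous_on A (S g)" for A g unfolding S_def by (intro continuous_intros ce)
 have em: "e j \<in> borel_measurable U01" for j unfolding e_def by (rule measurable_restrict_space1) simp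
 have yR: "y g \<omega> = (\<lambda>t\<in>{0..T}. (\<Sum>j<d. (\<theta> g j + \<epsilon> * \<omega> (real j)) * E j t) + sqrt vs * R t \<omega>)" for g \<omega>
 proof (unfold y_def, rule restrict_ext)
  fix t assume t: "t \<in> {0..T}"
  have "sqrt vs / sqrt T = \<epsilon>" by (simp add: \<epsilon>_def real_sqrt_divide)
  then have "sqrt vs * (\<omega> (real j) * (E j t / sqrt T)) = \<epsilon> * \<omega> (real j) * E j t" for j by (auto simp: mult_ac)
  then show "P g t + sqrt vs * W t \<omega> = (\<Sum>j<d. (\<theta> g j + \<epsilon> * \<omega> (real j)) * E j t) + sqrt vs * R t \<omega>"
   using t unfolding P_def W_def by (simp add: distrib_left distrib_right sum.distrib sum_distrib_left min_absorb1)
 qed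
 have y_inv: "y (fun_upd g (real i) a) (fun_upd \<omega> (real i) b) = y (fun_upd g (real i) a') (fun_upd \<omega> (real i) b')"
  if "sqrt (s i) * a + \<epsilon> * b = sqrt (s i) * a' + \<epsilon> * b'" for g \<omega> i a b a' b'
 proof -
  have "\<theta> (fun_upd g (real i) a) j + \<epsilon> * (fun_upd \<omega> (real i) b) (real j) = \<theta> (fun_upd g (real i) a') j + \<epsilon> * (fun_upd \<omega> (real i) b') (real j)" for j
   using that by (simp add: \<theta>_def)
  then show ?thesis unfolding yR R(4) by simp
 qed
 have Wm: "W t \<in> borel_measurable Gsp" if "0 \<le> t" for t using gfam_measurable[OF W(1)] that by simp
 have ym: "(\<lambda>p. y (fst p) (snd p)) \<in> measurable (Gsp \<Otimes>\<^sub>M Gsp) (skorokhod T)"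
  unfolding y_def
 proof (rule measurable_skorokhod)
  show "(\<lambda>p. P (fst p) t + sqrt vs * W t (snd p)) \<in> borel_measurable (Gsp \<Otimes>\<^sub>M Gsp)" if "t \<in> {0..T}" for t
  proof -
   have 1: "(\<lambda>p. W t (snd p)) \<in> borel_measurable (Gsp \<Otimes>\<^sub>M Gsp)" using measurable_compose[OF measurable_snd Wm, of t] that by simp
   have 2: "(\<lambda>p. (fst p) i) \<in> borel_measurable (Gsp \<Otimes>\<^sub>M Gsp)" for i by (rule measurable_compose[OF measurable_fst measurable_Gsp_component])
   show ?thesis unfolding P_def \<theta>_def using 1 2 by measurable
  qed
  show "cadlag_on {0..T} (\<lambda>t\<in>{0..T}. P (fst p) t + sqrt vs * W t (snd p))" for p
  proof (rule cadlag_continuous)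
   show "continuous_on {0..T} (\<lambda>t. P (fst p) t + sqrt vs * W t (snd p))"
   proof (intro continuous_on_add continuous_on_mult_left)
    show "continuous_on {0..T} (P (fst p))" by (rule DERIV_continuous_on[OF has_field_derivative_at_within[OF P']])
    show "continuous_on {0..T} (\<lambda>t. W t (snd p))" by (rule continuous_on_subset[OF W0(2)]) simp
   qed
  qed simp
 qed
 have Se': "Se \<in> estimators T" using Se by (simp add: T_def)
 define c where "c j g \<omega> = (\<integral>x. Se (y g \<omega>) x * e j x \<partial>U01)" for j g \<omega>
 have cm[measurable]: "(\<lambda>p. c j (fst p) (snd p)) \<in> borel_measurable (Gsp \<Otimes>\<^sub>M Gsp)" for j
 proof -
  have "(\<lambda>q. Se (y (fst (fst q)) (snd (fst q))) (snd q)) \<in> borel_measurable ((Gsp \<Otimes>\<^sub>M Gsp) \<Otimes>\<^sub>M U01)"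
   by (rule measurable_estimator[OF Se' measurable_compose[OF measurable_fst ym] measurable_snd])
  moreover have "(\<lambda>q. e j (snd q)) \<in> borel_measurable ((Gsp \<Otimes>\<^sub>M Gsp) \<Otimes>\<^sub>M U01)"
   by (rule measurable_compose[OF measurable_snd em])
  ultimately have "(\<lambda>q. Se (y (fst (fst q)) (snd (fst q))) (snd q) * e j (snd q)) \<in> borel_measurable ((Gsp \<Otimes>\<^sub>M Gsp) \<Otimes>\<^sub>M U01)"
   by (rule borel_measurable_times)
  then show ?thesis unfolding c_def by (intro U.borel_measurable_lebesgue_integral) (simp add: case_prod_unfold)
 qed
 \<comment> \<open>the truncation bounds the loss at parameters outside the ball, where the estimator is unconstrained\<close>
 define h where "h j g \<omega> = (if (\<Sum>j<d. (c j g \<omega>)\<^sup>2) \<le> 4 * r then c j g \<omega> else 0)" for j g \<omega>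
 have hm: "(\<lambda>p. h j (fst p) (snd p)) \<in> borel_measurable (Gsp \<Otimes>\<^sub>M Gsp)" for j unfolding h_def by measurable
 have dm: "(\<lambda>p. ennreal ((h j (fst p) (snd p) - \<theta> (fst p) j)\<^sup>2)) \<in> borel_measurable (Gsp \<Otimes>\<^sub>M Gsp)" for j
 proof -
  have "(\<lambda>p. (fst p) i) \<in> borel_measurable (Gsp \<Otimes>\<^sub>M Gsp)" for i by (rule measurable_compose[OF measurable_fst measurable_Gsp_component])
  then show ?thesis unfolding \<theta>_def using hm by measurable
 qed
 define X where "X g = (\<Sum>j<d. w j * (g (real j))\<^sup>2)" for g :: "real => real"
 have w0: "0 \<le> w j" "s j \<le> w j" if "j < d" for j
 proof -
  have "1 \<le> (\<Sum>i\<le>k. (2 * pi * real (frq j)) ^ (2 * i))"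
   using member_le_sum[of 0 "{..k}" "\<lambda>i. (2 * pi * real (frq j)) ^ (2 * i)"] by simp
  then show "s j \<le> w j" unfolding w using s[OF that] by simp
  then show "0 \<le> w j" using s[OF that] by simp
 qed
 have \<theta>2: "(\<theta> g j)\<^sup>2 = s j * (g (real j))\<^sup>2" if "j < d" for g j using s[OF that] by (simp add: \<theta>_def power_mult_distrib)
 have \<theta>X: "(\<Sum>j<d. (\<theta> g j)\<^sup>2) \<le> X g" for g
  unfolding X_def by (intro sum_mono) (simp add: \<theta>2 mult_right_mono w0)
 have bayes: "ennreal (s j * (vs / real n) / (s j + vs / real n)) \<le> (\<integral>\<^sup>+g. \<integral>\<^sup>+\<omega>. ennreal ((h j g \<omega> - \<theta> g j)\<^sup>2) \<partial>Gsp \<partial>Gsp)" if "j < d" for j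
 proof -
  have "ennreal (s j * \<epsilon>\<^sup>2 / (s j + \<epsilon>\<^sup>2)) \<le> (\<integral>\<^sup>+g. \<integral>\<^sup>+\<omega>. ennreal ((h j g \<omega> - sqrt (s j) * g (real j))\<^sup>2) \<partial>Gsp \<partial>Gsp)"
  proof (rule bayes_coordinate[OF hm s[OF that] \<epsilon>(1)])
   fix g \<omega> :: "real => real" and a b a' b' assume "sqrt (s j) * a + \<epsilon> * b = sqrt (s j) * a' + \<epsilon> * b'"
   from y_inv[OF this] show "h j (fun_upd g (real j) a) (fun_upd \<omega> (real j) b) = h j (fun_upd g (real j) a') (fun_upd \<omega> (real j) b')"
    unfolding h_def c_def by simp
  qed
  then show ?thesis unfolding \<epsilon>(2) T_def \<theta>_def .
 qed
 have \<kappa>: "0 < \<kappa>" using lam r by (metis less_le_trans zero_less_mult_pos2 zero_less_one)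
 have point: "(\<integral>\<^sup>+\<omega>. ennreal (\<Sum>j<d. (h j g \<omega> - \<theta> g j)\<^sup>2) \<partial>Gsp) \<le> ?SUP + ennreal (10 * r * exp (\<kappa> * (X g - r)))" for g
 proof (cases "X g \<le> r")
  case True
  have "(\<Sum>j<d. (\<theta> g j)\<^sup>2 * (\<Sum>i\<le>k. (2 * pi * real (frq j)) ^ (2 * i))) = X g"
   unfolding X_def by (intro sum.cong) (auto simp: \<theta>2 w)
  then have ball: "S g \<in> sobolev_ball k r"
   unfolding S_def e_def using True by (intro trig_sobolev_ball) simp
  have loss: "ennreal (\<Sum>j<d. (h j g \<omega> - \<theta> g j)\<^sup>2) \<le> norm01_sq (\<lambda>t. Se (y g \<omega>) t - S g t)" for \<omega>
  proof (cases "(\<integral>\<^sup>+t. ennreal ((Se (y g \<omega>) t - S g t)\<^sup>2) \<partial>U01) < \<infinity>")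
   case fin: True
   have "(\<lambda>x. y g \<omega>) \<in> measurable U01 (skorokhod T)"
    using measurable_space[OF ym, of "(g, \<omega>)"] by (intro measurable_const) (simp add: space_pair_measure space_PiM)
   from measurable_estimator[OF Se' this measurable_ident] have "Se (y g \<omega>) \<in> borel_measurable U01" by (simp add: id_def)
   then have um: "(\<lambda>t. Se (y g \<omega>) t - S g t) \<in> borel_measurable U01"
   proof (rule borel_measurable_diff)
    show "S g \<in> borel_measurable U01"
     by (rule measurable_restrict_space1) (use borel_measurable_continuous_onI[OF Sc, of g] in simp)
   qed
   have hb: "has_bochner_integral U01 (\<lambda>x. e i x * e j x) (if i = j then 1 else 0)" for i j
    using wave_integral[of i 0 j] by (simp add: e_def)
   have B1: "integrable U01 (\<lambda>x. (Se (y g \<omega>) x - S g x) * e j x)" if "j < d" for j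
    by (rule bessel(1)[where d=d and e=e, OF um em _ _ fin that]) (use hb in \<open>auto simp: has_bochner_integral_iff\<close>)
   have hS: "has_bochner_integral U01 (\<lambda>x. S g x * e j x) (\<theta> g j)" if j: "j < d" for j
   proof -
    have "has_bochner_integral U01 (\<lambda>x. \<Sum>i<d. \<theta> g i * (e i x * e j x)) (\<Sum>i<d. \<theta> g i * (if i = j then 1 else 0))"
     by (intro has_bochner_integral_sum has_bochner_integral_mult_right hb)
    then show ?thesis using j by (simp add: S_def sum_distrib_right mult.assoc if_distrib cong: if_cong)
   qed
   have cu: "c j g \<omega> - \<theta> g j = (\<integral>x. (Se (y g \<omega>) x - S g x) * e j x \<partial>U01)" if j: "j < d" for j
   proof -
    have "c j g \<omega> = (\<integral>x. (Se (y g \<omega>) x - S g x) * e j x + S g x * e j x \<partial>U01)" unfolding c_def by (simp add: algebra_simps)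
    also have "\<dots> = (\<integral>x. (Se (y g \<omega>) x - S g x) * e j x \<partial>U01) + \<theta> g j"
     using hS[OF j] B1[OF j] hb by (subst Bochner_Integration.integral_add) (auto simp: has_bochner_integral_iff)
    finally show ?thesis by simp
   qed
   have "(\<Sum>j<d. (h j g \<omega> - \<theta> g j)\<^sup>2) \<le> (\<Sum>j<d. (c j g \<omega> - \<theta> g j)\<^sup>2)"
    unfolding h_def using order.trans[OF \<theta>X True] by (rule truncation_good)
   also have "\<dots> = (\<Sum>j<d. (\<integral>x. (Se (y g \<omega>) x - S g x) * e j x \<partial>U01)\<^sup>2)" using cu by simp
   finally have "ennreal (\<Sum>j<d. (h j g \<omega> - \<theta> g j)\<^sup>2) \<le> ennreal (\<Sum>j<d. (\<integral>x. (Se (y g \<omega>) x - S g x) * e j x \<partial>U01)\<^sup>2)" by (rule ennreal_leI)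
   also have "\<dots> \<le> norm01_sq (\<lambda>t. Se (y g \<omega>) t - S g t)"
    unfolding norm01_U01 by (rule bessel(2)[where d=d and e=e, OF um em _ _ fin]) (use hb in \<open>auto simp: has_bochner_integral_iff\<close>)
   finally show ?thesis .
  qed (simp add: norm01_U01 less_top[symmetric])
  have "(\<integral>\<^sup>+\<omega>. ennreal (\<Sum>j<d. (h j g \<omega> - \<theta> g j)\<^sup>2) \<partial>Gsp) \<le> (\<integral>\<^sup>+\<omega>. norm01_sq (\<lambda>t. Se (y g \<omega>) t - S g t) \<partial>Gsp)"
   by (intro nn_integral_mono loss)
  also have "\<dots> \<le> robust_risk T (noise_laws T \<Lambda> amax rlow vs) Se (S g)"
   unfolding y_def using T by (intro robust_risk_ge[OF lm par _ W P' Sc _ Se']) (simp_all add: P_def E0)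
  also have "\<dots> \<le> ?SUP" using ball unfolding T_def by (rule SUP_upper)
  finally show ?thesis by (simp add: add_increasing2)
 next
  case False
  have "X g / r - 1 = (X g - r) / r" using r by (simp add: field_simps)
  also have "\<dots> \<le> \<kappa> * (X g - r)" using lam r False mult_right_mono[OF lam, of "(X g - r) / r"] by simp
  finally have "X g / r \<le> exp (\<kappa> * (X g - r))" using exp_ge_add_one_self[of "\<kappa> * (X g - r)"] by linarith
  then have X: "X g \<le> r * exp (\<kappa> * (X g - r))" using r by (simp add: field_simps)
  have "(\<Sum>j<d. (h j g \<omega> - \<theta> g j)\<^sup>2) \<le> 10 * r * exp (\<kappa> * (X g - r))" for \<omega>
  proof -
   have "(\<Sum>j<d. (h j g \<omega> - \<theta> g j)\<^sup>2) \<le> 8 * r + 2 * (\<Sum>j<d. (\<theta> g j)\<^sup>2)"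
    unfolding h_def using r by (intro truncation_bad) simp
   then show ?thesis using \<theta>X[of g] False X by linarith
  qed
  then have "(\<integral>\<^sup>+\<omega>. ennreal (\<Sum>j<d. (h j g \<omega> - \<theta> g j)\<^sup>2) \<partial>Gsp) \<le> (\<integral>\<^sup>+\<omega>. ennreal (10 * r * exp (\<kappa> * (X g - r))) \<partial>Gsp)"
   by (intro nn_integral_mono ennreal_leI)
  then show ?thesis by (simp add: G.emeasure_space_1 add_increasing)
 qed
 have ex: "ennreal (10 * r * exp (\<kappa> * (X g - r))) = ennreal (10 * r * exp (- (\<kappa> * r))) * (\<Prod>j<d. ennreal (exp (\<kappa> * w j * (g (real j))\<^sup>2)))" for g
 proof -
  have "exp (\<kappa> * (X g - r)) = exp (- (\<kappa> * r)) * (\<Prod>j<d. exp (\<kappa> * w j * (g (real j))\<^sup>2))"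
   unfolding X_def by (simp add: exp_sum[symmetric] exp_add[symmetric] right_diff_distrib sum_distrib_left mult.assoc)
  then show ?thesis using r by (simp add: prod_ennreal ennreal_mult'[symmetric] mult.assoc prod_nonneg)
 qed
 have "ennreal (\<Sum>j<d. s j * (vs / real n) / (s j + vs / real n)) = (\<Sum>j<d. ennreal (s j * (vs / real n) / (s j + vs / real n)))"
  using s par by (intro sum_ennreal[symmetric]) (auto intro!: divide_nonneg_nonneg mult_nonneg_nonneg add_nonneg_nonneg simp: less_imp_le)
 also have "\<dots> \<le> (\<Sum>j<d. \<integral>\<^sup>+g. \<integral>\<^sup>+\<omega>. ennreal ((h j g \<omega> - \<theta> g j)\<^sup>2) \<partial>Gsp \<partial>Gsp)"
  by (intro sum_mono bayes) simp
 also have "\<dots> = (\<integral>\<^sup>+g. (\<Sum>j<d. \<integral>\<^sup>+\<omega>. ennreal ((h j g \<omega> - \<theta> g j)\<^sup>2) \<partial>Gsp) \<partial>Gsp)"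
  using G.borel_measurable_nn_integral_fst[OF dm] by (intro nn_integral_sum[symmetric]) simp
 also have "\<dots> = (\<integral>\<^sup>+g. (\<integral>\<^sup>+\<omega>. ennreal (\<Sum>j<d. (h j g \<omega> - \<theta> g j)\<^sup>2) \<partial>Gsp) \<partial>Gsp)"
 proof (rule nn_integral_cong)
  fix g :: "real => real" assume g: "g \<in> space Gsp"
  have "(\<lambda>\<omega>. ennreal ((h j g \<omega> - \<theta> g j)\<^sup>2)) \<in> borel_measurable Gsp" for j
   using measurable_compose[OF measurable_Pair1'[OF g] dm[of j]] by simp
  then show "(\<Sum>j<d. \<integral>\<^sup>+\<omega>. ennreal ((h j g \<omega> - \<theta> g j)\<^sup>2) \<partial>Gsp) = (\<integral>\<^sup>+\<omega>. ennreal (\<Sum>j<d. (h j g \<omega> - \<theta> g j)\<^sup>2) \<partial>Gsp)"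
   by (subst nn_integral_sum[symmetric]) (auto simp: sum_ennreal)
 qed
 also have "\<dots> \<le> (\<integral>\<^sup>+g. ?SUP + ennreal (10 * r * exp (\<kappa> * (X g - r))) \<partial>Gsp)" by (intro nn_integral_mono point)
 also have "\<dots> = ?SUP + ennreal (10 * r * exp (- (\<kappa> * r))) * (\<Prod>j<d. \<integral>\<^sup>+x. ennreal (exp (\<kappa> * w j * x\<^sup>2)) \<partial>N01)"
 proof -
  have m: "(\<lambda>g. \<Prod>j<d. ennreal (exp (\<kappa> * w j * (g (real j))\<^sup>2))) \<in> borel_measurable Gsp" by measurable
  have "(\<integral>\<^sup>+g. (\<Prod>j<d. ennreal (exp (\<kappa> * w j * (g (real j))\<^sup>2))) \<partial>Gsp) = (\<Prod>j<d. \<integral>\<^sup>+x. ennreal (exp (\<kappa> * w j * x\<^sup>2)) \<partial>N01)"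
   by (rule nn_integral_Gsp_prod) measurable
  then show ?thesis unfolding ex using m by (simp add: nn_integral_add nn_integral_cmult G.emeasure_space_1)
 qed
 also have "\<dots> \<le> ?SUP + ennreal (10 * r * exp (- (\<kappa> * r))) * (\<Prod>j<d. ennreal (exp (\<kappa> * w j / (1 - \<delta>))))"
  using w0 \<kappa> w\<delta> \<delta> by (intro add_left_mono mult_left_mono prod_mono_ennreal chi_square_mgf) auto
 also have "ennreal (10 * r * exp (- (\<kappa> * r))) * (\<Prod>j<d. ennreal (exp (\<kappa> * w j / (1 - \<delta>)))) = ennreal (10 * r * exp (\<kappa> * ((\<Sum>j<d. w j) / (1 - \<delta>) - r)))"
 proof -
  have "exp (\<kappa> * ((\<Sum>j<d. w j) / (1 - \<delta>) - r)) = exp (- (\<kappa> * r)) * (\<Prod>j<d. exp (\<kappa> * w j / (1 - \<delta>)))"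
   by (simp add: exp_sum[symmetric] exp_add[symmetric] right_diff_distrib sum_distrib_left sum_divide_distrib)
  then show ?thesis using r by (simp add: prod_ennreal ennreal_mult'[symmetric] mult.assoc prod_nonneg)
 qed
 finally show ?thesis .
qed

section \<open>Power sums\<close>

lemma power_diff_bounds:
 fixes x y :: real
 assumes "0 \<le> y" "y \<le> x"
 shows "real (Suc p) * y ^ p * (x - y) \<le> x ^ Suc p - y ^ Suc p \<and> x ^ Suc p - y ^ Suc p \<le> real (Suc p) * x ^ p * (x - y)"
proof (induction p)
 case (Suc p)
 have e: "x ^ Suc (Suc p) - y ^ Suc (Suc p) = x * (x ^ Suc p - y ^ Suc p) + y ^ Suc p * (x - y)" by (simp add: algebra_simps)
 have y: "y ^ Suc p \<le> x ^ Suc p" using assms by (intro power_mono)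
 have "real (Suc p) * y ^ p * (x - y) * y \<le> (x ^ Suc p - y ^ Suc p) * x"
  using Suc assms y by (intro mult_mono) auto
 moreover have "x * (x ^ Suc p - y ^ Suc p) \<le> x * (real (Suc p) * x ^ p * (x - y))"
  using Suc assms by (intro mult_left_mono) auto
 moreover have "y ^ Suc p * (x - y) \<le> x ^ Suc p * (x - y)" using y assms by (intro mult_right_mono) auto
 ultimately show ?case unfolding e by (simp add: algebra_simps)
qed simp

text \<open>Comparison with the integral of \<open>x^p\<close>.\<close>

lemma power_sum_bounds:
 fixes K p :: nat
 assumes p: "1 \<le> p"
 shows "(\<Sum>i<K. real (Suc i) ^ p) \<le> real (Suc K) ^ Suc p / real (Suc p)"
  and "real (Suc K) ^ Suc p / real (Suc p) - real (Suc K) ^ p \<le> (\<Sum>i<K. real (Suc i) ^ p)"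
proof -
 have "(\<Sum>i<K. real (Suc i) ^ p) * real (Suc p) \<le> real (Suc K) ^ Suc p \<and>
   real (Suc K) ^ Suc p - real (Suc p) * real (Suc K) ^ p \<le> (\<Sum>i<K. real (Suc i) ^ p) * real (Suc p)"
 proof (induction K)
  case (Suc K)
  then show ?case using power_diff_bounds[of "real (Suc K)" "real (Suc (Suc K))" p]
   by (simp add: distrib_right mult.commute del: power_Suc of_nat_Suc) (simp add: algebra_simps)
 qed (use p in simp)
 then show "(\<Sum>i<K. real (Suc i) ^ p) \<le> real (Suc K) ^ Suc p / real (Suc p)"
  "real (Suc K) ^ Suc p / real (Suc p) - real (Suc K) ^ p \<le> (\<Sum>i<K. real (Suc i) ^ p)"
  by (simp_all add: field_simps del: of_nat_Suc power_Suc)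
qed

lemma sum_frequencies: "(\<Sum>j<2 * K. f (frq j)) = 2 * (\<Sum>i<K. f (Suc i))" for f :: "nat => real"
 unfolding sum_even_odd by (simp add: frq_def sum_distrib_left)

section \<open>The Pinsker weights\<close>

text \<open>With \<open>\<sigma> = (L/l)^k - 1\<close> the Bayes risk at frequency \<open>l\<close> is
  \<open>(1 - (l/L)^k) / v\<close>, and the Sobolev norm of the prior is, up to lower order, a sum of
  \<open>(2 pi)^(2k) (L^k l^k - l^(2k)) / v\<close>; both are power sums. Each single weight is of order
  \<open>1/h\<close>, which allows a Chernoff parameter \<open>c * h\<close>. The constraint leaves a margin
  \<open>(1 - \<delta>)\<^sup>2\<close>: one factor \<open>1 - \<delta>\<close> is lost in the moment
  generating functions, the other makes the exponent negative.\<close>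

theorem pinsker_weights_bound:
 fixes k n K :: nat and r \<tau> \<delta> h amax rlow vs :: real
 assumes lm: "levy_measure \<Lambda>" "(\<integral>\<^sup>+ x. ennreal (x\<^sup>2) \<partial>\<Lambda>) = 1" and par: "0 \<le> amax" "rlow \<le> vs" "0 < vs" and n: "1 \<le> n"
  and Se: "Se \<in> estimators (real n)" and k: "1 \<le> k" and r: "0 < r" and \<delta>: "0 < \<delta>" "\<delta> < 1"
  and h: "0 < h" "h ^ (2 * k + 1) = real n / vs" and \<tau>: "0 < \<tau>" "real (Suc K) \<le> \<tau> * h"
  and A: "A = (2 * pi) ^ (2 * k)" and c: "c = \<delta> / (2 * (A * (real k + 1) * \<tau> ^ (2 * k)))" and lam: "1 \<le> c * h * r"
  and con: "2 * A * (real k / ((real k + 1) * (2 * real k + 1)) * \<tau> ^ (2 * k + 1) + (real k + 1) * \<tau> ^ (2 * k) / h) \<le> (1 - \<delta>)\<^sup>2 * r"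
 shows "ennreal (2 / h ^ (2 * k + 1) * (real (Suc K) * (real k / (real k + 1)) - 1)) \<le>
  (SUP S\<in>sobolev_ball k r. robust_risk (real n) (noise_laws (real n) \<Lambda> amax rlow vs) Se S)
   + ennreal (10 * r * exp (- (c * \<delta> * r * h)))"
proof -
 define v where "v = real n / vs"
 have v: "0 < v" "vs / real n = 1 / v" using par n by (simp_all add: v_def)
 have hv: "h ^ (2 * k + 1) = v" using h by (simp add: v_def)
 define L where "L = real (Suc K)"
 have L: "1 \<le> L" "0 < L" "L \<le> \<tau> * h" using \<tau> by (simp_all add: L_def)
 define s where "s j = ((L / real (frq j)) ^ k - 1) / v" for j
 define w where "w j = s j * (\<Sum>i\<le>k. (2 * pi * real (frq j)) ^ (2 * i))" for j
 have A0: "0 < A" unfolding A by simp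
 have fr: "1 \<le> real (frq j)" "real (frq j) < L" if "j < 2 * K" for j
 proof -
  show "1 \<le> real (frq j)" by (simp add: frq_def)
  have "j div 2 < K" using that by (simp add: less_mult_imp_div_less mult.commute)
  then show "real (frq j) < L" by (simp add: frq_def L_def)
 qed
 have s0: "0 < s j" if "j < 2 * K" for j
  unfolding s_def using fr[OF that] v k by (auto intro!: divide_pos_pos one_less_power)
 \<comment> \<open>the derivatives of order below \<open>k\<close> contribute the term with \<open>L ^ (2 * k - 1)\<close>\<close>
 define W where "W l = A / v * (L ^ k * real l ^ k - real l ^ (2 * k) + real k * L ^ (2 * k - 1))" for l :: nat
 have wW: "w j \<le> W (frq j)" if j: "j < 2 * K" for j
 proof -
  define x where "x = real (frq j)"
  have x: "1 \<le> x" "x < L" using fr[OF j] by (simp_all add: x_def)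
  have px: "1 \<le> 2 * pi * x" using mult_mono[of 1 "2 * pi" 1 x] x pi_gt3 by simp
  have pp: "(2 * pi) ^ (2 * k - 1) \<le> A" unfolding A using pi_gt3 by (intro power_increasing) auto
  have "(\<Sum>i<k. (2 * pi * x) ^ (2 * i)) \<le> (\<Sum>i<k. (2 * pi * x) ^ (2 * k - 1))"
   using px by (intro sum_mono power_increasing) auto
  also have "\<dots> = real k * ((2 * pi) ^ (2 * k - 1) * x ^ (2 * k - 1))" by (simp add: power_mult_distrib)
  also have "\<dots> \<le> real k * (A * x ^ (2 * k - 1))"
   using pp x by (intro mult_left_mono mult_right_mono) auto
  finally have "(\<Sum>i\<le>k. (2 * pi * x) ^ (2 * i)) \<le> A * (real k * x ^ (2 * k - 1) + x ^ (2 * k))"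
   unfolding lessThan_Suc_atMost[symmetric] sum.lessThan_Suc by (simp add: A power_mult_distrib algebra_simps)
  then have "w j \<le> s j * (A * (real k * x ^ (2 * k - 1) + x ^ (2 * k)))"
   unfolding w_def x_def using s0[OF j] by (intro mult_left_mono) auto
  also have "\<dots> = A / v * (real k * (((L / x) ^ k - 1) * x ^ (2 * k - 1)) + ((L / x) ^ k - 1) * x ^ (2 * k))"
  proof -
   have "(q - 1) / v * (A * (m * a + b)) = A / v * (m * ((q - 1) * a) + (q - 1) * b)" for q m a b :: real
    using v(1) by (simp add: field_simps)
   then show ?thesis unfolding s_def x_def .
  qed
  also have "((L / x) ^ k - 1) * x ^ (2 * k) = L ^ k * x ^ k - x ^ (2 * k)"
   using x by (simp add: power_divide mult_2 power_add left_diff_distrib)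
  also have "A / v * (real k * (((L / x) ^ k - 1) * x ^ (2 * k - 1)) + (L ^ k * x ^ k - x ^ (2 * k)))
   \<le> A / v * (real k * L ^ (2 * k - 1) + (L ^ k * x ^ k - x ^ (2 * k)))"
  proof -
   have e: "2 * k - 1 = k + (k - 1)" using k by simp
   have "((L / x) ^ k - 1) * x ^ (2 * k - 1) \<le> (L / x) ^ k * x ^ (2 * k - 1)" using x by (intro mult_right_mono) auto
   also have "\<dots> = L ^ k * x ^ (k - 1)" using x unfolding e power_add by (simp add: power_divide)
   also have "\<dots> \<le> L ^ k * L ^ (k - 1)" using x by (intro mult_left_mono power_mono) auto
   also have "\<dots> = L ^ (2 * k - 1)" unfolding e power_add ..
   finally show ?thesis using v A0 by (intro mult_left_mono add_right_mono) auto
  qed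
  finally show ?thesis by (simp add: W_def x_def add.commute)
 qed
 have kL: "real k * L ^ (2 * k - 1) * L = real k * L ^ (2 * k)" using k by (simp add: power_eq_if[of L "2 * k"])
 have Wmax: "w j \<le> A / v * ((real k + 1) * L ^ (2 * k))" if j: "j < 2 * K" for j
 proof -
  have "L ^ k * real (frq j) ^ k \<le> L ^ k * L ^ k" using fr[OF j] by (intro mult_left_mono power_mono) auto
  moreover have "real k * L ^ (2 * k - 1) \<le> real k * L ^ (2 * k)" using L by (intro mult_left_mono power_increasing) auto
  moreover have "0 \<le> real (frq j) ^ (2 * k)" by simp
  moreover have "L ^ k * L ^ k = L ^ (2 * k)" by (simp add: mult_2 power_add)
  ultimately have "L ^ k * real (frq j) ^ k - real (frq j) ^ (2 * k) + real k * L ^ (2 * k - 1) \<le> (real k + 1) * L ^ (2 * k)"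
   unfolding distrib_right mult_1 by linarith
  then have "W (frq j) \<le> A / v * ((real k + 1) * L ^ (2 * k))" unfolding W_def using v A0 by (intro mult_left_mono) auto
  then show ?thesis using wW[OF j] by simp
 qed
 have Lk: "L ^ (2 * k) / v \<le> \<tau> ^ (2 * k) / h" "L ^ (2 * k + 1) / v \<le> \<tau> ^ (2 * k + 1)"
 proof -
  have "L ^ p \<le> \<tau> ^ p * h ^ p" for p using L by (simp add: power_mono power_mult_distrib[symmetric])
  from this[of "2 * k"] this[of "2 * k + 1"] show "L ^ (2 * k) / v \<le> \<tau> ^ (2 * k) / h" "L ^ (2 * k + 1) / v \<le> \<tau> ^ (2 * k + 1)"
   unfolding hv[symmetric] using h(1) by (simp_all add: field_simps)
 qed
 have w\<delta>: "2 * (c * h * w j) \<le> \<delta>" if j: "j < 2 * K" for j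
 proof -
  have ch: "0 \<le> c * h" using \<delta> A0 \<tau> h(1) by (simp add: c)
  have "w j \<le> A * (real k + 1) * (L ^ (2 * k) / v)" using Wmax[OF j] by simp
  also have "\<dots> \<le> A * (real k + 1) * (\<tau> ^ (2 * k) / h)" using A0 by (intro mult_left_mono Lk) auto
  finally have "c * h * w j \<le> c * h * (A * (real k + 1) * (\<tau> ^ (2 * k) / h))" using ch by (rule mult_left_mono)
  also have "\<dots> = c * (A * (real k + 1) * \<tau> ^ (2 * k))" using h(1) by simp
  also have "\<dots> = \<delta> / 2" unfolding c using A0 \<tau> by simp
  finally show ?thesis by simp
 qed
 have sw: "(\<Sum>j<2 * K. w j) \<le> (1 - \<delta>)\<^sup>2 * r"
 proof -
  have "(\<Sum>j<2 * K. w j) \<le> (\<Sum>j<2 * K. W (frq j))" using wW by (intro sum_mono) auto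
  also have "\<dots> = 2 * (A / v) * (L ^ k * (\<Sum>i<K. real (Suc i) ^ k) - (\<Sum>i<K. real (Suc i) ^ (2 * k)) + real K * (real k * L ^ (2 * k - 1)))"
  proof -
   have "(\<Sum>i<K. W (Suc i)) = A / v * (L ^ k * (\<Sum>i<K. real (Suc i) ^ k) - (\<Sum>i<K. real (Suc i) ^ (2 * k)) + real K * (real k * L ^ (2 * k - 1)))"
    unfolding W_def sum_distrib_left[symmetric] sum.distrib sum_subtractf by simp
   then show ?thesis unfolding sum_frequencies[of W] by simp
  qed
  also have "\<dots> \<le> 2 * (A / v) * (L ^ k * (L ^ Suc k / real (Suc k)) - (L ^ Suc (2 * k) / real (Suc (2 * k)) - L ^ (2 * k)) + real k * L ^ (2 * k))"
  proof (intro mult_left_mono add_mono diff_mono)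
   show "(\<Sum>i<K. real (Suc i) ^ k) \<le> L ^ Suc k / real (Suc k)" unfolding L_def by (rule power_sum_bounds(1)[OF k])
   show "L ^ Suc (2 * k) / real (Suc (2 * k)) - L ^ (2 * k) \<le> (\<Sum>i<K. real (Suc i) ^ (2 * k))"
    unfolding L_def by (rule power_sum_bounds(2)) (use k in simp)
   have "real K * (real k * L ^ (2 * k - 1)) \<le> L * (real k * L ^ (2 * k - 1))" using L by (intro mult_right_mono) (auto simp: L_def)
   also have "\<dots> = real k * L ^ (2 * k)" using kL by (simp only: mult.commute[of L])
   finally show "real K * (real k * L ^ (2 * k - 1)) \<le> real k * L ^ (2 * k)" .
  qed (use v A0 L in auto)
  also have "\<dots> = 2 * A * (real k / ((real k + 1) * (2 * real k + 1)) * (L ^ (2 * k + 1) / v) + (real k + 1) * (L ^ (2 * k) / v))"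
  proof -
   have f: "1 / real (Suc k) - 1 / real (Suc (2 * k)) = real k / ((real k + 1) * (2 * real k + 1))" by (simp add: field_simps)
   have "L ^ k * (L ^ Suc k / real (Suc k)) = L ^ (2 * k + 1) * (1 / real (Suc k))" by (simp add: mult_2 power_add del: of_nat_Suc)
   moreover have "L ^ Suc (2 * k) / real (Suc (2 * k)) = L ^ (2 * k + 1) * (1 / real (Suc (2 * k)))" by (simp del: of_nat_Suc)
   ultimately have B: "L ^ k * (L ^ Suc k / real (Suc k)) - (L ^ Suc (2 * k) / real (Suc (2 * k)) - L ^ (2 * k)) + real k * L ^ (2 * k)
    = real k / ((real k + 1) * (2 * real k + 1)) * L ^ (2 * k + 1) + (real k + 1) * L ^ (2 * k)"
    unfolding f[symmetric] by (simp only: algebra_simps)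
   have "2 * (A / v) * (f * P + m * Q) = 2 * A * (f * (P / v) + m * (Q / v))" for f P m Q :: real
    by (simp add: add_divide_distrib distrib_left)
   then show ?thesis unfolding B .
  qed
  also have "\<dots> \<le> 2 * A * (real k / ((real k + 1) * (2 * real k + 1)) * \<tau> ^ (2 * k + 1) + (real k + 1) * (\<tau> ^ (2 * k) / h))"
   using A0 by (intro mult_left_mono add_mono Lk) auto
  also have "\<dots> \<le> (1 - \<delta>)\<^sup>2 * r" using con by simp
  finally show ?thesis .
 qed
 have "(\<Sum>j<2 * K. w j) / (1 - \<delta>) \<le> (1 - \<delta>) * r"
  using sw \<delta> by (simp add: pos_divide_le_eq power2_eq_square mult_ac)
 then have "(\<Sum>j<2 * K. w j) / (1 - \<delta>) - r \<le> - (\<delta> * r)" by (simp add: left_diff_distrib)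
 then have "c * h * ((\<Sum>j<2 * K. w j) / (1 - \<delta>) - r) \<le> c * h * (- (\<delta> * r))"
  using \<delta> A0 \<tau> h(1) by (intro mult_left_mono) (auto simp: c)
 then have err: "ennreal (10 * r * exp (c * h * ((\<Sum>j<2 * K. w j) / (1 - \<delta>) - r))) \<le> ennreal (10 * r * exp (- (c * \<delta> * r * h)))"
  using r by (intro ennreal_leI mult_left_mono) (simp_all add: mult_ac)
 have "2 / h ^ (2 * k + 1) * (L * (real k / (real k + 1)) - 1) \<le> (\<Sum>j<2 * K. s j * (vs / real n) / (s j + vs / real n))"
 proof -
  have "s j * (vs / real n) / (s j + vs / real n) = 1 / v * (1 - (real (frq j) / L) ^ k)" for j
  proof -
   define q where "q = (L / real (frq j)) ^ k"
   have q: "0 < q" "(real (frq j) / L) ^ k = 1 / q" using L frq_pos[of j] by (simp_all add: q_def power_divide)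
   show ?thesis unfolding s_def v(2) q(2) q_def[symmetric] using q v(1) by (simp add: field_simps)
  qed
  then have f1: "(\<Sum>j<2 * K. s j * (vs / real n) / (s j + vs / real n)) = 2 * (\<Sum>i<K. 1 / v * (1 - (real (Suc i) / L) ^ k))"
   by (simp only: sum_frequencies[of "\<lambda>l. 1 / v * (1 - (real l / L) ^ k)"])
  have f2: "(\<Sum>i<K. 1 / v * (1 - (real (Suc i) / L) ^ k)) = 1 / v * (real K - (\<Sum>i<K. real (Suc i) ^ k) / L ^ k)"
   unfolding sum_distrib_left[symmetric] by (simp add: sum_subtractf power_divide sum_divide_distrib del: of_nat_Suc)
  have a: "L ^ Suc k / real (Suc k) / L ^ k = L / (real k + 1)" using L by (simp add: add.commute)
  have b: "real K = L - 1" by (simp add: L_def)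
  have f4: "real K - L ^ Suc k / real (Suc k) / L ^ k = L * (real k / (real k + 1)) - 1" unfolding a b by (simp add: field_simps)
  have "2 / v * (L * (real k / (real k + 1)) - 1) \<le> 2 / v * (real K - (\<Sum>i<K. real (Suc i) ^ k) / L ^ k)"
   using power_sum_bounds(1)[OF k, of K] v L unfolding f4[symmetric] L_def[symmetric]
   by (intro mult_left_mono diff_left_mono divide_right_mono) auto
  then show ?thesis unfolding hv f1 f2 by simp
 qed
 then have "ennreal (2 / h ^ (2 * k + 1) * (L * (real k / (real k + 1)) - 1)) \<le> ennreal (\<Sum>j<2 * K. s j * (vs / real n) / (s j + vs / real n))"
  by (rule ennreal_leI)
 also have "\<dots> \<le> (SUP S\<in>sobolev_ball k r. robust_risk (real n) (noise_laws (real n) \<Lambda> amax rlow vs) Se S)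
   + ennreal (10 * r * exp (c * h * ((\<Sum>j<2 * K. w j) / (1 - \<delta>) - r)))"
  by (rule bayes_risk_bound[OF lm par n Se s0 r lam \<delta>(2) w_def w\<delta>])
 also have "\<dots> \<le> (SUP S\<in>sobolev_ball k r. robust_risk (real n) (noise_laws (real n) \<Lambda> amax rlow vs) Se S)
   + ennreal (10 * r * exp (- (c * \<delta> * r * h)))"
  by (rule add_left_mono[OF err])
 finally show ?thesis unfolding L_def .
qed

section \<open>Asymptotics\<close>

lemma powr_power_eq: "0 < y ==> (y powr z) ^ m = y powr (z * real m)" for y z :: real
 by (simp add: powr_realpow[symmetric] powr_powr)

text \<open>The Pinsker constant is the limiting rescaled Bayes risk \<open>2 \<tau> k / (k + 1)\<close> for
  the \<open>\<tau>\<close> at which the prior fills the ball.\<close>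

lemma pinsker_const_bound:
 assumes k: "1 \<le> k" and r: "0 < r" and \<tau>: "0 < \<tau>" and x: "2 * \<tau> * (real k / (real k + 1)) < pinsker_const k r"
 shows "2 * (2 * pi) ^ (2 * k) * (real k / ((real k + 1) * (2 * real k + 1)) * \<tau> ^ (2 * k + 1)) < r"
proof -
 define m where "m = real k / (real k + 1)"
 have m: "0 < m" using k by (simp add: m_def)
 define N where "N = 2 * k + 1"
 have N: "real N = 2 * real k + 1" by (simp add: N_def)
 have b: "real k / (pi * (real k + 1)) = m / pi" by (simp add: m_def mult.commute)
 have "pinsker_const k r ^ N = (((1 + 2 * real k) * r) powr (1 / real N)) ^ N * ((m / pi) powr (2 * real k / real N)) ^ N"
  unfolding pinsker_const_def b N power_mult_distrib ..
 also have "\<dots> = (1 + 2 * real k) * r * (m / pi) ^ (2 * k)"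
 proof -
  have "((1 + 2 * real k) * r) powr (1 / real N * real N) = (1 + 2 * real k) * r" using r by (simp add: N_def)
  moreover have "(m / pi) powr (2 * real k / real N * real N) = (m / pi) ^ (2 * k)" using m powr_realpow[of "m / pi" "2 * k"] by (simp add: N_def)
  ultimately show ?thesis using r m by (subst powr_power_eq, simp, subst powr_power_eq, simp_all)
 qed
 finally have P: "pinsker_const k r ^ N = (1 + 2 * real k) * r * (m ^ (2 * k) / pi ^ (2 * k))" by (simp add: power_divide)
 have "(2 * \<tau> * m) ^ N < pinsker_const k r ^ N"
  using x \<tau> m by (intro power_strict_mono) (auto simp: m_def N_def)
 moreover have "(2 * \<tau> * m) ^ N = 2 * (2 ^ (2 * k) * (m * \<tau> ^ N)) * m ^ (2 * k)"
  by (simp add: N_def power_mult_distrib mult_ac)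
 ultimately have l: "2 * (2 ^ (2 * k) * (m * \<tau> ^ N)) * m ^ (2 * k) < (1 + 2 * real k) * r * (m ^ (2 * k) / pi ^ (2 * k))"
  by (simp only: P)
 have "X * b < Z" if "X * a < Z * (a / b)" "0 < a" "0 < b" for X Z a b :: real
 proof -
  have "X * a * b < Z * a" using that by (simp add: pos_less_divide_eq)
  then have "(X * b) * a < Z * a" by (simp only: mult_ac)
  then show ?thesis using that(2) by simp
 qed
 from this[OF l] have "2 * (2 ^ (2 * k) * (m * \<tau> ^ N)) * pi ^ (2 * k) < (1 + 2 * real k) * r" using m by simp
 then have "2 * (2 * pi) ^ (2 * k) * (m * \<tau> ^ N) < (1 + 2 * real k) * r"
  by (simp add: power_mult_distrib mult_ac)
 then have "2 * (2 * pi) ^ (2 * k) * (m * \<tau> ^ N) / (1 + 2 * real k) < r" by (simp add: pos_divide_less_eq mult.commute)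
 moreover have "2 * (2 * pi) ^ (2 * k) * (m * \<tau> ^ N) / (1 + 2 * real k) = 2 * (2 * pi) ^ (2 * k) * (real k / ((real k + 1) * (2 * real k + 1)) * \<tau> ^ (2 * k + 1))"
  by (simp add: m_def N_def add.commute)
 ultimately show ?thesis by simp
qed

text \<open>The rescaled finite bound as a function of \<open>h = v powr (1 / (2 k + 1))\<close>.\<close>

lemma risk_limit:
 fixes \<tau> m B r :: real
 assumes B: "0 < B"
 shows "((\<lambda>h. 2 * \<tau> * m - 2 * (m + 1) * inverse h - 10 * r * (h ^ p * exp (- (B * h)))) \<longlongrightarrow> 2 * \<tau> * m) at_top"
proof -
 have "filterlim (\<lambda>h :: real. B * h) at_top at_top"
  using B by (intro filterlim_tendsto_pos_mult_at_top[OF tendsto_const]) (auto simp: filterlim_ident)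
 from filterlim_compose[OF tendsto_power_div_exp_0[of p] this]
 have "((\<lambda>h. (B * h) ^ p / exp (B * h) / B ^ p) \<longlongrightarrow> 0 / B ^ p) at_top" by (rule tendsto_divide[OF _ tendsto_const]) (use B in simp)
 moreover have "(B * h) ^ p / exp (B * h) / B ^ p = h ^ p * exp (- (B * h))" for h
  using B by (simp add: power_mult_distrib exp_minus field_simps)
 ultimately have e: "((\<lambda>h. h ^ p * exp (- (B * h))) \<longlongrightarrow> 0) at_top" by simp
 have i: "((\<lambda>h :: real. inverse h) \<longlongrightarrow> 0) at_top" by (rule tendsto_inverse_0_at_top) (rule filterlim_ident)
 have "((\<lambda>h. 2 * \<tau> * m - 2 * (m + 1) * inverse h - 10 * r * (h ^ p * exp (- (B * h)))) \<longlongrightarrow> 2 * \<tau> * m - 2 * (m + 1) * 0 - 10 * r * 0) at_top"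
  by (intro tendsto_diff tendsto_mult tendsto_const e i)
 then show ?thesis by simp
qed

theorem theorem5p1:
  fixes k :: nat and r :: real
    and \<Lambda> :: "real measure"
    and amax rlow vs :: "nat \<Rightarrow> real"
  assumes "k \<ge> 1" and "r > 0"
    and "levy_measure \<Lambda>"
    and "(\<integral>\<^sup>+ x. ennreal (x\<^sup>2) \<partial>\<Lambda>) = 1"
    and "(\<integral>\<^sup>+ x. ennreal (x ^ 8) \<partial>\<Lambda>) < \<infinity>"
    and "\<And>n. n \<ge> 1 \<Longrightarrow> 0 \<le> amax n"
    and "\<And>n. n \<ge> 1 \<Longrightarrow> 0 < rlow n"
    and "\<And>n. n \<ge> 1 \<Longrightarrow> rlow n \<le> vs n"
    and "\<And>\<epsilon>::real. \<epsilon> > 0 \<Longrightarrow> (\<lambda>n. amax n / real n powr \<epsilon>) \<longlonglongrightarrow> 0"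
    and "\<And>\<epsilon>::real. \<epsilon> > 0 \<Longrightarrow> liminf (\<lambda>n. ereal (real n powr \<epsilon> * rlow n)) > 0"
    and "\<And>\<epsilon>::real. \<epsilon> > 0 \<Longrightarrow> (\<lambda>n. real n powr (- \<epsilon>) * vs n) \<longlonglongrightarrow> 0"
  shows "liminf (\<lambda>n. INF Se\<in>estimators (real n).
            ennreal ((real n / vs n) powr (2 * real k / (2 * real k + 1))) *
            (SUP S\<in>sobolev_ball k r.
               robust_risk (real n) (noise_laws (real n) \<Lambda> (amax n) (rlow n) (vs n)) Se S))
         \<ge> ennreal (pinsker_const k r)"
proof -
 note k = assms(1) and r = assms(2)
 have vs: "0 < vs n" if "1 \<le> n" for n using assms(7,8)[OF that] by linarith
 define h where "h n = (real n / vs n) powr (1 / (2 * real k + 1))" for n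
 have h: "0 < h n" "h n ^ (2 * k + 1) = real n / vs n" "(real n / vs n) powr (2 * real k / (2 * real k + 1)) = h n ^ (2 * k)" if "1 \<le> n" for n
 proof -
  have q: "0 < real n / vs n" using vs[OF that] that by simp
  have e: "1 / (2 * real k + 1) * real (2 * k + 1) = 1" "1 / (2 * real k + 1) * real (2 * k) = 2 * real k / (2 * real k + 1)" by (simp_all add: field_simps)
  show "0 < h n" using q that vs[OF that] by (simp add: h_def)
  show "h n ^ (2 * k + 1) = real n / vs n" unfolding h_def powr_power_eq[OF q] e using q vs[OF that] by simp
  show "(real n / vs n) powr (2 * real k / (2 * real k + 1)) = h n ^ (2 * k)" unfolding h_def powr_power_eq[OF q] e ..
 qed
 have h_top: "filterlim h at_top sequentially"
  unfolding filterlim_at_top_ge[where c=0]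
 proof (intro allI impI)
  fix Z :: real assume Z: "0 \<le> Z"
  have "eventually (\<lambda>n. real n powr (- (1 / 2)) * vs n < 1) sequentially"
   using order_tendstoD(2)[OF assms(11)[of "1 / 2"], of 1] by simp
  moreover have "eventually (\<lambda>n. Z ^ (2 * k + 1) \<le> sqrt (real n)) sequentially"
   using filterlim_compose[OF sqrt_at_top filterlim_real_sequentially] by (simp add: filterlim_at_top)
  ultimately show "eventually (\<lambda>n. Z \<le> h n) sequentially"
   using eventually_ge_at_top[of "1::nat"]
  proof eventually_elim
   case (elim n)
   have "real n powr (- (1 / 2)) = 1 / sqrt (real n)" by (simp add: powr_minus powr_half_sqrt inverse_eq_divide)
   then have "vs n < sqrt (real n)" using elim(1,3) by (simp add: pos_divide_less_eq)
   then have "sqrt (real n) * vs n \<le> sqrt (real n) * sqrt (real n)" by (intro mult_left_mono) auto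
   then have "sqrt (real n) \<le> real n / vs n" using vs[OF elim(3)] by (simp add: pos_le_divide_eq)
   then have "Z ^ Suc (2 * k) \<le> h n ^ Suc (2 * k)" using elim(2) h(2)[OF elim(3)] by simp
   then show "Z \<le> h n" by (rule power_le_imp_le_base) (use h(1)[OF elim(3)] in simp)
  qed
 qed
 show ?thesis
  unfolding le_Liminf_iff
 proof (intro allI impI)
  fix y assume y: "y < ennreal (pinsker_const k r)"
  then obtain y0 where y0: "0 \<le> y0" "y = ennreal y0" by (cases y) auto
  have yP: "y0 < pinsker_const k r" using y y0 by (simp add: ennreal_less_iff)
  define m where "m = real k / (real k + 1)"
  have m: "0 < m" using k by (simp add: m_def)
  obtain x where x: "y0 < x" "x < pinsker_const k r" using dense[OF yP] by blast
  \<comment> \<open>makes the limit \<open>2 * \<tau> * m\<close> of the rescaled bound equal to \<open>x\<close>\<close>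
  define \<tau> where "\<tau> = x / (2 * m)"
  have \<tau>: "0 < \<tau>" "2 * \<tau> * m = x" using x y0 m by (simp_all add: \<tau>_def)
  define A where "A = (2 * pi) ^ (2 * k)"
  define C where "C = 2 * A * (real k / ((real k + 1) * (2 * real k + 1)) * \<tau> ^ (2 * k + 1))"
  have A: "0 < A" by (simp add: A_def)
  have C: "C < r" "0 \<le> C" using pinsker_const_bound[OF k r \<tau>(1)] x(2) \<tau> A by (simp_all add: C_def A_def m_def)
  \<comment> \<open>so that \<open>C / r = 1 - 4 * \<delta>\<close>, which is less than \<open>(1 - \<delta>)\<^sup>2\<close>\<close>
  define \<delta> where "\<delta> = (1 - C / r) / 4"
  have \<delta>: "0 < \<delta>" "\<delta> < 1" using C r by (simp_all add: \<delta>_def field_simps)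
  have Cr: "C < (1 - \<delta>)\<^sup>2 * r"
  proof -
   have "C / r = 1 - 4 * \<delta>" by (simp add: \<delta>_def diff_divide_distrib)
   also have "\<dots> < 1 - 2 * \<delta> + \<delta>\<^sup>2" using \<delta> by (simp add: add_pos_pos)
   also have "\<dots> = (1 - \<delta>)\<^sup>2" by (simp add: power2_eq_square algebra_simps)
   finally show ?thesis using r by (simp add: pos_divide_less_eq)
  qed
  define c where "c = \<delta> / (2 * (A * (real k + 1) * \<tau> ^ (2 * k)))"
  have c: "0 < c" using \<delta> A \<tau> by (simp add: c_def)
  define \<Phi> where "\<Phi> h = 2 * \<tau> * m - 2 * (m + 1) * inverse h - 10 * r * (h ^ (2 * k) * exp (- (c * \<delta> * r * h)))" for h :: real
  have "(\<Phi> \<longlongrightarrow> x) at_top" using risk_limit[of "c * \<delta> * r" \<tau> m r "2 * k"] c \<delta> r \<tau> by (simp add: \<Phi>_def[abs_def])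
  from order_tendstoD(1)[OF this x(1)] have e1: "eventually (\<lambda>h. y0 < \<Phi> h) at_top" .
  have "((\<lambda>h. C + 2 * A * ((real k + 1) * \<tau> ^ (2 * k)) * inverse h) \<longlongrightarrow> C + 2 * A * ((real k + 1) * \<tau> ^ (2 * k)) * 0) at_top"
   by (intro tendsto_add tendsto_mult tendsto_const tendsto_inverse_0_at_top filterlim_ident)
  then have e2: "eventually (\<lambda>h. C + 2 * A * ((real k + 1) * \<tau> ^ (2 * k)) * inverse h < (1 - \<delta>)\<^sup>2 * r) at_top"
   using Cr by (intro order_tendstoD(2)) simp_all
  have ev: "eventually (\<lambda>h. y0 < \<Phi> h \<and> C + 2 * A * ((real k + 1) * \<tau> ^ (2 * k)) * inverse h < (1 - \<delta>)\<^sup>2 * r \<and> 1 / \<tau> \<le> h \<and> 1 / (c * r) \<le> h) at_top"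
   by (intro eventually_conj e1 e2 eventually_ge_at_top)
  from eventually_compose_filterlim[OF ev h_top] eventually_ge_at_top[of "1::nat"]
  show "eventually (\<lambda>n. y < (INF Se\<in>estimators (real n).
      ennreal ((real n / vs n) powr (2 * real k / (2 * real k + 1))) *
      (SUP S\<in>sobolev_ball k r.
        robust_risk (real n) (noise_laws (real n) \<Lambda> (amax n) (rlow n) (vs n)) Se S))) sequentially"
  proof eventually_elim
   case (elim n)
   define H where "H = h n"
   have H: "0 < H" "H ^ (2 * k + 1) = real n / vs n" using h[OF elim(2)] by (simp_all add: H_def)
   have el: "y0 < \<Phi> H" "C + 2 * A * ((real k + 1) * \<tau> ^ (2 * k)) * inverse H < (1 - \<delta>)\<^sup>2 * r" "1 / \<tau> \<le> H" "1 / (c * r) \<le> H"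
    using elim(1) by (auto simp: H_def)
   have tH: "1 \<le> \<tau> * H" "1 \<le> c * H * r" using el(3,4) \<tau>(1) c r by (simp_all add: pos_divide_le_eq mult_ac)
   \<comment> \<open>then \<open>L = Suc K\<close> is the integer part of \<open>\<tau> * H\<close>, and exactly the frequencies up to \<open>K\<close> have positive weight\<close>
   define K where "K = nat \<lfloor>\<tau> * H\<rfloor> - 1"
   have "1 \<le> nat \<lfloor>\<tau> * H\<rfloor>" using tH(1) by linarith
   then have RS: "real (Suc K) = of_int \<lfloor>\<tau> * H\<rfloor>" using tH(1) by (simp add: K_def)
   have K: "real (Suc K) \<le> \<tau> * H" "\<tau> * H - 1 \<le> real (Suc K)"
    unfolding RS using real_of_int_floor_gt_diff_one[of "\<tau> * H"] by simp_all
   have con: "2 * A * (real k / ((real k + 1) * (2 * real k + 1)) * \<tau> ^ (2 * k + 1) + (real k + 1) * \<tau> ^ (2 * k) / H) \<le> (1 - \<delta>)\<^sup>2 * r"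
   proof -
    have "2 * A * (P + Q / H) = 2 * A * P + 2 * A * Q * inverse H" for P Q by (simp add: divide_inverse distrib_left mult.assoc)
    then show ?thesis using el(2) unfolding C_def by (simp only: less_imp_le)
   qed
   have "ennreal (\<Phi> H) \<le> ennreal (H ^ (2 * k)) * (SUP S\<in>sobolev_ball k r. robust_risk (real n) (noise_laws (real n) \<Lambda> (amax n) (rlow n) (vs n)) Se S)" (is "_ \<le> _ * ?SUP")
    if Se: "Se \<in> estimators (real n)" for Se
   proof -
    define Y where "Y = 10 * r * exp (- (c * \<delta> * r * H))"
    have Y: "0 \<le> Y" using r by (simp add: Y_def)
    have "ennreal (2 / H ^ (2 * k + 1) * (real (Suc K) * (real k / (real k + 1)) - 1)) \<le> ?SUP + ennreal Y"
     unfolding Y_def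
     by (rule pinsker_weights_bound[OF assms(3,4) assms(6)[OF elim(2)] assms(8)[OF elim(2)] vs[OF elim(2)] elim(2) Se k r \<delta> H \<tau>(1) K(1) A_def c_def tH(2) con])
    then have B: "ennreal (H ^ (2 * k)) * ennreal (2 / H ^ (2 * k + 1) * (real (Suc K) * m - 1)) \<le> ennreal (H ^ (2 * k)) * (?SUP + ennreal Y)"
     unfolding m_def by (rule mult_left_mono) simp
    have "\<Phi> H + H ^ (2 * k) * Y = 2 * \<tau> * m - 2 * (m + 1) * inverse H" by (simp add: \<Phi>_def Y_def)
    also have "\<dots> = 2 / H * ((\<tau> * H - 1) * m - 1)" using H(1) by (simp add: field_simps)
    also have "\<dots> \<le> 2 / H * (real (Suc K) * m - 1)" using K m H(1) by (intro mult_left_mono diff_right_mono mult_right_mono) auto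
    also have "\<dots> = H ^ (2 * k) * (2 / H ^ (2 * k + 1) * (real (Suc K) * m - 1))" using H(1) by simp
    finally have "ennreal (\<Phi> H + H ^ (2 * k) * Y) \<le> ennreal (H ^ (2 * k) * (2 / H ^ (2 * k + 1) * (real (Suc K) * m - 1)))" by (rule ennreal_leI)
    also have "\<dots> = ennreal (H ^ (2 * k)) * ennreal (2 / H ^ (2 * k + 1) * (real (Suc K) * m - 1))" by (rule ennreal_mult') (use H in simp)
    also note B
    also have "ennreal (H ^ (2 * k)) * (?SUP + ennreal Y) = ennreal (H ^ (2 * k) * Y) + ennreal (H ^ (2 * k)) * ?SUP"
     using H(1) by (simp add: distrib_left ennreal_mult' add.commute)
    finally have "ennreal (H ^ (2 * k) * Y) + ennreal (\<Phi> H) \<le> ennreal (H ^ (2 * k) * Y) + ennreal (H ^ (2 * k)) * ?SUP"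
     using el(1) y0 Y H(1) by (simp add: ennreal_plus[symmetric] add.commute del: ennreal_plus)
    then show ?thesis by (simp add: ennreal_add_left_cancel_le)
   qed
   then have "ennreal (\<Phi> H) \<le> (INF Se\<in>estimators (real n). ennreal (H ^ (2 * k)) * (SUP S\<in>sobolev_ball k r. robust_risk (real n) (noise_laws (real n) \<Lambda> (amax n) (rlow n) (vs n)) Se S))"
    by (intro INF_greatest)
   moreover have "y < ennreal (\<Phi> H)" using el(1) y0 by (simp add: ennreal_less_iff)
   ultimately show ?case unfolding h(3)[OF elim(2)] H_def by (rule less_le_trans[rotated])
  qed
 qed
qed

end
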